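(* Let $\omega,\omega_0$ be fixed weight functions and let $p_{1,q}$, $p_{2,\vec r,k,q}$ be the functions on $\mathbb R^2$ described in the context. Let $Q\ge1$ be a large parameter. For $q\in\mathbb N$ and $\vec a\in\mathbb Z^2$ with $\gcd(\vec a,q)=1$ put $$p_{\Lambda(\vec a,q)}(\vec w)=p_{1,q}(\vec w)+\sum_{\substack{\vec r\in\Lambda(\vec a,q)\\ k=\gcd(\vec r)/\gcd(\vec r,q)}}\omega\Big(\frac{|\vec r|}{Q^{1/2}}\Big)p_{2,\vec r,k,q}(\vec w).$$ This function depends only on the lattice $\Lambda(\vec a,q)$ (and on $Q,\omega,\omega_0$). Moreover the following hold. (1) For every $\vec n\in\mathbb Z^2$ and every $N>0$, $$\delta_{\vec n}=\sum_{1\le q\le Q}\ \sum^{*}_{\vec a\bmod q}\int_{\mathbb R^2}p_{\Lambda(\vec a,q)}(\vec w)\,e\big((\vec a/q+\vec w)\cdot\vec n\big)\,d\vec w+O_N(Q^{-N}).$$ (2) For every $\delta>0$ and $N>0$, $p_{\Lambda(\vec a,q)}(\vec w)=1+O_{N,\delta}(Q^{-N})$ whenever $q<Q^{1/2-\delta}$ and $|\vec w|<q^{-1}Q^{-1-\delta}$. (3) For every $N>0$, $1\le q\le Q$ and $\vec w\in\mathbb R^2$, $$p_{1,q}(\vec w)\ll_N\frac{Q}{q(1+|\vec w|Q^{3/2})}\,(1+|\vec w|qQ^{1/2})^{-N}.$$ (4) For every $N>0$, $\vec w\in\mathbb R^2$, $k,q\in\mathbb N$ and $\vec r\in\mathbb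 Z^2$ with $\tfrac12Q^{1/2}\le|\vec r|\le Q^{1/2}$, $$p_{2,\vec r,k,q}(\vec w)\ll_N\big(1+|\vec w|kqQ^{1/2}+|\vec w\cdot\vec r^{\perp}|Q\big)^{-N}.$$ (5) For every $\vec n\in\mathbb Z^2$ and every $N>0$, $$\delta_{\vec n}=\sum_{1\le q\le Q}\ \sum^{*}_{\vec a\bmod q}\int_{\mathbb R^2}p_{1,q}(\vec w)\,e\big((\vec a/q+\vec w)\cdot\vec n\big)\,d\vec w$$ $$+\sum_{\substack{d,k\in\mathbb N\\ \vec c\in\mathbb Z^2\ \mathrm{primitive}\\ \vec r=dk\vec c}}\omega\Big(\frac{|\vec r|}{Q^{1/2}}\Big)\sum_{\substack{1\le q\le Q/k\\ d\mid q\\ \gcd(q/d,k)=1}}\ \sum^{*}_{\substack{\vec a\bmod q\\ q\mid d\vec c\cdot\vec a^{\perp}}}\int_{\mathbb R^2}p_{2,\vec r,k,q}(\vec w)\,e\big((\vec a/q+\vec w)\cdot\vec n\big)\,d\vec w+O_N(Q^{-N}).$$ All implicit constants depend only on the indicated parameters and on $\omega,\omega_0$.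
   Context: $|\cdot|$ is the Euclidean norm; $e(x)=\exp(2\pi ix)$; $\delta_{\vec n}=1$ if $\vec n=\vec 0$ and $0$ for $\vec n\in\mathbb Z^2\setminus\{\vec0\}$. For $\vec x=(x,y)$, $\vec x^{\perp}=(y,-x)$. $\gcd(\vec r)$ is the gcd of the coordinates and $\gcd(\vec r,q)=\gcd(r_1,r_2,q)$; a vector is primitive if its gcd is $1$. The asterisk in $\sum^*_{\vec a\bmod q}$ means that $\vec a$ runs over $(\mathbb Z/q\mathbb Z)^2$ with $\gcd(\vec a,q)=1$. For $\gcd(\vec a,q)=1$, $\Lambda(\vec a,q)=\{k\vec a+q\vec y:k\in\mathbb Z,\vec y\in\mathbb Z^2\}$. $\omega,\omega_0:\mathbb R\to[0,\infty)$ are fixed smooth functions: $\omega$ is supported on $(1/2,1)$ with $\int\omega=1$; $\omega_0$ is even, $\omega_0(0)=1$, $\int\omega_0=1$, supported on $(-1/2,1/2)$, and $x\mapsto\omega_0(|x|^{1/2})$ is smooth. Put $c=\big(\int_{\mathbb R^2}\omega(|\vec x|)\,d\vec x\big)^{-1}$ and, for $y>0$, $z\in\mathbb R$, $$h(y,z)=\sum_{j\in\mathbb N}\frac1{yj}\Big(\omega(yj)-\omega\Big(\frac{|z|}{yj}\Big)\Big).$$ The functions are $$p_{1,q}(\vec w)=-\frac{2c}{Q}\int_{\mathbb R^2}\omega_0\Big(\frac{|\vec x|}{Q^{3/2}}\Big)\sum_{j\in\mathbb N}\frac1{q^2j^2}\,\omega\Big(\frac{|\vec x|}{jqQ^{1/2}}\Big)e(-\vec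 w\cdot\vec x)\,d\vec x,$$ $$p_{2,\vec r,k,q}(\vec w)=\frac{c}{Q^3}\int_{\mathbb R^2}\omega_0\Big(\frac{|\vec x|}{Q^{3/2}}\Big)h\Big(\frac{kq}{Q},\frac{\vec r\cdot\vec x}{Q^2}\Big)e(-\vec w\cdot\vec x)\,d\vec x.$$ The term $\vec r=\vec 0$ in sums over $\vec r$ is zero because $\omega(0)=0$. *)

theory Defs
  imports "HOL-Analysis.Analysis"
begin

text \<open>
  Vectors of the plane are pairs: the norm and inner product on \<^typ>\<open>real \<times> real\<close> are the
  Euclidean ones, and \<^term>\<open>lborel :: (real \<times> real) measure\<close> is two-dimensional Lebesgue measure.
\<close>

definition smooth :: "(real \<Rightarrow> real) \<Rightarrow> bool" where
  "smooth f \<longleftrightarrow> (\<forall>k x. (deriv ^^ k) f differentiable (at x))"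

text \<open>``Supported on'' an open interval is read as vanishing outside that interval.\<close>

definition weight_functions :: "(real \<Rightarrow> real) \<Rightarrow> (real \<Rightarrow> real) \<Rightarrow> bool" where
  "weight_functions \<omega> \<omega>0 \<longleftrightarrow>
     smooth \<omega> \<and> (\<forall>x. \<omega> x \<ge> 0) \<and> {x. \<omega> x \<noteq> 0} \<subseteq> {1/2<..<1} \<and> (LINT x|lborel. \<omega> x) = 1 \<and>
     smooth \<omega>0 \<and> (\<forall>x. \<omega>0 x \<ge> 0) \<and> (\<forall>x. \<omega>0 (- x) = \<omega>0 x) \<and> \<omega>0 0 = 1 \<and>
     (LINT x|lborel. \<omega>0 x) = 1 \<and> {x. \<omega>0 x \<noteq> 0} \<subseteq> {-1/2<..<1/2} \<and>
     smooth (\<lambda>x. \<omega>0 (\<bar>x\<bar> powr (1/2)))"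

definition e2pi :: "real \<Rightarrow> complex" where
  "e2pi x = exp (2 * of_real pi * \<i> * of_real x)"

definition rvec :: "int \<times> int \<Rightarrow> real \<times> real" where
  "rvec r = (of_int (fst r), of_int (snd r))"

definition perp :: "'a::uminus \<times> 'a \<Rightarrow> 'a \<times> 'a" where
  "perp x = (snd x, - fst x)"

definition idot :: "int \<times> int \<Rightarrow> int \<times> int \<Rightarrow> int" where
  "idot x y = fst x * fst y + snd x * snd y"

definition iscale :: "int \<Rightarrow> int \<times> int \<Rightarrow> int \<times> int" where
  "iscale m x = (m * fst x, m * snd x)"

definition vgcd :: "int \<times> int \<Rightarrow> int" where
  "vgcd r = gcd (fst r) (snd r)"

definition vgcd_mod :: "int \<times> int \<Rightarrow> nat \<Rightarrow> int" where
  "vgcd_mod r q = gcd (vgcd r) (int q)"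

definition primitive :: "int \<times> int \<Rightarrow> bool" where
  "primitive r \<longleftrightarrow> vgcd r = 1"

definition lattice_of :: "int \<times> int \<Rightarrow> nat \<Rightarrow> (int \<times> int) set" where
  "lattice_of a q = {iscale k a + iscale (int q) y | k y. True}"

text \<open>
  Least nonnegative representatives of the \<open>\<^bold>a mod q\<close> with \<open>gcd(\<^bold>a,q) = 1\<close>.  In every sum below
  the condition on \<open>\<^bold>a\<close> and the summand depend only on \<open>\<^bold>a mod q\<close>.
\<close>

definition primitive_residues :: "nat \<Rightarrow> (int \<times> int) set" where
  "primitive_residues q = {a \<in> {0..<int q} \<times> {0..<int q}. vgcd_mod a q = 1}"

definition c_const :: "(real \<Rightarrow> real) \<Rightarrow> real" where
  "c_const \<omega> = inverse (LINT x|lborel. \<omega> (norm (x :: real \<times> real)))"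

text \<open>
  For weights supported as in \<^const>\<open>weight_functions\<close>, every \<open>\<Sum>\<^sub>\<infinity>\<close> below has only finitely many
  nonzero terms (for positive \<open>y\<close>, \<open>q\<close> and \<open>Q\<close>).
\<close>

definition h_fun :: "(real \<Rightarrow> real) \<Rightarrow> real \<Rightarrow> real \<Rightarrow> real" where
  "h_fun \<omega> y z =
     (\<Sum>\<^sub>\<infinity>j\<in>{1::nat..}. 1 / (y * real j) * (\<omega> (y * real j) - \<omega> (\<bar>z\<bar> / (y * real j))))"

definition p1 ::
  "(real \<Rightarrow> real) \<Rightarrow> (real \<Rightarrow> real) \<Rightarrow> real \<Rightarrow> nat \<Rightarrow> real \<times> real \<Rightarrow> complex" where
  "p1 \<omega> \<omega>0 Q q w =
     - of_real (2 * c_const \<omega> / Q) *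
       (LINT x|lborel.
          of_real (\<omega>0 (norm x / Q powr (3/2)) *
            (\<Sum>\<^sub>\<infinity>j\<in>{1::nat..}. 1 / ((real q)\<^sup>2 * (real j)\<^sup>2) *
               \<omega> (norm x / (real j * real q * Q powr (1/2)))))
          * e2pi (- (w \<bullet> x)))"

definition p2 ::
  "(real \<Rightarrow> real) \<Rightarrow> (real \<Rightarrow> real) \<Rightarrow> real \<Rightarrow> int \<times> int \<Rightarrow> nat \<Rightarrow> nat \<Rightarrow> real \<times> real \<Rightarrow> complex" where
  "p2 \<omega> \<omega>0 Q r k q w =
     of_real (c_const \<omega> / Q ^ 3) *
       (LINT x|lborel.
          of_real (\<omega>0 (norm x / Q powr (3/2)) *
            h_fun \<omega> (real k * real q / Q) ((rvec r \<bullet> x) / Q\<^sup>2))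
          * e2pi (- (w \<bullet> x)))"

text \<open>The term \<open>r = 0\<close> vanishes because \<open>\<omega> 0 = 0\<close>, so the value \<open>k = 0\<close> occurring there is harmless.\<close>

definition p_Lambda ::
  "(real \<Rightarrow> real) \<Rightarrow> (real \<Rightarrow> real) \<Rightarrow> real \<Rightarrow> int \<times> int \<Rightarrow> nat \<Rightarrow> real \<times> real \<Rightarrow> complex" where
  "p_Lambda \<omega> \<omega>0 Q a q w =
     p1 \<omega> \<omega>0 Q q w +
     (\<Sum>\<^sub>\<infinity>r\<in>lattice_of a q.
        of_real (\<omega> (norm (rvec r) / Q powr (1/2))) *
        p2 \<omega> \<omega>0 Q r (nat (vgcd r div vgcd_mod r q)) q w)"

definition delta_vec :: "int \<times> int \<Rightarrow> complex" where
  "delta_vec n = (if n = 0 then 1 else 0)"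

text \<open>\<open>\<integral> p(\<^bold>w) e((\<^bold>a/q + \<^bold>w) \<cdot> \<^bold>n) d\<^bold>w\<close>\<close>

definition arc_integral ::
  "(real \<times> real \<Rightarrow> complex) \<Rightarrow> int \<times> int \<Rightarrow> nat \<Rightarrow> int \<times> int \<Rightarrow> complex" where
  "arc_integral p a q n =
     (LINT w|lborel. p w * e2pi (((1 / real q) *\<^sub>R rvec a + w) \<bullet> rvec n))"

end

theory Submission
 imports Defs "HOL-Probability.Probability"
begin

text \<open>
 The functions \<open>p\<^sub>1\<close> and \<open>p\<^sub>2\<close> are Fourier transforms of smooth functions of compact support, so
 Fourier inversion turns every integral over \<open>w\<close> into a value at \<open>n\<close> times an additive character, and
 the bounds (3) and (4) are repeated integration by parts, for (4) in the coordinates along \<open>r\<close> and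
 \<open>r\<^sup>\<bottom>\<close>.  Summing the characters over \<open>a\<close> and \<open>q\<close> leaves divisor sums.  The contribution of
 \<open>r\<close> vanishes unless \<open>gcd(r)\<close> divides \<open>gcd(n)\<close> and \<open>r \<cdot> n = 0\<close>, because the two halves of \<open>h\<close> are
 exchanged by the divisor switch \<open>t \<mapsto> \<mu>/t\<close>.  For \<open>n \<noteq> 0\<close> the remaining \<open>r\<close> are the multiples
 \<open>\<plusminus>n\<^sup>\<bottom>/m\<close> with \<open>m | gcd(n)\<close>, and they cancel the terms of \<open>p\<^sub>1\<close>; for \<open>n = 0\<close> a smooth Riemann sum over
 \<open>r\<close> gives 1.  For (2), smooth Riemann sums over \<open>j\<close> and over the lattice write \<open>p\<^sub>1\<close> as 1 minus a mean
 over rays and the sum of the \<open>p\<^sub>2\<close> as the same mean, rotated by \<open>u \<mapsto> u\<^sup>\<bottom>\<close>.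
\<close>

text \<open>Every implied constant must be uniform in q, k, r, w and Q. Smoothness is therefore
  attached to families of functions with common derivative bounds rather than to single functions,
  and functions of two variables enter through their restrictions to lines, so that one-variable
  arguments suffice. The obstacle in (4) is that h(y,z) has size 1/y for z near 0. Once y \<le>
  2|z|, both halves of h have the same leading term, a constant over y, and these cancel. Hence h is
  dominated by a constant times 1 plus a Poisson kernel in z, whose integral over z, unlike its
  maximum, stays bounded as y tends to 0. The arithmetic depends on kq = lcm(gcd(r), q). Grouping
  terms by the multiple m of q that occurs in the weight turns the primitive residues modulo all q
  dividing m into a complete system modulo m, where the characters are orthogonal. In (2) the
  isolated 1 is the missing term j = 0 of the sum defining p1, because c normalises the
  weight.\<close>

lemma e2pi_eq_cis: "e2pi x = cis (2 * pi * x)"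
 by (simp add: e2pi_def cis_conv_exp mult_ac)

lemma norm_e2pi [simp]: "norm (e2pi x) = 1"
 by (simp add: e2pi_eq_cis)

lemma e2pi_0 [simp]: "e2pi 0 = 1"
 by (simp add: e2pi_eq_cis)

lemma e2pi_add: "e2pi (x + y) = e2pi x * e2pi y"
 by (simp add: e2pi_eq_cis cis_mult algebra_simps)

lemma e2pi_of_int [simp]: "e2pi (of_int n) = 1"
 by (simp add: e2pi_eq_cis cis_multiple_2pi)

lemma continuous_on_e2pi [continuous_intros]:
 "continuous_on A f \<Longrightarrow> continuous_on A (\<lambda>x. e2pi (f x))"
 unfolding e2pi_def by (intro continuous_intros)

lemma e2pi_measurable [measurable]: "e2pi \<in> borel_measurable borel"
 by (intro borel_measurable_continuous_onI continuous_intros)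

lemma has_vector_derivative_e2pi:
 "((\<lambda>x. e2pi (a * x + b)) has_vector_derivative 2 * of_real pi * \<i> * of_real a * e2pi (a * x + b)) (at x)"
proof -
 have "((\<lambda>z. exp (2 * of_real pi * \<i> * (of_real a * z + of_real b))) has_field_derivative
   2 * of_real pi * \<i> * of_real a * e2pi (a * x + b)) (at (of_real x))"
  unfolding e2pi_def by (auto intro!: derivative_eq_intros)
 from has_vector_derivative_real_field[OF this] show ?thesis
  by (simp add: e2pi_def o_def)
qed

section \<open>Families of functions with common derivative bounds\<close>

text \<open>The derivatives are collected in a second family F' instead of being computed by
  \<open>deriv\<close>: F' may be any convenient set containing them, such as all sums or products
  of members of known families. One bound serves the whole family at each level, which is the source
  of the uniformity below.\<close>

primrec bounded_derivs :: "nat \<Rightarrow> (real \<Rightarrow> complex) set \<Rightarrow> bool" where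
 "bounded_derivs 0 F \<longleftrightarrow>
   (\<exists>C. \<forall>f\<in>F. \<forall>x. norm (f x) \<le> C) \<and> (\<forall>f\<in>F. continuous_on UNIV f)"
| "bounded_derivs (Suc k) F \<longleftrightarrow>
   (\<exists>C. \<forall>f\<in>F. \<forall>x. norm (f x) \<le> C) \<and>
   (\<exists>F'. bounded_derivs k F' \<and> (\<forall>f\<in>F. \<exists>f'\<in>F'. \<forall>x. (f has_vector_derivative f' x) (at x)))"

lemma bounded_derivs_SucI:
 assumes "\<And>f x. f \<in> F \<Longrightarrow> norm (f x) \<le> C" "bounded_derivs k F'"
  "\<And>f. f \<in> F \<Longrightarrow> \<exists>f'\<in>F'. \<forall>x. (f has_vector_derivative f' x) (at x)"
 shows "bounded_derivs (Suc k) F"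
 unfolding bounded_derivs.simps using assms by blast

lemma bounded_derivs_SucE:
 assumes "bounded_derivs (Suc k) F"
 obtains F' where "bounded_derivs k F'"
  "\<And>f. f \<in> F \<Longrightarrow> \<exists>f'\<in>F'. \<forall>x. (f has_vector_derivative f' x) (at x)"
 using assms by auto

lemma bounded_derivs_bound:
 assumes "bounded_derivs k F"
 obtains C where "C > 0" "\<And>f x. f \<in> F \<Longrightarrow> norm (f x) \<le> C"
proof -
 obtain C where "\<forall>f\<in>F. \<forall>x. norm (f x) \<le> C"
  using assms by (cases k) auto
 then show ?thesis
  by (intro that[of "max C 1"]) (auto simp: le_max_iff_disj)
qed

lemma bounded_derivs_continuous:
 assumes "bounded_derivs k F" "f \<in> F"
 shows "continuous_on A f"
proof (cases k)
 case 0
 then show ?thesis using assms continuous_on_subset by auto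
next
 case (Suc j)
 then obtain f' where "\<And>x. (f has_vector_derivative f' x) (at x)"
  using assms by (metis bounded_derivs_SucE)
 then show ?thesis
  by (meson continuous_at_imp_continuous_on has_vector_derivative_continuous)
qed

lemma bounded_derivs_subset: "bounded_derivs k G \<Longrightarrow> F \<subseteq> G \<Longrightarrow> bounded_derivs k F"
 by (cases k) (fastforce dest: subsetD)+

lemma bounded_derivs_lower: "bounded_derivs (Suc k) F \<Longrightarrow> bounded_derivs k F"
proof (induction k arbitrary: F)
 case 0
 have "continuous_on UNIV f" if "f \<in> F" for f
  using bounded_derivs_continuous[OF 0 that] .
 then show ?case using 0 by auto
next
 case (Suc k)
 obtain F' where F': "bounded_derivs (Suc k) F'" "\<forall>f\<in>F. \<exists>f'\<in>F'. \<forall>x. (f has_vector_derivative f' x) (at x)"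
  using bounded_derivs_SucE[OF Suc.prems] by metis
 obtain C where C: "\<And>f x. f \<in> F \<Longrightarrow> norm (f x) \<le> C"
  using bounded_derivs_bound[OF Suc.prems] by metis
 show ?case
  by (rule bounded_derivs_SucI[of _ C, OF _ Suc.IH[OF F'(1)]]) (use F' C in auto)
qed

lemma bounded_derivs_add:
 "bounded_derivs k F \<Longrightarrow> bounded_derivs k G \<Longrightarrow>
   bounded_derivs k {\<lambda>x. f x + g x | f g. f \<in> F \<and> g \<in> G}"
proof (induction k arbitrary: F G)
 case 0
 obtain C D where "\<forall>f\<in>F. \<forall>x. norm (f x) \<le> C" "\<forall>f\<in>G. \<forall>x. norm (f x) \<le> D"
  using 0 by auto
 then have "\<forall>h\<in>{\<lambda>x. f x + g x | f g. f \<in> F \<and> g \<in> G}. \<forall>x. norm (h x) \<le> C + D"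
  by (auto intro!: norm_triangle_le add_mono)
 then show ?case using 0 by (auto intro!: continuous_intros)
next
 case (Suc k)
 obtain C D where "\<forall>f\<in>F. \<forall>x. norm (f x) \<le> C" "\<forall>f\<in>G. \<forall>x. norm (f x) \<le> D"
  using Suc by auto
 then have bd: "\<forall>h\<in>{\<lambda>x. f x + g x | f g. f \<in> F \<and> g \<in> G}. \<forall>x. norm (h x) \<le> C + D"
  by (auto intro!: norm_triangle_le add_mono)
 obtain F' G' where F': "bounded_derivs k F'" "\<forall>f\<in>F. \<exists>f'\<in>F'. \<forall>x. (f has_vector_derivative f' x) (at x)"
  and G': "bounded_derivs k G'" "\<forall>f\<in>G. \<exists>f'\<in>G'. \<forall>x. (f has_vector_derivative f' x) (at x)"
  using Suc.prems unfolding bounded_derivs.simps by blast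
 show ?case
 proof (rule bounded_derivs_SucI[where C="C + D"])
  show "bounded_derivs k {\<lambda>x. f x + g x | f g. f \<in> F' \<and> g \<in> G'}"
   by (rule Suc.IH) (use F' G' in auto)
  fix h assume "h \<in> {\<lambda>x. f x + g x | f g. f \<in> F \<and> g \<in> G}"
  then obtain f g where h: "h = (\<lambda>x. f x + g x)" "f \<in> F" "g \<in> G" by auto
  obtain f' g' where fg: "f' \<in> F'" "g' \<in> G'" "\<forall>x. (f has_vector_derivative f' x) (at x)"
   "\<forall>x. (g has_vector_derivative g' x) (at x)" using F' G' h by blast
  show "\<exists>f'\<in>{\<lambda>x. f x + g x | f g. f \<in> F' \<and> g \<in> G'}. \<forall>x. (h has_vector_derivative f' x) (at x)"
   using fg by (intro bexI[of _ "\<lambda>x. f' x + g' x"]) (auto simp: h intro!: derivative_intros)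
 qed (use bd in blast)
qed

lemma bounded_derivs_mult:
 "bounded_derivs k F \<Longrightarrow> bounded_derivs k G \<Longrightarrow>
   bounded_derivs k {\<lambda>x. f x * g x | f g. f \<in> F \<and> g \<in> G}"
proof (induction k arbitrary: F G)
 case 0
 obtain C D where "C > 0" "\<forall>f\<in>F. \<forall>x. norm (f x) \<le> C" "\<forall>f\<in>G. \<forall>x. norm (f x) \<le> D"
  using bounded_derivs_bound 0 by metis
 then have "\<forall>h\<in>{\<lambda>x. f x * g x | f g. f \<in> F \<and> g \<in> G}. \<forall>x. norm (h x) \<le> C * D"
  by (auto simp: norm_mult intro!: mult_mono)
 then show ?case using 0 by (auto intro!: continuous_intros)
next
 case (Suc k)
 obtain C D where "C > 0" "\<forall>f\<in>F. \<forall>x. norm (f x) \<le> C" "\<forall>f\<in>G. \<forall>x. norm (f x) \<le> D"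
  using bounded_derivs_bound Suc.prems by metis
 then have bd: "\<forall>h\<in>{\<lambda>x. f x * g x | f g. f \<in> F \<and> g \<in> G}. \<forall>x. norm (h x) \<le> C * D"
  by (auto simp: norm_mult intro!: mult_mono)
 obtain F' G' where F': "bounded_derivs k F'" "\<forall>f\<in>F. \<exists>f'\<in>F'. \<forall>x. (f has_vector_derivative f' x) (at x)"
  and G': "bounded_derivs k G'" "\<forall>f\<in>G. \<exists>f'\<in>G'. \<forall>x. (f has_vector_derivative f' x) (at x)"
  using Suc.prems unfolding bounded_derivs.simps by blast
 \<comment> \<open>Leibniz rule: in each product one factor is differentiated and the other is used
   at the lower level k.\<close>
 let ?A = "{\<lambda>x. f x * g x | f g. f \<in> F \<and> g \<in> G'}" and ?B = "{\<lambda>x. f x * g x | f g. f \<in> F' \<and> g \<in> G}"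
 show ?case
 proof (rule bounded_derivs_SucI[where C="C * D"])
  show "bounded_derivs k {\<lambda>x. f x + g x | f g. f \<in> ?A \<and> g \<in> ?B}"
   using Suc.prems[THEN bounded_derivs_lower] F'(1) G'(1) by (intro bounded_derivs_add Suc.IH)
  fix h assume "h \<in> {\<lambda>x. f x * g x | f g. f \<in> F \<and> g \<in> G}"
  then obtain f g where h: "h = (\<lambda>x. f x * g x)" "f \<in> F" "g \<in> G" by auto
  obtain f' g' where fg: "f' \<in> F'" "g' \<in> G'" "\<forall>x. (f has_vector_derivative f' x) (at x)"
   "\<forall>x. (g has_vector_derivative g' x) (at x)" using F' G' h by blast
  have "(\<lambda>x. f x * g' x + f' x * g x) \<in> {\<lambda>x. f x + g x | f g. f \<in> ?A \<and> g \<in> ?B}"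
   by (rule CollectI, rule exI[of _ "\<lambda>x. f x * g' x"], rule exI[of _ "\<lambda>x. f' x * g x"])
    (use h fg in auto)
  then show "\<exists>f'\<in>{\<lambda>x. f x + g x | f g. f \<in> ?A \<and> g \<in> ?B}. \<forall>x. (h has_vector_derivative f' x) (at x)"
   using fg by (intro bexI[of _ "\<lambda>x. f x * g' x + f' x * g x"])
    (auto simp: h intro!: has_vector_derivative_mult)
 qed (use bd in blast)
qed

lemma bounded_derivs_const: "bounded_derivs k {\<lambda>x. c | c. norm c \<le> B}"
proof (induction k arbitrary: B)
 case (Suc k)
 \<comment> \<open>The derivative of a constant lies in the same kind of family with B = 0, which
   contains only the zero function.\<close>
 show ?case
 proof (rule bounded_derivs_SucI[where C=B, OF _ Suc[of 0]])
  show "norm (f x) \<le> B" if "f \<in> {\<lambda>x. c | c. norm c \<le> B}" for f :: "real \<Rightarrow> complex" and x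
   using that by auto
  show "\<exists>f'\<in>{\<lambda>x. c | c. norm c \<le> 0}. \<forall>x. (f has_vector_derivative f' x) (at x)"
   if "f \<in> {\<lambda>x. c | c. norm c \<le> B}" for f :: "real \<Rightarrow> complex"
   using that by (intro bexI[of _ "\<lambda>x. 0"]) auto
 qed
next
 case 0
 have "\<forall>f\<in>{\<lambda>x. c | c. norm c \<le> B}. \<forall>x :: real. norm (f x) \<le> B" by auto
 then show ?case by auto
qed

lemma bounded_derivs_cmult:
 assumes "bounded_derivs k F"
 shows "bounded_derivs k {\<lambda>x. c * f x | c f. norm c \<le> B \<and> f \<in> F}"
proof (rule bounded_derivs_subset[OF bounded_derivs_mult[OF bounded_derivs_const[of k B] assms]], rule subsetI)
 fix h assume "h \<in> {\<lambda>x. c * f x | c f. norm c \<le> B \<and> f \<in> F}"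
 then obtain c f where "h = (\<lambda>x. c * f x)" "norm c \<le> B" "f \<in> F" by auto
 then show "h \<in> {\<lambda>x. f x * g x | f g. f \<in> {\<lambda>x. c | c. norm c \<le> B} \<and> g \<in> F}"
  by (intro CollectI exI[of _ "\<lambda>x. c"] exI[of _ f]) auto
qed

lemma bounded_derivs_e2pi: "bounded_derivs k {\<lambda>x. e2pi (a * x + b) | a b. \<bar>a\<bar> \<le> B}"
proof (induction k)
 case 0
 show ?case by (auto intro!: exI[of _ 1] continuous_intros)
next
 case (Suc k)
 let ?A = "{\<lambda>x. e2pi (a * x + b) | a b. \<bar>a\<bar> \<le> B}"
 show ?case
 proof (rule bounded_derivs_SucI[where C="1"])
  show "bounded_derivs k {\<lambda>x. c * f x | c f. norm c \<le> 2 * pi * B \<and> f \<in> ?A}"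
   by (intro bounded_derivs_cmult Suc.IH)
  fix h assume "h \<in> ?A"
  then obtain a b where h: "h = (\<lambda>x. e2pi (a * x + b))" "\<bar>a\<bar> \<le> B" by auto
  show "\<exists>f'\<in>{\<lambda>x. c * f x | c f. norm c \<le> 2 * pi * B \<and> f \<in> ?A}. \<forall>x. (h has_vector_derivative f' x) (at x)"
   using h(2) unfolding h(1)
   by (intro bexI[of _ "\<lambda>x. (2 * of_real pi * \<i> * of_real a) * e2pi (a * x + b)"] allI has_vector_derivative_e2pi)
    (auto simp: norm_mult intro!: exI[of _ "2 * of_real pi * \<i> * of_real a"] exI[of _ "\<lambda>x. e2pi (a * x + b)"])
 qed auto
qed


lemma vector_derivative_zero_outside:
 fixes f :: "real \<Rightarrow> complex"
 assumes "(f has_vector_derivative d) (at x)" "open S" "x \<in> S" "\<And>y. y \<in> S \<Longrightarrow> f y = 0"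
 shows "d = 0"
proof -
 have "((\<lambda>_. 0) has_vector_derivative d) (at x)"
  using has_vector_derivative_transform_within_open[OF assms(1-3)] assms(4) by simp
 then show ?thesis
  using vector_derivative_unique_at has_vector_derivative_const by blast
qed

lemma bounded_derivs_SucI':
 assumes "bounded_derivs j F" "bounded_derivs k F'"
  "\<And>f. f \<in> F \<Longrightarrow> \<exists>f'\<in>F'. \<forall>x. (f has_vector_derivative f' x) (at x)"
 shows "bounded_derivs (Suc k) F"
 by (rule bounded_derivs_bound[OF assms(1)], rule bounded_derivs_SucI[OF _ assms(2,3)])

definition supported_in :: "'a set \<Rightarrow> ('a \<Rightarrow> complex) set \<Rightarrow> bool" where
 "supported_in T F \<longleftrightarrow> (\<forall>f\<in>F. \<forall>x. x \<notin> T \<longrightarrow> f x = 0)"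

lemma supported_inD: "supported_in T F \<Longrightarrow> f \<in> F \<Longrightarrow> x \<notin> T \<Longrightarrow> f x = 0"
 by (auto simp: supported_in_def)

text \<open>The family F' supplied by the definition may contain functions that do not vanish
  outside T. Discarding them loses no derivative, because the complement of T is open and a function
  that is zero there has derivative zero there.\<close>

lemma bounded_derivs_SucE_support:
 assumes "bounded_derivs (Suc k) F" "closed T" "supported_in T F"
 obtains F' where "bounded_derivs k F'" "supported_in T F'"
  "\<And>f. f \<in> F \<Longrightarrow> \<exists>f'\<in>F'. \<forall>x. (f has_vector_derivative f' x) (at x)"
proof -
 obtain F' where F': "bounded_derivs k F'"
  "\<And>f. f \<in> F \<Longrightarrow> \<exists>f'\<in>F'. \<forall>x. (f has_vector_derivative f' x) (at x)"
  using bounded_derivs_SucE[OF assms(1)] by metis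
 let ?G = "{f'\<in>F'. \<forall>x. x \<notin> T \<longrightarrow> f' x = 0}"
 show ?thesis
 proof (rule that[of ?G])
  show "bounded_derivs k ?G" by (rule bounded_derivs_subset[OF F'(1)]) auto
  fix f assume f: "f \<in> F"
  then obtain f' where f': "f' \<in> F'" "\<And>x. (f has_vector_derivative f' x) (at x)"
   using F'(2) by blast
  have "f' x = 0" if "x \<notin> T" for x
   using vector_derivative_zero_outside[OF f'(2), of "-T" x] that f assms by (auto simp: supported_in_def)
  then show "\<exists>f'\<in>?G. \<forall>x. (f has_vector_derivative f' x) (at x)"
   using f' by auto
 qed (auto simp: supported_in_def)
qed

text \<open>Each differentiation of f(|\<alpha> + x \<beta>|^2) brings out the factor 2 (\<alpha> +
  x \<beta>) . \<beta>, so powers of it are included to close the induction. The factor is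
  unbounded, but on the support of f one has |\<alpha> + x \<beta>| \<le> 1 and it is at most 2B;
  the bounds are therefore independent of \<alpha>.\<close>

lemma bounded_derivs_sqnorm_weighted:
 fixes B :: real
 assumes "B \<ge> 0"
 shows "bounded_derivs k F \<Longrightarrow> supported_in {-1..1} F \<Longrightarrow>
  bounded_derivs k {\<lambda>x. of_real ((2 * ((\<alpha> + x *\<^sub>R \<beta>) \<bullet> \<beta>)) ^ m) * f ((norm (\<alpha> + x *\<^sub>R \<beta>))\<^sup>2) |
   f \<alpha> (\<beta> :: 'a::real_inner). f \<in> F \<and> norm \<beta> \<le> B}"
proof (induction k arbitrary: F m)
 case 0
 let ?G = "{\<lambda>x. of_real ((2 * ((\<alpha> + x *\<^sub>R \<beta>) \<bullet> \<beta>)) ^ m) * f ((norm (\<alpha> + x *\<^sub>R \<beta>))\<^sup>2) |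
   f \<alpha> (\<beta> :: 'a). f \<in> F \<and> norm \<beta> \<le> B}"
 obtain C where C: "C > 0" "\<And>f x. f \<in> F \<Longrightarrow> norm (f x) \<le> C"
  using bounded_derivs_bound[OF 0(1)] by metis
 have "norm (of_real ((2 * ((\<alpha> + x *\<^sub>R \<beta>) \<bullet> \<beta>)) ^ m) * f ((norm (\<alpha> + x *\<^sub>R \<beta>))\<^sup>2)) \<le> (2 * B) ^ m * C"
  if "f \<in> F" "norm \<beta> \<le> B" for f x and \<alpha> \<beta> :: "'a"
 proof (cases "(norm (\<alpha> + x *\<^sub>R \<beta>))\<^sup>2 \<le> 1")
  case True
  then have "norm (\<alpha> + x *\<^sub>R \<beta>) \<le> 1" by (simp add: power_le_one_iff)
  then have "\<bar>(\<alpha> + x *\<^sub>R \<beta>) \<bullet> \<beta>\<bar> \<le> 1 * B"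
   using Cauchy_Schwarz_ineq2[of "\<alpha> + x *\<^sub>R \<beta>" \<beta>] mult_mono[OF _ that(2), of "norm (\<alpha> + x *\<^sub>R \<beta>)" 1]
   by simp
  then have "\<bar>2 * ((\<alpha> + x *\<^sub>R \<beta>) \<bullet> \<beta>)\<bar> ^ m \<le> (2 * B) ^ m"
   by (intro power_mono) auto
  then show ?thesis
   using C that assms by (auto simp: norm_mult norm_power power_abs abs_mult intro!: mult_mono)
 qed (use supported_inD[OF 0(2) that(1)] assms C in \<open>auto intro!: mult_nonneg_nonneg\<close>)
 moreover have "continuous_on UNIV (\<lambda>x. of_real ((2 * ((\<alpha> + x *\<^sub>R \<beta>) \<bullet> \<beta>)) ^ m) * f ((norm (\<alpha> + x *\<^sub>R \<beta>))\<^sup>2))"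
  if "f \<in> F" for f and \<alpha> \<beta> :: "'a"
  by (intro continuous_intros continuous_on_compose2[OF bounded_derivs_continuous[OF 0(1) that], where f="\<lambda>x. (norm (\<alpha> + x *\<^sub>R \<beta>))\<^sup>2"]) auto
 ultimately have "\<forall>h\<in>?G. \<forall>x. norm (h x) \<le> (2 * B) ^ m * C" "\<forall>h\<in>?G. continuous_on UNIV h"
  by blast+
 then show ?case unfolding bounded_derivs.simps by blast
next
 case (Suc k)
 obtain F' where F': "bounded_derivs k F'" "supported_in {-1..1} F'"
  "\<And>f. f \<in> F \<Longrightarrow> \<exists>f'\<in>F'. \<forall>x. (f has_vector_derivative f' x) (at x)"
  using bounded_derivs_SucE_support[where T="{-1..1}", OF Suc.prems(1) closed_atLeastAtMost Suc.prems(2)] by metis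
 define H where "H m f \<alpha> \<beta> x = of_real ((2 * ((\<alpha> + x *\<^sub>R \<beta>) \<bullet> \<beta>)) ^ m) * f ((norm (\<alpha> + x *\<^sub>R \<beta>))\<^sup>2)"
  for m and f :: "real \<Rightarrow> complex" and \<alpha> \<beta> :: "'a" and x
 have IH: "bounded_derivs k {H m f \<alpha> \<beta> | f \<alpha> \<beta>. f \<in> F \<and> norm \<beta> \<le> B}"
  if "bounded_derivs k F" "supported_in {-1..1} F" for F m
  unfolding H_def[abs_def] by (rule Suc.IH[OF that])
 \<comment> \<open>Derivative of L^m f(P) with P' = L and L' = 2 |\<beta>|^2: the terms are L^(m+1)
   f'(P) and 2 m |\<beta>|^2 L^(m-1) f(P). For m = 0 the truncated exponent is harmless because the
   coefficient m is zero.\<close>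
 let ?A = "{H (Suc m) f \<alpha> \<beta> | f \<alpha> \<beta>. f \<in> F' \<and> norm \<beta> \<le> B}"
 let ?B = "{H (m - 1) f \<alpha> \<beta> | f \<alpha> \<beta>. f \<in> F \<and> norm \<beta> \<le> B}"
 let ?C = "{\<lambda>x. c * f x | c f. norm c \<le> m * (2 * B\<^sup>2) \<and> f \<in> ?B}"
 let ?D = "{\<lambda>x. f x + g x | f g. f \<in> ?A \<and> g \<in> ?C}"
 have "bounded_derivs (Suc k) {H m f \<alpha> \<beta> | f \<alpha> \<beta>. f \<in> F \<and> norm \<beta> \<le> B}"
 proof (rule bounded_derivs_SucI'[OF IH[OF bounded_derivs_lower[OF Suc.prems(1)] Suc.prems(2), of m]])
  show "bounded_derivs k ?D"
   using IH[OF F'(1,2), of "Suc m"] IH[OF bounded_derivs_lower[OF Suc.prems(1)] Suc.prems(2), of "m - 1"]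
   by (intro bounded_derivs_add bounded_derivs_cmult)
  fix h assume "h \<in> {H m f \<alpha> \<beta> | f \<alpha> \<beta>. f \<in> F \<and> norm \<beta> \<le> B}"
  then obtain f \<alpha> \<beta> where h: "h = H m f \<alpha> \<beta>" "f \<in> F" "norm \<beta> \<le> B" by auto
  obtain f' where f': "f' \<in> F'" "\<And>x. (f has_vector_derivative f' x) (at x)" using F'(3) h by blast
  define L where "L x = 2 * ((\<alpha> + x *\<^sub>R \<beta>) \<bullet> \<beta>)" for x
  define P where "P x = (norm (\<alpha> + x *\<^sub>R \<beta>))\<^sup>2" for x
  have L: "(L has_real_derivative 2 * (\<beta> \<bullet> \<beta>)) (at x)" for x
   unfolding L_def by (auto simp: inner_add_left intro!: derivative_eq_intros)
  have Pe: "P x = \<alpha> \<bullet> \<alpha> + x * (2 * (\<alpha> \<bullet> \<beta>)) + x\<^sup>2 * (\<beta> \<bullet> \<beta>)" for x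
   unfolding P_def power2_norm_eq_inner
   by (simp add: inner_add_left inner_add_right inner_commute algebra_simps power2_eq_square)
  have P: "(P has_real_derivative L x) (at x)" for x
   unfolding Pe[abs_def] L_def by (auto simp: inner_add_left algebra_simps intro!: derivative_eq_intros)
  have fP: "((\<lambda>x. f (P x)) has_vector_derivative (of_real (L x) * f' (P x))) (at x)" for x
   using vector_diff_chain_at[of P "L x" x f "f' (P x)", OF _ f'(2)] P
   by (simp add: o_def scaleR_conv_of_real has_real_derivative_iff_has_vector_derivative)
  have Lm: "((\<lambda>x. complex_of_real (L x ^ m)) has_vector_derivative of_real (m * L x ^ (m - 1) * (2 * (\<beta> \<bullet> \<beta>)))) (at x)" for x
   using DERIV_power[OF L[of x], of m] by (intro has_vector_derivative_of_real) (simp add: mult_ac)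
  have "((\<lambda>x. of_real (L x ^ m) * f (P x)) has_vector_derivative
    of_real (L x ^ Suc m) * f' (P x) + of_real (m * (2 * (\<beta> \<bullet> \<beta>))) * (of_real (L x ^ (m - 1)) * f (P x))) (at x)" for x
   by (rule has_vector_derivative_eq_rhs[OF has_vector_derivative_mult[OF Lm fP]]) (simp add: algebra_simps)
  then have "(h has_vector_derivative H (Suc m) f' \<alpha> \<beta> x + of_real (m * (2 * (\<beta> \<bullet> \<beta>))) * H (m - 1) f \<alpha> \<beta> x) (at x)" for x
   unfolding h(1) H_def[abs_def] L_def P_def .
  moreover have *: "norm (complex_of_real (m * (2 * (\<beta> \<bullet> \<beta>)))) \<le> m * (2 * B\<^sup>2)"
   using power_mono[OF h(3) norm_ge_zero, of 2] unfolding norm_of_real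
   by (simp add: abs_mult dot_square_norm mult_left_mono)
  moreover have "(\<lambda>x. H (Suc m) f' \<alpha> \<beta> x + of_real (m * (2 * (\<beta> \<bullet> \<beta>))) * H (m - 1) f \<alpha> \<beta> x) \<in> ?D"
  proof (rule CollectI, intro exI conjI)
   show "H (Suc m) f' \<alpha> \<beta> \<in> ?A" using f' h by auto
   show "(\<lambda>x. of_real (m * (2 * (\<beta> \<bullet> \<beta>))) * H (m - 1) f \<alpha> \<beta> x) \<in> ?C"
    using h * by (intro CollectI exI[of _ "complex_of_real (m * (2 * (\<beta> \<bullet> \<beta>)))"] exI[of _ "H (m - 1) f \<alpha> \<beta>"]) auto
  qed simp
  ultimately show "\<exists>f'\<in>?D. \<forall>x. (h has_vector_derivative f' x) (at x)"
   by (intro bexI[of _ "\<lambda>x. H (Suc m) f' \<alpha> \<beta> x + of_real (m * (2 * (\<beta> \<bullet> \<beta>))) * H (m - 1) f \<alpha> \<beta> x"] allI)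
 qed
 then show ?case unfolding H_def[abs_def] .
qed

lemma bounded_derivs_sqnorm:
 assumes "B \<ge> 0" "bounded_derivs k F" "supported_in {-1..1} F"
 shows "bounded_derivs k {\<lambda>x. f ((norm (\<alpha> + x *\<^sub>R \<beta>))\<^sup>2) | f \<alpha> (\<beta> :: 'a::real_inner). f \<in> F \<and> norm \<beta> \<le> B}"
 using bounded_derivs_sqnorm_weighted[where F=F and m=0, OF assms] by simp

text \<open>Negative exponents are included: the product vanishes for x < 1/2, so the singularity of
  the power at 0 is never met.\<close>

lemma bounded_derivs_powi:
 "bounded_derivs k F \<Longrightarrow> supported_in {1/2..1} F \<Longrightarrow>
  bounded_derivs k {\<lambda>x. of_real (x powi m) * f x | f. f \<in> F}"
proof (induction k arbitrary: F m)
 case 0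
 obtain C where C: "C > 0" "\<And>f x. f \<in> F \<Longrightarrow> norm (f x) \<le> C"
  using bounded_derivs_bound[OF 0(1)] by metis
 have cont: "continuous_on {1/2..1::real} (\<lambda>x. x powi m)"
  by (intro continuous_intros) auto
 obtain D where D: "\<And>x. x \<in> {1/2..1::real} \<Longrightarrow> norm (complex_of_real (x powi m)) \<le> D"
  using compact_imp_bounded[OF compact_continuous_image[OF cont compact_Icc]]
  unfolding bounded_iff norm_of_real real_norm_def[symmetric] by blast
 have D0: "D \<ge> 0" using D[of 1] by simp
 have "norm (of_real (x powi m) * f x) \<le> D * C" if "f \<in> F" for f x
  using C that D[of x] supported_inD[OF 0(2) that, of x] D0 by (cases "x \<in> {1/2..1}") (auto simp: norm_mult simp del: of_real_power_int intro!: mult_mono)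
 moreover have "continuous_on UNIV (\<lambda>x. of_real (x powi m) * f x)" if "f \<in> F" for f
 proof (rule continuous_at_imp_continuous_on, rule ballI)
  fix x :: real
  have fc: "isCont f x"
   using bounded_derivs_continuous[OF 0(1) that, of UNIV] by (simp add: continuous_on_eq_continuous_at)
  show "isCont (\<lambda>x. of_real (x powi m) * f x) x"
  proof (cases "x > 0")
   case True
   then show ?thesis by (intro continuous_intros fc) auto
  next
   case False
   have "\<forall>\<^sub>F t in nhds x. of_real (t powi m) * f t = 0"
    using False supported_inD[OF 0(2) that]
    by (intro eventually_mono[OF eventually_nhds_in_open[of "{..<1/2}"]]) auto
   from isCont_cong[OF this] show ?thesis by simp
  qed
 qed
 ultimately show ?case by auto
next
 case (Suc k)
 obtain F' where F': "bounded_derivs k F'" "supported_in {1/2..1} F'"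
  "\<And>f. f \<in> F \<Longrightarrow> \<exists>f'\<in>F'. \<forall>x. (f has_vector_derivative f' x) (at x)"
  using bounded_derivs_SucE_support[where T="{1/2..1}", OF Suc.prems(1) closed_atLeastAtMost Suc.prems(2)] by metis
 note low = bounded_derivs_lower[OF Suc.prems(1)]
 let ?A = "{\<lambda>x. of_real (x powi m) * f x | f. f \<in> F'}"
 let ?B = "{\<lambda>x. of_real (x powi (m - 1)) * f x | f. f \<in> F}"
 let ?C = "{\<lambda>x. c * f x | c f. norm c \<le> \<bar>of_int m\<bar> \<and> f \<in> ?B}"
 let ?D = "{\<lambda>x. f x + g x | f g. f \<in> ?A \<and> g \<in> ?C}"
 show ?case
 proof (rule bounded_derivs_SucI'[OF Suc.IH[OF low Suc.prems(2)]])
  show "bounded_derivs k ?D"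
   using Suc.IH[OF F'(1,2), of m] Suc.IH[OF low Suc.prems(2), of "m - 1"]
   by (intro bounded_derivs_add bounded_derivs_cmult)
  fix h assume "h \<in> {\<lambda>x. of_real (x powi m) * f x | f. f \<in> F}"
  then obtain f where h: "h = (\<lambda>x. of_real (x powi m) * f x)" "f \<in> F" by auto
  obtain f' where f': "f' \<in> F'" "\<And>x. (f has_vector_derivative f' x) (at x)" using F'(3) h by blast
  let ?h' = "\<lambda>x. of_real (x powi m) * f' x + of_real (of_int m) * (of_real (x powi (m - 1)) * f x)"
  have "(h has_vector_derivative ?h' x) (at x)" for x
  proof (cases "x > 0")
   case True
   have "((\<lambda>x. complex_of_real (x powi m)) has_vector_derivative of_real (of_int m * x powi (m - 1))) (at x)"
    using True by (intro has_vector_derivative_of_real)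
     (auto simp: has_field_derivative_def intro!: derivative_eq_intros)
   from has_vector_derivative_mult[OF this f'(2)] show ?thesis
    unfolding h by (simp add: algebra_simps)
  next
   case False
   have "((\<lambda>_. 0) has_vector_derivative (0::complex)) (at x)" by simp
   then have "(h has_vector_derivative 0) (at x)"
    by (rule has_vector_derivative_transform_within_open[of _ _ _ "{..<1/2}"])
     (use False supported_inD[OF Suc.prems(2) h(2)] h in auto)
   then show ?thesis using False supported_inD[OF F'(2) f'(1), of x] supported_inD[OF Suc.prems(2) h(2), of x] by simp
  qed
  moreover have "?h' \<in> ?D"
  proof (rule CollectI, intro exI conjI)
   show "(\<lambda>x. of_real (x powi m) * f' x) \<in> ?A" using f' by auto
   show "(\<lambda>x. of_real (of_int m) * (of_real (x powi (m - 1)) * f x)) \<in> ?C"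
    using h by (intro CollectI exI[of _ "of_real (of_int m)"] exI[of _ "\<lambda>x. of_real (x powi (m - 1)) * f x"]) auto
  qed simp
  ultimately show "\<exists>f'\<in>?D. \<forall>x. (h has_vector_derivative f' x) (at x)"
   by (intro bexI[of _ ?h'] allI)
 qed
qed

text \<open>By the differential equation for \<kappa>, the derivative of f(\<kappa>(x)) is
  g(\<kappa>(x)) with g(x) = c x^m f'(x), again a composition with the same \<kappa>, so the
  induction closes. The equation holds for the square root (c = 1/2, m = -1) and for inversion (c =
  -1, m = 2). Where \<kappa> leaves (1/3, 2), the composite is locally zero, which disposes of the
  singular points of \<kappa>.\<close>

lemma bounded_derivs_compose:
 fixes \<kappa> :: "real \<Rightarrow> real"
 assumes \<kappa>: "\<And>x. \<kappa> x \<in> {1/3<..<2} \<Longrightarrow> (\<kappa> has_real_derivative c * \<kappa> x powi m) (at x)"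
  and \<kappa>0: "\<And>x. \<kappa> x \<notin> {1/3<..<2} \<Longrightarrow> \<forall>\<^sub>F t in nhds x. \<kappa> t \<notin> {1/2..1}"
 shows "bounded_derivs k F \<Longrightarrow> supported_in {1/2..1} F \<Longrightarrow>
  bounded_derivs k {\<lambda>x. f (\<kappa> x) | f. f \<in> F}"
proof (induction k arbitrary: F)
 case 0
 obtain C where C: "C > 0" "\<And>f x. f \<in> F \<Longrightarrow> norm (f x) \<le> C"
  using bounded_derivs_bound[OF 0(1)] by metis
 have "continuous_on UNIV (\<lambda>x. f (\<kappa> x))" if f: "f \<in> F" for f
 proof (rule continuous_at_imp_continuous_on, rule ballI)
  fix x :: real
  have fc: "isCont f x" for x
   using bounded_derivs_continuous[OF 0(1) f, of UNIV] by (simp add: continuous_on_eq_continuous_at)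
  show "isCont (\<lambda>x. f (\<kappa> x)) x"
  proof (cases "\<kappa> x \<in> {1/3<..<2}")
   case True
   show ?thesis by (rule isCont_o2[OF DERIV_isCont[OF \<kappa>[OF True]] fc])
  next
   case False
   have "\<forall>\<^sub>F t in nhds x. f (\<kappa> t) = 0"
    using \<kappa>0[OF False] by eventually_elim (use supported_inD[OF 0(2) f] in auto)
   from isCont_cong[OF this] show ?thesis by simp
  qed
 qed
 then show ?case using C by auto
next
 case (Suc k)
 obtain F' where F': "bounded_derivs k F'" "supported_in {1/2..1} F'"
  "\<And>f. f \<in> F \<Longrightarrow> \<exists>f'\<in>F'. \<forall>x. (f has_vector_derivative f' x) (at x)"
  using bounded_derivs_SucE_support[where T="{1/2..1}", OF Suc.prems(1) closed_atLeastAtMost Suc.prems(2)] by metis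
 obtain C where C: "\<And>f x. f \<in> F \<Longrightarrow> norm (f x) \<le> C"
  using bounded_derivs_bound[OF Suc.prems(1)] by metis
 let ?A = "{\<lambda>x. of_real (x powi m) * f x | f. f \<in> F'}"
 let ?B = "{\<lambda>x. c' * f x | c' f. norm c' \<le> \<bar>c\<bar> \<and> f \<in> ?A}"
 have B: "bounded_derivs k ?B" by (intro bounded_derivs_cmult bounded_derivs_powi F')
 show ?case
 proof (rule bounded_derivs_SucI[where C=C])
  show "bounded_derivs k {\<lambda>x. f (\<kappa> x) | f. f \<in> ?B}"
   by (rule Suc.IH[OF B]) (use F'(2) in \<open>auto simp: supported_in_def\<close>)
  fix h assume "h \<in> {\<lambda>x. f (\<kappa> x) | f. f \<in> F}"
  then obtain f where h: "h = (\<lambda>x. f (\<kappa> x))" "f \<in> F" by auto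
  show "norm (h x) \<le> C" for x using h C by auto
  obtain f' where f': "f' \<in> F'" "\<And>x. (f has_vector_derivative f' x) (at x)" using F'(3) h by blast
  let ?g = "\<lambda>x. of_real c * (of_real (x powi m) * f' x)"
  have "?g \<in> ?B"
   using f' by (intro CollectI exI[of _ "of_real c"] exI[of _ "\<lambda>x. of_real (x powi m) * f' x"]) auto
  moreover have "(h has_vector_derivative ?g (\<kappa> x)) (at x)" for x
  proof (cases "\<kappa> x \<in> {1/3<..<2}")
   case True
   show ?thesis
    using vector_diff_chain_at[of \<kappa> "c * \<kappa> x powi m" x f "f' (\<kappa> x)", OF _ f'(2)] \<kappa>[OF True]
    unfolding h by (simp add: o_def scaleR_conv_of_real has_real_derivative_iff_has_vector_derivative mult_ac)
  next
   case False
   from \<kappa>0[OF False] obtain S where S: "open S" "x \<in> S" "\<And>t. t \<in> S \<Longrightarrow> \<kappa> t \<notin> {1/2..1}"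
    unfolding eventually_nhds by blast
   have "((\<lambda>_. 0) has_vector_derivative (0::complex)) (at x)" by simp
   then have "(h has_vector_derivative 0) (at x)"
    by (rule has_vector_derivative_transform_within_open[OF _ S(1,2)])
     (use S(3) supported_inD[OF Suc.prems(2) h(2)] h in auto)
   then show ?thesis using False supported_inD[OF F'(2) f'(1), of "\<kappa> x"] by auto
  qed
  moreover have "(\<lambda>x. ?g (\<kappa> x)) \<in> {\<lambda>x. f (\<kappa> x) | f. f \<in> ?B}"
   by (rule CollectI, rule exI[of _ ?g], rule conjI[OF refl]) fact
  ultimately show "\<exists>f'\<in>{\<lambda>x. f (\<kappa> x) | f. f \<in> ?B}. \<forall>x. (h has_vector_derivative f' x) (at x)"
   by (intro bexI[of _ "\<lambda>x. ?g (\<kappa> x)"] allI)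
 qed
qed


section \<open>Compact support: integration by parts and smooth Riemann sums\<close>

text \<open>All iterated derivatives inherit the support in [-R, R] and are bounded there by
  compactness. The induction starts from an arbitrary order i, so that the derivative family is the
  same statement at i + 1.\<close>

lemma smooth_bounded_derivs:
 assumes "smooth g" "\<And>x. x \<notin> {-R..R} \<Longrightarrow> g x = 0"
 shows "bounded_derivs k {\<lambda>x. complex_of_real (g x)}"
proof -
 have D: "((deriv ^^ i) g has_real_derivative (deriv ^^ Suc i) g x) (at x)" for i x
  using assms(1) by (simp add: smooth_def DERIV_deriv_iff_real_differentiable)
 have supp: "x \<notin> {-R..R} \<Longrightarrow> (deriv ^^ i) g x = 0" for i x
 proof (induction i arbitrary: x)
  case (Suc i)
  have "((\<lambda>x. complex_of_real ((deriv ^^ i) g x)) has_vector_derivative of_real ((deriv ^^ Suc i) g x)) (at x)"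
   by (rule has_vector_derivative_of_real[OF D])
  from vector_derivative_zero_outside[OF this, of "-{-R..R}"] show ?case
   using Suc by (auto simp del: funpow.simps)
 qed (use assms in auto)
 have bound: "\<exists>C. \<forall>x. norm (complex_of_real ((deriv ^^ i) g x)) \<le> C" for i
 proof -
  have cont: "continuous_on {-R..R} ((deriv ^^ i) g)"
   using D[THEN DERIV_isCont] by (simp add: continuous_at_imp_continuous_on)
  obtain C where C: "\<And>x. x \<in> {-R..R} \<Longrightarrow> norm ((deriv ^^ i) g x) \<le> C"
   using compact_imp_bounded[OF compact_continuous_image[OF cont compact_Icc]]
   unfolding bounded_iff by blast
  have "norm (complex_of_real ((deriv ^^ i) g x)) \<le> max C 0" for x
   using C[of x] supp[of x i] by (cases "x \<in> {-R..R}") (auto simp: le_max_iff_disj)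
  then show ?thesis by blast
 qed
 have "bounded_derivs k {\<lambda>x. complex_of_real ((deriv ^^ i) g x)}" for i
 proof (induction k arbitrary: i)
  case 0
  have "continuous_on UNIV ((deriv ^^ i) g)"
   using D[THEN DERIV_isCont] by (simp add: continuous_at_imp_continuous_on)
  then show ?case using bound[of i] by (auto intro!: continuous_intros)
 next
  case (Suc k)
  obtain C where "\<forall>x. norm (complex_of_real ((deriv ^^ i) g x)) \<le> C" using bound by blast
  then show ?case
   by (intro bounded_derivs_SucI[where C=C, OF _ Suc[of "Suc i"]])
    (auto simp del: funpow.simps intro!: has_vector_derivative_of_real D)
 qed
 from this[of 0] show ?thesis by simp
qed

lemma compact_support_integrable:
 fixes f :: "'a::euclidean_space \<Rightarrow> 'b::{banach, second_countable_topology}"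
 assumes "continuous_on UNIV f" "\<And>x. norm x > R \<Longrightarrow> f x = 0"
 shows "integrable lborel f"
proof -
 have "integrable lborel (\<lambda>x. indicator (cball 0 R) x *\<^sub>R f x)"
  by (rule borel_integrable_compact) (use assms continuous_on_subset[OF assms(1)] in auto)
 also have "(\<lambda>x. indicator (cball 0 R) x *\<^sub>R f x) = f"
  using assms(2) by (auto simp: fun_eq_iff indicator_def)
 finally show ?thesis .
qed

lemma norm_integral_support_le:
 fixes f :: "real \<Rightarrow> complex"
 assumes "\<And>x. \<bar>x\<bar> > R \<Longrightarrow> f x = 0" "\<And>x. norm (f x) \<le> C" "R \<ge> 0"
 shows "norm (LINT x|lborel. f x) \<le> 2 * R * C"
proof (cases "integrable lborel f")
 case True
 have "integrable lborel (\<lambda>x. C * indicator {-R..R} x)"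
  using borel_integrable_compact[of "{-R..R}" "\<lambda>_. C"] by (simp add: mult.commute)
 then have "norm (LINT x|lborel. f x) \<le> (LINT x|lborel. C * indicator {-R..R} x)"
  by (rule Bochner_Integration.integral_norm_bound_integral[OF True]) (use assms in \<open>auto simp: indicator_def\<close>)
 then show ?thesis using assms(3) by (simp add: mult_ac)
next
 \<comment> \<open>A non-integrable function has integral 0 by convention, so the bound reduces to
   its right-hand side being nonnegative.\<close>
 case False
 then show ?thesis
  using assms(3) order_trans[OF norm_ge_zero assms(2)] by (simp add: not_integrable_integral_eq)
qed

lemma integral_derivative_compact_support:
 fixes g :: "real \<Rightarrow> complex"
 assumes "\<And>x. (g has_vector_derivative g' x) (at x)" "continuous_on UNIV g'"
  and "\<And>x. \<bar>x\<bar> > R \<Longrightarrow> g x = 0" "\<And>x. \<bar>x\<bar> > R \<Longrightarrow> g' x = 0" "R \<ge> 0"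
 shows "(LINT x|lborel. g' x) = 0"
proof -
 \<comment> \<open>The interval is enlarged by 1 so that its endpoints satisfy |x| > R, where g
   vanishes.\<close>
 have "(LINT x|lborel. indicator {-(R+1)..R+1} x *\<^sub>R g' x) = g (R + 1) - g (-(R + 1))"
  by (rule integral_FTC_atLeastAtMost)
   (use assms in \<open>auto intro: has_vector_derivative_at_within continuous_on_subset\<close>)
 also have "(\<lambda>x. indicator {-(R+1)..R+1} x *\<^sub>R g' x) = g'"
  using assms(4) by (auto simp: fun_eq_iff indicator_def abs_le_iff not_le)
 finally show ?thesis using assms(3,5) by simp
qed

text \<open>The constant belongs to the whole family, and the support enters only through the factor
  R. Each integration by parts gains 2 \<pi> |\<theta>|, of which only |\<theta>| is kept, so the
  constant of the derivative family is reused unchanged.\<close>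

lemma fourier_decay:
 "bounded_derivs N F \<Longrightarrow> \<exists>C\<ge>0. \<forall>f\<in>F. \<forall>R\<ge>0. (\<forall>x. \<bar>x\<bar> > R \<longrightarrow> f x = 0) \<longrightarrow>
  (\<forall>\<theta>. \<bar>\<theta>\<bar> ^ N * norm (LINT x|lborel. f x * e2pi (- (\<theta> * x))) \<le> C * R)"
proof (induction N arbitrary: F)
 case 0
 obtain C where C: "C > 0" "\<And>f x. f \<in> F \<Longrightarrow> norm (f x) \<le> C"
  using bounded_derivs_bound[OF 0] by metis
 have "norm (LINT x|lborel. f x * e2pi (- (\<theta> * x))) \<le> 2 * C * R"
  if "f \<in> F" "R \<ge> 0" "\<forall>x. \<bar>x\<bar> > R \<longrightarrow> f x = 0" for f R \<theta>
  using norm_integral_support_le[of R "\<lambda>x. f x * e2pi (- (\<theta> * x))" C] that C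
  by (auto simp: norm_mult mult_ac)
 then show ?case using C(1) by (intro exI[of _ "2 * C"]) auto
next
 case (Suc N)
 obtain F' where F': "bounded_derivs N F'"
  "\<And>f. f \<in> F \<Longrightarrow> \<exists>f'\<in>F'. \<forall>x. (f has_vector_derivative f' x) (at x)"
  using bounded_derivs_SucE[OF Suc.prems] by metis
 obtain C where C: "C \<ge> 0" "\<And>f R \<theta>. f \<in> F' \<Longrightarrow> R \<ge> 0 \<Longrightarrow> \<forall>x. \<bar>x\<bar> > R \<longrightarrow> f x = 0 \<Longrightarrow>
  \<bar>\<theta>\<bar> ^ N * norm (LINT x|lborel. f x * e2pi (- (\<theta> * x))) \<le> C * R"
  using Suc.IH[OF F'(1)] by blast
 have "\<bar>\<theta>\<bar> ^ Suc N * norm (LINT x|lborel. f x * e2pi (- (\<theta> * x))) \<le> C * R"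
  if f: "f \<in> F" "R \<ge> 0" "\<forall>x. \<bar>x\<bar> > R \<longrightarrow> f x = 0" for f R \<theta>
 proof -
  obtain f' where f': "f' \<in> F'" "\<And>x. (f has_vector_derivative f' x) (at x)" using F' f by blast
  have f'0: "\<bar>x\<bar> > R \<Longrightarrow> f' x = 0" for x
   by (rule vector_derivative_zero_outside[OF f'(2), of "-{-R..R}" x]) (use f(3) in auto)
  note cf = bounded_derivs_continuous[OF Suc.prems f(1)] and cf' = bounded_derivs_continuous[OF F'(1) f'(1)]
  define c where "c = 2 * of_real pi * \<i> * complex_of_real (- \<theta>)"
  define I where "I = (LINT x|lborel. f x * e2pi (- (\<theta> * x)))"
  define I' where "I' = (LINT x|lborel. f' x * e2pi (- (\<theta> * x)))"
  have int: "integrable lborel (\<lambda>x. f x * e2pi (- (\<theta> * x)))" "integrable lborel (\<lambda>x. f' x * e2pi (- (\<theta> * x)))"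
   by (rule compact_support_integrable[of _ R], use f f'0 in \<open>auto intro!: continuous_intros cf cf'\<close>)+
  have "(LINT x|lborel. c * (f x * e2pi (- (\<theta> * x))) + f' x * e2pi (- (\<theta> * x))) = 0"
  proof (rule integral_derivative_compact_support[of "\<lambda>x. f x * e2pi (- (\<theta> * x))" _ R])
   show "((\<lambda>x. f x * e2pi (- (\<theta> * x))) has_vector_derivative
    c * (f x * e2pi (- (\<theta> * x))) + f' x * e2pi (- (\<theta> * x))) (at x)" for x
    using has_vector_derivative_mult[OF f'(2) has_vector_derivative_e2pi[of "-\<theta>" 0 x]]
    by (simp add: c_def algebra_simps)
  qed (use f f'0 in \<open>auto intro!: continuous_intros cf cf'\<close>)
  then have "c * I + I' = 0"
   unfolding I_def I'_def by (subst (asm) Bochner_Integration.integral_add) (use int in auto)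
  then have "norm (c * I) = norm I'"
   by (metis add_eq_0_iff norm_minus_cancel)
  then have "2 * pi * \<bar>\<theta>\<bar> * norm I = norm I'" by (simp add: c_def norm_mult)
  moreover have "1 * (\<bar>\<theta>\<bar> * norm I) \<le> (2 * pi) * (\<bar>\<theta>\<bar> * norm I)"
   using pi_gt3 by (intro mult_right_mono) auto
  ultimately have "\<bar>\<theta>\<bar> * norm I \<le> norm I'" by (simp add: mult_ac)
  then have "\<bar>\<theta>\<bar> ^ N * (\<bar>\<theta>\<bar> * norm I) \<le> \<bar>\<theta>\<bar> ^ N * norm I'" by (rule mult_left_mono) simp
  also have "\<dots> \<le> C * R" unfolding I'_def using C(2)[OF f'(1) f(2)] f'0 by blast
  finally show ?thesis by (simp add: I_def mult_ac)
 qed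
 then show ?case using C(1) by blast
qed

text \<open>Mean of the periodisation of g over one period: the intervals [n, n+1) tile the line,
  and those with |n| \<le> M contain the support.\<close>

lemma sum_unit_intervals:
 fixes g :: "real \<Rightarrow> complex" and M :: int
 assumes "continuous_on UNIV g" "\<And>y. \<bar>y\<bar> \<ge> of_int M \<Longrightarrow> g y = 0"
 shows "(LINT x|lborel. indicator {0..<1} x *\<^sub>R (\<Sum>n\<in>{-M..M}. g (of_int n + x))) = (LINT y|lborel. g y)"
proof -
 have int: "integrable lborel g"
  by (rule compact_support_integrable[of _ M]) (use assms in auto)
 have ind: "integrable lborel (\<lambda>x. indicator {of_int n..<of_int n + 1 :: real} x *\<^sub>R g x)" for n :: int
  by (intro integrable_mult_indicator int) auto
 have ind': "integrable lborel (\<lambda>x. indicator {0..<1} x *\<^sub>R g (of_int n + x))" for n :: int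
  using lborel_integrable_real_affine[OF int, of 1 "of_int n"]
  by (intro integrable_mult_indicator) auto
 have "(LINT x|lborel. indicator {0..<1} x *\<^sub>R (\<Sum>n\<in>{-M..M}. g (of_int n + x)))
   = (\<Sum>n\<in>{-M..M}. (LINT x|lborel. indicator {0..<1} x *\<^sub>R g (of_int n + x)))"
  unfolding scaleR_sum_right by (rule Bochner_Integration.integral_sum) (rule ind')
 also have "\<dots> = (\<Sum>n\<in>{-M..M}. (LINT x|lborel. indicator {of_int n..<of_int n + 1} x *\<^sub>R g x))"
  by (intro sum.cong refl, subst (2) lborel_integral_real_affine[of 1, OF _ ])
   (auto simp: indicator_def intro!: Bochner_Integration.integral_cong)
 also have "\<dots> = (LINT x|lborel. (\<Sum>n\<in>{-M..M}. indicator {of_int n..<of_int n + 1} x *\<^sub>R g x))"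
  by (rule Bochner_Integration.integral_sum[symmetric]) (rule ind)
 also have "(\<lambda>x. (\<Sum>n\<in>{-M..M}. indicator {of_int n..<of_int n + 1} x *\<^sub>R g x)) = g"
 proof
  fix x
  have "indicator {of_int n..<of_int n + 1} x *\<^sub>R g x = (if \<lfloor>x\<rfloor> = n then g x else 0)" for n
   by (auto simp: indicator_def floor_eq_iff)
  then have "(\<Sum>n\<in>{-M..M}. indicator {of_int n..<of_int n + 1} x *\<^sub>R g x) = (if \<lfloor>x\<rfloor> \<in> {-M..M} then g x else 0)"
   by (simp add: sum.delta')
  moreover have "\<lfloor>x\<rfloor> \<in> {-M..M}" if "g x \<noteq> 0"
   using assms(2)[of x] that by (cases "of_int M \<le> \<bar>x\<bar>") (auto simp: le_floor_iff floor_le_iff)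
  ultimately show "(\<Sum>n\<in>{-M..M}. indicator {of_int n..<of_int n + 1} x *\<^sub>R g x) = g x" by auto
 qed
 finally show ?thesis .
qed

lemma sum_minus_mean_le:
 fixes S :: "real \<Rightarrow> complex"
 assumes "\<And>x. (S has_vector_derivative S' x) (at x)" "\<And>x. x \<in> {0..1} \<Longrightarrow> norm (S' x) \<le> D" "x \<in> {0..1}"
 shows "norm (S x - (LINT y|lborel. indicator {0..<1} y *\<^sub>R S y)) \<le> D"
proof -
 have cS: "continuous_on A S" for A
  using assms(1) by (meson continuous_at_imp_continuous_on has_vector_derivative_continuous)
 have D: "D \<ge> 0" using order_trans[OF norm_ge_zero assms(2)[OF assms(3)]] .
 have diff: "norm (S x - S y) \<le> D" if "y \<in> {0..1}" for y
 proof -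
  have "norm (S x - S y) \<le> D * norm (x - y)"
   by (rule differentiable_bound[of "{0..1}" S "\<lambda>x h. h *\<^sub>R S' x"])
    (use assms that in \<open>auto simp: has_vector_derivative_def onorm_scaleR_left[OF bounded_linear_ident] onorm_id
     intro: has_derivative_at_withinI\<close>)
  also have "\<dots> \<le> D * 1" using assms(3) that D by (intro mult_left_mono) auto
  finally show ?thesis by simp
 qed
 have i1: "integrable lborel (\<lambda>y. indicator {0..1::real} y *\<^sub>R S y)"
  by (rule borel_integrable_compact) (auto intro: cS)
 have "integrable lborel (\<lambda>y. indicator {0..<1::real} y *\<^sub>R (indicator {0..1} y *\<^sub>R S y))"
  by (intro integrable_mult_indicator i1) auto
 also have "(\<lambda>y. indicator {0..<1::real} y *\<^sub>R (indicator {0..1} y *\<^sub>R S y)) = (\<lambda>y. indicator {0..<1} y *\<^sub>R S y)"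
  by (auto simp: indicator_def fun_eq_iff)
 finally have i2: "integrable lborel (\<lambda>y. indicator {0..<1::real} y *\<^sub>R S y)" .
 have i3: "integrable lborel (\<lambda>y. indicator {0..<1::real} y *\<^sub>R S x)" by simp
 have "S x - (LINT y|lborel. indicator {0..<1} y *\<^sub>R S y) = (LINT y|lborel. indicator {0..<1} y *\<^sub>R (S x - S y))"
  using Bochner_Integration.integral_diff[OF i3 i2] by (simp add: scaleR_diff_right)
 also have "norm \<dots> \<le> (LINT y|lborel. indicator {0..<1::real} y * D)"
 proof (rule Bochner_Integration.integral_norm_bound_integral)
  show "integrable lborel (\<lambda>y. indicator {0..<1::real} y *\<^sub>R (S x - S y))"
   using Bochner_Integration.integrable_diff[OF i3 i2] by (simp add: scaleR_diff_right)
  show "integrable lborel (\<lambda>y. indicator {0..<1::real} y * D)" by simp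
 qed (use diff in \<open>auto simp: indicator_def\<close>)
 finally show ?thesis by simp
qed

text \<open>
 A substitute for Poisson summation. The periodisation of \<open>f(\<sqdot>/X)\<close> has mean \<open>X\<integral>f\<close> over a period and so
 differs from it by at most the maximum of its derivative. This is \<open>1/X\<close> times the periodisation of
 \<open>f'\<close>, whose mean vanishes, so that the argument can be repeated.
\<close>

lemma periodic_sum_approx:
 "bounded_derivs N F \<Longrightarrow> \<exists>C\<ge>0. \<forall>f\<in>F. \<forall>R\<ge>0::real. \<forall>X>0::real. \<forall>M::int. \<forall>x\<in>{0..1}.
   (\<forall>x. \<bar>x\<bar> > R \<longrightarrow> f x = 0) \<longrightarrow> R * X + 1 \<le> of_int M \<longrightarrow>
   norm ((\<Sum>n\<in>{-M..M}. f ((of_int n + x) / X)) - X *\<^sub>R (LINT y|lborel. f y)) \<le> C * of_int M / X ^ N"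
proof (induction N arbitrary: F)
 case 0
 obtain C where C: "C > 0" "\<And>f x. f \<in> F \<Longrightarrow> norm (f x) \<le> C"
  using bounded_derivs_bound[OF 0] by metis
 \<comment> \<open>Without derivatives no cancellation is claimed: the sum has 2M + 1 \<le> 3M terms
   bounded by C, and X times the integral is at most 2 R X C \<le> 2 M C.\<close>
 have "norm ((\<Sum>n\<in>{-M..M}. f ((of_int n + x) / X)) - X *\<^sub>R (LINT y|lborel. f y)) \<le> 5 * C * of_int M"
  if f: "f \<in> F" "R \<ge> 0" "X > 0" "\<forall>x. \<bar>x\<bar> > R \<longrightarrow> f x = 0" "R * X + 1 \<le> of_int M" for f R X x and M :: int
 proof -
  have M: "M \<ge> 1" using that by (smt (verit) mult_nonneg_nonneg of_int_less_1_iff)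
  have "norm (\<Sum>n\<in>{-M..M}. f ((of_int n + x) / X)) \<le> (\<Sum>n\<in>{-M..M}. C)"
   by (rule sum_norm_le) (use C f in auto)
  also have "\<dots> = (2 * of_int M + 1) * C" using M by simp
  also have "\<dots> \<le> 3 * M * C" using M C by (intro mult_right_mono) auto
  finally have 1: "norm (\<Sum>n\<in>{-M..M}. f ((of_int n + x) / X)) \<le> 3 * M * C" .
  have "norm (X *\<^sub>R (LINT y|lborel. f y)) \<le> X * (2 * R * C)"
   using norm_integral_support_le[of R f C] f C by (auto intro!: mult_left_mono)
  also have "\<dots> = 2 * (R * X) * C" by simp
  also have "\<dots> \<le> 2 * M * C" using f C by (intro mult_right_mono) auto
  finally show ?thesis using norm_triangle_ineq4[of "\<Sum>n\<in>{-M..M}. f ((of_int n + x) / X)" "X *\<^sub>R (LINT y|lborel. f y)"] 1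
   by (simp add: algebra_simps)
 qed
 then show ?case using C(1) by (intro exI[of _ "5 * C"]) auto
next
 case (Suc N)
 obtain F' where F': "bounded_derivs N F'"
  "\<And>f. f \<in> F \<Longrightarrow> \<exists>f'\<in>F'. \<forall>x. (f has_vector_derivative f' x) (at x)"
  using bounded_derivs_SucE[OF Suc.prems] by metis
 obtain C where C: "C \<ge> 0" "\<And>f R X x. \<And>M::int. f \<in> F' \<Longrightarrow> R \<ge> 0 \<Longrightarrow> X > 0 \<Longrightarrow> x \<in> {0..1} \<Longrightarrow>
   \<forall>x. \<bar>x\<bar> > R \<longrightarrow> f x = 0 \<Longrightarrow> R * X + 1 \<le> of_int M \<Longrightarrow>
   norm ((\<Sum>n\<in>{-M..M}. f ((of_int n + x) / X)) - X *\<^sub>R (LINT y|lborel. f y)) \<le> C * of_int M / X ^ N"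
  using Suc.IH[OF F'(1)] by blast
 have "norm ((\<Sum>n\<in>{-M..M}. f ((of_int n + x) / X)) - X *\<^sub>R (LINT y|lborel. f y)) \<le> C * of_int M / X ^ Suc N"
  if f: "f \<in> F" "R \<ge> 0" "X > 0" "x \<in> {0..1}" "\<forall>x. \<bar>x\<bar> > R \<longrightarrow> f x = 0" "R * X + 1 \<le> of_int M" for f R X x and M :: int
 proof -
  obtain f' where f': "f' \<in> F'" "\<And>x. (f has_vector_derivative f' x) (at x)" using F' f by blast
  have f'0: "\<bar>x\<bar> > R \<Longrightarrow> f' x = 0" for x
   by (rule vector_derivative_zero_outside[OF f'(2), of "-{-R..R}" x]) (use f(5) in auto)
  note cf = bounded_derivs_continuous[OF Suc.prems f(1)] and cf' = bounded_derivs_continuous[OF F'(1) f'(1)]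
  have int0: "(LINT x|lborel. f' x) = 0"
   by (rule integral_derivative_compact_support[OF f'(2) cf' _ f'0 f(2)]) (use f in auto)
  define S where "S x = (\<Sum>n\<in>{-M..M}. f ((of_int n + x) / X))" for x
  define S' where "S' x = (1 / X) *\<^sub>R (\<Sum>n\<in>{-M..M}. f' ((of_int n + x) / X))" for x
  have "((\<lambda>x. f ((of_int n + x) / X)) has_vector_derivative (1 / X) *\<^sub>R f' ((of_int n + x) / X)) (at x)" for n :: int and x
  proof -
   have "((\<lambda>x. (of_int n + x) / X) has_vector_derivative (1 / X)) (at x)"
    unfolding has_real_derivative_iff_has_vector_derivative[symmetric]
    using f(3) by (auto intro!: derivative_eq_intros)
   from vector_diff_chain_at[OF this f'(2)] show ?thesis by (simp add: o_def)
  qed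
  then have "(S has_vector_derivative S' x) (at x)" for x
   unfolding S_def[abs_def] S'_def scaleR_sum_right by (intro has_vector_derivative_sum)
  moreover have "norm (S' x) \<le> C * of_int M / X ^ Suc N" if "x \<in> {0..1}" for x
  proof -
   have "norm (S' x) = (1 / X) * norm ((\<Sum>n\<in>{-M..M}. f' ((of_int n + x) / X)) - X *\<^sub>R (LINT y|lborel. f' y))"
    using f by (simp add: S'_def int0)
   also have "\<dots> \<le> (1 / X) * (C * of_int M / X ^ N)"
    using C(2)[OF f'(1) f(2,3) that] f'0 f by (intro mult_left_mono) auto
   finally show ?thesis by simp
  qed
  ultimately have "norm (S x - (LINT y|lborel. indicator {0..<1} y *\<^sub>R S y)) \<le> C * of_int M / X ^ Suc N"
   by (rule sum_minus_mean_le[OF _ _ f(4)])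
  also have "(LINT y|lborel. indicator {0..<1} y *\<^sub>R S y) = (LINT y|lborel. f (y / X))"
   unfolding S_def
  proof (rule sum_unit_intervals[of "\<lambda>y. f (y / X)" M])
   show "continuous_on UNIV (\<lambda>y. f (y / X))"
    by (rule continuous_on_compose2[OF cf[of UNIV], where f="\<lambda>y. y / X"]) (use f in \<open>auto intro!: continuous_intros\<close>)
   show "f (y / X) = 0" if "of_int M \<le> \<bar>y\<bar>" for y
   proof -
    have "R * X < \<bar>y\<bar>" using that f by linarith
    then have "R < \<bar>y / X\<bar>" using f by (simp add: field_simps)
    then show ?thesis using f by blast
   qed
  qed
  also have "\<dots> = X *\<^sub>R (LINT y|lborel. f y)"
   using lborel_integral_real_affine[of X "\<lambda>y. f (y / X)" 0] f by simp
  finally show ?thesis unfolding S_def .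
 qed
 then show ?case using C(1) by blast
qed


section \<open>Linear substitutions and Fubini in the plane\<close>

text \<open>One coordinate at a time. For fixed y the substitution of a x + b y by x turns the
  second entry into (c x + D y)/a, with D the determinant; after exchanging the integrals, a
  substitution in y finishes. The factors 1/|a| and |a|/|D| multiply to 1/|D|.\<close>

lemma nn_integral_linear_pair_aux:
 fixes g :: "real \<times> real \<Rightarrow> ennreal"
 assumes [measurable]: "g \<in> borel_measurable borel" and D: "a * d - b * c \<noteq> 0" and a: "a \<noteq> 0"
 shows "(\<integral>\<^sup>+y. \<integral>\<^sup>+x. g (a * x + b * y, c * x + d * y) \<partial>lborel \<partial>lborel)
  = ennreal (1 / \<bar>a * d - b * c\<bar>) * (\<integral>\<^sup>+p. g p \<partial>lborel)"
proof -
 define D where "D = a * d - b * c"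
 have gp [measurable]: "(\<lambda>p. g (fst p, snd p)) \<in> borel_measurable (lborel \<Otimes>\<^sub>M lborel)"
  by (simp add: lborel_prod)
 have gm: "(\<lambda>p :: real \<times> real. g (u p, v p)) \<in> borel_measurable (lborel \<Otimes>\<^sub>M lborel)"
  if "u \<in> borel_measurable borel" "v \<in> borel_measurable borel" for u v
  using that unfolding lborel_prod by measurable
 have "(\<integral>\<^sup>+x. g (a * x + b * y, c * x + d * y) \<partial>lborel)
   = ennreal (1 / \<bar>a\<bar>) * (\<integral>\<^sup>+x. g (x, (c * x + D * y) / a) \<partial>lborel)" for y
 proof -
  have "(\<integral>\<^sup>+x. g (x, (c * x + D * y) / a) \<partial>lborel)
    = \<bar>a\<bar> * (\<integral>\<^sup>+x. g (b * y + a * x, (c * (b * y + a * x) + D * y) / a) \<partial>lborel)"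
   by (rule nn_integral_real_affine) (use a in measurable)
  also have "(\<lambda>x. g (b * y + a * x, (c * (b * y + a * x) + D * y) / a)) = (\<lambda>x. g (a * x + b * y, c * x + d * y))"
   using a by (auto simp: D_def field_simps intro!: ext arg_cong[where f=g])
  finally show ?thesis
   using a by (simp add: mult.assoc[symmetric] ennreal_mult[symmetric])
 qed
 then have "(\<integral>\<^sup>+y. \<integral>\<^sup>+x. g (a * x + b * y, c * x + d * y) \<partial>lborel \<partial>lborel)
   = (\<integral>\<^sup>+y. ennreal (1 / \<bar>a\<bar>) * (\<integral>\<^sup>+x. g (x, (c * x + D * y) / a) \<partial>lborel) \<partial>lborel)" by simp
 also have "\<dots> = ennreal (1 / \<bar>a\<bar>) * (\<integral>\<^sup>+y. (\<integral>\<^sup>+x. g (x, (c * x + D * y) / a) \<partial>lborel) \<partial>lborel)"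
  by (rule nn_integral_cmult) measurable
 also have "(\<integral>\<^sup>+y. (\<integral>\<^sup>+x. g (x, (c * x + D * y) / a) \<partial>lborel) \<partial>lborel)
   = (\<integral>\<^sup>+x. (\<integral>\<^sup>+y. g (x, (c * x + D * y) / a) \<partial>lborel) \<partial>lborel)"
  by (rule lborel_pair.Fubini'[symmetric]) (auto simp: case_prod_beta intro!: gm)
 also have "\<dots> = (\<integral>\<^sup>+x. ennreal (\<bar>a\<bar> / \<bar>D\<bar>) * (\<integral>\<^sup>+y. g (x, y) \<partial>lborel) \<partial>lborel)"
 proof (rule nn_integral_cong)
  fix x
  have "(\<integral>\<^sup>+y. g (x, y) \<partial>lborel) = \<bar>D / a\<bar> * (\<integral>\<^sup>+y. g (x, c * x / a + D / a * y) \<partial>lborel)"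
   by (rule nn_integral_real_affine) (use a D in \<open>auto simp: D_def\<close>)
  also have "(\<lambda>y. g (x, c * x / a + D / a * y)) = (\<lambda>y. g (x, (c * x + D * y) / a))"
   using a by (auto simp: field_simps)
  finally show "(\<integral>\<^sup>+y. g (x, (c * x + D * y) / a) \<partial>lborel) = ennreal (\<bar>a\<bar> / \<bar>D\<bar>) * (\<integral>\<^sup>+y. g (x, y) \<partial>lborel)"
   using a D by (simp add: mult.assoc[symmetric] ennreal_mult[symmetric] D_def)
 qed
 also have "\<dots> = ennreal (\<bar>a\<bar> / \<bar>D\<bar>) * (\<integral>\<^sup>+x. (\<integral>\<^sup>+y. g (x, y) \<partial>lborel) \<partial>lborel)"
  by (rule nn_integral_cmult) measurable
 also have "(\<integral>\<^sup>+x. (\<integral>\<^sup>+y. g (x, y) \<partial>lborel) \<partial>lborel) = (\<integral>\<^sup>+p. g p \<partial>lborel)"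
  by (subst lborel.nn_integral_fst) (auto simp: lborel_prod)
 finally show ?thesis
  using a by (simp add: mult.assoc[symmetric] ennreal_mult[symmetric] D_def)
qed

text \<open>Applied to indicators, the formula for nonnegative functions says that the image of
  Lebesgue measure under the map is a constant multiple of Lebesgue measure, from which the formula
  for Bochner integrals follows.\<close>

lemma lborel_integral_linear_pair:
 fixes f :: "real \<times> real \<Rightarrow> 'b::{banach, second_countable_topology}"
 assumes [measurable]: "f \<in> borel_measurable borel" and D: "a * d - b * c \<noteq> 0"
 shows "(LINT p|lborel. f (a * fst p + b * snd p, c * fst p + d * snd p))
  = (1 / \<bar>a * d - b * c\<bar>) *\<^sub>R (LINT p|lborel. f p)"
proof -
 define T where "T p = (a * fst p + b * snd p, c * fst p + d * snd p)" for p :: "real \<times> real"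
 have T [measurable]: "T \<in> borel_measurable borel"
  unfolding T_def[abs_def] borel_prod[symmetric] by measurable
 have nn: "(\<integral>\<^sup>+p. g (T p) \<partial>lborel) = ennreal (1 / \<bar>a * d - b * c\<bar>) * (\<integral>\<^sup>+p. g p \<partial>lborel)"
  if [measurable]: "g \<in> borel_measurable borel" for g :: "real \<times> real \<Rightarrow> ennreal"
 proof -
  have m: "(\<lambda>p. g (T p)) \<in> borel_measurable (lborel \<Otimes>\<^sub>M lborel)" by (simp add: lborel_prod)
  show ?thesis
  proof (cases "a = 0")
   case False
   have "(\<integral>\<^sup>+p. g (T p) \<partial>lborel) = (\<integral>\<^sup>+y. \<integral>\<^sup>+x. g (T (x, y)) \<partial>lborel \<partial>lborel)"
    using lborel_pair.nn_integral_snd[OF m] by (simp add: lborel_prod)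
   then show ?thesis
    using nn_integral_linear_pair_aux[OF that D False] by (simp add: T_def)
  next
   \<comment> \<open>If a = 0 then b is nonzero, and the other order of integration exchanges the
     two columns of the matrix.\<close>
   case True
   then have b: "b \<noteq> 0" using D by auto
   have D': "b * c - a * d \<noteq> 0" using D by auto
   have "(\<integral>\<^sup>+p. g (T p) \<partial>lborel) = (\<integral>\<^sup>+x. \<integral>\<^sup>+y. g (T (x, y)) \<partial>lborel \<partial>lborel)"
    using lborel.nn_integral_fst[OF m] by (simp add: lborel_prod)
   then show ?thesis
    using nn_integral_linear_pair_aux[OF that D' b]
    by (simp add: T_def add.commute abs_minus_commute)
  qed
 qed
 have "distr lborel borel T = density lborel (\<lambda>_. ennreal (1 / \<bar>a * d - b * c\<bar>))"
 proof (rule measure_eqI)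
  fix A assume "A \<in> sets (distr lborel borel T)"
  then have A [measurable]: "A \<in> sets borel" by simp
  have "emeasure (distr lborel borel T) A = (\<integral>\<^sup>+p. indicator A (T p) \<partial>lborel)"
   using nn_integral_distr[of T lborel borel "indicator A"] by simp
  also have "\<dots> = ennreal (1 / \<bar>a * d - b * c\<bar>) * (\<integral>\<^sup>+p. indicator A p \<partial>lborel)"
   by (rule nn) simp
  finally show "emeasure (distr lborel borel T) A = emeasure (density lborel (\<lambda>_. ennreal (1 / \<bar>a * d - b * c\<bar>))) A"
   by (simp add: emeasure_density nn_integral_cmult)
 qed simp
 then have "(LINT p|distr lborel borel T. f p) = (LINT p|density lborel (\<lambda>_. ennreal (1 / \<bar>a * d - b * c\<bar>)). f p)"
  by simp
 then show ?thesis
  by (simp add: integral_distr integral_density T_def)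
qed

lemma lborel_integral_scale_pair:
 fixes f :: "real \<times> real \<Rightarrow> 'b::{banach, second_countable_topology}"
 assumes "f \<in> borel_measurable borel" and "a \<noteq> 0"
 shows "(LINT p|lborel. f p) = a\<^sup>2 *\<^sub>R (LINT p|lborel. f (a *\<^sub>R p))"
 using lborel_integral_linear_pair[OF assms(1), of a a 0 0] assms(2)
 by (simp add: scaleR_prod_def power2_eq_square)

lemma
 fixes f :: "real \<times> real \<Rightarrow> 'b::{banach, second_countable_topology}"
 assumes "integrable lborel f"
 shows lborel_integral_fst: "(LINT x|lborel. (LINT y|lborel. f (x, y))) = (LINT p|lborel. f p)"
  and lborel_integral_snd: "(LINT y|lborel. (LINT x|lborel. f (x, y))) = (LINT p|lborel. f p)"
  and lborel_integrable_fst: "integrable lborel (\<lambda>x. LINT y|lborel. f (x, y))"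
  and lborel_integrable_snd: "integrable lborel (\<lambda>y. LINT x|lborel. f (x, y))"
 using lborel_pair.integral_fst[of "\<lambda>x y. f (x, y)"] lborel_pair.integral_snd[of "\<lambda>x y. f (x, y)"]
  lborel_pair.integrable_fst[of "\<lambda>x y. f (x, y)"] lborel_pair.integrable_snd[of "\<lambda>x y. f (x, y)"] assms
 by (simp_all add: lborel_prod)

lemma integrable_product_lborel:
 fixes f :: "'a::euclidean_space \<Rightarrow> complex" and g :: "'b::euclidean_space \<Rightarrow> complex"
 assumes "integrable lborel f" "integrable lborel g"
 shows "integrable (lborel \<Otimes>\<^sub>M lborel) (\<lambda>(x, y). f x * g y)"
proof -
 note [measurable] = borel_measurable_integrable[OF assms(1)] borel_measurable_integrable[OF assms(2)]
 show ?thesis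
 proof (rule lborel_pair.Fubini_integrable)
  show "(\<lambda>(x, y). f x * g y) \<in> borel_measurable (lborel \<Otimes>\<^sub>M lborel)"
   by measurable
  have "(\<lambda>x. LINT y|lborel. norm (case (x, y) of (x, y) \<Rightarrow> f x * g y)) = (\<lambda>x. norm (f x) * (LINT y|lborel. norm (g y)))"
   by (simp add: norm_mult)
  then show "integrable lborel (\<lambda>x. LINT y|lborel. norm (case (x, y) of (x, y) \<Rightarrow> f x * g y))"
   using assms by simp
  show "AE x in lborel. integrable lborel (\<lambda>y. case (x, y) of (x, y) \<Rightarrow> f x * g y)"
   using assms by simp
 qed
qed

section \<open>Gaussian regularisation and Fourier inversion\<close>

lemma has_gaussian_char:
 fixes t :: real
 shows "integrable lborel (\<lambda>x. complex_of_real (std_normal_density x))"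
  and "(LINT x|lborel. of_real (std_normal_density x) * exp (\<i> * of_real (t * x))) = exp (- of_real (t\<^sup>2 / 2))"
proof -
 show "integrable lborel (\<lambda>x. complex_of_real (std_normal_density x))"
  by (intro integrable_of_real) simp
 have "char std_normal_distribution t = exp (- of_real (t\<^sup>2 / 2))"
  by (simp add: char_std_normal_distribution exp_of_real[symmetric] of_real_exp)
 then show "(LINT x|lborel. of_real (std_normal_density x) * exp (\<i> * of_real (t * x))) = exp (- of_real (t\<^sup>2 / 2))"
  unfolding char_def
  by (subst (asm) integral_density) (auto simp: scaleR_conv_of_real)
qed

lemma lborel_integral_shift:
 fixes f :: "'a::euclidean_space \<Rightarrow> 'b::{banach, second_countable_topology}"
 assumes [measurable]: "f \<in> borel_measurable borel"
 shows "(LINT x|lborel. f (c + x)) = (LINT x|lborel. f x)"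
 using integral_distr[of "(+) c" lborel borel f] by (simp add: lborel_distr_plus)

definition gauss2 :: "real \<times> real \<Rightarrow> complex" where
 "gauss2 w = of_real (std_normal_density (fst w)) * of_real (std_normal_density (snd w))"

lemma gauss2_eq: "gauss2 w = of_real (exp (- (norm w)\<^sup>2 / 2) / (2 * pi))"
proof -
 have "std_normal_density a * std_normal_density b = exp (- (a\<^sup>2 + b\<^sup>2) / 2) / (2 * pi)" for a b :: real
 proof -
  have "std_normal_density a * std_normal_density b
    = (exp (- a\<^sup>2 / 2) * exp (- b\<^sup>2 / 2)) / (sqrt (2 * pi) * sqrt (2 * pi))"
   by (simp add: std_normal_density_def)
  also have "exp (- a\<^sup>2 / 2) * exp (- b\<^sup>2 / 2) = exp (- (a\<^sup>2 + b\<^sup>2) / 2)"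
   unfolding exp_add[symmetric] by (simp add: diff_divide_distrib add_divide_distrib)
  finally show ?thesis by simp
 qed
 then show ?thesis
  unfolding gauss2_def of_real_mult[symmetric] by (simp add: norm_prod_def)
qed

lemma gauss2_integrable: "integrable lborel gauss2"
 using integrable_product_lborel[OF has_gaussian_char(1) has_gaussian_char(1)]
 by (simp add: lborel_prod gauss2_def[abs_def] case_prod_beta')

lemma gauss2_fourier:
 "(LINT w|lborel. gauss2 w * e2pi (w \<bullet> t)) = exp (- of_real (2 * pi\<^sup>2 * (norm t)\<^sup>2))"
proof -
 define G where "G a x = complex_of_real (std_normal_density x) * exp (\<i> * of_real (2 * pi * a * x))" for a x
 have G: "(LINT x|lborel. G a x) = exp (- of_real ((2 * pi * a)\<^sup>2 / 2))" for a
  unfolding G_def by (rule has_gaussian_char(2))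
 have Gi: "integrable lborel (G a)" for a
  by (rule Bochner_Integration.integrable_bound[OF has_gaussian_char(1)]) (auto simp: G_def[abs_def] norm_mult)
 have eq: "gauss2 w * e2pi (w \<bullet> t) = G (fst t) (fst w) * G (snd t) (snd w)" for w
  by (simp add: gauss2_def G_def e2pi_def inner_prod_def exp_add[symmetric] algebra_simps)
 have int: "integrable lborel (\<lambda>w. G (fst t) (fst w) * G (snd t) (snd w))"
  using integrable_product_lborel[OF Gi Gi, of "fst t" "snd t"] by (simp add: lborel_prod case_prod_beta')
 have "(LINT w|lborel. gauss2 w * e2pi (w \<bullet> t)) = (LINT x|lborel. LINT y|lborel. G (fst t) x * G (snd t) y)"
  unfolding eq using lborel_integral_fst[OF int] by simp
 also have "\<dots> = exp (- of_real ((2 * pi * fst t)\<^sup>2 / 2)) * exp (- of_real ((2 * pi * snd t)\<^sup>2 / 2))"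
  by (simp add: G)
 finally show ?thesis
  by (simp add: exp_add[symmetric] norm_prod_def power2_eq_square algebra_simps)
qed

text \<open>A Gaussian factor of width tending to infinity is inserted into the integral over w. By
  Fubini the regularised integral is an average of f around n at scale \<epsilon>. As \<epsilon>
  tends to 0, dominated convergence applies on both sides, with majorant |F| on one and B times a
  Gaussian on the other, where continuity of f gives the limit f(n).\<close>

lemma fourier_inversion_pair:
 fixes f :: "real \<times> real \<Rightarrow> complex"
 assumes cont: "continuous_on UNIV f" and bd: "\<And>x. norm (f x) \<le> B" and f: "integrable lborel f"
 defines "F \<equiv> \<lambda>w. LINT x|lborel. f x * e2pi (- (w \<bullet> x))"
 assumes F: "integrable lborel F"
 shows "(LINT w|lborel. F w * e2pi (w \<bullet> n)) = f n"
proof -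
 \<comment> \<open>Normalised so that the Fourier transform of \<open>E \<epsilon>\<close> is the
   probability density gauss2(z/\<epsilon>)/\<epsilon>^2.\<close>
 define E where "E \<epsilon> w = exp (- complex_of_real (2 * pi\<^sup>2 * \<epsilon>\<^sup>2 * (norm w)\<^sup>2))" for \<epsilon> :: real and w :: "real \<times> real"
 have E_eq: "E \<epsilon> w = of_real (2 * pi) * gauss2 ((2 * pi * \<epsilon>) *\<^sub>R w)" for \<epsilon> w
  by (simp add: E_def gauss2_eq exp_of_real[symmetric] power_mult_distrib mult.assoc)
 have [measurable]: "gauss2 \<in> borel_measurable borel" using gauss2_integrable by auto
 have [measurable]: "f \<in> borel_measurable borel" by (rule borel_measurable_continuous_onI[OF cont])
 have [measurable]: "E \<epsilon> \<in> borel_measurable borel" for \<epsilon> unfolding E_eq[abs_def] by measurable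
 have Fm [measurable]: "F \<in> borel_measurable borel" using F by auto
 have E1: "norm (E \<epsilon> w) \<le> 1" for \<epsilon> w
  by (simp add: E_def exp_of_real[symmetric] flip: of_real_minus)
 have E_int: "integrable lborel (E \<epsilon>)" if "\<epsilon> > 0" for \<epsilon>
 proof -
  define c where "c = 2 * pi * \<epsilon>"
  have c: "c \<noteq> 0" using that by (simp add: c_def)
  have "integrable (density (distr lborel borel (\<lambda>x. 0 + c *\<^sub>R x)) (\<lambda>_. ennreal (\<bar>c\<bar> ^ DIM(real \<times> real)))) gauss2"
   using gauss2_integrable by (subst lborel_affine[OF c, of 0, symmetric])
  then have "integrable lborel (\<lambda>w. \<bar>c\<bar> ^ DIM(real \<times> real) *\<^sub>R gauss2 (c *\<^sub>R w))"
   by (simp add: integrable_density integrable_distr_eq)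
  then have "integrable lborel (\<lambda>w. (1 / \<bar>c\<bar> ^ DIM(real \<times> real)) *\<^sub>R (\<bar>c\<bar> ^ DIM(real \<times> real) *\<^sub>R gauss2 (c *\<^sub>R w)))"
   by (rule integrable_scaleR_right)
  then show ?thesis unfolding E_eq[abs_def] c_def[symmetric] using c by simp
 qed
 have K: "(LINT w|lborel. E \<epsilon> w * e2pi (w \<bullet> z)) = of_real (1 / \<epsilon>\<^sup>2) * gauss2 ((1 / \<epsilon>) *\<^sub>R z)" if "\<epsilon> > 0" for \<epsilon> z
 proof -
  let ?a = "1 / (2 * pi * \<epsilon>)"
  have "(LINT w|lborel. E \<epsilon> w * e2pi (w \<bullet> z)) = ?a\<^sup>2 *\<^sub>R (LINT w|lborel. E \<epsilon> (?a *\<^sub>R w) * e2pi ((?a *\<^sub>R w) \<bullet> z))"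
   by (rule lborel_integral_scale_pair) (use that in auto)
  also have "(\<lambda>w. E \<epsilon> (?a *\<^sub>R w) * e2pi ((?a *\<^sub>R w) \<bullet> z)) = (\<lambda>w. of_real (2 * pi) * (gauss2 w * e2pi (w \<bullet> (?a *\<^sub>R z))))"
   using that by (simp add: E_eq mult_ac)
  finally have 1: "(LINT w|lborel. E \<epsilon> w * e2pi (w \<bullet> z))
    = ?a\<^sup>2 *\<^sub>R (of_real (2 * pi) * exp (- of_real (2 * pi\<^sup>2 * (norm (?a *\<^sub>R z))\<^sup>2)))"
   unfolding integral_mult_right_zero gauss2_fourier .
  have 2: "2 * pi\<^sup>2 * (norm (?a *\<^sub>R z))\<^sup>2 = (norm ((1 / \<epsilon>) *\<^sub>R z))\<^sup>2 / 2"
   using that by (simp add: power_mult_distrib power_divide)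
  have 3: "exp (- complex_of_real t) = of_real (exp (- t))" for t
   by (simp add: exp_of_real[symmetric])
  show ?thesis unfolding 1 2 3 gauss2_eq scaleR_conv_of_real of_real_mult[symmetric]
   using that by (intro arg_cong[where f=complex_of_real]) (simp add: field_simps power2_eq_square)
 qed
 have main: "(LINT w|lborel. F w * e2pi (w \<bullet> n) * E \<epsilon> w) = (LINT z|lborel. f (n - \<epsilon> *\<^sub>R z) * gauss2 z)" if e: "\<epsilon> > 0" for \<epsilon>
 proof -
  have int: "integrable (lborel \<Otimes>\<^sub>M lborel) (\<lambda>(x, w). f x * (E \<epsilon> w * e2pi (w \<bullet> (n - x))))"
   by (rule Bochner_Integration.integrable_bound[OF integrable_product_lborel[OF f E_int[OF e]]])
    (auto simp: norm_mult case_prod_beta)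
  have "(LINT w|lborel. F w * e2pi (w \<bullet> n) * E \<epsilon> w)
    = (LINT w|lborel. LINT x|lborel. f x * (E \<epsilon> w * e2pi (w \<bullet> (n - x))))"
  proof (rule Bochner_Integration.integral_cong[OF refl])
   fix w
   have eq: "f x * (E \<epsilon> w * e2pi (w \<bullet> (n - x))) = (f x * e2pi (- (w \<bullet> x))) * (e2pi (w \<bullet> n) * E \<epsilon> w)" for x
    using e2pi_add[of "w \<bullet> n" "- (w \<bullet> x)"] by (simp add: inner_diff_right)
   have "(LINT x|lborel. f x * (E \<epsilon> w * e2pi (w \<bullet> (n - x)))) = F w * (e2pi (w \<bullet> n) * E \<epsilon> w)"
    unfolding eq F_def by (rule integral_mult_left_zero)
   then show "F w * e2pi (w \<bullet> n) * E \<epsilon> w = (LINT x|lborel. f x * (E \<epsilon> w * e2pi (w \<bullet> (n - x))))"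
    by (simp only: mult.assoc)
  qed
  also have "\<dots> = (LINT x|lborel. LINT w|lborel. f x * (E \<epsilon> w * e2pi (w \<bullet> (n - x))))"
   by (rule lborel_pair.Fubini_integral[OF int])
  also have "\<dots> = (LINT x|lborel. f x * (of_real (1 / \<epsilon>\<^sup>2) * gauss2 ((1 / \<epsilon>) *\<^sub>R (n - x))))"
   by (simp add: K[OF e])
  also have "\<dots> = (LINT x|lborel. f (n + x) * (of_real (1 / \<epsilon>\<^sup>2) * gauss2 ((1 / \<epsilon>) *\<^sub>R (- x))))"
   by (subst lborel_integral_shift[symmetric, of _ n]) auto
  \<comment> \<open>Scaling by -\<epsilon> absorbs the reflection in the argument of
    \<open>gauss2\<close> together with the scale.\<close>
  also have "\<dots> = (- \<epsilon>)\<^sup>2 *\<^sub>R (LINT x|lborel. f (n + (- \<epsilon>) *\<^sub>R x) * (of_real (1 / \<epsilon>\<^sup>2) * gauss2 ((1 / \<epsilon>) *\<^sub>R (- ((- \<epsilon>) *\<^sub>R x)))))"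
   by (rule lborel_integral_scale_pair) (use e in auto)
  also have "\<dots> = (LINT z|lborel. f (n - \<epsilon> *\<^sub>R z) * gauss2 z)"
  proof -
   have "f (n + (- \<epsilon>) *\<^sub>R x) * (of_real (1 / \<epsilon>\<^sup>2) * gauss2 ((1 / \<epsilon>) *\<^sub>R (- ((- \<epsilon>) *\<^sub>R x))))
    = of_real (1 / \<epsilon>\<^sup>2) * (f (n - \<epsilon> *\<^sub>R x) * gauss2 x)" for x
    using e by simp
   then show ?thesis using e by (simp add: scaleR_conv_of_real)
  qed
  finally show ?thesis .
 qed
 define \<epsilon> where "\<epsilon> i = 1 / real (Suc i)" for i
 have e0: "\<epsilon> \<longlonglongrightarrow> 0" unfolding \<epsilon>_def by (rule LIMSEQ_Suc[OF lim_1_over_n])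
 have "(\<lambda>i. LINT w|lborel. F w * e2pi (w \<bullet> n) * E (\<epsilon> i) w) \<longlonglongrightarrow> (LINT w|lborel. F w * e2pi (w \<bullet> n))"
 proof (rule integral_dominated_convergence[where w="\<lambda>w. norm (F w)"])
  show "AE w in lborel. (\<lambda>i. F w * e2pi (w \<bullet> n) * E (\<epsilon> i) w) \<longlonglongrightarrow> F w * e2pi (w \<bullet> n)"
  proof (rule AE_I2)
   fix w
   have "(\<lambda>i. E (\<epsilon> i) w) \<longlonglongrightarrow> exp (- complex_of_real (2 * pi\<^sup>2 * 0\<^sup>2 * (norm w)\<^sup>2))"
    unfolding E_def by (intro tendsto_intros e0)
   from tendsto_mult[OF tendsto_const[of "F w * e2pi (w \<bullet> n)"] this]
   show "(\<lambda>i. F w * e2pi (w \<bullet> n) * E (\<epsilon> i) w) \<longlonglongrightarrow> F w * e2pi (w \<bullet> n)" by simp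
  qed
  show "AE w in lborel. norm (F w * e2pi (w \<bullet> n) * E (\<epsilon> i) w) \<le> norm (F w)" for i
   by (rule AE_I2) (simp add: norm_mult mult_left_le E1 del: split_paired_All)
 qed (use F in auto)
 moreover have "(\<lambda>i. LINT z|lborel. f (n - \<epsilon> i *\<^sub>R z) * gauss2 z) \<longlonglongrightarrow> (LINT z|lborel. f n * gauss2 z)"
 proof (rule integral_dominated_convergence[where w="\<lambda>z. B * norm (gauss2 z)"])
  show "AE z in lborel. (\<lambda>i. f (n - \<epsilon> i *\<^sub>R z) * gauss2 z) \<longlonglongrightarrow> f n * gauss2 z"
  proof (rule AE_I2)
   fix z
   have "(\<lambda>i. n - \<epsilon> i *\<^sub>R z) \<longlonglongrightarrow> n - 0 *\<^sub>R z" by (intro tendsto_intros e0)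
   then have "(\<lambda>i. f (n - \<epsilon> i *\<^sub>R z)) \<longlonglongrightarrow> f n"
    using cont by (intro isCont_tendsto_compose[of n f])
     (auto simp: continuous_on_eq_continuous_at[OF open_UNIV] simp del: split_paired_All)
   then show "(\<lambda>i. f (n - \<epsilon> i *\<^sub>R z) * gauss2 z) \<longlonglongrightarrow> f n * gauss2 z"
    by (intro tendsto_intros)
  qed
  show "AE z in lborel. norm (f (n - \<epsilon> i *\<^sub>R z) * gauss2 z) \<le> B * norm (gauss2 z)" for i
   by (rule AE_I2) (simp add: norm_mult mult_right_mono bd)
 qed (use gauss2_integrable in auto)
 moreover have "(LINT z|lborel. f n * gauss2 z) = f n"
  using gauss2_fourier[of 0] by simp
 moreover have "\<epsilon> i > 0" for i by (simp add: \<epsilon>_def)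
 ultimately show ?thesis
  using main LIMSEQ_unique by auto
qed


lemma bounded_derivs_multI:
 assumes "bounded_derivs k F" "bounded_derivs k G"
  "\<And>h. h \<in> H \<Longrightarrow> \<exists>f\<in>F. \<exists>g\<in>G. h = (\<lambda>x. f x * g x)"
 shows "bounded_derivs k H"
 by (rule bounded_derivs_subset[OF bounded_derivs_mult[OF assms(1,2)]]) (use assms(3) in fastforce)

section \<open>Fourier decay and Riemann sums in two variables\<close>

lemma norm_Pair_le_add: "norm (p :: real \<times> real) \<le> \<bar>fst p\<bar> + \<bar>snd p\<bar>"
 using sqrt_sum_squares_le_sum_abs[of "fst p" "snd p"] by (simp add: norm_prod_def)

lemma
 fixes p :: "real \<times> real"
 shows abs_fst_le_norm: "\<bar>fst p\<bar> \<le> norm p" and abs_snd_le_norm: "\<bar>snd p\<bar> \<le> norm p"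
 using norm_fst_le[of "fst p" "snd p"] norm_snd_le[of "snd p" "fst p"] by simp_all

lemma integral_iterated_support_le:
 fixes g :: "real \<times> real \<Rightarrow> complex"
 assumes "continuous_on UNIV g" "\<And>x y. \<bar>x\<bar> > R \<or> \<bar>y\<bar> > R \<Longrightarrow> g (x, y) = 0" "R \<ge> 0"
 shows "(\<And>x. norm (LINT y|lborel. g (x, y)) \<le> C) \<Longrightarrow> norm (LINT p|lborel. g p) \<le> 2 * R * C"
  and "(\<And>y. norm (LINT x|lborel. g (x, y)) \<le> C) \<Longrightarrow> norm (LINT p|lborel. g p) \<le> 2 * R * C"
proof -
 have int: "integrable lborel g"
 proof (rule compact_support_integrable[OF assms(1), of "2 * R"])
  fix p :: "real \<times> real" assume "2 * R < norm p"
  then have "\<bar>fst p\<bar> > R \<or> \<bar>snd p\<bar> > R" using norm_Pair_le_add[of p] by linarith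
  then show "g p = 0" using assms(2)[of "fst p" "snd p"] by simp
 qed
 show "norm (LINT p|lborel. g p) \<le> 2 * R * C" if "\<And>x. norm (LINT y|lborel. g (x, y)) \<le> C"
  unfolding lborel_integral_fst[OF int, symmetric]
  by (rule norm_integral_support_le) (use assms that in auto)
 show "norm (LINT p|lborel. g p) \<le> 2 * R * C" if "\<And>y. norm (LINT x|lborel. g (x, y)) \<le> C"
  unfolding lborel_integral_snd[OF int, symmetric]
  by (rule norm_integral_support_le) (use assms that in auto)
qed

lemma e2pi_minus_inner_Pair:
 "e2pi (- (v \<bullet> (x, y))) = e2pi (- (fst v * x)) * e2pi (- (snd v * y))"
 using e2pi_add[of "- (fst v * x)" "- (snd v * y)"] by (simp add: inner_prod_def)

text \<open>Derivative bounds are imposed on the restrictions of g to lines parallel to the axes.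
  Integration by parts is done in the coordinate in which v is larger, and |v| is at most twice that
  coordinate; the other integration costs a factor 2R.\<close>

lemma fourier_decay_pair:
 assumes "bounded_derivs N F"
 shows "\<exists>C\<ge>0. \<forall>g R v. continuous_on UNIV g \<longrightarrow> (\<forall>y. (\<lambda>x. g (x, y)) \<in> F) \<longrightarrow> (\<forall>x. (\<lambda>y. g (x, y)) \<in> F) \<longrightarrow>
   (\<forall>x y. \<bar>x\<bar> > R \<or> \<bar>y\<bar> > R \<longrightarrow> g (x, y) = 0) \<longrightarrow> R \<ge> 0 \<longrightarrow>
   norm v ^ N * norm (LINT p|lborel. g p * e2pi (- (v \<bullet> p))) \<le> C * R\<^sup>2"
proof -
 obtain C where C: "C \<ge> 0" "\<And>f R \<theta>. f \<in> F \<Longrightarrow> R \<ge> 0 \<Longrightarrow> \<forall>x. \<bar>x\<bar> > R \<longrightarrow> f x = 0 \<Longrightarrow>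
  \<bar>\<theta>\<bar> ^ N * norm (LINT x|lborel. f x * e2pi (- (\<theta> * x))) \<le> C * R"
  using fourier_decay[OF assms] by blast
 have "norm v ^ N * norm (LINT p|lborel. g p * e2pi (- (v \<bullet> p))) \<le> (2 ^ N * (2 * C)) * R\<^sup>2"
  if g: "continuous_on UNIV g" "\<forall>y. (\<lambda>x. g (x, y)) \<in> F" "\<forall>x. (\<lambda>y. g (x, y)) \<in> F"
   "\<forall>x y. \<bar>x\<bar> > R \<or> \<bar>y\<bar> > R \<longrightarrow> g (x, y) = 0" "R \<ge> 0" for g R v
 proof -
  define G where "G p = g p * e2pi (- (v \<bullet> p))" for p
  have cG: "continuous_on UNIV (\<lambda>p. of_real c * G p)" for c
   unfolding G_def by (intro continuous_intros g)
  have 1: "norm (of_real (\<bar>fst v\<bar> ^ N) * (LINT p|lborel. G p)) \<le> 2 * R * (C * R)"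
  proof -
   have "norm (LINT p|lborel. of_real (\<bar>fst v\<bar> ^ N) * G p) \<le> 2 * R * (C * R)"
   proof (rule integral_iterated_support_le(2)[OF cG _ g(5)])
    fix y
    have "(\<lambda>x. of_real (\<bar>fst v\<bar> ^ N) * G (x, y)) =
     (\<lambda>x. (of_real (\<bar>fst v\<bar> ^ N) * e2pi (- (snd v * y))) * (g (x, y) * e2pi (- (fst v * x))))"
     by (auto simp: G_def e2pi_minus_inner_Pair)
    then show "norm (LINT x|lborel. of_real (\<bar>fst v\<bar> ^ N) * G (x, y)) \<le> C * R"
     using C(2)[of "\<lambda>x. g (x, y)" R "fst v"] g by (simp add: norm_mult norm_power)
   qed (use g in \<open>auto simp: G_def\<close>)
   then show ?thesis by simp
  qed
  have 2: "norm (of_real (\<bar>snd v\<bar> ^ N) * (LINT p|lborel. G p)) \<le> 2 * R * (C * R)"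
  proof -
   have "norm (LINT p|lborel. of_real (\<bar>snd v\<bar> ^ N) * G p) \<le> 2 * R * (C * R)"
   proof (rule integral_iterated_support_le(1)[OF cG _ g(5)])
    fix x
    have "(\<lambda>y. of_real (\<bar>snd v\<bar> ^ N) * G (x, y)) =
     (\<lambda>y. (of_real (\<bar>snd v\<bar> ^ N) * e2pi (- (fst v * x))) * (g (x, y) * e2pi (- (snd v * y))))"
     by (auto simp: G_def e2pi_minus_inner_Pair)
    then show "norm (LINT y|lborel. of_real (\<bar>snd v\<bar> ^ N) * G (x, y)) \<le> C * R"
     using C(2)[of "\<lambda>y. g (x, y)" R "snd v"] g by (simp add: norm_mult norm_power)
   qed (use g in \<open>auto simp: G_def\<close>)
   then show ?thesis by simp
  qed
  define m where "m = max \<bar>fst v\<bar> \<bar>snd v\<bar>"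
  have "norm v \<le> 2 * m" using norm_Pair_le_add[of v] by (auto simp: m_def)
  then have "norm v ^ N \<le> 2 ^ N * m ^ N" unfolding power_mult_distrib[symmetric] by (intro power_mono) auto
  moreover have "m ^ N * norm (LINT p|lborel. G p) \<le> 2 * R * (C * R)"
   using 1 2 unfolding m_def max_def by (auto simp: norm_mult norm_power)
  ultimately have "norm v ^ N * norm (LINT p|lborel. G p) \<le> 2 ^ N * (m ^ N * norm (LINT p|lborel. G p))"
   by (simp add: mult.assoc[symmetric] mult_right_mono)
  also have "\<dots> \<le> 2 ^ N * (2 * R * (C * R))" by (rule mult_left_mono) (fact, simp)
  finally show ?thesis by (simp add: G_def power2_eq_square mult_ac)
 qed
 then show ?thesis using C(1) by (intro exI[of _ "2 ^ N * (2 * C)"]) auto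
qed

text \<open>The sum over n is replaced by an integral for each m, then the sum over m under the
  integral sign. The first step is made for at most 3M values of m; the second is integrated over
  length 2R and multiplied by X, with R X \<le> M. Together this gives 5C.\<close>

lemma periodic_sum_approx_pair:
 assumes "bounded_derivs N F"
 shows "\<exists>C\<ge>0. \<forall>g R X. \<forall>M::int. continuous_on UNIV g \<longrightarrow> (\<forall>y. (\<lambda>x. g (x, y)) \<in> F) \<longrightarrow> (\<forall>x. (\<lambda>y. g (x, y)) \<in> F) \<longrightarrow>
   (\<forall>x y. \<bar>x\<bar> > R \<or> \<bar>y\<bar> > R \<longrightarrow> g (x, y) = 0) \<longrightarrow> R \<ge> 0 \<longrightarrow> X > 0 \<longrightarrow> R * X + 1 \<le> of_int M \<longrightarrow>
   norm ((\<Sum>m\<in>{-M..M}. \<Sum>n\<in>{-M..M}. g (of_int m / X, of_int n / X)) - X\<^sup>2 *\<^sub>R (LINT p|lborel. g p))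
    \<le> C * (of_int M)\<^sup>2 / X ^ N"
proof -
 obtain C where C: "C \<ge> 0" "\<And>f R X x. \<And>M::int. f \<in> F \<Longrightarrow> R \<ge> 0 \<Longrightarrow> X > 0 \<Longrightarrow> x \<in> {0..1} \<Longrightarrow>
   \<forall>x. \<bar>x\<bar> > R \<longrightarrow> f x = 0 \<Longrightarrow> R * X + 1 \<le> of_int M \<Longrightarrow>
   norm ((\<Sum>n\<in>{-M..M}. f ((of_int n + x) / X)) - X *\<^sub>R (LINT y|lborel. f y)) \<le> C * of_int M / X ^ N"
  using periodic_sum_approx[OF assms] by blast
 have "norm ((\<Sum>m\<in>{-M..M}. \<Sum>n\<in>{-M..M}. g (of_int m / X, of_int n / X)) - X\<^sup>2 *\<^sub>R (LINT p|lborel. g p))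
    \<le> (5 * C) * (of_int M)\<^sup>2 / X ^ N"
  if g: "continuous_on UNIV g" "\<forall>y. (\<lambda>x. g (x, y)) \<in> F" "\<forall>x. (\<lambda>y. g (x, y)) \<in> F"
   "\<forall>x y. \<bar>x\<bar> > R \<or> \<bar>y\<bar> > R \<longrightarrow> g (x, y) = 0" "R \<ge> 0" "X > 0" "R * X + 1 \<le> of_int M" for g R X and M :: int
 proof -
  have M: "M \<ge> 1" using g by (smt (verit) mult_nonneg_nonneg of_int_less_1_iff)
  have int: "integrable lborel g"
  proof (rule compact_support_integrable[OF g(1), of "2 * R"])
   fix p :: "real \<times> real" assume "2 * R < norm p"
   then have "\<bar>fst p\<bar> > R \<or> \<bar>snd p\<bar> > R" using norm_Pair_le_add[of p] by linarith
   then show "g p = 0" using g(4) by (metis prod.collapse)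
  qed
  have ci: "integrable lborel (\<lambda>y. g (x, y))" for x
   by (rule compact_support_integrable[of _ R])
     (use g bounded_derivs_continuous[OF assms, of "\<lambda>y. g (x, y)"] in auto)
  let ?I = "\<lambda>x. LINT y|lborel. g (x, y)"
  let ?J = "\<lambda>y. LINT x|lborel. g (x, y)"
  have A: "norm ((\<Sum>n\<in>{-M..M}. g (x, of_int n / X)) - X *\<^sub>R ?I x) \<le> C * of_int M / X ^ N" for x
   using C(2)[of "\<lambda>y. g (x, y)" R X 0 M] g by auto
  have B: "norm ((\<Sum>n\<in>{-M..M}. g (of_int n / X, y)) - X *\<^sub>R ?J y) \<le> C * of_int M / X ^ N" for y
   using C(2)[of "\<lambda>x. g (x, y)" R X 0 M] g by auto
  have nn: "C * of_int M / X ^ N \<ge> 0" using C M g by auto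
  have "norm ((\<Sum>m\<in>{-M..M}. \<Sum>n\<in>{-M..M}. g (of_int m / X, of_int n / X)) - (\<Sum>m\<in>{-M..M}. X *\<^sub>R ?I (of_int m / X)))
    \<le> (\<Sum>m\<in>{-M..M}. C * of_int M / X ^ N)"
   unfolding sum_subtractf[symmetric] by (rule sum_norm_le) (rule A)
  also have "\<dots> = (2 * of_int M + 1) * (C * of_int M / X ^ N)" using M by simp
  also have "\<dots> \<le> (3 * of_int M) * (C * of_int M / X ^ N)" using M nn by (intro mult_right_mono) auto
  finally have 1: "norm ((\<Sum>m\<in>{-M..M}. \<Sum>n\<in>{-M..M}. g (of_int m / X, of_int n / X)) - (\<Sum>m\<in>{-M..M}. X *\<^sub>R ?I (of_int m / X)))
    \<le> (3 * of_int M) * (C * of_int M / X ^ N)" .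
  have eq: "(\<Sum>m\<in>{-M..M}. X *\<^sub>R ?I (of_int m / X)) - X\<^sup>2 *\<^sub>R (LINT p|lborel. g p)
   = X *\<^sub>R (LINT y|lborel. (\<Sum>n\<in>{-M..M}. g (of_int n / X, y)) - X *\<^sub>R ?J y)"
   using lborel_integral_snd[OF int] lborel_integrable_snd[OF int] ci
   by (simp add: Bochner_Integration.integral_diff Bochner_Integration.integral_sum scaleR_diff_right scaleR_sum_right power2_eq_square)
  have "norm (LINT y|lborel. (\<Sum>n\<in>{-M..M}. g (of_int n / X, y)) - X *\<^sub>R ?J y) \<le> 2 * R * (C * of_int M / X ^ N)"
   by (rule norm_integral_support_le[OF _ B g(5)]) (use g in auto)
  from mult_left_mono[OF this, of X] have "norm (X *\<^sub>R (LINT y|lborel. (\<Sum>n\<in>{-M..M}. g (of_int n / X, y)) - X *\<^sub>R ?J y)) \<le> X * (2 * R * (C * of_int M / X ^ N))"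
   using g(6) by simp
  also have "\<dots> = 2 * (R * X) * (C * of_int M / X ^ N)" by simp
  also have "\<dots> \<le> 2 * of_int M * (C * of_int M / X ^ N)" using g nn by (intro mult_right_mono mult_left_mono) auto
  finally have 2: "norm ((\<Sum>m\<in>{-M..M}. X *\<^sub>R ?I (of_int m / X)) - X\<^sup>2 *\<^sub>R (LINT p|lborel. g p)) \<le> 2 * of_int M * (C * of_int M / X ^ N)"
   unfolding eq .
  have "norm ((\<Sum>m\<in>{-M..M}. \<Sum>n\<in>{-M..M}. g (of_int m / X, of_int n / X)) - X\<^sup>2 *\<^sub>R (LINT p|lborel. g p))
   \<le> (3 * of_int M) * (C * of_int M / X ^ N) + 2 * of_int M * (C * of_int M / X ^ N)"
   using norm_triangle_mono[OF 1 2] by simp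
  then show ?thesis by (simp add: power2_eq_square algebra_simps add_divide_distrib[symmetric])
 qed
 then show ?thesis using C(1) by (intro exI[of _ "5 * C"]) auto
qed

section \<open>The weights and the families built from them\<close>

locale delta_weights =
 fixes \<omega> \<omega>0 :: "real \<Rightarrow> real"
 assumes weights: "weight_functions \<omega> \<omega>0"
begin

lemma \<omega>_smooth: "smooth \<omega>" and \<omega>_nonneg: "\<omega> x \<ge> 0" and \<omega>_integral: "(LINT x|lborel. \<omega> x) = 1"
 and \<omega>0_even: "\<omega>0 (- x) = \<omega>0 x" and \<omega>0_0 [simp]: "\<omega>0 0 = 1"
 and \<omega>0_sqrt_smooth: "smooth (\<lambda>x. \<omega>0 (\<bar>x\<bar> powr (1/2)))"
 using weights by (auto simp: weight_functions_def)

lemma \<omega>_0: "x \<le> 1/2 \<or> x \<ge> 1 \<Longrightarrow> \<omega> x = 0" and \<omega>0_outside: "\<bar>x\<bar> \<ge> 1/2 \<Longrightarrow> \<omega>0 x = 0"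
proof -
 have "{x. \<omega> x \<noteq> 0} \<subseteq> {1/2<..<1}" "{x. \<omega>0 x \<noteq> 0} \<subseteq> {-1/2<..<1/2}"
  using weights by (auto simp: weight_functions_def)
 then show "x \<le> 1/2 \<or> x \<ge> 1 \<Longrightarrow> \<omega> x = 0" "\<bar>x\<bar> \<ge> 1/2 \<Longrightarrow> \<omega>0 x = 0" by force+
qed

text \<open>This exhibits \<omega>0(|u|) as the function assumed smooth, evaluated at |u|^2, a
  polynomial in the coordinates; smoothness across u = 0 comes from here.\<close>

lemma \<omega>0_norm: "\<omega>0 (norm u) = \<omega>0 (\<bar>(norm u)\<^sup>2\<bar> powr (1/2))"
 by (simp add: powr_half_sqrt)

lemma bounded_derivs_\<omega>: "bounded_derivs k {\<lambda>x. complex_of_real (\<omega> x)}"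
 by (rule smooth_bounded_derivs[of _ 1]) (auto intro: \<omega>_smooth \<omega>_0)

lemma supported_\<omega>: "supported_in {1/2..1} {\<lambda>x. complex_of_real (\<omega> x)}"
 using \<omega>_0 by (auto simp: supported_in_def not_le)

text \<open>Here \<omega>(|u|) is viewed as a function of |u|^2. The square root is singular only at
  0, where \<omega> vanishes, and elsewhere satisfies the differential equation required for
  composition.\<close>

lemma bounded_derivs_\<omega>_norm:
 "bounded_derivs k {\<lambda>x. complex_of_real (\<omega> (norm (\<alpha> + x *\<^sub>R \<beta>))) | \<alpha> \<beta> :: real \<times> real. norm \<beta> \<le> B}"
proof (cases "B \<ge> 0")
 case True
 have sq: "bounded_derivs k {\<lambda>x. f (sqrt x) | f. f \<in> {\<lambda>x. complex_of_real (\<omega> x)}}"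
 proof (rule bounded_derivs_compose[where c="1/2" and m="-1", OF _ _ bounded_derivs_\<omega> supported_\<omega>])
  show "(sqrt has_real_derivative 1 / 2 * sqrt x powi - 1) (at x)" if "sqrt x \<in> {1/3<..<2}" for x
  proof -
   have "x > 0" using that real_sqrt_gt_0_iff[of x] by (simp del: real_sqrt_gt_0_iff)
   then show ?thesis using DERIV_real_sqrt[of x] by (simp add: power_int_minus field_simps)
  qed
  show "\<forall>\<^sub>F t in nhds x. sqrt t \<notin> {1/2..1}" if "sqrt x \<notin> {1/3<..<2}" for x
  proof -
   have "open (sqrt -` (- {1/2..1}))" by (intro open_vimage continuous_intros)
   then show ?thesis
    using that by (intro eventually_mono[OF eventually_nhds_in_open[of "sqrt -` (- {1/2..1})"]])
     (auto simp del: real_sqrt_le_1_iff real_sqrt_ge_1_iff)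
  qed
 qed
 have supp: "supported_in {-1..1} {\<lambda>x. f (sqrt x) | f. f \<in> {\<lambda>x. complex_of_real (\<omega> x)}}"
 proof -
  have "\<omega> (sqrt x) = 0" if "x \<notin> {-1..1}" for x
  proof -
   have "sqrt x \<le> 1/2 \<or> sqrt x \<ge> 1"
    using that by (cases "x \<ge> 1") (auto intro: order_trans[of _ 0])
   then show ?thesis by (rule \<omega>_0)
  qed
  then show ?thesis by (auto simp: supported_in_def)
 qed
 show ?thesis
 proof (rule bounded_derivs_subset[OF bounded_derivs_sqnorm[OF True sq supp]], safe)
  fix \<alpha> \<beta> :: "real \<times> real" assume b: "norm \<beta> \<le> B"
  show "\<exists>f (\<alpha>' :: real \<times> real) \<beta>'. (\<lambda>x. complex_of_real (\<omega> (norm (\<alpha> + x *\<^sub>R \<beta>)))) = (\<lambda>x. f ((norm (\<alpha>' + x *\<^sub>R \<beta>'))\<^sup>2)) \<and>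
   f \<in> {\<lambda>x. f (sqrt x) |f. f \<in> {\<lambda>x. complex_of_real (\<omega> x)}} \<and> norm \<beta>' \<le> B"
   by (intro exI[of _ "\<lambda>x. complex_of_real (\<omega> (sqrt x))"] exI[of _ \<alpha>] exI[of _ \<beta>]) (use b in auto)
 qed
next
 case False
 have *: "{\<lambda>x. complex_of_real (\<omega> (norm (\<alpha> + x *\<^sub>R \<beta>))) | \<alpha> \<beta> :: real \<times> real. norm \<beta> \<le> B} = {}"
  using False order_trans[OF norm_ge_zero] by auto
 show ?thesis unfolding * using bounded_derivs_subset[OF bounded_derivs_\<omega>] by blast
qed

text \<open>The cutoff is 1 at the origin, where the square root is singular, so the composition
  argument used for \<omega> breaks down; the assumed smoothness of \<omega>0(|x|^(1/2)) takes its
  place.\<close>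

lemma bounded_derivs_\<omega>0_norm:
 assumes "B \<ge> 0"
 shows "bounded_derivs k {\<lambda>x. complex_of_real (\<omega>0 (norm (\<alpha> + x *\<^sub>R \<beta>))) | \<alpha> \<beta> :: real \<times> real. norm \<beta> \<le> B}"
proof -
 have out: "\<omega>0 (\<bar>x\<bar> powr (1/2)) = 0" if "x \<notin> {-1..1}" for x
 proof -
  have "\<bar>x\<bar> powr (1/2) \<ge> 1" using that by (intro ge_one_powr_ge_zero) auto
  then show ?thesis by (intro \<omega>0_outside) auto
 qed
 have bd: "bounded_derivs k {\<lambda>x. complex_of_real (\<omega>0 (\<bar>x\<bar> powr (1/2)))}"
  by (rule smooth_bounded_derivs[OF \<omega>0_sqrt_smooth, of 1]) (rule out)
 have supp: "supported_in {-1..1} {\<lambda>x. complex_of_real (\<omega>0 (\<bar>x\<bar> powr (1/2)))}"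
  using out by (auto simp: supported_in_def)
 show ?thesis
  unfolding \<omega>0_norm
 proof (rule bounded_derivs_subset[OF bounded_derivs_sqnorm[OF assms bd supp]], safe)
  fix \<alpha> \<beta> :: "real \<times> real" assume b: "norm \<beta> \<le> B"
  show "\<exists>f (\<alpha>' :: real \<times> real) \<beta>'. (\<lambda>x. complex_of_real (\<omega>0 (\<bar>(norm (\<alpha> + x *\<^sub>R \<beta>))\<^sup>2\<bar> powr (1/2)))) = (\<lambda>x. f ((norm (\<alpha>' + x *\<^sub>R \<beta>'))\<^sup>2)) \<and>
   f \<in> {\<lambda>x. complex_of_real (\<omega>0 (\<bar>x\<bar> powr (1/2)))} \<and> norm \<beta>' \<le> B"
   by (intro exI[of _ "\<lambda>x. complex_of_real (\<omega>0 (\<bar>x\<bar> powr (1/2)))"] exI[of _ \<alpha>] exI[of _ \<beta>] conjI refl b) auto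
 qed
qed

text \<open>Restrictions to lines of the cutoff times a character. B bounds the speed along the line
  and the frequency, while the starting point and the phase are free. \<open>fam1\<close> adds the
  radial weight along a line, \<open>fam2\<close> adds the weight in the line parameter
  itself.\<close>

definition fam0 :: "real \<Rightarrow> (real \<Rightarrow> complex) set" where
 "fam0 B = {\<lambda>x. of_real (\<omega>0 (norm (\<alpha> + x *\<^sub>R \<beta>))) * e2pi (a * x + b) | (\<alpha> :: real \<times> real) \<beta> a b. norm \<beta> \<le> B \<and> \<bar>a\<bar> \<le> B}"

definition fam1 :: "real \<Rightarrow> (real \<Rightarrow> complex) set" where
 "fam1 B = {\<lambda>x. of_real (\<omega> (norm (\<alpha> + x *\<^sub>R \<beta>))) * f x | (\<alpha> :: real \<times> real) \<beta> f. norm \<beta> \<le> B \<and> f \<in> fam0 B}"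

definition fam2 :: "real \<Rightarrow> (real \<Rightarrow> complex) set" where
 "fam2 B = {\<lambda>x. of_real (\<omega> x) * f x | f. f \<in> fam0 B}"

lemma bounded_derivs_fam0:
 assumes "B \<ge> 0"
 shows "bounded_derivs k (fam0 B)"
proof (rule bounded_derivs_multI[OF bounded_derivs_\<omega>0_norm[OF assms] bounded_derivs_e2pi])
 fix h assume "h \<in> fam0 B"
 then obtain \<alpha> \<beta> :: "real \<times> real" and a b where h: "norm \<beta> \<le> B" "\<bar>a\<bar> \<le> B"
  "h = (\<lambda>x. of_real (\<omega>0 (norm (\<alpha> + x *\<^sub>R \<beta>))) * e2pi (a * x + b))"
  unfolding fam0_def by blast
 show "\<exists>f\<in>{\<lambda>x. complex_of_real (\<omega>0 (norm (\<alpha> + x *\<^sub>R \<beta>))) | \<alpha> \<beta> :: real \<times> real. norm \<beta> \<le> B}.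
  \<exists>g\<in>{\<lambda>x. e2pi (a * x + b) | a b. \<bar>a\<bar> \<le> B}. h = (\<lambda>x. f x * g x)"
  by (rule bexI[of _ "\<lambda>x. complex_of_real (\<omega>0 (norm (\<alpha> + x *\<^sub>R \<beta>)))"],
    rule bexI[of _ "\<lambda>x. e2pi (a * x + b)"], rule h(3)) (use h(1,2) in blast)+
qed

lemma bounded_derivs_fam1:
 assumes "B \<ge> 0"
 shows "bounded_derivs k (fam1 B)"
proof (rule bounded_derivs_multI[OF bounded_derivs_\<omega>_norm bounded_derivs_fam0[OF assms]])
 fix h assume "h \<in> fam1 B"
 then obtain \<alpha> \<beta> :: "real \<times> real" and f where h: "norm \<beta> \<le> B" "f \<in> fam0 B"
  "h = (\<lambda>x. of_real (\<omega> (norm (\<alpha> + x *\<^sub>R \<beta>))) * f x)"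
  unfolding fam1_def by blast
 show "\<exists>f\<in>{\<lambda>x. complex_of_real (\<omega> (norm (\<alpha> + x *\<^sub>R \<beta>))) | \<alpha> \<beta> :: real \<times> real. norm \<beta> \<le> B}.
  \<exists>g\<in>fam0 B. h = (\<lambda>x. f x * g x)"
  by (rule bexI[of _ "\<lambda>x. complex_of_real (\<omega> (norm (\<alpha> + x *\<^sub>R \<beta>)))"],
    rule bexI[of _ f], rule h(3), rule h(2)) (use h(1) in blast)
qed

lemma bounded_derivs_fam2:
 assumes "B \<ge> 0"
 shows "bounded_derivs k (fam2 B)"
 by (rule bounded_derivs_multI[OF bounded_derivs_\<omega> bounded_derivs_fam0[OF assms]])
   (auto simp: fam2_def)

end


section \<open>Size and cancellation in the kernel h\<close>

lemma infsum_eq_sum: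
 fixes f :: "'a \<Rightarrow> 'b::{comm_monoid_add, t2_space}"
 assumes "finite B" "B \<subseteq> A" "\<And>x. x \<in> A - B \<Longrightarrow> f x = 0"
 shows "infsum f A = sum f B"
proof -
 have "infsum f A = infsum f B"
  by (rule infsum_cong_neutral) (use assms in auto)
 then show ?thesis using assms(1) by simp
qed

lemma sum_int_symmetric_eq_nat:
 fixes f :: "int \<Rightarrow> 'a::comm_monoid_add"
 assumes "\<And>n. n \<in> {-M..M} \<Longrightarrow> n < 1 \<or> n > int J \<Longrightarrow> f n = 0" "\<And>n. n > M \<Longrightarrow> n \<le> int J \<Longrightarrow> f n = 0"
 shows "(\<Sum>n\<in>{-M..M}. f n) = (\<Sum>j\<in>{1..J}. f (int j))"
proof -
 have "(\<Sum>n\<in>{-M..M}. f n) = (\<Sum>n\<in>{1..int J} \<inter> {-M..M}. f n)"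
  by (rule sum.mono_neutral_right) (use assms(1) in auto)
 also have "\<dots> = (\<Sum>n\<in>{1..int J}. f n)"
  by (rule sum.mono_neutral_left) (use assms(2) in auto)
 also have "{1..int J} = int ` {1..J}"
  using image_int_atLeastAtMost[of 1 J] by simp
 finally show ?thesis by (simp add: sum.reindex)
qed

lemma periodic_sum_approx_single:
 assumes "bounded_derivs N {g}" "R \<ge> 0" "\<And>x. \<bar>x\<bar> > R \<Longrightarrow> g x = 0"
 obtains C where "C \<ge> 0" "\<And>X M. X > 0 \<Longrightarrow> R * X + 1 \<le> of_int M \<Longrightarrow>
  norm ((\<Sum>n\<in>{-M..M}. g (of_int n / X)) - X *\<^sub>R (LINT y|lborel. g y)) \<le> C * of_int M / X ^ N"
proof -
 obtain C where C: "C \<ge> 0" "\<forall>f\<in>{g}. \<forall>R\<ge>0::real. \<forall>X>0::real. \<forall>M::int. \<forall>x\<in>{0..1}.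
   (\<forall>x. \<bar>x\<bar> > R \<longrightarrow> f x = 0) \<longrightarrow> R * X + 1 \<le> of_int M \<longrightarrow>
   norm ((\<Sum>n\<in>{-M..M}. f ((of_int n + x) / X)) - X *\<^sub>R (LINT y|lborel. f y)) \<le> C * of_int M / X ^ N"
  using periodic_sum_approx[OF assms(1)] by blast
 show ?thesis
 proof (rule that[OF C(1)])
  fix X :: real and M :: int assume X: "X > 0" "R * X + 1 \<le> of_int M"
  show "norm ((\<Sum>n\<in>{-M..M}. g (of_int n / X)) - X *\<^sub>R (LINT y|lborel. g y)) \<le> C * of_int M / X ^ N"
   using C(2)[rule_format, of g R X 0 M] X assms(2,3) by simp
 qed
qed

text \<open>If W is an antiderivative of f, then -W(1/t) is one of the left integrand. The interval
  [1/4, 4] is stable under inversion and contains both [1/2, 1] and its image [1, 2].\<close>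

lemma integral_inverse_substitution:
 fixes f :: "real \<Rightarrow> complex"
 assumes f: "continuous_on UNIV f" and supp: "\<And>x. x \<notin> {1/2..1} \<Longrightarrow> f x = 0"
 shows "(LINT t|lborel. f (1 / t) / of_real (t\<^sup>2)) = (LINT t|lborel. f t)"
proof -
 obtain W where W: "\<And>x. x \<in> {1/4..4} \<Longrightarrow> (W has_vector_derivative f x) (at x within {1/4..4})"
  using antiderivative_continuous[OF continuous_on_subset[OF f], of "1/4" 4] by auto
 have W1: "((\<lambda>t. - W (1 / t)) has_vector_derivative f (1 / t) / of_real (t\<^sup>2)) (at t within {1/4..4})"
  if t: "t \<in> {1/4..4}" for t
 proof -
  have d: "((\<lambda>t. 1 / t) has_vector_derivative - (1 / t\<^sup>2)) (at t within {1/4..4})"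
   unfolding has_real_derivative_iff_has_vector_derivative[symmetric]
   using t by (auto intro!: derivative_eq_intros simp: power2_eq_square)
  have im: "(\<lambda>t. 1 / t) ` {1/4..4} \<subseteq> {1/4..4::real}"
   by (auto simp: field_simps)
  have "(W has_vector_derivative f (1 / t)) (at (1 / t) within (\<lambda>t. 1 / t) ` {1/4..4})"
   using imageI[OF t, of "\<lambda>t. 1 / t"] im by (intro has_vector_derivative_within_subset[OF W im]) blast
  from vector_diff_chain_within[OF d this]
  have "((\<lambda>t. W (1 / t)) has_vector_derivative - (1 / t\<^sup>2) *\<^sub>R f (1 / t)) (at t within {1/4..4})"
   by (simp add: o_def)
  moreover have "- (- (1 / t\<^sup>2) *\<^sub>R f (1 / t)) = f (1 / t) / of_real (t\<^sup>2)"
   by (simp add: scaleR_conv_of_real)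
  ultimately show ?thesis
   using has_vector_derivative_minus by metis
 qed
 have "(LINT t|lborel. indicator {1/4..4} t *\<^sub>R (f (1 / t) / of_real (t\<^sup>2))) = - W (1 / 4) - (- W (1 / (1/4)))"
  by (rule integral_FTC_atLeastAtMost)
    (use W1 in \<open>auto intro!: continuous_intros continuous_on_compose2[OF f]\<close>)
 moreover have "(\<lambda>t. indicator {1/4..4} t *\<^sub>R (f (1 / t) / of_real (t\<^sup>2))) = (\<lambda>t. f (1 / t) / of_real (t\<^sup>2))"
 proof
  fix t :: real
  have "f (1 / t) = 0" if "t \<notin> {1/4..4}"
  proof (rule supp)
   show "1 / t \<notin> {1/2..1}"
    using that by (cases "t > 0") (auto simp: field_simps not_le divide_simps)
  qed
  then show "indicator {1/4..4} t *\<^sub>R (f (1 / t) / of_real (t\<^sup>2)) = f (1 / t) / of_real (t\<^sup>2)"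
   by (auto simp: indicator_def)
 qed
 moreover have "(LINT t|lborel. indicator {1/4..4} t *\<^sub>R f t) = W 4 - W (1/4)"
  by (rule integral_FTC_atLeastAtMost) (use W continuous_on_subset[OF f] in auto)
 moreover have "(\<lambda>t. indicator {1/4..4} t *\<^sub>R f t) = f"
  using supp by (auto simp: indicator_def fun_eq_iff)
 ultimately show ?thesis by simp
qed

context delta_weights
begin

lemma continuous_on_\<omega> [continuous_intros]: "continuous_on A f \<Longrightarrow> continuous_on A (\<lambda>x. \<omega> (f x))"
proof -
 have "(\<omega> has_real_derivative deriv \<omega> x) (at x)" for x
  using \<omega>_smooth[unfolded smooth_def, rule_format, of 0 x] by (simp add: DERIV_deriv_iff_real_differentiable)
 then have "continuous_on UNIV \<omega>"
  by (meson DERIV_isCont continuous_at_imp_continuous_on)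
 then show "continuous_on A f \<Longrightarrow> continuous_on A (\<lambda>x. \<omega> (f x))"
  by (rule continuous_on_compose2) auto
qed

lemma continuous_on_\<omega>0_norm [continuous_intros]:
 fixes f :: "'b::topological_space \<Rightarrow> real \<times> real"
 assumes "continuous_on A f"
 shows "continuous_on A (\<lambda>x. \<omega>0 (norm (f x)))"
proof -
 have "(\<lambda>x. complex_of_real (\<omega>0 (\<bar>x\<bar> powr (1/2)))) \<in> {\<lambda>x. complex_of_real (\<omega>0 (\<bar>x\<bar> powr (1/2)))}" by simp
 have d: "((\<lambda>x. \<omega>0 (\<bar>x\<bar> powr (1/2))) has_real_derivative deriv (\<lambda>x. \<omega>0 (\<bar>x\<bar> powr (1/2))) x) (at x)" for x
  using \<omega>0_sqrt_smooth[unfolded smooth_def, rule_format, of 0 x] by (simp add: DERIV_deriv_iff_real_differentiable)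
 have c: "continuous_on UNIV (\<lambda>x. \<omega>0 (\<bar>x\<bar> powr (1/2)))"
  by (rule continuous_at_imp_continuous_on) (use d DERIV_isCont in blast)
 show ?thesis unfolding \<omega>0_norm
  by (rule continuous_on_compose2[OF c]) (auto intro!: continuous_intros assms)
qed

text \<open>The integral of \<omega> against dt/t. Divided by y, it is the leading term of both
  halves of h. The power -1 is written with \<open>powi\<close> to fit
  \<open>bounded_derivs_powi\<close>.\<close>

definition log_mean :: complex where
 "log_mean = (LINT t|lborel. of_real (t powi -1) * of_real (\<omega> t))"

definition h_main :: "nat \<Rightarrow> real \<Rightarrow> real" where
 "h_main J y = (\<Sum>j\<in>{1..J}. \<omega> (y * real j) / (y * real j))"

text \<open>At most one of the two signs contributes, so the sum of the two values replaces \<omega>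
  at |z|/(yj). This removes the absolute value and lets each term be treated by a linear
  substitution in z.\<close>

definition h_tail :: "nat \<Rightarrow> real \<Rightarrow> real \<Rightarrow> real" where
 "h_tail J y z = (\<Sum>j\<in>{1..J}. (\<omega> (z / (y * real j)) + \<omega> (- (z / (y * real j)))) / (y * real j))"

definition h_sum :: "nat \<Rightarrow> real \<Rightarrow> real \<Rightarrow> real" where
 "h_sum J y z = h_main J y - h_tail J y z"

lemma \<omega>_abs:
 assumes "c > 0"
 shows "\<omega> (\<bar>z\<bar> / c) = \<omega> (z / c) + \<omega> (- (z / c))"
proof (cases "z \<ge> 0")
 case True
 then have "z / c \<ge> 0" using assms by simp
 then have "\<omega> (- (z / c)) = 0" by (intro \<omega>_0) linarith
 then show ?thesis using True by simp
next
 case False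
 then have "z / c < 0" using assms by (simp add: divide_neg_pos)
 then have "\<omega> (z / c) = 0" by (intro \<omega>_0) linarith
 then show ?thesis using False by simp
qed

text \<open>The range |z| \<le> 1/2 is the one left by the cutoff in p2. There a term with y j \<ge>
  1 vanishes in both halves, so any J with J y \<ge> 1 truncates the series exactly.\<close>

lemma h_fun_eq:
 assumes "y > 0" "\<bar>z\<bar> \<le> 1/2" "real J * y \<ge> 1"
 shows "h_fun \<omega> y z = h_sum J y z"
proof -
 have out: "\<omega> (y * real j) = 0 \<and> \<omega> (\<bar>z\<bar> / (y * real j)) = 0" if "j > J" for j
 proof -
  have "real J * y \<le> y * real j" using that assms by (simp add: mult.commute)
  then have yj: "y * real j \<ge> 1" using assms by linarith
  moreover have "\<bar>z\<bar> / (y * real j) \<le> 1/2"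
   using yj assms by (simp add: field_simps)
  ultimately show ?thesis by (auto intro!: \<omega>_0)
 qed
 have "h_fun \<omega> y z = (\<Sum>j\<in>{1..J}. 1 / (y * real j) * (\<omega> (y * real j) - \<omega> (\<bar>z\<bar> / (y * real j))))"
  unfolding h_fun_def by (rule infsum_eq_sum) (use out in \<open>auto simp: not_le\<close>)
 also have "\<dots> = (\<Sum>j\<in>{1..J}. \<omega> (y * real j) / (y * real j) - (\<omega> (z / (y * real j)) + \<omega> (- (z / (y * real j)))) / (y * real j))"
  using assms(1) by (intro sum.cong refl, subst \<omega>_abs) (auto simp: diff_divide_distrib)
 finally show ?thesis by (simp add: h_sum_def h_main_def h_tail_def sum_subtractf)
qed

text \<open>Already the term j = 1 vanishes. This makes p2 zero for kq \<ge> Q and accounts for the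
  range q \<le> Q/k in (5).\<close>

lemma h_fun_eq_0: "y \<ge> 1 \<Longrightarrow> \<bar>z\<bar> \<le> 1/2 \<Longrightarrow> h_fun \<omega> y z = 0"
proof -
 assume a: "y \<ge> 1" "\<bar>z\<bar> \<le> 1/2"
 have "\<omega> y = 0" "\<omega> (\<bar>z\<bar> / y) = 0"
  using a by (auto intro!: \<omega>_0 simp: field_simps)
 then show ?thesis using h_fun_eq[of y z 1] \<omega>_abs[of y z] a by (auto simp: h_sum_def h_main_def h_tail_def)
qed

lemma continuous_on_h_sum [continuous_intros]:
 "y > 0 \<Longrightarrow> continuous_on A f \<Longrightarrow> continuous_on A (\<lambda>x. h_sum J y (f x))"
 unfolding h_sum_def h_tail_def by (intro continuous_intros) auto

text \<open>A smooth Riemann sum of \<omega>(x)/x with step y, hence accurate to any power of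
  y.\<close>

lemma h_main_approx:
 "\<exists>C\<ge>0. \<forall>y J. 0 < y \<longrightarrow> y \<le> 1 \<longrightarrow> real J * y \<ge> 1 \<longrightarrow>
  norm (complex_of_real (h_main J y) - of_real (1 / y) * log_mean) \<le> C * y ^ N"
proof -
 let ?g = "\<lambda>x. complex_of_real (x powi -1) * of_real (\<omega> x)"
 have "bounded_derivs (Suc N) {\<lambda>x. of_real (x powi -1) * f x | f. f \<in> {\<lambda>x. complex_of_real (\<omega> x)}}"
  by (rule bounded_derivs_powi[OF bounded_derivs_\<omega> supported_\<omega>])
 also have "{\<lambda>x. of_real (x powi -1) * f x | f. f \<in> {\<lambda>x. complex_of_real (\<omega> x)}} = {?g}" by auto
 finally have bd: "bounded_derivs (Suc N) {?g}" .
 have g_out: "?g x = 0" if "\<bar>x\<bar> > 1" for x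
  using that \<omega>_0[of x] by (cases "x \<ge> 0") auto
 obtain C where C: "C \<ge> 0" "\<And>X M. X > 0 \<Longrightarrow> 1 * X + 1 \<le> of_int M \<Longrightarrow>
   norm ((\<Sum>n\<in>{-M..M}. ?g (of_int n / X)) - X *\<^sub>R (LINT y|lborel. ?g y)) \<le> C * of_int M / X ^ Suc N"
  by (rule periodic_sum_approx_single[where R=1, OF bd zero_le_one g_out], simp, rule that)
 have "norm (complex_of_real (h_main J y) - of_real (1 / y) * log_mean) \<le> (3 * C) * y ^ N"
  if y: "0 < y" "y \<le> 1" "real J * y \<ge> 1" for y J
 proof -
  \<comment> \<open>The bound M \<le> 3/y costs a factor 1/y, which is why one derivative more than
    N is used.\<close>
  define M where "M = \<lceil>1 / y\<rceil> + 1"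
  have M: "of_int M \<ge> 1 / y + 1" "of_int M \<le> 3 / y"
  proof -
   show "of_int M \<ge> 1 / y + 1" unfolding M_def by linarith
   have "of_int M \<le> 1 / y + 2" unfolding M_def by linarith
   also have "2 \<le> 2 / y" using y by (simp add: field_simps)
   finally show "of_int M \<le> 3 / y" by simp
  qed
  have "norm ((\<Sum>n\<in>{-M..M}. ?g (of_int n / (1 / y))) - (1 / y) *\<^sub>R (LINT y|lborel. ?g y)) \<le> C * of_int M / (1 / y) ^ Suc N"
   by (rule C(2)) (use y M in auto)
  also have "(\<Sum>n\<in>{-M..M}. ?g (of_int n / (1 / y))) = (\<Sum>j\<in>{1..J}. ?g (of_int (int j) / (1 / y)))"
  proof (rule sum_int_symmetric_eq_nat)
   fix n assume n: "n \<in> {-M..M}" "n < 1 \<or> n > int J"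
   have "of_int n * y \<le> 1/2 \<or> of_int n * y \<ge> 1"
   proof (cases "n < 1")
    case True
    then have "of_int n * y \<le> 0" using y by (auto simp: mult_nonpos_nonneg)
    then show ?thesis by simp
   next
    case False
    then have "real J \<le> of_int n" using n by auto
    then have "real J * y \<le> of_int n * y" using y by (intro mult_right_mono) auto
    then show ?thesis using y by linarith
   qed
   then show "?g (of_int n / (1 / y)) = 0" using \<omega>_0[of "of_int n * y"] by simp
  next
   fix n assume "n > M"
   then have "of_int n \<ge> 1 / y" using M(1) by linarith
   then have "of_int n * y \<ge> 1" using y by (simp add: field_simps)
   then show "?g (of_int n / (1 / y)) = 0" using \<omega>_0[of "of_int n * y"] by simp
  qed
  also have "(\<Sum>j\<in>{1..J}. ?g (of_int (int j) / (1 / y))) = of_real (h_main J y)"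
   unfolding h_main_def of_real_sum by (intro sum.cong refl) (simp add: power_int_minus field_simps)
  also have "C * of_int M / (1 / y) ^ Suc N \<le> C * (3 / y) / (1 / y) ^ Suc N"
   using M C y by (intro divide_right_mono mult_left_mono) auto
  also have "\<dots> = 3 * C * y ^ N" using y by (simp add: field_simps)
  finally show ?thesis by (simp add: log_mean_def scaleR_conv_of_real)
 qed
 then show ?thesis using C(1) by (intro exI[of _ "3 * C"]) auto
qed

text \<open>With X = |z|/y, the number |z| times the tail is a Riemann sum of \<omega>(1/x)/x with
  step 1/X. Inversion identifies the integral of this function with \<open>log_mean\<close>, so the
  leading term agrees with that of \<open>h_main\<close>. Two derivatives give the error y/z^2,
  which is integrable over |z| \<ge> y/2.\<close>

lemma h_tail_approx:
 "\<exists>C\<ge>0. \<forall>y J z. 0 < y \<longrightarrow> y \<le> 1 \<longrightarrow> real J * y \<ge> 1 \<longrightarrow> \<bar>z\<bar> \<le> 1/2 \<longrightarrow> y \<le> 2 * \<bar>z\<bar> \<longrightarrow>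
  norm (complex_of_real (h_tail J y z) - of_real (1 / y) * log_mean) \<le> C * (y / z\<^sup>2)"
proof -
 let ?g = "\<lambda>x. complex_of_real ((1 / x) powi 1) * of_real (\<omega> (1 / x))"
 let ?F = "{\<lambda>x. of_real (x powi 1) * f x | f. f \<in> {\<lambda>x. complex_of_real (\<omega> x)}}"
 have F: "bounded_derivs 2 ?F"
  by (rule bounded_derivs_powi[OF bounded_derivs_\<omega> supported_\<omega>])
 have Fs: "supported_in {1/2..1} ?F"
  using supported_\<omega> by (auto simp: supported_in_def)
 have "bounded_derivs 2 {\<lambda>x. f (1 / x) | f. f \<in> ?F}"
 proof (rule bounded_derivs_compose[where c="-1" and m=2, OF _ _ F Fs])
  show "((\<lambda>x. 1 / x) has_real_derivative - 1 * (1 / x) powi 2) (at x)" if "1 / x \<in> {1 / 3<..<2}" for x :: real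
   using that by (cases "x = 0") (auto intro!: derivative_eq_intros simp: power2_eq_square)
  show "\<forall>\<^sub>F t in nhds x. 1 / t \<notin> {1/2..1}" if "1 / x \<notin> {1 / 3<..<2}" for x :: real
  proof -
   have one_half: "1 / t < 1/2 \<or> 1 / t > 1" if "t < 1 \<or> t > 2" for t :: real
   proof (cases "t > 0")
    case False
    then have "1 / t \<le> 0" by (intro divide_nonneg_nonpos) auto
    then show ?thesis by linarith
   qed (use that in \<open>auto simp: field_simps\<close>)
   have "x \<le> 1/2 \<or> x \<ge> 3" using that by (cases "x > 0") (auto simp: field_simps)
   then show ?thesis
   proof
    assume "x \<le> 1/2"
    then show ?thesis
     by (intro eventually_mono[OF eventually_nhds_in_open[of "{..<1}"]]) (use one_half in force)+
   next
    assume "x \<ge> 3"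
    then show ?thesis
     by (intro eventually_mono[OF eventually_nhds_in_open[of "{2<..}"]]) (use one_half in force)+
   qed
  qed
 qed
 also have "{\<lambda>x. f (1 / x) | f. f \<in> ?F} = {?g}" by auto
 finally have bd: "bounded_derivs 2 {?g}" .
 have g_out: "?g x = 0" if "x \<le> 1 \<or> x \<ge> 2" for x
 proof -
  have "1 / x \<le> 1/2 \<or> 1 / x \<ge> 1"
  proof (cases "x > 0")
   case False
   then have "1 / x \<le> 0" by (intro divide_nonneg_nonpos) auto
   then show ?thesis by linarith
  qed (use that in \<open>auto simp: field_simps\<close>)
  then show ?thesis by (simp add: \<omega>_0)
 qed
 have g_out': "?g x = 0" if "\<bar>x\<bar> > 2" for x
  using that by (intro g_out) auto
 obtain C where C: "C \<ge> 0" "\<And>X M. X > 0 \<Longrightarrow> 2 * X + 1 \<le> of_int M \<Longrightarrow>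
   norm ((\<Sum>n\<in>{-M..M}. ?g (of_int n / X)) - X *\<^sub>R (LINT y|lborel. ?g y)) \<le> C * of_int M / X ^ 2"
  by (rule periodic_sum_approx_single[where R=2, OF bd zero_le_numeral g_out'], simp, rule that)
 have int: "(LINT y|lborel. ?g y) = log_mean"
 proof -
  let ?f = "\<lambda>t. complex_of_real (t powi -1) * of_real (\<omega> t)"
  have "(\<lambda>t. of_real (t powi -1) * complex_of_real (\<omega> t)) \<in> {\<lambda>x. of_real (x powi -1) * f x | f. f \<in> {\<lambda>x. complex_of_real (\<omega> x)}}"
   by (rule CollectI, rule exI[of _ "\<lambda>t. complex_of_real (\<omega> t)"]) simp
  from bounded_derivs_continuous[OF bounded_derivs_powi[OF bounded_derivs_\<omega>[of 0] supported_\<omega>] this]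
  have "(LINT t|lborel. ?f (1 / t) / of_real (t\<^sup>2)) = (LINT t|lborel. ?f t)"
   by (intro integral_inverse_substitution) (use supported_\<omega> in \<open>auto simp: supported_in_def\<close>)
  also have "(\<lambda>t. ?f (1 / t) / of_real (t\<^sup>2)) = ?g"
   by (rule ext) (simp add: power_int_minus power2_eq_square)
  finally show ?thesis by (simp add: log_mean_def)
 qed
 have "norm (complex_of_real (h_tail J y z) - of_real (1 / y) * log_mean) \<le> (6 * C) * (y / z\<^sup>2)"
  if y: "0 < y" "y \<le> 1" "real J * y \<ge> 1" and z: "\<bar>z\<bar> \<le> 1/2" "y \<le> 2 * \<bar>z\<bar>" for y J z
 proof -
  define X where "X = \<bar>z\<bar> / y"
  have X: "X \<ge> 1/2" using y z by (simp add: X_def field_simps)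
  have z0: "\<bar>z\<bar> > 0" using y z by linarith
  \<comment> \<open>From X \<ge> 1/2 one has 2 X + 2 \<le> 6 X, so M is of order X.\<close>
  define M where "M = \<lceil>2 * X\<rceil> + 1"
  have M: "of_int M \<ge> 2 * X + 1" "of_int M \<le> 6 * X"
   unfolding M_def using X by linarith+
  have "norm ((\<Sum>n\<in>{-M..M}. ?g (of_int n / X)) - X *\<^sub>R (LINT y|lborel. ?g y)) \<le> C * of_int M / X ^ 2"
   by (rule C(2)) (use X M in auto)
  also have "(\<Sum>n\<in>{-M..M}. ?g (of_int n / X)) = (\<Sum>j\<in>{1..J}. ?g (of_int (int j) / X))"
  proof (rule sum_int_symmetric_eq_nat)
   fix n assume n: "n \<in> {-M..M}" "n < 1 \<or> n > int J"
   have "of_int n / X \<le> 1 \<or> of_int n / X \<ge> 2"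
   proof (cases "n < 1")
    case True
    then have "of_int n / X \<le> 0" using X by (auto simp: divide_nonpos_pos)
    then show ?thesis by simp
   next
    case False
    then have "real J \<le> of_int n" using n by auto
    moreover have "2 * X \<le> 1 / y" using y z by (simp add: X_def field_simps)
    moreover have "1 / y \<le> real J" using y by (simp add: field_simps)
    ultimately have "of_int n \<ge> 2 * X" by linarith
    then show ?thesis using X by (simp add: field_simps)
   qed
   then show "?g (of_int n / X) = 0" using g_out[of "of_int n / X"] by simp
  next
   fix n assume "n > M"
   then have "of_int n \<ge> 2 * X" using M(1) by linarith
   then have "of_int n / X \<ge> 2" using X by (simp add: field_simps)
   then show "?g (of_int n / X) = 0" using g_out[of "of_int n / X"] by simp
  qed
  also have "(\<Sum>j\<in>{1..J}. ?g (of_int (int j) / X)) = of_real (\<bar>z\<bar> * h_tail J y z)"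
   unfolding h_tail_def sum_distrib_left of_real_sum
  proof (intro sum.cong refl)
   fix j assume "j \<in> {1..J}"
   then have "y * j > 0" using y by auto
   from \<omega>_abs[OF this, of z] have "\<omega> (\<bar>z\<bar> / (y * j)) = \<omega> (z / (y * j)) + \<omega> (- (z / (y * j)))" .
   then show "?g (of_int (int j) / X) = of_real (\<bar>z\<bar> * ((\<omega> (z / (y * real j)) + \<omega> (- (z / (y * real j)))) / (y * real j)))"
    by (simp add: X_def mult_ac)
  qed
  also have "of_real (\<bar>z\<bar> * h_tail J y z) = complex_of_real \<bar>z\<bar> * of_real (h_tail J y z)" by simp
  finally have "norm (complex_of_real \<bar>z\<bar> * of_real (h_tail J y z) - of_real X * log_mean) \<le> C * of_int M / X\<^sup>2"
   unfolding int scaleR_conv_of_real .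
  also have "complex_of_real \<bar>z\<bar> * of_real (h_tail J y z) - of_real X * log_mean
    = complex_of_real \<bar>z\<bar> * (of_real (h_tail J y z) - of_real (1 / y) * log_mean)"
   by (simp add: X_def algebra_simps)
  also have "norm \<dots> = \<bar>z\<bar> * norm (of_real (h_tail J y z) - of_real (1 / y) * log_mean)"
   by (simp add: norm_mult)
  also have "C * of_int M / X\<^sup>2 \<le> C * (6 * X) / X\<^sup>2"
   using M C by (intro divide_right_mono mult_left_mono) auto
  also have "\<dots> = \<bar>z\<bar> * ((6 * C) * (y / z\<^sup>2))"
   using y z0 by (simp add: X_def power2_eq_square field_simps)
  finally show ?thesis using z0 by (simp only: mult_le_cancel_left_pos)
 qed
 then show ?thesis using C(1) by (intro exI[of _ "6 * C"]) auto
qed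

text \<open>For y \<le> 2|z| the leading terms of the two halves cancel and leave y/z^2, which is
  comparable to the Poisson kernel. For y > 2|z| the tail vanishes and the main half, of size 1/y,
  is itself comparable to that kernel.\<close>

lemma h_sum_bound:
 "\<exists>C\<ge>0. \<forall>y J z. 0 < y \<longrightarrow> y \<le> 1 \<longrightarrow> real J * y \<ge> 1 \<longrightarrow> \<bar>z\<bar> \<le> 1/2 \<longrightarrow>
  \<bar>h_sum J y z\<bar> \<le> C * (1 + y / (y\<^sup>2 + z\<^sup>2))"
proof -
 obtain A where A: "A \<ge> 0" "\<And>y J. 0 < y \<Longrightarrow> y \<le> 1 \<Longrightarrow> real J * y \<ge> 1 \<Longrightarrow>
  norm (complex_of_real (h_main J y) - of_real (1 / y) * log_mean) \<le> A"
  using h_main_approx[of 0] unfolding power_0 mult_1_right by blast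
 obtain B where B: "B \<ge> 0" "\<And>y J z. 0 < y \<Longrightarrow> y \<le> 1 \<Longrightarrow> real J * y \<ge> 1 \<Longrightarrow> \<bar>z\<bar> \<le> 1/2 \<Longrightarrow> y \<le> 2 * \<bar>z\<bar> \<Longrightarrow>
  norm (complex_of_real (h_tail J y z) - of_real (1 / y) * log_mean) \<le> B * (y / z\<^sup>2)"
  using h_tail_approx by blast
 define D where "D = A + 5 * B + 2 * norm log_mean"
 have "\<bar>h_sum J y z\<bar> \<le> D * (1 + y / (y\<^sup>2 + z\<^sup>2))"
  if y: "0 < y" "y \<le> 1" "real J * y \<ge> 1" "\<bar>z\<bar> \<le> 1/2" for y J z
 proof -
  have pos: "y\<^sup>2 + z\<^sup>2 > 0" using y by (simp add: sum_power2_gt_zero_iff)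
  have nn: "y / (y\<^sup>2 + z\<^sup>2) \<ge> 0" using y by simp
  show ?thesis
  proof (cases "y \<le> 2 * \<bar>z\<bar>")
   case True
   have z0: "z \<noteq> 0" using True y by auto
   have "y\<^sup>2 \<le> 4 * z\<^sup>2" using power_mono[OF True, of 2] y by (simp add: power_mult_distrib)
   then have "y * (y\<^sup>2 + z\<^sup>2) \<le> y * (5 * z\<^sup>2)" using y by (intro mult_left_mono) auto
   then have zz: "y / z\<^sup>2 \<le> 5 * (y / (y\<^sup>2 + z\<^sup>2))"
    using z0 pos by (simp add: field_simps)
   have "\<bar>h_sum J y z\<bar> = norm (complex_of_real (h_main J y) - complex_of_real (h_tail J y z))"
    by (simp add: h_sum_def flip: of_real_diff)
   also have "\<dots> \<le> A + B * (y / z\<^sup>2)"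
    using A(2)[OF y(1-3)] B(2)[OF y True]
     norm_triangle_ineq4[of "complex_of_real (h_main J y) - of_real (1 / y) * log_mean" "complex_of_real (h_tail J y z) - of_real (1 / y) * log_mean"]
    by simp
   also have "\<dots> \<le> A + B * (5 * (y / (y\<^sup>2 + z\<^sup>2)))" using zz B(1) by (intro add_left_mono mult_left_mono)
   also have "\<dots> \<le> D + D * (y / (y\<^sup>2 + z\<^sup>2))"
   proof (rule add_mono)
    show "A \<le> D" using B by (simp add: D_def)
    have "(5 * B) * (y / (y\<^sup>2 + z\<^sup>2)) \<le> D * (y / (y\<^sup>2 + z\<^sup>2))"
     by (rule mult_right_mono[OF _ nn]) (use A B in \<open>simp add: D_def\<close>)
    then show "B * (5 * (y / (y\<^sup>2 + z\<^sup>2))) \<le> D * (y / (y\<^sup>2 + z\<^sup>2))" by (simp add: mult_ac)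
   qed
   finally show ?thesis by (simp add: algebra_simps)
  next
   case False
   have "\<omega> (z / (y * j)) + \<omega> (- (z / (y * j))) = 0" if "j \<in> {1..J}" for j
   proof -
    have yj: "y * j > 0" "y \<le> y * j" using that y by auto
    then have "\<bar>z\<bar> / (y * j) \<le> 1/2" using False by (simp add: field_simps)
    then show ?thesis using \<omega>_abs[OF yj(1), of z] \<omega>_0 by simp
   qed
   then have t0: "h_tail J y z = 0" by (simp add: h_tail_def)
   have "\<bar>z\<bar>\<^sup>2 \<le> y\<^sup>2" using False y by (intro power_mono) auto
   then have "y\<^sup>2 + z\<^sup>2 \<le> 2 * y\<^sup>2" by simp
   then have yy: "1 / y \<le> 2 * (y / (y\<^sup>2 + z\<^sup>2))" using pos y by (simp add: field_simps power2_eq_square)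
   have "\<bar>h_sum J y z\<bar> = norm (complex_of_real (h_main J y))" by (simp add: h_sum_def t0)
   also have "\<dots> \<le> A + norm (of_real (1 / y) * log_mean)"
    using A(2)[OF y(1-3)] norm_triangle_sub[of "complex_of_real (h_main J y)" "of_real (1 / y) * log_mean"] by simp
   also have "\<dots> = A + norm log_mean * (1 / y)" using y by (simp add: norm_mult norm_divide)
   also have "\<dots> \<le> A + norm log_mean * (2 * (y / (y\<^sup>2 + z\<^sup>2)))"
    using yy by (intro add_left_mono mult_left_mono) auto
   also have "\<dots> \<le> D + D * (y / (y\<^sup>2 + z\<^sup>2))"
   proof (rule add_mono)
    show "A \<le> D" using B by (simp add: D_def)
    have "(2 * norm log_mean) * (y / (y\<^sup>2 + z\<^sup>2)) \<le> D * (y / (y\<^sup>2 + z\<^sup>2))"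
     by (rule mult_right_mono[OF _ nn]) (use A B in \<open>simp add: D_def\<close>)
    then show "norm log_mean * (2 * (y / (y\<^sup>2 + z\<^sup>2))) \<le> D * (y / (y\<^sup>2 + z\<^sup>2))" by (simp add: mult_ac)
   qed
   finally show ?thesis by (simp add: algebra_simps)
  qed
 qed
 moreover have "D \<ge> 0" using A B by (simp add: D_def)
 ultimately show ?thesis by blast
qed

text \<open>By scaling, y/(y^2 + z^2) has the same integral for every y. This bounded integral is
  what keeps the estimate of p2 free of a factor 1/y.\<close>

lemma h_sum_integral_bound:
 "\<exists>C\<ge>0. \<forall>y J. 0 < y \<longrightarrow> y \<le> 1 \<longrightarrow> real J * y \<ge> 1 \<longrightarrow>
  (LINT z|lborel. indicator {-1/2..1/2} z * \<bar>h_sum J y z\<bar>) \<le> C"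
proof -
 obtain C where C: "C \<ge> 0" "\<And>y J z. 0 < y \<Longrightarrow> y \<le> 1 \<Longrightarrow> real J * y \<ge> 1 \<Longrightarrow> \<bar>z\<bar> \<le> 1/2 \<Longrightarrow>
  \<bar>h_sum J y z\<bar> \<le> C * (1 + y / (y\<^sup>2 + z\<^sup>2))"
  using h_sum_bound by blast
 define K where "K = (LINT z|lborel. inverse (1 + z\<^sup>2 :: real))"
 have K: "integrable lborel (\<lambda>z. inverse (1 + z\<^sup>2 :: real))"
  using integrable_inverse_1_plus_square by (simp add: set_integrable_def einterval_eq)
 have "(LINT z|lborel. indicator {-1/2..1/2} z * \<bar>h_sum J y z\<bar>) \<le> C * (1 + K)"
  if y: "0 < y" "y \<le> 1" "real J * y \<ge> 1" for y J
 proof -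
  have eq: "y / (y\<^sup>2 + z\<^sup>2) = (1 / y) * inverse (1 + (0 + (1 / y) * z)\<^sup>2)" for z
   using y by (simp add: field_simps power2_eq_square)
  have i1: "integrable lborel (\<lambda>z. y / (y\<^sup>2 + z\<^sup>2))"
   unfolding eq by (intro integrable_mult_right lborel_integrable_real_affine[OF K]) (use y in auto)
  have v1: "(LINT z|lborel. y / (y\<^sup>2 + z\<^sup>2)) = K"
   unfolding eq K_def integral_mult_right_zero
   using lborel_integral_real_affine[of "1 / y" "\<lambda>z. inverse (1 + z\<^sup>2)" 0] y
   by (simp only: real_scaleR_def abs_of_pos zero_less_divide_1_iff divide_eq_0_iff) simp
  have i2: "integrable lborel (\<lambda>z. C * (indicator {-1/2..1/2::real} z + y / (y\<^sup>2 + z\<^sup>2)))"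
   using i1 borel_integrable_compact[of "{-1/2..1/2::real}" "\<lambda>_. 1::real"] by simp
  have "(LINT z|lborel. indicator {-1/2..1/2} z * \<bar>h_sum J y z\<bar>)
    \<le> (LINT z|lborel. C * (indicator {-1/2..1/2::real} z + y / (y\<^sup>2 + z\<^sup>2)))"
  proof (rule integral_mono)
   show "integrable lborel (\<lambda>z. indicator {-1/2..1/2} z * \<bar>h_sum J y z\<bar>)"
    using borel_integrable_compact[of "{-1/2..1/2}" "\<lambda>z. \<bar>h_sum J y z\<bar>"] y
    by (simp add: continuous_on_h_sum continuous_intros)
   fix z show "indicator {-1/2..1/2} z * \<bar>h_sum J y z\<bar> \<le> C * (indicator {-1/2..1/2::real} z + y / (y\<^sup>2 + z\<^sup>2))"
    using C(2)[OF y, of z] C(1) y by (auto simp: indicator_def abs_le_iff)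
  qed (rule i2)
  also have "\<dots> = C * (1 + K)"
   using v1 i1 borel_integrable_compact[of "{-1/2..1/2::real}" "\<lambda>_. 1::real"] by simp
  finally show ?thesis .
 qed
 moreover have "K \<ge> 0" unfolding K_def by (intro integral_nonneg_AE) auto
 ultimately show ?thesis using C(1) by (intro exI[of _ "C * (1 + K)"]) auto
qed

end


section \<open>Decay of the transform of h in the directions of r and its perpendicular\<close>

lemma perp_inner [simp]: "\<rho> \<bullet> perp \<rho> = 0" "perp \<rho> \<bullet> \<rho> = 0" for \<rho> :: "real \<times> real"
 by (simp_all add: perp_def inner_prod_def)

lemma norm_perp [simp]: "norm (perp \<rho>) = norm \<rho>" for \<rho> :: "real \<times> real"
 by (simp add: perp_def norm_prod_def add.commute)

lemma perp_inner_perp [simp]: "perp \<rho> \<bullet> perp \<rho> = (norm \<rho>)\<^sup>2" for \<rho> :: "real \<times> real"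
 by (metis norm_perp power2_norm_eq_inner)

text \<open>The first basis vector is scaled by 1/|\<rho>|^2 so that s is exactly \<rho> . u, the
  argument of h, and the change of coordinates has determinant of absolute value 1.\<close>

definition coord :: "real \<times> real \<Rightarrow> real \<Rightarrow> real \<Rightarrow> real \<times> real" where
 "coord \<rho> s t = s *\<^sub>R ((1 / (norm \<rho>)\<^sup>2) *\<^sub>R \<rho>) + t *\<^sub>R perp \<rho>"

lemma integral_coord:
 fixes f :: "real \<times> real \<Rightarrow> 'b::{banach, second_countable_topology}"
 assumes "f \<in> borel_measurable borel" "\<rho> \<noteq> 0"
 shows "(LINT u|lborel. f u) = (LINT p|lborel. f (coord \<rho> (fst p) (snd p)))"
proof -
 define n where "n = (norm \<rho>)\<^sup>2"
 have n: "n > 0" "(fst \<rho>)\<^sup>2 + (snd \<rho>)\<^sup>2 = n" 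
 proof -
  show "n > 0" unfolding n_def using assms(2) by simp
 qed (simp add: n_def norm_prod_def)
 have det: "fst \<rho> / n * (- fst \<rho>) - snd \<rho> * (snd \<rho> / n) = -1"
 proof -
  have "fst \<rho> / n * (- fst \<rho>) - snd \<rho> * (snd \<rho> / n) = - (((fst \<rho>)\<^sup>2 + (snd \<rho>)\<^sup>2) / n)"
   by (simp add: power2_eq_square add_divide_distrib)
  then show ?thesis using n by simp
 qed
 have "coord \<rho> (fst p) (snd p) = (fst \<rho> / n * fst p + snd \<rho> * snd p, snd \<rho> / n * fst p + (- fst \<rho>) * snd p)" for p
  by (simp add: coord_def n_def perp_def prod_eq_iff)
 then show ?thesis
  using lborel_integral_linear_pair[OF assms(1), of "fst \<rho> / n" "- fst \<rho>" "snd \<rho>" "snd \<rho> / n"] det by simp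
qed

lemma inner_coord: "\<rho> \<noteq> 0 \<Longrightarrow> \<rho> \<bullet> coord \<rho> s t = s"
 by (simp add: coord_def inner_add_right power2_norm_eq_inner[symmetric])

lemma coord_bounds:
 assumes "1/2 \<le> norm \<rho>" "norm \<rho> \<le> 1" "norm (coord \<rho> s t) < 1/2"
 shows "\<bar>s\<bar> \<le> 1/2" "\<bar>t\<bar> \<le> 1"
proof -
 have \<rho>: "\<rho> \<noteq> 0" using assms(1) by auto
 have "\<bar>s\<bar> \<le> norm \<rho> * norm (coord \<rho> s t)"
  using Cauchy_Schwarz_ineq2[of \<rho> "coord \<rho> s t"] inner_coord[OF \<rho>] by simp
 also have "\<dots> \<le> 1 * (1/2)" using assms by (intro mult_mono) auto
 finally show "\<bar>s\<bar> \<le> 1/2" by simp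
 have "perp \<rho> \<bullet> coord \<rho> s t = t * (norm \<rho>)\<^sup>2"
  by (simp add: coord_def inner_add_right)
 then have "\<bar>t\<bar> * (norm \<rho>)\<^sup>2 \<le> norm \<rho> * norm (coord \<rho> s t)"
  using Cauchy_Schwarz_ineq2[of "perp \<rho>" "coord \<rho> s t"] by (simp add: abs_mult)
 then have "norm \<rho> * (norm \<rho> * \<bar>t\<bar>) \<le> norm \<rho> * norm (coord \<rho> s t)"
  by (simp add: power2_eq_square mult_ac)
 then have "norm \<rho> * \<bar>t\<bar> \<le> norm (coord \<rho> s t)" using \<rho> by (simp add: mult_le_cancel_left_pos)
 moreover have "1/2 * \<bar>t\<bar> \<le> norm \<rho> * \<bar>t\<bar>" using assms by (intro mult_right_mono) auto
 ultimately show "\<bar>t\<bar> \<le> 1" using assms(3) by linarith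
qed

lemma sum_inverse_squares_le: "(\<Sum>j\<in>{1..J}. 1 / (real j)\<^sup>2) \<le> 2"
proof -
 have "(\<Sum>j\<in>{1..J}. 1 / (real j)\<^sup>2) \<le> 2 - 1 / real J" if "J \<ge> 1" for J
  using that
 proof (induction J rule: dec_induct)
  case (step n)
  have "1 / (real (Suc n))\<^sup>2 \<le> 1 / (real n * real (Suc n))"
   using step(1) by (intro divide_left_mono) (auto simp: power2_eq_square)
  also have "\<dots> = 1 / real n - 1 / real (Suc n)" using step(1) by (simp add: field_simps)
  finally show ?case using step by simp
 qed simp
 from this[of J] show ?thesis
  using order_trans[of "\<Sum>j\<in>{1..J}. 1 / (real j)\<^sup>2" "2 - 1 / real J" 2] by (cases "J \<ge> 1") auto
qed

lemma one_plus_power_le: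
 fixes a b :: real
 assumes "a \<ge> 0" "b \<ge> 0"
 shows "(1 + a + b) ^ N \<le> 3 ^ N * (1 + a ^ N + b ^ N)"
proof -
 define m where "m = max 1 (max a b)"
 have "1 + a + b \<le> 3 * m" by (auto simp: m_def max_def)
 then have "(1 + a + b) ^ N \<le> 3 ^ N * m ^ N"
  unfolding power_mult_distrib[symmetric] using assms by (intro power_mono) auto
 also have "m ^ N \<le> 1 + a ^ N + b ^ N"
  using assms by (auto simp: m_def max_def)
 finally show ?thesis by simp
qed

text \<open>Estimates are proved with natural exponents; rounding N up passes to real
  exponents.\<close>

lemma powr_minus_ge_power:
 fixes X :: real
 assumes "X \<ge> 1"
 shows "1 / X ^ nat \<lceil>N\<rceil> \<le> X powr (- N)"
proof -
 have "X powr N \<le> X powr real (nat \<lceil>N\<rceil>)" by (rule powr_mono) (use assms in \<open>auto simp: of_nat_ceiling\<close>)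
 then have "1 / X powr real (nat \<lceil>N\<rceil>) \<le> 1 / X powr N" using assms by (intro divide_left_mono) auto
 then show ?thesis using assms by (simp add: powr_realpow powr_minus divide_inverse)
qed

context delta_weights
begin

lemma fam0I:
 fixes \<alpha> \<beta> :: "real \<times> real"
 shows "norm \<beta> \<le> B \<Longrightarrow> \<bar>a\<bar> \<le> B \<Longrightarrow> (\<lambda>x. of_real (\<omega>0 (norm (\<alpha> + x *\<^sub>R \<beta>))) * e2pi (a * x + b)) \<in> fam0 B"
 unfolding fam0_def
 by (rule CollectI, rule exI[of _ \<alpha>], rule exI[of _ \<beta>], rule exI[of _ a], rule exI[of _ b]) simp

lemma fam0I':
 fixes \<alpha> \<beta> :: "real \<times> real"
 shows "norm \<beta> \<le> B \<Longrightarrow> (\<lambda>x. complex_of_real (\<omega>0 (norm (\<alpha> + x *\<^sub>R \<beta>)))) \<in> fam0 B"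
 using fam0I[of \<beta> B 0 \<alpha> 0] order_trans[OF norm_ge_zero, of \<beta> B] by simp

lemma fam1I:
 fixes \<alpha> \<beta> :: "real \<times> real"
 shows "norm \<beta> \<le> B \<Longrightarrow> f \<in> fam0 B \<Longrightarrow> (\<lambda>x. of_real (\<omega> (norm (\<alpha> + x *\<^sub>R \<beta>))) * f x) \<in> fam1 B"
 unfolding fam1_def
 by (rule CollectI, rule exI[of _ \<alpha>], rule exI[of _ \<beta>], rule exI[of _ f]) simp

lemma fam2I: "f \<in> fam0 B \<Longrightarrow> (\<lambda>x. of_real (\<omega> x) * f x) \<in> fam2 B"
 unfolding fam2_def by blast

lemma \<omega>0_coord_eq_0:
 assumes "1/2 \<le> norm \<rho>" "norm \<rho> \<le> 1" "\<bar>s\<bar> > 1/2 \<or> \<bar>t\<bar> > 1"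
 shows "\<omega>0 (norm (coord \<rho> s t)) = 0"
proof (rule \<omega>0_outside, rule ccontr)
 assume "\<not> 1 / 2 \<le> \<bar>norm (coord \<rho> s t)\<bar>"
 then show False using coord_bounds[OF assms(1,2), of s t] assms(3) by auto
qed

text \<open>p2 up to the constant c after the substitution x = Q^(3/2) u, with \<rho> = r/Q^(1/2), v
  = Q^(3/2) w and H(z) = h(kq/Q, z). The variable u then ranges over the disc of radius 1/2 and
  \<rho> over the annulus 1/2 \<le> |\<rho>| \<le> 1, independently of Q.\<close>

definition window :: "(real \<Rightarrow> real) \<Rightarrow> real \<times> real \<Rightarrow> real \<times> real \<Rightarrow> complex" where
 "window H \<rho> v = (LINT u|lborel. of_real (\<omega>0 (norm u) * H (\<rho> \<bullet> u)) * e2pi (- (v \<bullet> u)))"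

definition window_coord :: "(real \<Rightarrow> real) \<Rightarrow> real \<times> real \<Rightarrow> real \<times> real \<Rightarrow> real \<times> real \<Rightarrow> complex" where
 "window_coord H \<rho> v p = of_real (\<omega>0 (norm (coord \<rho> (fst p) (snd p))) * H (fst p)) *
   (e2pi (- ((v \<bullet> ((1 / (norm \<rho>)\<^sup>2) *\<^sub>R \<rho>)) * fst p)) * e2pi (- ((v \<bullet> perp \<rho>) * snd p)))"

lemma continuous_window_coord:
 assumes "continuous_on UNIV H"
 shows "continuous_on UNIV (window_coord H \<rho> v)"
 unfolding window_coord_def coord_def
 by (intro continuous_intros continuous_on_compose2[OF assms]) auto

lemma window_eq_coord:
 assumes "continuous_on UNIV H" "\<rho> \<noteq> 0"
 shows "window H \<rho> v = (LINT p|lborel. window_coord H \<rho> v p)"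
proof -
 have "window H \<rho> v = (LINT p|lborel. of_real (\<omega>0 (norm (coord \<rho> (fst p) (snd p))) * H (\<rho> \<bullet> coord \<rho> (fst p) (snd p)))
   * e2pi (- (v \<bullet> coord \<rho> (fst p) (snd p))))"
  unfolding window_def
  by (rule integral_coord[OF _ assms(2)], rule borel_measurable_continuous_onI)
    (intro continuous_intros continuous_on_compose2[OF assms(1)], auto)
 also have "\<dots> = (LINT p|lborel. window_coord H \<rho> v p)"
 proof (rule Bochner_Integration.integral_cong[OF refl])
  fix p :: "real \<times> real"
  have "- (v \<bullet> coord \<rho> (fst p) (snd p)) = - ((v \<bullet> ((1 / (norm \<rho>)\<^sup>2) *\<^sub>R \<rho>)) * fst p) + - ((v \<bullet> perp \<rho>) * snd p)"
   by (simp add: coord_def inner_add_right)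
  then show "of_real (\<omega>0 (norm (coord \<rho> (fst p) (snd p))) * H (\<rho> \<bullet> coord \<rho> (fst p) (snd p)))
   * e2pi (- (v \<bullet> coord \<rho> (fst p) (snd p))) = window_coord H \<rho> v p"
   unfolding window_coord_def by (simp only: inner_coord[OF assms(2)] e2pi_add)
 qed
 finally show ?thesis .
qed

lemma window_coord_0:
 assumes "1/2 \<le> norm \<rho>" "norm \<rho> \<le> 1" "\<bar>s\<bar> > 1/2 \<or> \<bar>t\<bar> > 1"
 shows "window_coord H \<rho> v (s, t) = 0"
 using \<omega>0_coord_eq_0[OF assms] by (simp add: window_coord_def)

text \<open>H depends on s alone, so integration by parts in t never differentiates it, and the only
  price is the integral of |H|.\<close>

lemma window_decay_perp:
 "\<exists>C\<ge>0. \<forall>H \<rho> v. continuous_on UNIV H \<longrightarrow> 1/2 \<le> norm \<rho> \<longrightarrow> norm \<rho> \<le> 1 \<longrightarrow>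
  \<bar>v \<bullet> perp \<rho>\<bar> ^ N * norm (window H \<rho> v) \<le> C * (LINT z|lborel. indicator {-1/2..1/2} z * \<bar>H z\<bar>)"
proof -
 obtain C where C: "C \<ge> 0" "\<forall>f\<in>fam0 1. \<forall>R\<ge>0::real. (\<forall>x. \<bar>x\<bar> > R \<longrightarrow> f x = 0) \<longrightarrow>
  (\<forall>\<theta>. \<bar>\<theta>\<bar> ^ N * norm (LINT x|lborel. f x * e2pi (- (\<theta> * x))) \<le> C * R)"
  using fourier_decay[OF bounded_derivs_fam0[of 1 N]] by auto
 have "\<bar>v \<bullet> perp \<rho>\<bar> ^ N * norm (window H \<rho> v) \<le> C * (LINT z|lborel. indicator {-1/2..1/2} z * \<bar>H z\<bar>)"
  if H: "continuous_on UNIV H" and \<rho>: "1/2 \<le> norm \<rho>" "norm \<rho> \<le> 1" for H \<rho> v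
 proof -
  have \<rho>0: "\<rho> \<noteq> 0" using \<rho> by auto
  define \<tau> where "\<tau> = v \<bullet> perp \<rho>"
  define G where "G = window_coord H \<rho> v"
  have G0: "G (s, t) = 0" if "\<bar>s\<bar> > 1/2 \<or> \<bar>t\<bar> > 1" for s t
   unfolding G_def by (rule window_coord_0[OF \<rho> that])
  have int: "integrable lborel G"
  proof (rule compact_support_integrable[of _ 2])
   show "continuous_on UNIV G" unfolding G_def by (rule continuous_window_coord[OF H])
   fix p :: "real \<times> real" assume "norm p > 2"
   then have "\<bar>fst p\<bar> > 1/2 \<or> \<bar>snd p\<bar> > 1" using norm_Pair_le_add[of p] by linarith
   then show "G p = 0" using G0[of "fst p" "snd p"] by simp
  qed
  have inner: "\<bar>\<tau>\<bar> ^ N * norm (LINT t|lborel. G (s, t)) \<le> C * (indicator {-1/2..1/2} s * \<bar>H s\<bar>)" for s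
  proof (cases "\<bar>s\<bar> \<le> 1/2")
   case True
   let ?f = "\<lambda>t. complex_of_real (\<omega>0 (norm (s *\<^sub>R ((1 / (norm \<rho>)\<^sup>2) *\<^sub>R \<rho>) + t *\<^sub>R perp \<rho>)))"
   have mem: "?f \<in> fam0 1" by (rule fam0I') (use \<rho> in simp)
   have f0: "\<forall>t. \<bar>t\<bar> > 1 \<longrightarrow> ?f t = 0"
    using \<omega>0_coord_eq_0[OF \<rho>, of s] by (simp add: coord_def)
   have "\<bar>\<tau>\<bar> ^ N * norm (LINT t|lborel. ?f t * e2pi (- (\<tau> * t))) \<le> C"
    using C(2)[rule_format, OF mem, of 1 \<tau>] f0 by simp
   moreover have "(\<lambda>t. G (s, t)) = (\<lambda>t. (of_real (H s) * e2pi (- ((v \<bullet> ((1 / (norm \<rho>)\<^sup>2) *\<^sub>R \<rho>)) * s))) * (?f t * e2pi (- (\<tau> * t))))"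
    by (simp add: G_def window_coord_def \<tau>_def coord_def mult_ac)
   then have "norm (LINT t|lborel. G (s, t)) = \<bar>H s\<bar> * norm (LINT t|lborel. ?f t * e2pi (- (\<tau> * t)))"
    by (simp only: integral_mult_right_zero norm_mult norm_of_real norm_e2pi mult_1_right)
   ultimately have "\<bar>\<tau>\<bar> ^ N * norm (LINT t|lborel. G (s, t)) \<le> \<bar>H s\<bar> * C"
    using mult_left_mono[of _ C "\<bar>H s\<bar>"] by (simp add: mult.left_commute)
   moreover have "indicator {-1/2..1/2} s = (1::real)" using True by (auto simp: indicator_def abs_le_iff)
   ultimately show ?thesis by (simp only: mult_1 mult.commute)
  next
   case False
   then have "(\<lambda>t. G (s, t)) = (\<lambda>t. 0)" using G0[of s] by auto
   then show ?thesis using C(1) by simp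
  qed
  have "norm (LINT s|lborel. of_real (\<bar>\<tau>\<bar> ^ N) * (LINT t|lborel. G (s, t))) \<le> (LINT s|lborel. C * (indicator {-1/2..1/2} s * \<bar>H s\<bar>))"
  proof (rule Bochner_Integration.integral_norm_bound_integral)
   show "integrable lborel (\<lambda>s. of_real (\<bar>\<tau>\<bar> ^ N) * (LINT t|lborel. G (s, t)))"
    by (intro integrable_mult_right lborel_integrable_fst int)
   show "integrable lborel (\<lambda>s. C * (indicator {-1/2..1/2} s * \<bar>H s\<bar>))"
    using borel_integrable_compact[of "{-1/2..1/2}" "\<lambda>s. \<bar>H s\<bar>"] continuous_on_subset[OF H]
    by (simp add: continuous_intros)
   show "norm (of_real (\<bar>\<tau>\<bar> ^ N) * (LINT t|lborel. G (s, t))) \<le> C * (indicator {-1/2..1/2} s * \<bar>H s\<bar>)" for s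
    using inner[of s] by (simp add: norm_mult norm_power)
  qed
  then show ?thesis
   unfolding window_eq_coord[OF H \<rho>0] G_def[symmetric] \<tau>_def[symmetric]
   using lborel_integral_fst[OF int] by (simp add: norm_mult norm_power)
 qed
 then show ?thesis using C(1) by blast
qed

lemma h_main_le: "\<exists>C\<ge>0. \<forall>y J. 0 < y \<longrightarrow> y \<le> 1 \<longrightarrow> real J * y \<ge> 1 \<longrightarrow> \<bar>h_main J y\<bar> \<le> C / y"
proof -
 obtain A where A: "A \<ge> 0" "\<And>y J. 0 < y \<Longrightarrow> y \<le> 1 \<Longrightarrow> real J * y \<ge> 1 \<Longrightarrow>
  norm (complex_of_real (h_main J y) - of_real (1 / y) * log_mean) \<le> A"
  using h_main_approx[of 0] unfolding power_0 mult_1_right by blast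
 have "\<bar>h_main J y\<bar> \<le> (A + norm log_mean) / y" if y: "0 < y" "y \<le> 1" "real J * y \<ge> 1" for y J
 proof -
  have "\<bar>h_main J y\<bar> = norm (complex_of_real (h_main J y))" by simp
  also have "\<dots> \<le> A + norm (of_real (1 / y) * log_mean)"
   using A(2)[OF y] norm_triangle_sub[of "complex_of_real (h_main J y)" "of_real (1 / y) * log_mean"] by simp
  also have "\<dots> = A + norm log_mean / y" using y by (simp add: norm_mult norm_divide)
  also have "A \<le> A / y" using y A(1) mult_left_mono[of y 1 A] by (simp add: field_simps)
  finally show ?thesis by (simp add: add_divide_distrib)
 qed
 then show ?thesis using A(1) by (intro exI[of _ "A + norm log_mean"]) auto
qed

text \<open>In the direction of \<rho> the two halves of h are separated. \<open>h_main\<close> does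
  not depend on s; its size 1/y is paid for by one of the factors y. In the tail, the j-th term
  becomes, under s = c x with c = y j or -y j, a Fourier integral of \<omega> times the cutoff at
  frequency \<sigma> c, and so gains 1/j^N, which is summable because N \<ge> 2.\<close>

lemma window_decay_radial:
 assumes N: "N \<ge> 2"
 shows "\<exists>C\<ge>0. \<forall>y J \<rho> v. 0 < y \<longrightarrow> y \<le> 1 \<longrightarrow> real J * y \<ge> 1 \<longrightarrow> real J * y \<le> 2 \<longrightarrow> 1/2 \<le> norm \<rho> \<longrightarrow> norm \<rho> \<le> 1 \<longrightarrow>
  (y * \<bar>v \<bullet> ((1 / (norm \<rho>)\<^sup>2) *\<^sub>R \<rho>)\<bar>) ^ N * norm (window (h_sum J y) \<rho> v) \<le> C"
proof -
 obtain A where A: "A \<ge> 0" "\<forall>f\<in>fam0 2. \<forall>R\<ge>0::real. (\<forall>x. \<bar>x\<bar> > R \<longrightarrow> f x = 0) \<longrightarrow>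
  (\<forall>\<theta>. \<bar>\<theta>\<bar> ^ N * norm (LINT x|lborel. f x * e2pi (- (\<theta> * x))) \<le> A * R)"
  using fourier_decay[OF bounded_derivs_fam0[of 2 N]] by auto
 obtain B where B: "B \<ge> 0" "\<forall>f\<in>fam2 4. \<forall>R\<ge>0::real. (\<forall>x. \<bar>x\<bar> > R \<longrightarrow> f x = 0) \<longrightarrow>
  (\<forall>\<theta>. \<bar>\<theta>\<bar> ^ N * norm (LINT x|lborel. f x * e2pi (- (\<theta> * x))) \<le> B * R)"
  using fourier_decay[OF bounded_derivs_fam2[of 4 N]] by auto
 obtain D where D: "D \<ge> 0" "\<And>y J. 0 < y \<Longrightarrow> y \<le> 1 \<Longrightarrow> real J * y \<ge> 1 \<Longrightarrow> \<bar>h_main J y\<bar> \<le> D / y"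
  using h_main_le by blast
 have "(y * \<bar>v \<bullet> ((1 / (norm \<rho>)\<^sup>2) *\<^sub>R \<rho>)\<bar>) ^ N * norm (window (h_sum J y) \<rho> v) \<le> 2 * 1 * (D * A + 4 * B)"
  if y: "0 < y" "y \<le> 1" "real J * y \<ge> 1" "real J * y \<le> 2" and \<rho>: "1/2 \<le> norm \<rho>" "norm \<rho> \<le> 1" for y J \<rho> v
 proof -
  have \<rho>0: "\<rho> \<noteq> 0" using \<rho> by auto
  define \<beta> where "\<beta> = (1 / (norm \<rho>)\<^sup>2) *\<^sub>R \<rho>"
  have n\<beta>: "norm \<beta> \<le> 2"
  proof -
   have "norm \<beta> = 1 / norm \<rho>" using \<rho>0 by (simp add: \<beta>_def power2_eq_square)
   also have "\<dots> \<le> 1 / (1/2)" using \<rho> by (intro divide_left_mono) auto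
   finally show ?thesis by simp
  qed
  define \<sigma> where "\<sigma> = v \<bullet> \<beta>"
  define G where "G = window_coord (h_sum J y) \<rho> v"
  have H: "continuous_on UNIV (h_sum J y)" using y by (intro continuous_intros) auto
  \<comment> \<open>The tail term after s = c x; the Jacobian |c| = y j cancels the factor 1/(y j)
    in h.\<close>
  define K where "K t c = (LINT x|lborel. (of_real (\<omega> x) * of_real (\<omega>0 (norm (t *\<^sub>R perp \<rho> + x *\<^sub>R (c *\<^sub>R \<beta>))))) * e2pi (- ((\<sigma> * c) * x)))" for t c
  have K: "\<bar>\<sigma> * c\<bar> ^ N * norm (K t c) \<le> B" if "\<bar>c\<bar> \<le> 2" for t c
  proof -
   \<comment> \<open>The parameter 4 of \<open>fam2\<close> is this product: |c| \<le> J y \<le> 2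
     and |\<beta>| = 1/|\<rho>| \<le> 2.\<close>
   have "norm (c *\<^sub>R \<beta>) \<le> 4" using mult_mono[OF that n\<beta>] by simp
   from B(2)[rule_format, OF fam2I[OF fam0I'[OF this, of "t *\<^sub>R perp \<rho>"]], of 1 "\<sigma> * c"]
   show ?thesis unfolding K_def using \<omega>_0 by (auto simp: abs_if split: if_splits)
  qed
  have inner: "norm (of_real ((y * \<bar>\<sigma>\<bar>) ^ N) * (LINT s|lborel. G (s, t))) \<le> D * A + 4 * B" for t
  proof -
   let ?f = "\<lambda>s. complex_of_real (\<omega>0 (norm (t *\<^sub>R perp \<rho> + s *\<^sub>R \<beta>)))"
   define A0 where "A0 = (LINT s|lborel. ?f s * e2pi (- (\<sigma> * s)))"
   have f0: "?f s = 0" if "\<bar>s\<bar> > 1" for s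
    using \<omega>0_coord_eq_0[OF \<rho>, of s t] that by (simp add: coord_def \<beta>_def add.commute)
   have A0: "\<bar>\<sigma>\<bar> ^ N * norm A0 \<le> A"
    unfolding A0_def using A(2)[rule_format, OF fam0I'[OF n\<beta>, of "t *\<^sub>R perp \<rho>"], of 1 \<sigma>] f0 by auto
   have i0: "integrable lborel (\<lambda>s. ?f s * e2pi (- (\<sigma> * s)))"
    by (rule compact_support_integrable[of _ 1]) (use f0 in \<open>auto intro!: continuous_intros\<close>)
   have ij: "integrable lborel (\<lambda>s. of_real (\<omega> (s / c)) * ?f s * e2pi (- (\<sigma> * s)))" if "c \<noteq> 0" for c
    by (rule compact_support_integrable[of _ 1]) (use f0 that in \<open>auto intro!: continuous_intros\<close>)
   have Kc: "(LINT s|lborel. of_real (\<omega> (s / c)) * ?f s * e2pi (- (\<sigma> * s))) = of_real \<bar>c\<bar> * K t c" if "c \<noteq> 0" for c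
    using lborel_integral_real_affine[OF that, of "\<lambda>s. of_real (\<omega> (s / c)) * ?f s * e2pi (- (\<sigma> * s))" 0] that
    by (simp add: K_def scaleR_conv_of_real mult_ac)
   have nz: "y * real j \<noteq> 0" "- (y * real j) \<noteq> 0" if "j \<in> {1..J}" for j using that y by auto
   define T where "T j s = of_real (1 / (y * real j)) * (of_real (\<omega> (s / (y * real j))) * ?f s * e2pi (- (\<sigma> * s))
       + of_real (\<omega> (s / (- (y * real j)))) * ?f s * e2pi (- (\<sigma> * s)))" for j s
   have iT: "integrable lborel (T j)" if "j \<in> {1..J}" for j
    unfolding T_def[abs_def] by (intro integrable_mult_right Bochner_Integration.integrable_add ij nz[OF that])
   have vT: "(LINT s|lborel. T j s) = of_real (1 / (y * real j)) * (of_real \<bar>y * real j\<bar> * K t (y * real j) + of_real \<bar>- (y * real j)\<bar> * K t (- (y * real j)))"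
    if "j \<in> {1..J}" for j
    unfolding T_def integral_mult_right_zero
    by (simp only: Bochner_Integration.integral_add[OF ij[OF nz(1)[OF that]] ij[OF nz(2)[OF that]]] Kc[OF nz(1)[OF that]] Kc[OF nz(2)[OF that]])
   have Geq: "G (s, t) = e2pi (- ((v \<bullet> perp \<rho>) * t)) * (of_real (h_main J y) * (?f s * e2pi (- (\<sigma> * s)))
     - (\<Sum>j\<in>{1..J}. T j s))" for s
    unfolding T_def G_def window_coord_def h_sum_def h_tail_def coord_def \<sigma>_def \<beta>_def
    by (simp add: sum_distrib_left sum_distrib_right algebra_simps add_divide_distrib sum.distrib)
   have "(LINT s|lborel. G (s, t)) = e2pi (- ((v \<bullet> perp \<rho>) * t)) * (of_real (h_main J y) * A0
     - (\<Sum>j\<in>{1..J}. of_real (1 / (y * real j)) * (of_real \<bar>y * real j\<bar> * K t (y * real j) + of_real \<bar>- (y * real j)\<bar> * K t (- (y * real j)))))"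
    unfolding Geq integral_mult_right_zero
    by (subst Bochner_Integration.integral_diff)
      (use iT i0 vT in \<open>auto simp: A0_def Bochner_Integration.integral_sum simp del: of_real_divide of_real_mult intro!: sum.cong\<close>)
   also have "(\<Sum>j\<in>{1..J}. of_real (1 / (y * real j)) * (of_real \<bar>y * real j\<bar> * K t (y * real j) + of_real \<bar>- (y * real j)\<bar> * K t (- (y * real j))))
     = (\<Sum>j\<in>{1..J}. K t (y * real j) + K t (- (y * real j)))"
    using y by (intro sum.cong refl) (auto simp: field_simps)
   finally have eq: "norm (LINT s|lborel. G (s, t)) = norm (of_real (h_main J y) * A0 - (\<Sum>j\<in>{1..J}. K t (y * real j) + K t (- (y * real j))))"
    by (simp add: norm_mult)
   have "(y * \<bar>\<sigma>\<bar>) ^ N * norm (of_real (h_main J y) * A0) \<le> D * A"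
   proof -
    have "(y * \<bar>\<sigma>\<bar>) ^ N * norm (of_real (h_main J y) * A0) = y ^ N * \<bar>h_main J y\<bar> * (\<bar>\<sigma>\<bar> ^ N * norm A0)"
     by (simp add: norm_mult power_mult_distrib mult_ac)
    \<comment> \<open>\<open>h_main\<close> is at most D/y, and y^N \<le> y since y \<le> 1.\<close>
    also have "\<dots> \<le> y * (D / y) * A"
    proof (intro mult_mono A0)
     show "y ^ N \<le> y" using power_decreasing[of 1 N y] N y by simp
    qed (use y A D in auto)
    finally show ?thesis using y by simp
   qed
   moreover have "(y * \<bar>\<sigma>\<bar>) ^ N * norm (\<Sum>j\<in>{1..J}. K t (y * real j) + K t (- (y * real j))) \<le> 4 * B"
   proof -
    have one: "(y * \<bar>\<sigma>\<bar>) ^ N * norm (K t c) \<le> B * (1 / (real j)\<^sup>2)" if "j \<in> {1..J}" "\<bar>c\<bar> = y * real j" for c j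
    proof -
     have "y * real j \<le> real J * y" using that(1) y by (simp add: mult.commute)
     then have "\<bar>c\<bar> \<le> 2" using that(2) y by linarith
     from K[OF this, of t] have "\<bar>\<sigma>\<bar> ^ N * (y * real j) ^ N * norm (K t c) \<le> B"
      by (simp add: abs_mult power_mult_distrib that(2))
     then have "real j ^ N * ((y * \<bar>\<sigma>\<bar>) ^ N * norm (K t c)) \<le> B"
      by (simp add: power_mult_distrib mult_ac)
     moreover have "(real j)\<^sup>2 * ((y * \<bar>\<sigma>\<bar>) ^ N * norm (K t c)) \<le> real j ^ N * ((y * \<bar>\<sigma>\<bar>) ^ N * norm (K t c))"
      using that(1) N y by (intro mult_right_mono power_increasing) auto
     ultimately show ?thesis using that(1) by (simp add: field_simps)
    qed
    have "(y * \<bar>\<sigma>\<bar>) ^ N * norm (\<Sum>j\<in>{1..J}. K t (y * real j) + K t (- (y * real j)))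
     \<le> (y * \<bar>\<sigma>\<bar>) ^ N * (\<Sum>j\<in>{1..J}. norm (K t (y * real j)) + norm (K t (- (y * real j))))"
     using y by (intro mult_left_mono sum_norm_le norm_triangle_ineq) auto
    also have "\<dots> = (\<Sum>j\<in>{1..J}. (y * \<bar>\<sigma>\<bar>) ^ N * norm (K t (y * real j)) + (y * \<bar>\<sigma>\<bar>) ^ N * norm (K t (- (y * real j))))"
     by (simp add: sum_distrib_left distrib_left)
    also have "\<dots> \<le> (\<Sum>j\<in>{1..J}. B * (1 / (real j)\<^sup>2) + B * (1 / (real j)\<^sup>2))"
     using y by (intro sum_mono add_mono one) (auto simp: abs_mult)
    also have "\<dots> = 2 * B * (\<Sum>j\<in>{1..J}. 1 / (real j)\<^sup>2)"
     unfolding sum_distrib_left by (intro sum.cong refl) simp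
    also have "\<dots> \<le> 2 * B * 2" using B(1) by (intro mult_left_mono sum_inverse_squares_le) auto
    finally show ?thesis by simp
   qed
   moreover have "norm (of_real ((y * \<bar>\<sigma>\<bar>) ^ N) * (LINT s|lborel. G (s, t))) = (y * \<bar>\<sigma>\<bar>) ^ N * norm (LINT s|lborel. G (s, t))"
    using y by (simp add: norm_mult norm_power)
   moreover have "(y * \<bar>\<sigma>\<bar>) ^ N * norm (LINT s|lborel. G (s, t)) \<le> (y * \<bar>\<sigma>\<bar>) ^ N *
     (norm (of_real (h_main J y) * A0) + norm (\<Sum>j\<in>{1..J}. K t (y * real j) + K t (- (y * real j))))"
    unfolding eq using y by (intro mult_left_mono norm_triangle_ineq4) auto
   ultimately show ?thesis by (simp add: distrib_left)
  qed
  have "norm (LINT p|lborel. of_real ((y * \<bar>\<sigma>\<bar>) ^ N) * G p) \<le> 2 * 1 * (D * A + 4 * B)"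
  proof (rule integral_iterated_support_le(2))
   show "continuous_on UNIV (\<lambda>p. of_real ((y * \<bar>\<sigma>\<bar>) ^ N) * G p)"
    unfolding G_def by (intro continuous_intros continuous_window_coord H)
   show "of_real ((y * \<bar>\<sigma>\<bar>) ^ N) * G (s, t) = 0" if "\<bar>s\<bar> > 1 \<or> \<bar>t\<bar> > 1" for s t
    unfolding G_def using window_coord_0[OF \<rho>, where s=s and t=t and v=v and H="h_sum J y"] that
    by (auto simp del: split_paired_All)
   show "norm (LINT s|lborel. of_real ((y * \<bar>\<sigma>\<bar>) ^ N) * G (s, t)) \<le> D * A + 4 * B" for t
    using inner[of t] by simp
  qed simp
  then show ?thesis
   unfolding window_eq_coord[OF H \<rho>0] G_def[symmetric] \<beta>_def[symmetric] \<sigma>_def[symmetric]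
   using y by (simp add: norm_mult norm_power)
 qed
 moreover have "2 * 1 * (D * A + 4 * B) \<ge> 0" using A B D by auto
 ultimately show ?thesis by blast
qed

text \<open>Since y \<le> 1, the quantity y|v| is at most y|\<sigma>| + 2|\<tau>|, so decay in the
  two coordinates of v separately implies decay in the combined quantity. Raising N to at least 2
  meets the requirement of the radial estimate.\<close>

lemma window_decay:
 "\<exists>C\<ge>0. \<forall>y J \<rho> v. 0 < y \<longrightarrow> y \<le> 1 \<longrightarrow> real J * y \<ge> 1 \<longrightarrow> real J * y \<le> 2 \<longrightarrow> 1/2 \<le> norm \<rho> \<longrightarrow> norm \<rho> \<le> 1 \<longrightarrow>
  norm (window (h_sum J y) \<rho> v) \<le> C / (1 + y * norm v + \<bar>v \<bullet> perp \<rho>\<bar>) ^ N"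
proof -
 define n where "n = max N 2"
 obtain A where A: "A \<ge> 0" "\<And>H \<rho> v. continuous_on UNIV H \<Longrightarrow> 1/2 \<le> norm \<rho> \<Longrightarrow> norm \<rho> \<le> 1 \<Longrightarrow>
  \<bar>v \<bullet> perp \<rho>\<bar> ^ n * norm (window H \<rho> v) \<le> A * (LINT z|lborel. indicator {-1/2..1/2} z * \<bar>H z\<bar>)"
  using window_decay_perp[of n] by blast
 obtain A' where A': "A' \<ge> 0" "\<And>H \<rho> v. continuous_on UNIV H \<Longrightarrow> 1/2 \<le> norm \<rho> \<Longrightarrow> norm \<rho> \<le> 1 \<Longrightarrow>
  norm (window H \<rho> v) \<le> A' * (LINT z|lborel. indicator {-1/2..1/2} z * \<bar>H z\<bar>)"
  using window_decay_perp[of 0] unfolding power_0 mult_1 by blast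
 obtain B where B: "B \<ge> 0" "\<And>y J \<rho> v. 0 < y \<Longrightarrow> y \<le> 1 \<Longrightarrow> real J * y \<ge> 1 \<Longrightarrow> real J * y \<le> 2 \<Longrightarrow> 1/2 \<le> norm \<rho> \<Longrightarrow> norm \<rho> \<le> 1 \<Longrightarrow>
  (y * \<bar>v \<bullet> ((1 / (norm \<rho>)\<^sup>2) *\<^sub>R \<rho>)\<bar>) ^ n * norm (window (h_sum J y) \<rho> v) \<le> B"
  using window_decay_radial[of n] by (auto simp: n_def)
 obtain D where D: "D \<ge> 0" "\<And>y J. 0 < y \<Longrightarrow> y \<le> 1 \<Longrightarrow> real J * y \<ge> 1 \<Longrightarrow>
  (LINT z|lborel. indicator {-1/2..1/2} z * \<bar>h_sum J y z\<bar>) \<le> D"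
  using h_sum_integral_bound by blast
 define C where "C = 3 ^ n * (A' * D + B + 3 ^ n * (A * D))"
 have "norm (window (h_sum J y) \<rho> v) \<le> C / (1 + y * norm v + \<bar>v \<bullet> perp \<rho>\<bar>) ^ N"
  if y: "0 < y" "y \<le> 1" "real J * y \<ge> 1" "real J * y \<le> 2" and \<rho>: "1/2 \<le> norm \<rho>" "norm \<rho> \<le> 1" for y J \<rho> v
 proof -
  have \<rho>0: "\<rho> \<noteq> 0" using \<rho> by auto
  define \<sigma> where "\<sigma> = v \<bullet> ((1 / (norm \<rho>)\<^sup>2) *\<^sub>R \<rho>)"
  define \<tau> where "\<tau> = v \<bullet> perp \<rho>"
  define W where "W = norm (window (h_sum J y) \<rho> v)"
  have H: "continuous_on UNIV (h_sum J y)" using y by (intro continuous_intros) auto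
  have W0: "W \<le> A' * D" unfolding W_def
   using A'(2)[OF H \<rho>, of v] mult_left_mono[OF D(2)[OF y(1-3)] A'(1)] by linarith
  have W1: "\<bar>\<tau>\<bar> ^ n * W \<le> A * D" unfolding W_def \<tau>_def
   using A(2)[OF H \<rho>, of v] mult_left_mono[OF D(2)[OF y(1-3)] A(1)] by linarith
  have W2: "(y * \<bar>\<sigma>\<bar>) ^ n * W \<le> B" unfolding W_def \<sigma>_def by (rule B(2)[OF y \<rho>])
  \<comment> \<open>Expansion of v in the orthogonal basis \<rho>, perp \<rho>; the factor 2 comes
    from |\<rho>| \<ge> 1/2.\<close>
  have nv: "norm v \<le> \<bar>\<sigma>\<bar> + 2 * \<bar>\<tau>\<bar>"
  proof -
   have "(norm \<rho>)\<^sup>2 *\<^sub>R v = (v \<bullet> \<rho>) *\<^sub>R \<rho> + \<tau> *\<^sub>R perp \<rho>"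
    by (cases v, cases \<rho>) (simp add: \<tau>_def perp_def inner_prod_def norm_prod_def power2_eq_square algebra_simps)
   then have "norm ((norm \<rho>)\<^sup>2 *\<^sub>R v) \<le> \<bar>v \<bullet> \<rho>\<bar> * norm \<rho> + \<bar>\<tau>\<bar> * norm \<rho>"
    using norm_triangle_ineq[of "(v \<bullet> \<rho>) *\<^sub>R \<rho>" "\<tau> *\<^sub>R perp \<rho>"] by simp
   also have "v \<bullet> \<rho> = \<sigma> * (norm \<rho>)\<^sup>2" using \<rho>0 by (simp add: \<sigma>_def)
   finally have "norm \<rho> * (norm \<rho> * norm v) \<le> norm \<rho> * (\<bar>\<sigma>\<bar> * (norm \<rho>)\<^sup>2 + \<bar>\<tau>\<bar>)"
    by (simp add: abs_mult power2_eq_square algebra_simps)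
   then have "norm \<rho> * norm v \<le> \<bar>\<sigma>\<bar> * (norm \<rho>)\<^sup>2 + \<bar>\<tau>\<bar>" using \<rho>0 by (simp add: mult_le_cancel_left_pos)
   also have "\<dots> \<le> \<bar>\<sigma>\<bar> * norm \<rho> + \<bar>\<tau>\<bar> * (2 * norm \<rho>)"
    using \<rho> mult_left_mono[of 1 "2 * norm \<rho>" "\<bar>\<tau>\<bar>"]
    by (intro add_mono mult_left_mono) (auto simp: power2_eq_square mult_left_le)
   finally have "norm \<rho> * norm v \<le> norm \<rho> * (\<bar>\<sigma>\<bar> + 2 * \<bar>\<tau>\<bar>)" by (simp add: algebra_simps)
   then show ?thesis using \<rho>0 by (simp add: mult_le_cancel_left_pos)
  qed
  define E where "E = 1 + y * norm v + \<bar>\<tau>\<bar>"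
  have E1: "E \<ge> 1" using y by (simp add: E_def)
  have "y * norm v \<le> y * \<bar>\<sigma>\<bar> + 2 * \<bar>\<tau>\<bar>"
  proof -
   have "y * norm v \<le> y * (\<bar>\<sigma>\<bar> + 2 * \<bar>\<tau>\<bar>)" using nv y by (intro mult_left_mono) auto
   also have "\<dots> \<le> y * \<bar>\<sigma>\<bar> + 1 * (2 * \<bar>\<tau>\<bar>)" unfolding distrib_left using y by (intro add_mono mult_right_mono) auto
   finally show ?thesis by simp
  qed
  then have "E \<le> 1 + y * \<bar>\<sigma>\<bar> + 3 * \<bar>\<tau>\<bar>" by (simp add: E_def)
  then have "E ^ n \<le> (1 + y * \<bar>\<sigma>\<bar> + 3 * \<bar>\<tau>\<bar>) ^ n" using E1 by (intro power_mono) auto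
  also have "\<dots> \<le> 3 ^ n * (1 + (y * \<bar>\<sigma>\<bar>) ^ n + (3 * \<bar>\<tau>\<bar>) ^ n)"
   using y by (intro one_plus_power_le) auto
  finally have "E ^ n * W \<le> 3 ^ n * (1 + (y * \<bar>\<sigma>\<bar>) ^ n + (3 * \<bar>\<tau>\<bar>) ^ n) * W"
   by (rule mult_right_mono) (simp add: W_def)
  also have "\<dots> = 3 ^ n * (W + (y * \<bar>\<sigma>\<bar>) ^ n * W + 3 ^ n * (\<bar>\<tau>\<bar> ^ n * W))"
   by (simp add: power_mult_distrib algebra_simps)
  also have "\<dots> \<le> C" unfolding C_def
   by (intro mult_left_mono add_mono W0 W1 W2) auto
  finally have "E ^ n * W \<le> C" .
  moreover have "E ^ N * W \<le> E ^ n * W" using E1 by (intro mult_right_mono power_increasing) (auto simp: n_def W_def)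
  ultimately have "E ^ N * W \<le> C" by linarith
  then show ?thesis using E1 unfolding W_def[symmetric] E_def[symmetric] \<tau>_def[symmetric] by (simp add: field_simps)
 qed
 moreover have "C \<ge> 0" using A A' B D by (auto simp: C_def)
 ultimately show ?thesis by blast
qed

end


section \<open>Rescaling p1 and p2; their pointwise bounds\<close>

lemma frac_one_plus_mono:
 fixes x X a :: real
 assumes "a \<ge> 0" "x \<ge> 0" "x \<le> X"
 shows "x / (1 + x * a) \<le> X / (1 + X * a)"
proof -
 have "1 + x * a > 0" "1 + X * a > 0" using assms by (auto intro!: add_pos_nonneg)
 moreover have "x * (1 + X * a) \<le> X * (1 + x * a)" using assms by (simp add: algebra_simps)
 ultimately show ?thesis by (simp add: divide_le_eq pos_le_divide_eq mult.commute)
qed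

lemma norm_divide_scaleR:
 fixes x :: "'a::real_normed_vector"
 assumes "a \<ge> 0"
 shows "norm ((1 / a) *\<^sub>R x) = norm x / a"
 using assms by simp

context delta_weights
begin

abbreviation p1' where "p1' \<equiv> p1 \<omega> \<omega>0"
abbreviation p2' where "p2' \<equiv> p2 \<omega> \<omega>0"

lemma powr_Q:
 fixes Q :: real
 assumes "Q \<ge> 1"
 shows "Q powr (1/2) \<ge> 1" "Q powr (3/2) > 0" "(Q powr (1/2))\<^sup>2 = Q" "(Q powr (3/2))\<^sup>2 = Q ^ 3"
  "Q powr (3/2) = Q * Q powr (1/2)"
proof -
 show "Q powr (1/2) \<ge> 1" using assms by (intro ge_one_powr_ge_zero) auto
 show "Q powr (3/2) > 0" using assms by simp
 show 1: "(Q powr (1/2))\<^sup>2 = Q" using assms by (simp add: powr_half_sqrt)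
 have "Q powr (3/2) = Q powr (1 + 1/2)" by simp
 also have "\<dots> = Q powr 1 * Q powr (1/2)" by (rule powr_add)
 finally show 2: "Q powr (3/2) = Q * Q powr (1/2)" using assms by simp
 show "(Q powr (3/2))\<^sup>2 = Q ^ 3" unfolding 2 power_mult_distrib 1 by (simp add: power2_eq_square power3_eq_cube)
qed

text \<open>The scales fit exactly: |r| \<le> Q^(1/2) and |x| < Q^(3/2)/2 give |r . x| \<le> Q^2/2,
  the range in which h is a finite sum with y j < 1.\<close>

lemma p2_argument_le:
 assumes Q: "Q \<ge> 1" and r: "norm (rvec r) \<le> Q powr (1/2)" and x: "norm x / Q powr (3/2) < 1/2"
 shows "\<bar>(rvec r \<bullet> x) / Q\<^sup>2\<bar> \<le> 1/2"
proof -
 have "\<bar>rvec r \<bullet> x\<bar> \<le> norm (rvec r) * norm x" by (rule Cauchy_Schwarz_ineq2)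
 also have "\<dots> \<le> Q powr (1/2) * (Q powr (3/2) / 2)"
  using x powr_Q[OF Q] by (intro mult_mono r) (auto simp: field_simps)
 also have "\<dots> = Q * (Q powr (1/2))\<^sup>2 / 2" unfolding powr_Q(5)[OF Q] by (simp add: power2_eq_square)
 also have "\<dots> = Q\<^sup>2 / 2" unfolding powr_Q(3)[OF Q] by (simp add: power2_eq_square)
 finally show ?thesis using Q by (simp add: field_simps)
qed

lemma p2_integrand_eq:
 assumes Q: "Q \<ge> 1" and r: "norm (rvec r) \<le> Q powr (1/2)" and kq: "k \<ge> 1" "q \<ge> 1"
  and J: "real J * (real k * real q / Q) \<ge> 1"
 shows "\<omega>0 (norm x / Q powr (3/2)) * h_fun \<omega> (real k * real q / Q) ((rvec r \<bullet> x) / Q\<^sup>2)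
  = \<omega>0 (norm ((1 / Q powr (3/2)) *\<^sub>R x)) * h_sum J (real k * real q / Q) ((rvec r \<bullet> x) / Q\<^sup>2)"
proof (cases "norm x / Q powr (3/2) < 1/2")
 case True
 have "h_fun \<omega> (real k * real q / Q) ((rvec r \<bullet> x) / Q\<^sup>2) = h_sum J (real k * real q / Q) ((rvec r \<bullet> x) / Q\<^sup>2)"
  by (rule h_fun_eq) (use p2_argument_le[OF Q r True] Q kq J in auto)
 then show ?thesis by (simp only: norm_divide_scaleR powr_ge_zero)
next
 case False
 then have "\<omega>0 (norm x / Q powr (3/2)) = 0" by (intro \<omega>0_outside) auto
 then show ?thesis by (simp only: norm_divide_scaleR powr_ge_zero mult_zero_left)
qed

text \<open>Substitution x = Q^(3/2) u; the Jacobian Q^3 cancels the prefactor of p2.\<close>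

lemma p2_eq_window:
 assumes Q: "Q \<ge> 1" and r: "norm (rvec r) \<le> Q powr (1/2)" and kq: "k \<ge> 1" "q \<ge> 1"
  and J: "real J * (real k * real q / Q) \<ge> 1"
 shows "p2' Q r k q w = of_real (c_const \<omega>) *
  window (h_sum J (real k * real q / Q)) ((1 / Q powr (1/2)) *\<^sub>R rvec r) (Q powr (3/2) *\<^sub>R w)"
proof -
 define y where "y = real k * real q / Q"
 have y: "y > 0" using Q kq by (simp add: y_def)
 define a where "a = Q powr (3/2)"
 have a: "a > 0" "a\<^sup>2 = Q ^ 3" using powr_Q[OF Q] by (simp_all add: a_def)
 define g where "g x = complex_of_real (\<omega>0 (norm ((1 / a) *\<^sub>R x)) * h_sum J y ((rvec r \<bullet> x) / Q\<^sup>2)) * e2pi (- (w \<bullet> x))" for x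
 have "p2' Q r k q w = of_real (c_const \<omega> / Q ^ 3) * (LINT x|lborel. g x)"
  unfolding p2_def p2_integrand_eq[OF assms] g_def a_def y_def ..
 also have "(LINT x|lborel. g x) = a\<^sup>2 *\<^sub>R (LINT x|lborel. g (a *\<^sub>R x))"
 proof (rule lborel_integral_scale_pair)
  show "g \<in> borel_measurable borel"
   unfolding g_def using y Q by (intro borel_measurable_continuous_onI continuous_intros) auto
 qed (use a in auto)
 also have "(\<lambda>x. g (a *\<^sub>R x)) = (\<lambda>u. of_real (\<omega>0 (norm u) * h_sum J y (((1 / Q powr (1/2)) *\<^sub>R rvec r) \<bullet> u)) * e2pi (- ((Q powr (3/2) *\<^sub>R w) \<bullet> u)))"
 proof
  fix u
  have "(rvec r \<bullet> (a *\<^sub>R u)) / Q\<^sup>2 = ((1 / Q powr (1/2)) *\<^sub>R rvec r) \<bullet> u"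
   using Q powr_Q(3)[OF Q] powr_Q(1)[OF Q] unfolding a_def powr_Q(5)[OF Q]
   by (simp add: field_simps power2_eq_square)
  then show "g (a *\<^sub>R u) = of_real (\<omega>0 (norm u) * h_sum J y (((1 / Q powr (1/2)) *\<^sub>R rvec r) \<bullet> u)) * e2pi (- ((Q powr (3/2) *\<^sub>R w) \<bullet> u))"
   unfolding g_def using a by (simp add: a_def)
 qed
 finally show ?thesis
  using Q unfolding window_def y_def[symmetric] a(2) by (simp add: scaleR_conv_of_real)
qed

lemma p2_eq_0:
 assumes Q: "Q \<ge> 1" and r: "norm (rvec r) \<le> Q powr (1/2)" and kq: "real k * real q \<ge> Q"
 shows "p2' Q r k q w = 0"
proof -
 have "\<omega>0 (norm x / Q powr (3/2)) * h_fun \<omega> (real k * real q / Q) ((rvec r \<bullet> x) / Q\<^sup>2) = 0" for x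
 proof (cases "norm x / Q powr (3/2) < 1/2")
  case True
  have "h_fun \<omega> (real k * real q / Q) ((rvec r \<bullet> x) / Q\<^sup>2) = 0"
   by (rule h_fun_eq_0) (use p2_argument_le[OF Q r True] Q kq in auto)
  then show ?thesis by simp
 next
  case False
  then have "\<omega>0 (norm x / Q powr (3/2)) = 0" by (intro \<omega>0_outside) auto
  then show ?thesis by simp
 qed
 then show ?thesis unfolding p2_def by (simp only: of_real_0 mult_zero_left integral_zero mult_zero_right)
qed

lemma nat_ceiling_bounds:
 fixes y :: real
 assumes "0 < y" "y \<le> 1"
 shows "real (nat \<lceil>1 / y\<rceil>) * y \<ge> 1" "real (nat \<lceil>1 / y\<rceil>) * y \<le> 2"
proof -
 have "1 / y > 0" using assms by simp
 then have "1 / y \<le> real (nat \<lceil>1 / y\<rceil>)" "real (nat \<lceil>1 / y\<rceil>) \<le> 1 / y + 1"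
  by linarith+
 from mult_right_mono[OF this(1), of y] mult_right_mono[OF this(2), of y]
 have "1 / y * y \<le> real (nat \<lceil>1 / y\<rceil>) * y" "real (nat \<lceil>1 / y\<rceil>) * y \<le> (1 / y + 1) * y"
  using assms by (simp_all only: less_imp_le)
 moreover have "1 / y * y = 1" "(1 / y + 1) * y = 1 + y" using assms by (simp_all add: distrib_right)
 ultimately show "real (nat \<lceil>1 / y\<rceil>) * y \<ge> 1" "real (nat \<lceil>1 / y\<rceil>) * y \<le> 2"
  using assms by linarith+
qed

text \<open>For kq \<ge> Q the function vanishes. Otherwise the decay of \<open>window\<close> is
  translated back: with y = kq/Q and v = Q^(3/2) w, the quantity y|v| is |w| k q Q^(1/2) and v .
  perp \<rho> is Q times w . perp r.\<close>

theorem p2_bound_power: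
 "\<exists>C\<ge>0. \<forall>Q\<ge>1. \<forall>w k q r. k \<ge> 1 \<longrightarrow> q \<ge> 1 \<longrightarrow> 1/2 * Q powr (1/2) \<le> norm (rvec r) \<longrightarrow> norm (rvec r) \<le> Q powr (1/2) \<longrightarrow>
  cmod (p2' Q r k q w) \<le> C / (1 + norm w * real k * real q * Q powr (1/2) + \<bar>w \<bullet> perp (rvec r)\<bar> * Q) ^ N"
proof -
 obtain C where C: "C \<ge> 0" "\<And>y J \<rho> v. 0 < y \<Longrightarrow> y \<le> 1 \<Longrightarrow> real J * y \<ge> 1 \<Longrightarrow> real J * y \<le> 2 \<Longrightarrow> 1/2 \<le> norm \<rho> \<Longrightarrow> norm \<rho> \<le> 1 \<Longrightarrow>
  norm (window (h_sum J y) \<rho> v) \<le> C / (1 + y * norm v + \<bar>v \<bullet> perp \<rho>\<bar>) ^ N"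
  using window_decay[of N] by blast
 have "cmod (p2' Q r k q w) \<le> (\<bar>c_const \<omega>\<bar> * C) / (1 + norm w * real k * real q * Q powr (1/2) + \<bar>w \<bullet> perp (rvec r)\<bar> * Q) ^ N"
  if Q: "Q \<ge> 1" and kq: "k \<ge> 1" "q \<ge> 1" and r: "1/2 * Q powr (1/2) \<le> norm (rvec r)" "norm (rvec r) \<le> Q powr (1/2)"
  for Q w k q r
 proof (cases "real k * real q \<ge> Q")
  case True
  show ?thesis unfolding p2_eq_0[OF Q r(2) True] using C(1) Q by simp
 next
  case False
  define y where "y = real k * real q / Q"
  have y: "0 < y" "y \<le> 1" using False Q kq by (auto simp: y_def)
  define J where "J = nat \<lceil>1 / y\<rceil>"
  have J: "real J * y \<ge> 1" "real J * y \<le> 2" unfolding J_def using nat_ceiling_bounds[OF y] by auto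
  define \<rho> where "\<rho> = (1 / Q powr (1/2)) *\<^sub>R rvec r"
  have q0: "Q powr (1/2) > 0" using Q by simp
  have \<rho>: "1/2 \<le> norm \<rho>" "norm \<rho> \<le> 1" using r q0 by (auto simp: \<rho>_def field_simps)
  have e1: "y * norm (Q powr (3/2) *\<^sub>R w) = norm w * real k * real q * Q powr (1/2)"
   using Q unfolding powr_Q(5)[OF Q] y_def by simp
  have e2: "\<bar>(Q powr (3/2) *\<^sub>R w) \<bullet> perp \<rho>\<bar> = \<bar>w \<bullet> perp (rvec r)\<bar> * Q"
  proof -
   have "(Q powr (3/2) *\<^sub>R w) \<bullet> perp \<rho> = Q * (w \<bullet> perp (rvec r))"
    using q0 Q unfolding powr_Q(5)[OF Q] \<rho>_def perp_def by (simp add: inner_prod_def field_simps)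
   then show ?thesis using Q by (simp add: abs_mult)
  qed
  have "cmod (p2' Q r k q w) = \<bar>c_const \<omega>\<bar> * norm (window (h_sum J y) \<rho> (Q powr (3/2) *\<^sub>R w))"
   unfolding y_def \<rho>_def by (subst p2_eq_window[OF Q r(2) kq J(1)[unfolded y_def]]) (simp add: norm_mult)
  also have "\<dots> \<le> \<bar>c_const \<omega>\<bar> * (C / (1 + y * norm (Q powr (3/2) *\<^sub>R w) + \<bar>(Q powr (3/2) *\<^sub>R w) \<bullet> perp \<rho>\<bar>) ^ N)"
   by (rule mult_left_mono[OF C(2)[OF y J \<rho>]]) simp
  finally show ?thesis unfolding e1 e2 by simp
 qed
 then show ?thesis using C(1) by (intro exI[of _ "\<bar>c_const \<omega>\<bar> * C"]) auto
qed

theorem p2_bound: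
 "\<forall>N::real. N > 0 \<longrightarrow> (\<exists>C::real. \<forall>Q::real. Q \<ge> 1 \<longrightarrow>
    (\<forall>(w :: real \<times> real) (k::nat) (q::nat) (r :: int \<times> int).
     k \<ge> 1 \<and> q \<ge> 1 \<and>
     1/2 * Q powr (1/2) \<le> norm (rvec r) \<and> norm (rvec r) \<le> Q powr (1/2) \<longrightarrow>
     cmod (p2 \<omega> \<omega>0 Q r k q w)
     \<le> C * (1 + norm w * real k * real q * Q powr (1/2)
          + \<bar>w \<bullet> perp (rvec r)\<bar> * Q) powr (- N)))"
proof (intro allI impI)
 fix N :: real assume "N > 0"
 obtain C where C: "C \<ge> 0" "\<And>Q w k q r. Q \<ge> 1 \<Longrightarrow> k \<ge> 1 \<Longrightarrow> q \<ge> 1 \<Longrightarrow> 1/2 * Q powr (1/2) \<le> norm (rvec r) \<Longrightarrow> norm (rvec r) \<le> Q powr (1/2) \<Longrightarrow>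
  cmod (p2' Q r k q w) \<le> C / (1 + norm w * real k * real q * Q powr (1/2) + \<bar>w \<bullet> perp (rvec r)\<bar> * Q) ^ nat \<lceil>N\<rceil>"
  using p2_bound_power[of "nat \<lceil>N\<rceil>"] by blast
 show "\<exists>C::real. \<forall>Q::real. Q \<ge> 1 \<longrightarrow>
    (\<forall>(w :: real \<times> real) (k::nat) (q::nat) (r :: int \<times> int).
     k \<ge> 1 \<and> q \<ge> 1 \<and>
     1/2 * Q powr (1/2) \<le> norm (rvec r) \<and> norm (rvec r) \<le> Q powr (1/2) \<longrightarrow>
     cmod (p2 \<omega> \<omega>0 Q r k q w)
     \<le> C * (1 + norm w * real k * real q * Q powr (1/2)
          + \<bar>w \<bullet> perp (rvec r)\<bar> * Q) powr (- N))"
 proof (rule exI[of _ C], intro allI impI)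
  fix Q :: real and w :: "real \<times> real" and k q :: nat and r :: "int \<times> int"
  assume Q: "Q \<ge> 1" and a: "k \<ge> 1 \<and> q \<ge> 1 \<and> 1/2 * Q powr (1/2) \<le> norm (rvec r) \<and> norm (rvec r) \<le> Q powr (1/2)"
  define E where "E = 1 + norm w * real k * real q * Q powr (1/2) + \<bar>w \<bullet> perp (rvec r)\<bar> * Q"
  have E: "E \<ge> 1" using Q by (simp add: E_def)
  have "cmod (p2 \<omega> \<omega>0 Q r k q w) \<le> C * (1 / E ^ nat \<lceil>N\<rceil>)"
   using C(2)[OF Q, of k q r w] a by (simp add: E_def)
  also have "\<dots> \<le> C * E powr (- N)"
   by (rule mult_left_mono[OF powr_minus_ge_power[OF E] C(1)])
  finally show "cmod (p2 \<omega> \<omega>0 Q r k q w)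
   \<le> C * (1 + norm w * real k * real q * Q powr (1/2) + \<bar>w \<bullet> perp (rvec r)\<bar> * Q) powr (- N)"
   by (simp add: E_def)
 qed
qed

text \<open>The j-th term of p1 after the substitution x = j q Q^(1/2) u: a fixed annulus in u, with
  the cutoff stretched by s = jq/Q.\<close>

definition shell :: "real \<Rightarrow> real \<times> real \<Rightarrow> complex" where
 "shell s v = (LINT u|lborel. of_real (\<omega>0 (norm (s *\<^sub>R u)) * \<omega> (norm u)) * e2pi (- (v \<bullet> u)))"

lemma continuous_\<omega>_norm: "continuous_on A (\<lambda>u :: real \<times> real. \<omega> (norm u))"
 by (intro continuous_intros)

text \<open>For every s in [0, 1] the restrictions to lines parallel to the axes lie in
  \<open>fam1 1\<close>, so the constant does not depend on s.\<close>

lemma shell_decay: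
 "\<exists>C\<ge>0. \<forall>s v. 0 \<le> s \<longrightarrow> s \<le> 1 \<longrightarrow> norm (shell s v) \<le> C / (1 + norm v) ^ N"
proof -
 have *: "\<exists>C\<ge>0. \<forall>s v. 0 \<le> s \<longrightarrow> s \<le> 1 \<longrightarrow> norm v ^ N * norm (shell s v) \<le> C" for N
 proof -
  obtain C where C: "C \<ge> 0" "\<forall>g R v. continuous_on UNIV g \<longrightarrow> (\<forall>y. (\<lambda>x. g (x, y)) \<in> fam1 1) \<longrightarrow> (\<forall>x. (\<lambda>y. g (x, y)) \<in> fam1 1) \<longrightarrow>
   (\<forall>x y. \<bar>x\<bar> > R \<or> \<bar>y\<bar> > R \<longrightarrow> g (x, y) = 0) \<longrightarrow> R \<ge> 0 \<longrightarrow>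
   norm v ^ N * norm (LINT p|lborel. g p * e2pi (- (v \<bullet> p))) \<le> C * R\<^sup>2"
   using fourier_decay_pair[OF bounded_derivs_fam1[of 1 N]] by auto
  have "norm v ^ N * norm (shell s v) \<le> C" if s: "0 \<le> s" "s \<le> 1" for s v
  proof -
   define g where "g u = complex_of_real (\<omega>0 (norm (s *\<^sub>R u)) * \<omega> (norm u))" for u :: "real \<times> real"
   have "continuous_on UNIV g" unfolding g_def by (intro continuous_intros)
   moreover have "(\<lambda>x. g (x, y)) \<in> fam1 1" for y
   proof -
    have "(\<lambda>x. of_real (\<omega> (norm ((0, y) + x *\<^sub>R (1::real, 0)))) * complex_of_real (\<omega>0 (norm ((0, s * y) + x *\<^sub>R (s, 0))))) \<in> fam1 1"
     by (rule fam1I[where \<alpha>="(0, y)" and \<beta>="(1, 0)"], simp, rule fam0I'[where \<alpha>="(0, s * y)" and \<beta>="(s, 0)"]) (use s in simp)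
    then show ?thesis by (simp add: g_def mult.commute)
   qed
   moreover have "(\<lambda>y. g (x, y)) \<in> fam1 1" for x
   proof -
    have "(\<lambda>y. of_real (\<omega> (norm ((x, 0) + y *\<^sub>R (0, 1::real)))) * complex_of_real (\<omega>0 (norm ((s * x, 0) + y *\<^sub>R (0, s))))) \<in> fam1 1"
     by (rule fam1I[where \<alpha>="(x, 0)" and \<beta>="(0, 1)"], simp, rule fam0I'[where \<alpha>="(s * x, 0)" and \<beta>="(0, s)"]) (use s in simp)
    then show ?thesis by (simp add: g_def mult.commute)
   qed
   moreover have "\<forall>x y. \<bar>x\<bar> > 1 \<or> \<bar>y\<bar> > 1 \<longrightarrow> g (x, y) = 0"
   proof (intro allI impI)
    fix x y :: real assume "\<bar>x\<bar> > 1 \<or> \<bar>y\<bar> > 1"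
    then have "norm (x, y) \<ge> 1" using abs_fst_le_norm[of "(x, y)"] abs_snd_le_norm[of "(x, y)"] by auto
    then show "g (x, y) = 0" by (simp add: g_def \<omega>_0)
   qed
   ultimately have "norm v ^ N * norm (LINT p|lborel. g p * e2pi (- (v \<bullet> p))) \<le> C * 1\<^sup>2"
    by (intro C(2)[rule_format]) auto
   then show ?thesis by (simp add: shell_def g_def)
  qed
  then show ?thesis using C(1) by blast
 qed
 obtain A where A: "A \<ge> 0" "\<And>s v. 0 \<le> s \<Longrightarrow> s \<le> 1 \<Longrightarrow> norm v ^ N * norm (shell s v) \<le> A" using *[of N] by blast
 obtain B where B: "B \<ge> 0" "\<And>s v. 0 \<le> s \<Longrightarrow> s \<le> 1 \<Longrightarrow> norm (shell s v) \<le> B"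
  using *[of 0] unfolding power_0 mult_1 by blast
 have "norm (shell s v) \<le> 3 ^ N * (B + A + B) / (1 + norm v) ^ N" if s: "0 \<le> s" "s \<le> 1" for s v
 proof -
  have "(1 + norm v + 0) ^ N \<le> 3 ^ N * (1 + norm v ^ N + 0 ^ N)" by (rule one_plus_power_le) auto
  also have "\<dots> \<le> 3 ^ N * (1 + norm v ^ N + 1)" by (intro mult_left_mono add_left_mono) (auto simp: power_le_one)
  finally have "(1 + norm v) ^ N * norm (shell s v) \<le> 3 ^ N * (1 + norm v ^ N + 1) * norm (shell s v)"
   by (intro mult_right_mono) auto
  also have "\<dots> = 3 ^ N * (norm (shell s v) + norm v ^ N * norm (shell s v) + norm (shell s v))" by (simp add: algebra_simps)
  also have "\<dots> \<le> 3 ^ N * (B + A + B)" by (intro mult_left_mono add_mono A B s) auto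
  finally have "(1 + norm v) ^ N * norm (shell s v) \<le> 3 ^ N * (B + A + B)" .
  moreover have "(1 + norm v) ^ N > 0" by (intro zero_less_power add_pos_nonneg) auto
  ultimately show ?thesis by (simp add: pos_le_divide_eq mult.commute)
 qed
 moreover have "3 ^ N * (B + A + B) \<ge> 0" using A B by auto
 ultimately show ?thesis by blast
qed

text \<open>For jq \<ge> Q the annulus of the j-th term lies outside the support of the cutoff,
  since |x| < Q^(3/2)/2 makes the argument of \<omega> at most 1/2.\<close>

lemma p1_integrand_eq:
 assumes Q: "Q \<ge> 1" and q: "q \<ge> 1" and J: "\<And>j. j > J \<Longrightarrow> real j * real q \<ge> Q"
 shows "\<omega>0 (norm x / Q powr (3/2)) * (\<Sum>\<^sub>\<infinity>j\<in>{1::nat..}. 1 / ((real q)\<^sup>2 * (real j)\<^sup>2) * \<omega> (norm x / (real j * real q * Q powr (1/2))))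
  = (\<Sum>j\<in>{1..J}. 1 / ((real q)\<^sup>2 * (real j)\<^sup>2) * (\<omega>0 (norm ((1 / Q powr (3/2)) *\<^sub>R x)) * \<omega> (norm ((1 / (real j * real q * Q powr (1/2))) *\<^sub>R x))))"
proof (cases "norm x / Q powr (3/2) < 1/2")
 case True
 have "(\<Sum>\<^sub>\<infinity>j\<in>{1::nat..}. 1 / ((real q)\<^sup>2 * (real j)\<^sup>2) * \<omega> (norm x / (real j * real q * Q powr (1/2))))
  = (\<Sum>j\<in>{1..J}. 1 / ((real q)\<^sup>2 * (real j)\<^sup>2) * \<omega> (norm x / (real j * real q * Q powr (1/2))))"
 proof (rule infsum_eq_sum)
  fix j assume "j \<in> {1..} - {1..J}"
  then have "real j * real q \<ge> Q" using J by auto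
  then have "Q powr (3/2) \<le> real j * real q * Q powr (1/2)"
   unfolding powr_Q(5)[OF Q] by (intro mult_right_mono) auto
  moreover from this have "real j * real q * Q powr (1/2) > 0" using powr_Q(2)[OF Q] by linarith
  ultimately have "norm x / (real j * real q * Q powr (1/2)) \<le> norm x / Q powr (3/2)"
   using powr_Q(2)[OF Q] by (intro divide_left_mono mult_pos_pos[of "real j * real q * Q powr (1/2)"] norm_ge_zero)
  then show "1 / ((real q)\<^sup>2 * (real j)\<^sup>2) * \<omega> (norm x / (real j * real q * Q powr (1/2))) = 0"
  proof -
   assume "norm x / (real j * real q * Q powr (1/2)) \<le> norm x / Q powr (3/2)"
   then have "norm x / (real j * real q * Q powr (1/2)) \<le> 1/2" using True by linarith
   then have "\<omega> (norm x / (real j * real q * Q powr (1/2))) = 0" by (intro \<omega>_0 disjI1)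
   then show ?thesis by (simp only: mult_zero_right)
  qed
 qed auto
 moreover have "real j * real q * Q powr (1/2) \<ge> 0" for j by simp
 ultimately show ?thesis
  by (simp only: norm_divide_scaleR powr_ge_zero sum_distrib_left) (simp only: mult.left_commute)
next
 case False
 then have "\<omega>0 (norm x / Q powr (3/2)) = 0" by (intro \<omega>0_outside) auto
 then show ?thesis by (simp only: norm_divide_scaleR powr_ge_zero mult_zero_left mult_zero_right sum.neutral_const)
qed

text \<open>The Jacobian j^2 q^2 Q of x = j q Q^(1/2) u cancels both the coefficient 1/(q^2 j^2) and
  the prefactor 1/Q.\<close>

lemma p1_eq_shell:
 assumes Q: "Q \<ge> 1" and q: "q \<ge> 1" and J: "\<And>j. j > J \<Longrightarrow> real j * real q \<ge> Q"
 shows "p1' Q q w = - of_real (2 * c_const \<omega>) *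
  (\<Sum>j\<in>{1..J}. shell (real j * real q / Q) ((real j * real q * Q powr (1/2)) *\<^sub>R w))"
proof -
 define g where "g j x = complex_of_real (1 / ((real q)\<^sup>2 * (real j)\<^sup>2) * (\<omega>0 (norm ((1 / Q powr (3/2)) *\<^sub>R x)) * \<omega> (norm ((1 / (real j * real q * Q powr (1/2))) *\<^sub>R x)))) * e2pi (- (w \<bullet> x))"
  for j x
 have int: "integrable lborel (g j)" and val: "(LINT x|lborel. g j x) = of_real Q * shell (real j * real q / Q) ((real j * real q * Q powr (1/2)) *\<^sub>R w)"
  if j: "j \<in> {1..J}" for j
 proof -
  define a where "a = real j * real q * Q powr (1/2)"
  have a: "a > 0" unfolding a_def using j q Q by (intro mult_pos_pos) auto
  have cont: "continuous_on UNIV (g j)" unfolding g_def by (intro continuous_intros)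
  show "integrable lborel (g j)"
  proof (rule compact_support_integrable[OF cont, of "Q powr (3/2)"])
   fix x :: "real \<times> real" assume "norm x > Q powr (3/2)"
   then have "norm x / Q powr (3/2) > 1" using powr_Q(2)[OF Q] by (simp add: pos_less_divide_eq)
   then have "1/2 \<le> \<bar>norm ((1 / Q powr (3/2)) *\<^sub>R x)\<bar>" unfolding norm_divide_scaleR[OF powr_ge_zero] by linarith
   then have "\<omega>0 (norm ((1 / Q powr (3/2)) *\<^sub>R x)) = 0" by (rule \<omega>0_outside)
   then show "g j x = 0" by (simp add: g_def)
  qed
  have "(LINT x|lborel. g j x) = a\<^sup>2 *\<^sub>R (LINT x|lborel. g j (a *\<^sub>R x))"
   by (rule lborel_integral_scale_pair) (use a cont in \<open>auto intro: borel_measurable_continuous_onI\<close>)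
  also have "(\<lambda>x. g j (a *\<^sub>R x)) = (\<lambda>u. of_real (1 / ((real q)\<^sup>2 * (real j)\<^sup>2)) * (of_real (\<omega>0 (norm ((real j * real q / Q) *\<^sub>R u)) * \<omega> (norm u)) * e2pi (- ((a *\<^sub>R w) \<bullet> u))))"
  proof
   fix u :: "real \<times> real"
   have "(1 / Q powr (3/2)) * a = real j * real q / Q"
    using powr_Q(1)[OF Q] Q unfolding powr_Q(5)[OF Q] a_def by (simp add: field_simps)
   then have e: "(1 / Q powr (3/2)) *\<^sub>R (a *\<^sub>R u) = (real j * real q / Q) *\<^sub>R u" by (simp only: scaleR_scaleR)
   have e': "(1 / (real j * real q * Q powr (1/2))) *\<^sub>R (a *\<^sub>R u) = u"
    using a unfolding a_def[symmetric] by simp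
   show "g j (a *\<^sub>R u) = of_real (1 / ((real q)\<^sup>2 * (real j)\<^sup>2)) * (of_real (\<omega>0 (norm ((real j * real q / Q) *\<^sub>R u)) * \<omega> (norm u)) * e2pi (- ((a *\<^sub>R w) \<bullet> u)))"
    unfolding g_def e e' by simp
  qed
  also have "a\<^sup>2 *\<^sub>R (LINT u|lborel. of_real (1 / ((real q)\<^sup>2 * (real j)\<^sup>2)) * (of_real (\<omega>0 (norm ((real j * real q / Q) *\<^sub>R u)) * \<omega> (norm u)) * e2pi (- ((a *\<^sub>R w) \<bullet> u))))
    = of_real (a\<^sup>2 * (1 / ((real q)\<^sup>2 * (real j)\<^sup>2))) * shell (real j * real q / Q) (a *\<^sub>R w)"
   unfolding integral_mult_right_zero shell_def scaleR_conv_of_real of_real_mult mult.assoc ..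
  also have "a\<^sup>2 * (1 / ((real q)\<^sup>2 * (real j)\<^sup>2)) = Q"
   using j q powr_Q(3)[OF Q] by (simp add: a_def power_mult_distrib)
  finally show "(LINT x|lborel. g j x) = of_real Q * shell (real j * real q / Q) ((real j * real q * Q powr (1/2)) *\<^sub>R w)"
   by (simp add: a_def)
 qed
 have "p1' Q q w = - of_real (2 * c_const \<omega> / Q) * (LINT x|lborel. (\<Sum>j\<in>{1..J}. g j x))"
 proof -
  have "complex_of_real (\<omega>0 (norm x / Q powr (3/2)) * (\<Sum>\<^sub>\<infinity>j\<in>{1::nat..}. 1 / ((real q)\<^sup>2 * (real j)\<^sup>2) * \<omega> (norm x / (real j * real q * Q powr (1/2)))))
    * e2pi (- (w \<bullet> x)) = (\<Sum>j\<in>{1..J}. g j x)" for x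
   unfolding g_def sum_distrib_right[symmetric] of_real_sum[symmetric]
   by (subst p1_integrand_eq[OF Q q J]) auto
  then show ?thesis unfolding p1_def by (simp only:)
 qed
 also have "(LINT x|lborel. (\<Sum>j\<in>{1..J}. g j x)) = (\<Sum>j\<in>{1..J}. of_real Q * shell (real j * real q / Q) ((real j * real q * Q powr (1/2)) *\<^sub>R w))"
  by (subst Bochner_Integration.integral_sum[OF int]) (use val in auto)
 finally show ?thesis using Q by (simp add: sum_distrib_left[symmetric])
qed

text \<open>With a = |w| q Q^(1/2), the j-th term is O((1 + ja)^(-N-2)). N of the factors are
  bounded by (1 + a)^(-N); the remaining 1/(1 + ja)^2 is dominated by j/(1 + ja) - (j-1)/(1 +
  (j-1)a), which telescopes to J/(1 + Ja). Since J \<le> Q/q, this is at most (Q/q)/(1 + |w|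
  Q^(3/2)).\<close>

lemma p1_bound_power:
 "\<exists>C\<ge>0. \<forall>Q\<ge>1. \<forall>q w. 1 \<le> q \<longrightarrow> real q \<le> Q \<longrightarrow>
   cmod (p1' Q q w) \<le> C * (Q / (real q * (1 + norm w * Q powr (3/2)))) / (1 + norm w * real q * Q powr (1/2)) ^ N"
proof -
 obtain C where C: "C \<ge> 0" "\<And>s v. 0 \<le> s \<Longrightarrow> s \<le> 1 \<Longrightarrow> norm (shell s v) \<le> C / (1 + norm v) ^ (N + 2)"
  using shell_decay[of "N + 2"] by blast
 have "cmod (p1' Q q w) \<le> (2 * \<bar>c_const \<omega>\<bar> * C) * (Q / (real q * (1 + norm w * Q powr (3/2)))) / (1 + norm w * real q * Q powr (1/2)) ^ N"
  if Q: "Q \<ge> 1" and q: "1 \<le> q" "real q \<le> Q" for Q q w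
 proof -
  define J where "J = nat \<lfloor>Q / real q\<rfloor>"
  have J: "real j * real q \<ge> Q" if "j > J" for j
  proof -
   have "real j > Q / real q" using that unfolding J_def by linarith
   then show ?thesis using q by (simp add: field_simps)
  qed
  have J': "real J \<le> Q / real q" unfolding J_def using Q by simp
  define a where "a = norm w * real q * Q powr (1/2)"
  have a: "a \<ge> 0" by (simp add: a_def)
  have ter: "norm (shell (real j * real q / Q) ((real j * real q * Q powr (1/2)) *\<^sub>R w))
    \<le> C / (1 + a) ^ N * (real j / (1 + real j * a) - real (j - 1) / (1 + real (j - 1) * a))" if j: "j \<in> {1..J}" for j
  proof -
   have "real j * real q \<le> Q" using j J' q by (simp add: field_simps) (smt (verit) mult_right_mono of_nat_0_le_iff of_nat_mono)
   then have s: "0 \<le> real j * real q / Q" "real j * real q / Q \<le> 1" using Q by auto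
   have nv: "norm ((real j * real q * Q powr (1/2)) *\<^sub>R w) = real j * a" by (simp add: a_def)
   have p: "1 + real j * a > 0" "1 + real (j - 1) * a > 0" using a by (simp_all add: add_pos_nonneg)
   have "1 * a \<le> real j * a" using j a by (intro mult_right_mono) auto
   then have aj: "(1 + a) ^ N \<le> (1 + real j * a) ^ N" using a by (intro power_mono) auto
   have "norm (shell (real j * real q / Q) ((real j * real q * Q powr (1/2)) *\<^sub>R w)) \<le> C / (1 + real j * a) ^ (N + 2)"
    using C(2)[OF s, of "(real j * real q * Q powr (1/2)) *\<^sub>R w"] unfolding nv .
   also have "\<dots> = C / (1 + real j * a) ^ N * (1 / (1 + real j * a)\<^sup>2)" by (simp add: power_add power2_eq_square)
   also have "\<dots> \<le> C / (1 + a) ^ N * (1 / (1 + real j * a)\<^sup>2)"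
    using aj C(1) a by (intro mult_right_mono divide_left_mono mult_pos_pos zero_less_power p) auto
   finally have L: "norm (shell (real j * real q / Q) ((real j * real q * Q powr (1/2)) *\<^sub>R w)) \<le> C / (1 + a) ^ N * (1 / (1 + real j * a)\<^sup>2)" .
   have "1 / (1 + real j * a)\<^sup>2 \<le> 1 / ((1 + real (j - 1) * a) * (1 + real j * a))"
    using p a j unfolding power2_eq_square by (intro divide_left_mono mult_right_mono mult_pos_pos) (auto intro!: mult_right_mono)
   also have "\<dots> = real j / (1 + real j * a) - real (j - 1) / (1 + real (j - 1) * a)"
    using p j by (simp add: diff_frac_eq of_nat_diff field_simps)
   finally have R: "1 / (1 + real j * a)\<^sup>2 \<le> real j / (1 + real j * a) - real (j - 1) / (1 + real (j - 1) * a)" .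
   show ?thesis
    by (rule order_trans[OF L mult_left_mono[OF R]]) (use C(1) a in auto)
  qed
  have tel: "(\<Sum>j\<in>{1..J}. real j / (1 + real j * a) - real (j - 1) / (1 + real (j - 1) * a)) = real J / (1 + real J * a)"
   by (induction J) (auto simp: sum.nat_ivl_Suc')
  have "norm (\<Sum>j\<in>{1..J}. shell (real j * real q / Q) ((real j * real q * Q powr (1/2)) *\<^sub>R w))
    \<le> (\<Sum>j\<in>{1..J}. C / (1 + a) ^ N * (real j / (1 + real j * a) - real (j - 1) / (1 + real (j - 1) * a)))"
   by (rule sum_norm_le) (rule ter)
  also have "\<dots> = C / (1 + a) ^ N * (real J / (1 + real J * a))"
   unfolding sum_distrib_left[symmetric] tel ..
  finally have L: "norm (\<Sum>j\<in>{1..J}. shell (real j * real q / Q) ((real j * real q * Q powr (1/2)) *\<^sub>R w))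
    \<le> C / (1 + a) ^ N * (real J / (1 + real J * a))" .
  have "real J / (1 + real J * a) \<le> (Q / real q) / (1 + (Q / real q) * a)"
   by (rule frac_one_plus_mono[OF a _ J']) simp

  also have "(Q / real q) * a = norm w * Q powr (3/2)"
   unfolding powr_Q(5)[OF Q] a_def using q by simp
  finally have R: "real J / (1 + real J * a) \<le> (Q / real q) / (1 + norm w * Q powr (3/2))" .
  have S: "norm (\<Sum>j\<in>{1..J}. shell (real j * real q / Q) ((real j * real q * Q powr (1/2)) *\<^sub>R w))
    \<le> C / (1 + a) ^ N * ((Q / real q) / (1 + norm w * Q powr (3/2)))"
   by (rule order_trans[OF L mult_left_mono[OF R]]) (use C(1) a in auto)
  have "cmod (p1' Q q w) = 2 * \<bar>c_const \<omega>\<bar> * norm (\<Sum>j\<in>{1..J}. shell (real j * real q / Q) ((real j * real q * Q powr (1/2)) *\<^sub>R w))"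
  proof -
   have "p1' Q q w = - of_real (2 * c_const \<omega>) * (\<Sum>j\<in>{1..J}. shell (real j * real q / Q) ((real j * real q * Q powr (1/2)) *\<^sub>R w))"
    by (rule p1_eq_shell[OF Q q(1)]) (rule J)
   then show ?thesis by (simp only: norm_mult norm_minus_cancel norm_of_real abs_mult abs_numeral)
  qed
  also have "\<dots> \<le> 2 * \<bar>c_const \<omega>\<bar> * (C / (1 + a) ^ N * ((Q / real q) / (1 + norm w * Q powr (3/2))))"
   by (rule mult_left_mono[OF S]) simp
  finally show ?thesis unfolding a_def[symmetric] by (simp add: mult_ac)
 qed
 moreover have "2 * \<bar>c_const \<omega>\<bar> * C \<ge> 0" using C(1) by simp
 ultimately show ?thesis by blast
qed

theorem p1_bound:
 "\<forall>N::real. N > 0 \<longrightarrow> (\<exists>C::real. \<forall>Q::real. Q \<ge> 1 \<longrightarrow>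
    (\<forall>(q::nat) (w :: real \<times> real). 1 \<le> q \<and> real q \<le> Q \<longrightarrow>
     cmod (p1 \<omega> \<omega>0 Q q w)
     \<le> C * (Q / (real q * (1 + norm w * Q powr (3/2)))) *
       (1 + norm w * real q * Q powr (1/2)) powr (- N)))"
proof (intro allI impI)
 fix N :: real assume "N > 0"
 obtain C where C: "C \<ge> 0" "\<And>Q q w. Q \<ge> 1 \<Longrightarrow> 1 \<le> q \<Longrightarrow> real q \<le> Q \<Longrightarrow>
   cmod (p1' Q q w) \<le> C * (Q / (real q * (1 + norm w * Q powr (3/2)))) / (1 + norm w * real q * Q powr (1/2)) ^ nat \<lceil>N\<rceil>"
  using p1_bound_power[of "nat \<lceil>N\<rceil>"] by blast
 show "\<exists>C::real. \<forall>Q::real. Q \<ge> 1 \<longrightarrow>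
    (\<forall>(q::nat) (w :: real \<times> real). 1 \<le> q \<and> real q \<le> Q \<longrightarrow>
     cmod (p1 \<omega> \<omega>0 Q q w)
     \<le> C * (Q / (real q * (1 + norm w * Q powr (3/2)))) *
       (1 + norm w * real q * Q powr (1/2)) powr (- N))"
 proof (rule exI[of _ C], intro allI impI)
  fix Q :: real and q :: nat and w :: "real \<times> real" assume Q: "Q \<ge> 1" and a: "1 \<le> q \<and> real q \<le> Q"
  define E where "E = 1 + norm w * real q * Q powr (1/2)"
  define D where "D = C * (Q / (real q * (1 + norm w * Q powr (3/2))))"
  have E: "E \<ge> 1" by (simp add: E_def)
  have D: "D \<ge> 0" using C(1) Q by (simp add: D_def)
  have "cmod (p1 \<omega> \<omega>0 Q q w) \<le> D * (1 / E ^ nat \<lceil>N\<rceil>)"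
   using C(2)[OF Q, of q w] a by (simp add: E_def D_def)
  also have "\<dots> \<le> D * E powr (- N)"
   by (rule mult_left_mono[OF powr_minus_ge_power[OF E] D])
  finally show "cmod (p1 \<omega> \<omega>0 Q q w) \<le> C * (Q / (real q * (1 + norm w * Q powr (3/2)))) * (1 + norm w * real q * Q powr (1/2)) powr (- N)"
   by (simp add: E_def D_def)
 qed
qed

end


section \<open>Complete character sums and reduction to lowest terms\<close>

lemma e2pi_of_nat_mult: "e2pi (real k * x) = e2pi x ^ k"
 by (induction k) (simp_all add: e2pi_add distrib_right)

lemma e2pi_eq_1_iff: "e2pi x = 1 \<longleftrightarrow> x \<in> \<int>"
proof
 assume "e2pi x = 1"
 then have "exp (2 * of_real pi * \<i> * of_real x) = 1" by (simp add: e2pi_def)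
 then obtain k :: int where "Im (2 * of_real pi * \<i> * of_real x) = of_int (2 * k) * pi"
  unfolding exp_eq_1 by blast
 then have "x = of_int k" by simp
 then show "x \<in> \<int>" by simp
qed (auto elim!: Ints_cases)

lemma sum_e2pi:
 assumes "m \<ge> 1"
 shows "(\<Sum>x\<in>{0..<int m}. e2pi (of_int (x * t) / real m)) = (if int m dvd t then of_nat m else 0)"
proof -
 define z where "z = e2pi (of_int t / real m)"
 have "(\<Sum>x\<in>{0..<int m}. e2pi (of_int (x * t) / real m)) = (\<Sum>x\<in>int ` {0..<m}. e2pi (of_int (x * t) / real m))"
  by (simp add: image_int_atLeastLessThan)
 also have "\<dots> = (\<Sum>x<m. z ^ x)"
  by (subst sum.reindex) (auto simp: z_def e2pi_of_nat_mult[symmetric] atLeast0LessThan)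
 finally have eq: "(\<Sum>x\<in>{0..<int m}. e2pi (of_int (x * t) / real m)) = (\<Sum>x<m. z ^ x)" .
 have zm: "z ^ m = 1"
  using assms by (simp add: z_def e2pi_of_nat_mult[symmetric])
 show ?thesis
 proof (cases "int m dvd t")
  case True
  then have "z = 1" using assms by (auto simp: z_def elim!: dvdE)
  then show ?thesis using True eq by simp
 next
  case False
  have "z \<noteq> 1"
  proof
   assume "z = 1"
   then obtain k where "of_int t / real m = of_int k" unfolding z_def e2pi_eq_1_iff by (auto elim: Ints_cases)
   then have "real_of_int t = of_int (k * int m)" using assms by (simp add: field_simps)
   then have "t = k * int m" by (simp only: of_int_eq_iff)
   then show False using False by simp
  qed
  then have "(\<Sum>x<m. z ^ x) = 0" using zm by (simp add: sum_gp_strict)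
  then show ?thesis using False eq by simp
 qed
qed

definition residue_box :: "nat \<Rightarrow> (int \<times> int) set" where
 "residue_box m = {0..<int m} \<times> {0..<int m}"

lemma finite_residue_box [simp]: "finite (residue_box m)" by (simp add: residue_box_def)

definition frac_char :: "int \<times> int \<Rightarrow> nat \<Rightarrow> int \<times> int \<Rightarrow> complex" where
 "frac_char a q n = e2pi (of_int (idot a n) / real q)"

lemma sum_frac_char:
 assumes "m \<ge> 1"
 shows "(\<Sum>b\<in>residue_box m. frac_char b m n) = (if int m dvd vgcd n then of_nat m ^ 2 else 0)"
proof -
 have "(\<Sum>b\<in>residue_box m. frac_char b m n) = (\<Sum>x\<in>{0..<int m}. \<Sum>y\<in>{0..<int m}. e2pi (of_int (x * fst n) / real m) * e2pi (of_int (y * snd n) / real m))"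
  unfolding residue_box_def sum.cartesian_product
  by (intro sum.cong refl) (auto simp: frac_char_def idot_def e2pi_add[symmetric] add_divide_distrib)
 also have "\<dots> = (\<Sum>x\<in>{0..<int m}. e2pi (of_int (x * fst n) / real m)) * (\<Sum>y\<in>{0..<int m}. e2pi (of_int (y * snd n) / real m))"
  by (simp add: sum_product)
 finally show ?thesis unfolding sum_e2pi[OF assms] by (auto simp: vgcd_def power2_eq_square)
qed

lemma card_progression:
 assumes "t \<ge> 1"
 shows "card {x \<in> {0..<int (e * t)}. int t dvd x - x0} = e"
proof -
 define c where "c = x0 mod int t"
 have c: "0 \<le> c" "c < int t" using assms by (auto simp: c_def)
 have "{x \<in> {0..<int (e * t)}. int t dvd x - x0} = (\<lambda>i. c + int t * int i) ` {0..<e}"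
 proof (intro equalityI subsetI)
  fix x assume "x \<in> {x \<in> {0..<int (e * t)}. int t dvd x - x0}"
  then have x: "0 \<le> x" "x < int e * int t" "x mod int t = c"
   by (auto simp: c_def mod_eq_dvd_iff)
  have eq: "x = c + int t * int (nat (x div int t))"
   using x mult_div_mod_eq[of "int t" x] assms by (simp add: pos_imp_zdiv_nonneg_iff)
  have "x div int t < int e"
  proof (rule ccontr)
   assume "\<not> x div int t < int e"
   then have "int e * int t \<le> (x div int t) * int t" by (intro mult_right_mono) auto
   moreover have "(x div int t) * int t \<le> x" using x mult_div_mod_eq[of "int t" x] c by (simp add: mult.commute)
   ultimately show False using x by linarith
  qed
  then have "nat (x div int t) < e" using x assms by (simp add: nat_less_iff pos_imp_zdiv_nonneg_iff)
  then show "x \<in> (\<lambda>i. c + int t * int i) ` {0..<e}" using eq by (intro image_eqI[of _ _ "nat (x div int t)"]) auto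
 next
  fix x assume "x \<in> (\<lambda>i. c + int t * int i) ` {0..<e}"
  then obtain i where i: "i < e" "x = c + int t * int i" by auto
  have "int t * int i + int t \<le> int e * int t"
   using mult_right_mono[of "int i + 1" "int e" "int t"] i by (simp add: algebra_simps)
  moreover have "x mod int t = x0 mod int t" using i by (simp add: c_def)
  then have "int t dvd x - x0" by (simp only: mod_eq_dvd_iff)
  ultimately show "x \<in> {x \<in> {0..<int (e * t)}. int t dvd x - x0}"
   using i c by auto
 qed
 moreover have "inj_on (\<lambda>i. c + int t * int i) {0..<e}" using assms by (auto simp: inj_on_def)
 ultimately show ?thesis by (simp add: card_image)
qed

text \<open>The determinant of r and b. For gcd(a, q) = 1, divisibility of
  \<open>incident r a\<close> by q is membership of r in \<Lambda>(a, q).\<close>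

definition incident :: "int \<times> int \<Rightarrow> int \<times> int \<Rightarrow> int" where
 "incident r b = idot r (perp b)"

lemma incident_iscale: "incident r (iscale k b) = k * incident r b" "incident (iscale k r) b = k * incident r b"
 by (simp_all add: incident_def idot_def perp_def iscale_def algebra_simps)

text \<open>The congruence is detected by characters with an auxiliary x modulo m. The sum over b is
  then complete and forces n to be congruent to x times perp r modulo m; its value m^2 divided by
  the m of the detection leaves m per solution x.\<close>

lemma sum_frac_char_incident:
 assumes m: "m \<ge> 1"
 shows "(\<Sum>b\<in>{b \<in> residue_box m. int m dvd incident r b}. frac_char b m n)
  = of_nat (m * card {x \<in> {0..<int m}. int m dvd fst n - x * snd r \<and> int m dvd snd n + x * fst r})"
proof -
 have "of_nat m * (\<Sum>b\<in>{b \<in> residue_box m. int m dvd incident r b}. frac_char b m n)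
   = (\<Sum>b\<in>residue_box m. (if int m dvd incident r b then of_nat m else 0) * frac_char b m n)"
  unfolding sum_distrib_left by (rule sum.mono_neutral_cong_left) auto
 also have "\<dots> = (\<Sum>b\<in>residue_box m. (\<Sum>x\<in>{0..<int m}. e2pi (of_int (x * incident r b) / real m)) * frac_char b m n)"
  unfolding sum_e2pi[OF m] ..
 also have "\<dots> = (\<Sum>x\<in>{0..<int m}. \<Sum>b\<in>residue_box m. e2pi (of_int (x * incident r b) / real m) * frac_char b m n)"
  unfolding sum_distrib_right by (rule sum.swap)
 also have "\<dots> = (\<Sum>x\<in>{0..<int m}. \<Sum>b\<in>residue_box m. frac_char b m (fst n - x * snd r, snd n + x * fst r))"
  by (intro sum.cong refl)
    (simp add: frac_char_def e2pi_add[symmetric] add_divide_distrib[symmetric] incident_def idot_def perp_def algebra_simps)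
 also have "\<dots> = (\<Sum>x\<in>{0..<int m}. if int m dvd fst n - x * snd r \<and> int m dvd snd n + x * fst r then of_nat m ^ 2 else 0)"
  unfolding sum_frac_char[OF m] by (intro sum.cong refl) (auto simp: vgcd_def)
 also have "\<dots> = of_nat (card {x \<in> {0..<int m}. int m dvd fst n - x * snd r \<and> int m dvd snd n + x * fst r}) * of_nat m ^ 2"
  by (subst sum.inter_filter[symmetric]) auto
 finally show ?thesis using m by (simp add: power2_eq_square)
qed

text \<open>With r = e c, the congruence between n and x times perp r modulo et forces e to divide
  n. After division by e it is a congruence modulo t with the primitive vector perp c, solvable
  exactly when t divides c . n/e, and then uniquely modulo t; this gives e solutions modulo
  et.\<close>

lemma card_incident_solutions:
 assumes c: "primitive c" and t: "t \<ge> 1" and e: "e \<ge> 1"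
 defines "r \<equiv> iscale (int e) c"
 shows "card {x \<in> {0..<int (e * t)}. int (e * t) dvd fst n - x * snd r \<and> int (e * t) dvd snd n + x * fst r}
  = (if int e dvd vgcd n \<and> int t dvd idot c n div int e then e else 0)"
proof (cases "int e dvd vgcd n")
 case False
 have "int e dvd fst n" "int e dvd snd n" if "int (e * t) dvd fst n - x * snd r" "int (e * t) dvd snd n + x * fst r" for x
 proof -
  have e1: "int e dvd fst n - x * snd r" "int e dvd snd n + x * fst r"
   using that by (auto intro: dvd_trans[of "int e" "int (e * t)"])
  have e2: "int e dvd x * snd r" "int e dvd x * fst r" by (auto simp: r_def iscale_def)
  show "int e dvd fst n" using dvd_add[OF e1(1) e2(1)] by simp
  show "int e dvd snd n" using dvd_diff[OF e1(2) e2(2)] by simp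
 qed
 then have "{x \<in> {0..<int (e * t)}. int (e * t) dvd fst n - x * snd r \<and> int (e * t) dvd snd n + x * fst r} = {}"
  using False by (auto simp: vgcd_def)
 then show ?thesis using False by (simp only: card.empty if_False simp_thms)
next
 case True
 then obtain n1 n2 where n: "fst n = int e * n1" "snd n = int e * n2"
  by (auto simp: vgcd_def elim!: dvdE)
 have e0: "int e \<noteq> 0" using e by simp
 have cn: "idot c n div int e = fst c * n1 + snd c * n2"
 proof -
  have "idot c n = int e * (fst c * n1 + snd c * n2)" by (simp add: idot_def n algebra_simps)
  then show ?thesis using e0 by simp
 qed
 have red: "int (e * t) dvd fst n - x * snd r \<longleftrightarrow> int t dvd n1 - x * snd c"
    "int (e * t) dvd snd n + x * fst r \<longleftrightarrow> int t dvd n2 + x * fst c" for x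
 proof -
  have "fst n - x * snd r = int e * (n1 - x * snd c)" "snd n + x * fst r = int e * (n2 + x * fst c)"
   by (simp_all add: n r_def iscale_def algebra_simps)
  then show "int (e * t) dvd fst n - x * snd r \<longleftrightarrow> int t dvd n1 - x * snd c"
    "int (e * t) dvd snd n + x * fst r \<longleftrightarrow> int t dvd n2 + x * fst c"
   using e0 by simp_all
 qed
 obtain u v where uv: "u * fst c + v * snd c = 1"
  using bezout_int[of "fst c" "snd c"] c unfolding primitive_def vgcd_def by auto
 show ?thesis
 proof (cases "int t dvd fst c * n1 + snd c * n2")
  case div: True
  \<comment> \<open>The solution comes from the Bezout relation u c1 + v c2 = 1; its two residuals
    are multiples of c . n/e.\<close>
  define x0 where "x0 = v * n1 - u * n2"
  have s1: "n1 - x0 * snd c = u * (fst c * n1 + snd c * n2)"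
  proof -
   have "n1 - x0 * snd c - u * (fst c * n1 + snd c * n2) = n1 * (1 - (u * fst c + v * snd c))"
    by (simp add: x0_def algebra_simps)
   then show ?thesis unfolding uv by simp
  qed
  have s2: "n2 + x0 * fst c = v * (fst c * n1 + snd c * n2)"
  proof -
   have "n2 + x0 * fst c - v * (fst c * n1 + snd c * n2) = n2 * (1 - (u * fst c + v * snd c))"
    by (simp add: x0_def algebra_simps)
   then show ?thesis unfolding uv by simp
  qed
  have iff: "int t dvd n1 - x * snd c \<and> int t dvd n2 + x * fst c \<longleftrightarrow> int t dvd x - x0" for x
  proof
   assume a: "int t dvd n1 - x * snd c \<and> int t dvd n2 + x * fst c"
   have "int t dvd (n1 - x0 * snd c) - (n1 - x * snd c)" "int t dvd (n2 + x * fst c) - (n2 + x0 * fst c)"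
    using a div unfolding s1 s2 by (auto intro!: dvd_diff)
   then have "int t dvd v * ((n1 - x0 * snd c) - (n1 - x * snd c)) + u * ((n2 + x * fst c) - (n2 + x0 * fst c))"
    by (intro dvd_add dvd_mult)
   also have "v * ((n1 - x0 * snd c) - (n1 - x * snd c)) + u * ((n2 + x * fst c) - (n2 + x0 * fst c)) = (x - x0) * (u * fst c + v * snd c)"
    by (simp add: algebra_simps)
   finally show "int t dvd x - x0" unfolding uv by simp
  next
   assume a: "int t dvd x - x0"
   have "n1 - x * snd c = (n1 - x0 * snd c) - (x - x0) * snd c" "n2 + x * fst c = (n2 + x0 * fst c) + (x - x0) * fst c"
    by (simp_all add: algebra_simps)
   then show "int t dvd n1 - x * snd c \<and> int t dvd n2 + x * fst c"
    using a div unfolding s1 s2 by (auto intro!: dvd_diff dvd_add)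
  qed
  show ?thesis
   using div True card_progression[OF t, of e x0] unfolding red iff cn by simp
 next
  case nd: False
  have "int t dvd fst c * n1 + snd c * n2" if "int t dvd n1 - x * snd c" "int t dvd n2 + x * fst c" for x
  proof -
   have "int t dvd fst c * (n1 - x * snd c) + snd c * (n2 + x * fst c)"
    by (rule dvd_add[OF dvd_mult[OF that(1)] dvd_mult[OF that(2)]])
   also have "fst c * (n1 - x * snd c) + snd c * (n2 + x * fst c) = fst c * n1 + snd c * n2"
    by (simp add: algebra_simps)
   finally show ?thesis .
  qed
  then have E: "{x \<in> {0..<int (e * t)}. int t dvd n1 - x * snd c \<and> int t dvd n2 + x * fst c} = {}"
   using nd by blast
  show ?thesis unfolding red cn E using nd by simp
 qed
qed

lemma finite_primitive_residues [simp]: "finite (primitive_residues q)"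
 by (rule finite_subset[of _ "residue_box q"]) (auto simp: primitive_residues_def residue_box_def)

text \<open>Every b/m has a unique form a/q in lowest terms, with m/q = gcd(b, m).\<close>

lemma sum_primitive_residues_divisors:
 fixes H :: "int \<times> int \<Rightarrow> complex"
 assumes m: "m \<ge> 1"
 shows "(\<Sum>q\<in>{q. q dvd m}. \<Sum>a\<in>primitive_residues q. H (iscale (int (m div q)) a)) = (\<Sum>b\<in>residue_box m. H b)"
proof -
 have fin: "finite {q. q dvd m}" using m by auto
 define g where "g b = nat (vgcd_mod b m)" for b
 have g: "g b dvd m" "int (g b) dvd fst b" "int (g b) dvd snd b" "g b \<ge> 1" for b
 proof -
  have "vgcd_mod b m > 0" using m by (simp add: vgcd_mod_def)
  then have i: "int (g b) = vgcd_mod b m" by (simp add: g_def)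
  show "int (g b) dvd fst b" "int (g b) dvd snd b" unfolding i vgcd_mod_def vgcd_def by (auto intro: dvd_trans)
  have "int (g b) dvd int m" unfolding i vgcd_mod_def by simp
  then show "g b dvd m" by simp
  show "g b \<ge> 1" using m \<open>vgcd_mod b m > 0\<close> by (simp add: g_def)
 qed
 have "(\<Sum>q\<in>{q. q dvd m}. \<Sum>a\<in>primitive_residues q. H (iscale (int (m div q)) a))
  = (\<Sum>(q, a)\<in>(SIGMA q:{q. q dvd m}. primitive_residues q). H (iscale (int (m div q)) a))"
  by (rule sum.Sigma) (use fin in auto)
 also have "\<dots> = (\<Sum>b\<in>residue_box m. H b)"
 proof (rule sum.reindex_bij_witness[where i="\<lambda>b. (m div g b, (fst b div int (g b), snd b div int (g b)))"
    and j="\<lambda>(q, a). iscale (int (m div q)) a"])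
  fix p assume "p \<in> (SIGMA q:{q. q dvd m}. primitive_residues q)"
  then obtain q a where p: "p = (q, a)" "q dvd m" "a \<in> primitive_residues q" by auto
  then have q: "q \<ge> 1" using m by (cases q) auto
  define k where "k = m div q"
  have mk: "m = q * k" "k \<ge> 1" using p m by (auto simp: k_def Suc_le_eq intro: Nat.gr0I)
  have a: "0 \<le> fst a" "fst a < int q" "0 \<le> snd a" "snd a < int q" "gcd (gcd (fst a) (snd a)) (int q) = 1"
   using p(3) by (auto simp: primitive_residues_def vgcd_mod_def vgcd_def)
  have "vgcd_mod (iscale (int k) a) m = gcd (gcd (int k * fst a) (int k * snd a)) (int k * int q)"
   by (simp add: vgcd_mod_def vgcd_def iscale_def mk mult.commute)
  also have "\<dots> = int k * gcd (gcd (fst a) (snd a)) (int q)"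
   by (simp add: gcd_mult_left abs_mult)
  finally have gk: "g (iscale (int k) a) = k" using a(5) by (simp add: g_def)
  show "(\<lambda>b. (m div g b, (fst b div int (g b), snd b div int (g b)))) (case p of (q, a) \<Rightarrow> iscale (int (m div q)) a) = p"
   unfolding p(1) prod.case k_def[symmetric] gk using mk by (simp add: iscale_def)
  show "(case p of (q, a) \<Rightarrow> iscale (int (m div q)) a) \<in> residue_box m"
   unfolding p(1) prod.case k_def[symmetric] using a mk by (simp add: iscale_def residue_box_def)
  show "H (case p of (q, a) \<Rightarrow> iscale (int (m div q)) a) = (case p of (q, a) \<Rightarrow> H (iscale (int (m div q)) a))"
   by (simp add: p)
 next
  fix b assume b: "b \<in> residue_box m"
  define k where "k = g b"
  obtain q where mq: "m = k * q" using g(1)[of b] by (auto simp: k_def elim: dvdE)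
  have k: "k \<ge> 1" using g(4) by (simp add: k_def)
  then have q: "m div k = q" "q \<ge> 1" using mq m by (auto simp: Suc_le_eq intro: Nat.gr0I)
  obtain a1 a2 where a: "fst b = int k * a1" "snd b = int k * a2"
   using g(2,3)[of b] by (auto simp: k_def elim!: dvdE)
  have bb: "0 \<le> int k * a1" "int k * a1 < int k * int q" "0 \<le> int k * a2" "int k * a2 < int k * int q"
   using b by (auto simp: residue_box_def mq a[symmetric])
  have ab: "0 \<le> a1" "a1 < int q" "0 \<le> a2" "a2 < int q"
   using bb k by (auto simp: zero_le_mult_iff)
  have "int k = vgcd_mod b m" using k by (simp add: k_def g_def)
  also have "\<dots> = gcd (gcd (int k * a1) (int k * a2)) (int k * int q)"
   by (simp add: vgcd_mod_def vgcd_def a mq)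
  also have "\<dots> = int k * gcd (gcd a1 a2) (int q)" by (simp add: gcd_mult_left abs_mult)
  finally have "gcd (gcd a1 a2) (int q) = 1" using k by simp
  then have pr: "(a1, a2) \<in> primitive_residues q"
   using ab by (simp add: primitive_residues_def vgcd_mod_def vgcd_def)
  have w: "(m div g b, (fst b div int (g b), snd b div int (g b))) = (q, (a1, a2))"
   unfolding k_def[symmetric] a q using k by simp
  show "(case (m div g b, (fst b div int (g b), snd b div int (g b))) of (q, a) \<Rightarrow> iscale (int (m div q)) a) = b"
   unfolding w prod.case using mq q a by (simp add: iscale_def prod_eq_iff)
  show "(m div g b, (fst b div int (g b), snd b div int (g b))) \<in> (SIGMA q:{q. q dvd m}. primitive_residues q)"
   unfolding w using pr mq by simp
 qed
 finally show ?thesis .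
qed

lemma frac_char_iscale:
 assumes "q dvd m" "m \<ge> 1"
 shows "frac_char (iscale (int (m div q)) a) m n = frac_char a q n"
proof -
 obtain k where k: "m = q * k" using assms by auto
 have "q > 0" "k > 0" using assms k by (auto intro: Nat.gr0I)
 have "real_of_int (idot (iscale (int (m div q)) a) n) / real m = (real k * of_int (idot a n)) / (real k * real q)"
  using \<open>q > 0\<close> by (simp add: idot_def iscale_def k algebra_simps)
 also have "\<dots> = of_int (idot a n) / real q" using \<open>k > 0\<close> by simp
 finally show ?thesis by (simp only: frac_char_def)
qed

lemma incident_iscale_dvd:
 assumes "q dvd m" "m \<ge> 1"
 shows "int m dvd incident r (iscale (int (m div q)) a) \<longleftrightarrow> int q dvd incident r a"
proof -
 obtain k where k: "m = q * k" using assms by auto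
 have "q > 0" "k > 0" using assms k by (auto intro: Nat.gr0I)
 then show ?thesis by (simp add: incident_iscale k mult.commute)
qed

lemma ramanujan_sum_divisors:
 assumes m: "m \<ge> 1"
 shows "(\<Sum>q\<in>{q. q dvd m}. \<Sum>a\<in>primitive_residues q. frac_char a q n) = (if int m dvd vgcd n then of_nat m ^ 2 else 0)"
proof -
 have "(\<Sum>q\<in>{q. q dvd m}. \<Sum>a\<in>primitive_residues q. frac_char a q n)
  = (\<Sum>q\<in>{q. q dvd m}. \<Sum>a\<in>primitive_residues q. frac_char (iscale (int (m div q)) a) m n)"
  using m by (intro sum.cong refl) (simp add: frac_char_iscale)
 then show ?thesis using sum_primitive_residues_divisors[OF m, of "\<lambda>b. frac_char b m n"] sum_frac_char[OF m, of n] by simp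
qed

text \<open>The incidence condition for a modulo q is the one for (m/q) a modulo m, so reduction to
  lowest terms turns the double sum into one complete sum modulo m = et.\<close>

lemma incident_sum_divisors:
 assumes c: "primitive c" and t: "t \<ge> 1" and e: "e \<ge> 1"
 shows "(\<Sum>q\<in>{q. q dvd e * t}. \<Sum>a\<in>{a \<in> primitive_residues q. int q dvd incident (iscale (int e) c) a}. frac_char a q n)
  = (if int e dvd vgcd n \<and> int t dvd idot c n div int e then of_nat (e * t) * of_nat e else 0)"
proof -
 define m where "m = e * t"
 define r where "r = iscale (int e) c"
 have m: "m \<ge> 1" using t e by (simp add: m_def)
 let ?H = "\<lambda>b. if int m dvd incident r b then frac_char b m n else 0"
 have "(\<Sum>a\<in>{a \<in> primitive_residues q. int q dvd incident r a}. frac_char a q n)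
   = (\<Sum>a\<in>primitive_residues q. ?H (iscale (int (m div q)) a))" if "q dvd m" for q
  using that m by (subst sum.inter_filter) (auto simp: frac_char_iscale incident_iscale_dvd intro!: sum.cong)
 then have "(\<Sum>q\<in>{q. q dvd m}. \<Sum>a\<in>{a \<in> primitive_residues q. int q dvd incident r a}. frac_char a q n)
  = (\<Sum>q\<in>{q. q dvd m}. \<Sum>a\<in>primitive_residues q. ?H (iscale (int (m div q)) a))" by simp
 also have "\<dots> = (\<Sum>b\<in>residue_box m. ?H b)" by (rule sum_primitive_residues_divisors[OF m])
 also have "\<dots> = (\<Sum>b\<in>{b \<in> residue_box m. int m dvd incident r b}. frac_char b m n)"
  by (rule sum.inter_filter[symmetric]) simp
 also have "\<dots> = of_nat (m * (if int e dvd vgcd n \<and> int t dvd idot c n div int e then e else 0))"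
  using sum_frac_char_incident[OF m, where r=r and n=n] card_incident_solutions[OF c t e, of n]
  unfolding m_def r_def by (simp only:)
 finally show ?thesis by (simp add: m_def r_def)
qed


section \<open>Arc integrals by Fourier inversion\<close>

lemma fourier_transform_measurable:
 fixes f :: "real \<times> real \<Rightarrow> complex"
 assumes [measurable]: "f \<in> borel_measurable borel"
 shows "(\<lambda>w. LINT x|lborel. f x * e2pi (- (w \<bullet> x))) \<in> borel_measurable borel"
proof -
 have "(\<lambda>p :: (real \<times> real) \<times> (real \<times> real). e2pi (- (fst p \<bullet> snd p))) \<in> borel_measurable borel"
  by (intro borel_measurable_continuous_onI continuous_intros)
 then have "(\<lambda>(w, x). f x * e2pi (- (w \<bullet> x))) \<in> borel_measurable (borel \<Otimes>\<^sub>M lborel)"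
  by (simp add: case_prod_beta' borel_prod cong: measurable_cong_sets)
 then show ?thesis
  by (rule sigma_finite_measure.borel_measurable_lebesgue_integral[OF sigma_finite_lborel])
qed

text \<open>The fourth power dominates the product of 1 + (b w1)^2 and 1 + (b w2)^2, whose
  reciprocal is integrable over the plane by Fubini. This is the exponent at which the bounds on p1
  and p2 are invoked later.\<close>

lemma integrable_quartic_decay:
 fixes F :: "real \<times> real \<Rightarrow> complex"
 assumes [measurable]: "F \<in> borel_measurable borel" and b: "b > 0"
  and bd: "\<And>w. norm (F w) \<le> C / (1 + b * norm w) ^ 4"
 shows "integrable lborel F"
proof -
 define g where "g x = complex_of_real (inverse (1 + (0 + b * x)\<^sup>2))" for x :: real
 have "integrable lborel (\<lambda>x::real. inverse (1 + x\<^sup>2))"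
  using integrable_inverse_1_plus_square by (simp add: set_integrable_def einterval_eq)
 then have g: "integrable lborel g"
  unfolding g_def using lborel_integrable_real_affine[of "\<lambda>x. inverse (1 + x\<^sup>2)" b 0] b
  by (intro integrable_of_real) auto
 have C: "C \<ge> 0" using order_trans[OF norm_ge_zero bd[of 0]] by simp
 have "integrable lborel (\<lambda>p. of_real C * (g (fst p) * g (snd p)))"
  using integrable_product_lborel[OF g g] by (intro integrable_mult_right) (simp add: lborel_prod case_prod_beta')
 then show ?thesis
 proof (rule Bochner_Integration.integrable_bound)
  show "AE w in lborel. norm (F w) \<le> norm (of_real C * (g (fst w) * g (snd w)))"
  proof (rule AE_I2)
   fix w :: "real \<times> real"
   have le: "1 + (b * x)\<^sup>2 \<le> (1 + b * norm w)\<^sup>2" if "\<bar>x\<bar> \<le> norm w" for x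
   proof -
    have "(b * x)\<^sup>2 \<le> (b * norm w)\<^sup>2" using that b by (intro power2_le_iff_abs_le[THEN iffD2]) (auto simp: abs_mult)
    moreover have "0 \<le> b * norm w" using b by simp
    ultimately show ?thesis unfolding power2_sum one_power2 by linarith
   qed
   have "(1 + (b * fst w)\<^sup>2) * (1 + (b * snd w)\<^sup>2) \<le> (1 + b * norm w)\<^sup>2 * (1 + b * norm w)\<^sup>2"
    by (intro mult_mono le abs_fst_le_norm abs_snd_le_norm) auto
   also have "\<dots> = (1 + b * norm w) ^ 4" by (simp add: power_add[symmetric])
   finally have P: "(1 + (b * fst w)\<^sup>2) * (1 + (b * snd w)\<^sup>2) \<le> (1 + b * norm w) ^ 4" .
   have pos: "(1 + (b * fst w)\<^sup>2) * (1 + (b * snd w)\<^sup>2) > 0" by (intro mult_pos_pos add_pos_nonneg) auto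
   have "norm (F w) \<le> C / (1 + b * norm w) ^ 4" by (rule bd)
   also have "\<dots> \<le> C / ((1 + (b * fst w)\<^sup>2) * (1 + (b * snd w)\<^sup>2))"
    by (rule divide_left_mono[OF P C mult_pos_pos[OF less_le_trans[OF pos P] pos]])
   also have "\<dots> = norm (of_real C * (g (fst w) * g (snd w)))"
   proof -
    have ng: "norm (g x) = 1 / (1 + (b * x)\<^sup>2)" for x
     unfolding g_def norm_of_real by (simp add: divide_inverse)
    show ?thesis unfolding norm_mult norm_of_real ng abs_of_nonneg[OF C] by simp
   qed
   finally show "norm (F w) \<le> norm (of_real C * (g (fst w) * g (snd w)))" .
  qed
 qed simp
qed

text \<open>The phase of a/q is constant in w; what remains is the inversion integral at n,
  legitimate once F is integrable.\<close>

lemma arc_integral_fourier: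
 fixes f :: "real \<times> real \<Rightarrow> complex"
 assumes f: "continuous_on UNIV f" "\<And>x. norm x > R \<Longrightarrow> f x = 0"
  and F: "F = (\<lambda>w. LINT x|lborel. f x * e2pi (- (w \<bullet> x)))"
  and b: "b > 0" and bd: "\<And>w. norm (F w) \<le> C / (1 + b * norm w) ^ 4"
 shows "integrable lborel F" "arc_integral F a q n = frac_char a q n * f (rvec n)"
proof -
 have fm: "f \<in> borel_measurable borel" by (rule borel_measurable_continuous_onI[OF f(1)])
 have Fm: "F \<in> borel_measurable borel" unfolding F by (rule fourier_transform_measurable[OF fm])
 show int: "integrable lborel F" by (rule integrable_quartic_decay[OF Fm b bd])
 obtain B where B: "\<And>x. norm (f x) \<le> B"
 proof -
  have "bounded (f ` cball 0 R)"
   by (rule compact_imp_bounded[OF compact_continuous_image[OF continuous_on_subset[OF f(1)]]]) auto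
  then obtain B where B: "\<And>x. x \<in> cball 0 R \<Longrightarrow> norm (f x) \<le> B" unfolding bounded_iff by blast
  have "norm (f x) \<le> max B 0" for x
   using B[of x] f(2)[of x] by (cases "norm x \<le> R") (auto simp: le_max_iff_disj)
  then show ?thesis by (rule that)
 qed
 have inv: "(LINT w|lborel. F w * e2pi (w \<bullet> rvec n)) = f (rvec n)"
  using fourier_inversion_pair[OF f(1) B compact_support_integrable[OF f]] int unfolding F by blast
 have "arc_integral F a q n = (LINT w|lborel. frac_char a q n * (F w * e2pi (w \<bullet> rvec n)))"
  unfolding arc_integral_def
 proof (rule Bochner_Integration.integral_cong[OF refl])
  fix w
  have "((1 / real q) *\<^sub>R rvec a + w) \<bullet> rvec n = of_int (idot a n) / real q + w \<bullet> rvec n"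
   by (simp add: inner_add_left rvec_def idot_def inner_prod_def add_divide_distrib distrib_right)
  then show "F w * e2pi (((1 / real q) *\<^sub>R rvec a + w) \<bullet> rvec n) = frac_char a q n * (F w * e2pi (w \<bullet> rvec n))"
   by (simp add: e2pi_add frac_char_def)
 qed
 then show "arc_integral F a q n = frac_char a q n * f (rvec n)" by (simp add: inv)
qed

context delta_weights
begin

definition cut :: "real \<Rightarrow> int \<times> int \<Rightarrow> real" where
 "cut Q n = \<omega>0 (norm ((1 / Q powr (3/2)) *\<^sub>R rvec n))"

lemma cut_support:
 assumes "Q \<ge> 1" "cut Q n \<noteq> 0"
 shows "norm (rvec n) < Q powr (3/2) / 2"
proof (rule ccontr)
 assume "\<not> norm (rvec n) < Q powr (3/2) / 2"
 then have "1/2 \<le> norm (rvec n) / Q powr (3/2)" using powr_Q(2)[OF assms(1)] by (simp add: field_simps)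
 then have "1/2 \<le> \<bar>norm ((1 / Q powr (3/2)) *\<^sub>R rvec n)\<bar>" unfolding norm_divide_scaleR[OF powr_ge_zero] by linarith
 then show False using \<omega>0_outside assms(2) unfolding cut_def by blast
qed

lemma \<omega>0_scaled_0:
 assumes "Q \<ge> 1" "norm (x :: real \<times> real) > Q powr (3/2)"
 shows "\<omega>0 (norm ((1 / Q powr (3/2)) *\<^sub>R x)) = 0"
proof -
 have "norm x / Q powr (3/2) > 1" using powr_Q(2)[OF assms(1)] assms(2) by (simp add: pos_less_divide_eq)
 then have "1/2 \<le> \<bar>norm ((1 / Q powr (3/2)) *\<^sub>R x)\<bar>" unfolding norm_divide_scaleR[OF powr_ge_zero] by linarith
 then show ?thesis by (rule \<omega>0_outside)
qed

lemma arc_integral_p2: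
 assumes Q: "Q \<ge> 1" and r: "1/2 * Q powr (1/2) \<le> norm (rvec r)" "norm (rvec r) \<le> Q powr (1/2)"
  and kq: "k \<ge> 1" "q \<ge> 1" and J: "real J * (real k * real q / Q) \<ge> 1"
 shows "integrable lborel (p2' Q r k q)"
  and "arc_integral (p2' Q r k q) a q n = frac_char a q n * of_real (c_const \<omega> / Q ^ 3 * (cut Q n * h_sum J (real k * real q / Q) ((rvec r \<bullet> rvec n) / Q\<^sup>2)))"
proof -
 define f where "f x = complex_of_real (c_const \<omega> / Q ^ 3 * (\<omega>0 (norm ((1 / Q powr (3/2)) *\<^sub>R x)) * h_sum J (real k * real q / Q) ((rvec r \<bullet> x) / Q\<^sup>2)))" for x
 have F: "p2' Q r k q = (\<lambda>w. LINT x|lborel. f x * e2pi (- (w \<bullet> x)))"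
  unfolding p2_def p2_integrand_eq[OF Q r(2) kq J] f_def of_real_mult[of "c_const \<omega> / Q ^ 3"] mult.assoc integral_mult_right_zero ..
 have y: "real k * real q / Q > 0" using kq Q by auto
 have cont: "continuous_on UNIV f" unfolding f_def using y Q by (intro continuous_intros) auto
 have supp: "f x = 0" if "norm x > Q powr (3/2)" for x
  using \<omega>0_scaled_0[OF Q that] by (simp add: f_def)
 obtain C where C: "C \<ge> 0" "\<And>Q w k q r. Q \<ge> 1 \<Longrightarrow> k \<ge> 1 \<Longrightarrow> q \<ge> 1 \<Longrightarrow> 1/2 * Q powr (1/2) \<le> norm (rvec r) \<Longrightarrow> norm (rvec r) \<le> Q powr (1/2) \<Longrightarrow>
  cmod (p2' Q r k q w) \<le> C / (1 + norm w * real k * real q * Q powr (1/2) + \<bar>w \<bullet> perp (rvec r)\<bar> * Q) ^ 4"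
  using p2_bound_power[of 4] by blast
 define b where "b = real k * real q * Q powr (1/2)"
 have b: "b > 0" unfolding b_def using kq Q by (intro mult_pos_pos) auto
 have bd: "norm (p2' Q r k q w) \<le> C / (1 + b * norm w) ^ 4" for w
 proof -
  have "1 + b * norm w \<le> 1 + norm w * real k * real q * Q powr (1/2) + \<bar>w \<bullet> perp (rvec r)\<bar> * Q"
   using Q by (simp add: b_def mult_ac)
  moreover have "1 + b * norm w > 0" using b by (intro add_pos_nonneg) auto
  ultimately have "C / (1 + norm w * real k * real q * Q powr (1/2) + \<bar>w \<bullet> perp (rvec r)\<bar> * Q) ^ 4 \<le> C / (1 + b * norm w) ^ 4"
   using C(1) by (intro divide_left_mono power_mono mult_pos_pos zero_less_power) auto
  then show ?thesis using C(2)[OF Q kq r, of w] by linarith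
 qed
 note * = arc_integral_fourier[OF cont supp F b bd]
 show "integrable lborel (p2' Q r k q)" by (rule *(1))
 show "arc_integral (p2' Q r k q) a q n = frac_char a q n * of_real (c_const \<omega> / Q ^ 3 * (cut Q n * h_sum J (real k * real q / Q) ((rvec r \<bullet> rvec n) / Q\<^sup>2)))"
  using *(2) unfolding f_def cut_def .
qed

lemma arc_integral_p1:
 assumes Q: "Q \<ge> 1" and q: "q \<ge> 1" "real q \<le> Q" and J: "\<And>j. j > J \<Longrightarrow> real j * real q \<ge> Q"
 shows "integrable lborel (p1' Q q)"
  and "arc_integral (p1' Q q) a q n = frac_char a q n * of_real (- (2 * c_const \<omega> / Q) *
   (cut Q n * (\<Sum>j\<in>{1..J}. 1 / (real (q * j))\<^sup>2 * \<omega> (norm (rvec n) / (real (q * j) * Q powr (1/2))))))"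
proof -
 define f where "f x = complex_of_real (- (2 * c_const \<omega> / Q) * (\<Sum>j\<in>{1..J}. 1 / ((real q)\<^sup>2 * (real j)\<^sup>2) *
   (\<omega>0 (norm ((1 / Q powr (3/2)) *\<^sub>R x)) * \<omega> (norm ((1 / (real j * real q * Q powr (1/2))) *\<^sub>R x)))))" for x :: "real \<times> real"
 have F: "p1' Q q = (\<lambda>w. LINT x|lborel. f x * e2pi (- (w \<bullet> x)))"
 proof
  fix w
  have "p1' Q q w = - of_real (2 * c_const \<omega> / Q) * (LINT x|lborel. of_real (\<Sum>j\<in>{1..J}. 1 / ((real q)\<^sup>2 * (real j)\<^sup>2) *
   (\<omega>0 (norm ((1 / Q powr (3/2)) *\<^sub>R x)) * \<omega> (norm ((1 / (real j * real q * Q powr (1/2))) *\<^sub>R x)))) * e2pi (- (w \<bullet> x)))"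
   unfolding p1_def
   by (intro arg_cong2[where f="(*)"] refl Bochner_Integration.integral_cong, subst p1_integrand_eq[OF Q q(1) J]) auto
  also have "\<dots> = (LINT x|lborel. f x * e2pi (- (w \<bullet> x)))"
   unfolding f_def of_real_mult[of "- (2 * c_const \<omega> / Q)"] mult.assoc integral_mult_right_zero of_real_minus ..
  finally show "p1' Q q w = (LINT x|lborel. f x * e2pi (- (w \<bullet> x)))" .
 qed
 have cont: "continuous_on UNIV f" unfolding f_def by (intro continuous_intros)
 have supp: "f x = 0" if "norm x > Q powr (3/2)" for x
  using \<omega>0_scaled_0[OF Q that] by (simp add: f_def)
 obtain C where C: "C \<ge> 0" "\<And>Q q w. Q \<ge> 1 \<Longrightarrow> 1 \<le> q \<Longrightarrow> real q \<le> Q \<Longrightarrow>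
   cmod (p1' Q q w) \<le> C * (Q / (real q * (1 + norm w * Q powr (3/2)))) / (1 + norm w * real q * Q powr (1/2)) ^ 4"
  using p1_bound_power[of 4] by blast
 define b where "b = real q * Q powr (1/2)"
 have b: "b > 0" unfolding b_def using q Q by (intro mult_pos_pos) auto
 have bd: "norm (p1' Q q w) \<le> (C * Q) / (1 + b * norm w) ^ 4" for w
 proof -
  have p: "1 + b * norm w > 0" using b by (intro add_pos_nonneg) auto
  have "1 * 1 \<le> real q * (1 + norm w * Q powr (3/2))" using q by (intro mult_mono) auto
  then have "Q / (real q * (1 + norm w * Q powr (3/2))) \<le> Q / 1" using Q by (intro divide_left_mono) auto
  then have "C * (Q / (real q * (1 + norm w * Q powr (3/2)))) \<le> C * Q" using C(1) by (intro mult_left_mono) auto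
  then have "C * (Q / (real q * (1 + norm w * Q powr (3/2)))) / (1 + b * norm w) ^ 4 \<le> C * Q / (1 + b * norm w) ^ 4"
   using p by (intro divide_right_mono) auto
  moreover have eq: "1 + norm w * real q * Q powr (1/2) = 1 + b * norm w" by (simp add: b_def mult_ac)
  ultimately show ?thesis using C(2)[OF Q q, of w, unfolded eq] by linarith
 qed
 note * = arc_integral_fourier[OF cont supp F b bd]
 show "integrable lborel (p1' Q q)" by (rule *(1))
 have "f (rvec n) = of_real (- (2 * c_const \<omega> / Q) *
   (cut Q n * (\<Sum>j\<in>{1..J}. 1 / (real (q * j))\<^sup>2 * \<omega> (norm (rvec n) / (real (q * j) * Q powr (1/2))))))"
  unfolding f_def cut_def sum_distrib_left[of "\<omega>0 _"]
 proof (rule arg_cong[where f=complex_of_real], rule arg_cong2[where f="(*)"], rule refl, rule sum.cong, rule refl)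
  fix j
  have "real j * real q * Q powr (1/2) \<ge> 0" by simp
  then show "1 / ((real q)\<^sup>2 * (real j)\<^sup>2) * (\<omega>0 (norm ((1 / Q powr (3/2)) *\<^sub>R rvec n)) * \<omega> (norm ((1 / (real j * real q * Q powr (1/2))) *\<^sub>R rvec n)))
   = \<omega>0 (norm ((1 / Q powr (3/2)) *\<^sub>R rvec n)) * (1 / (real (q * j))\<^sup>2 * \<omega> (norm (rvec n) / (real (q * j) * Q powr (1/2))))"
   unfolding norm_divide_scaleR[OF \<open>real j * real q * Q powr (1/2) \<ge> 0\<close>]
   by (simp only: of_nat_mult power_mult_distrib mult.commute[of "real j" "real q"] mult.left_commute)
 qed
 then show "arc_integral (p1' Q q) a q n = frac_char a q n * of_real (- (2 * c_const \<omega> / Q) *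
   (cut Q n * (\<Sum>j\<in>{1..J}. 1 / (real (q * j))\<^sup>2 * \<omega> (norm (rvec n) / (real (q * j) * Q powr (1/2))))))"
  using *(2) by simp
qed

end


section \<open>Summation over moduli and residues\<close>

text \<open>As j varies, m = lcm(e, q) j runs through the common multiples of e and q up to M.
  Writing m = et instead, the same pairs are described by t and a divisor q of et.\<close>

lemma sum_divisor_swap:
 fixes G :: "nat \<Rightarrow> nat \<Rightarrow> complex"
 assumes e: "e \<ge> 1"
 shows "(\<Sum>q\<in>{1..M}. \<Sum>j\<in>{1..M div lcm e q}. G q (lcm e q * j)) = (\<Sum>t\<in>{1..M div e}. \<Sum>q\<in>{q. q dvd e * t}. G q (e * t))"
proof -
 have fin: "finite {q. q dvd e * t}" if "t \<in> {1..M div e}" for t using that e by (intro finite_divisors_nat) auto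
 have "(\<Sum>q\<in>{1..M}. \<Sum>j\<in>{1..M div lcm e q}. G q (lcm e q * j))
   = (\<Sum>(q, j)\<in>(SIGMA q:{1..M}. {1..M div lcm e q}). G q (lcm e q * j))"
  by (rule sum.Sigma) auto
 also have "\<dots> = (\<Sum>(t, q)\<in>(SIGMA t:{1..M div e}. {q. q dvd e * t}). G q (e * t))"
 proof (rule sum.reindex_bij_witness[where i="\<lambda>(t, q). (q, e * t div lcm e q)" and j="\<lambda>(q, j). (lcm e q * j div e, q)"])
  fix p assume "p \<in> (SIGMA q:{1..M}. {1..M div lcm e q})"
  then obtain q j where p: "p = (q, j)" "1 \<le> q" "q \<le> M" "1 \<le> j" "j \<le> M div lcm e q" by auto
  have l: "lcm e q \<ge> 1" using p e by (simp add: Suc_le_eq lcm_pos_nat)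
  have dv: "e dvd lcm e q * j" by simp
  then have et: "e * (lcm e q * j div e) = lcm e q * j" by simp
  have "lcm e q * j \<le> M" using p l by (metis div_times_less_eq_dividend le_trans mult.commute mult_le_mono2)
  then have le: "lcm e q * j div e \<le> M div e" by (rule div_le_mono)
  have pos: "lcm e q * j div e \<ge> 1" using et l p by (metis One_nat_def Suc_leI gr0I mult_eq_0_iff not_one_le_zero)
  show "(case case p of (q, j) \<Rightarrow> (lcm e q * j div e, q) of (t, q) \<Rightarrow> (q, e * t div lcm e q)) = p"
   using l by (simp add: p et)
  show "(case p of (q, j) \<Rightarrow> (lcm e q * j div e, q)) \<in> (SIGMA t:{1..M div e}. {q. q dvd e * t})"
   using le pos by (auto simp: p et)
  show "(case case p of (q, j) \<Rightarrow> (lcm e q * j div e, q) of (t, q) \<Rightarrow> G q (e * t)) = (case p of (q, j) \<Rightarrow> G q (lcm e q * j))"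
   by (simp add: p et)
 next
  fix p assume "p \<in> (SIGMA t:{1..M div e}. {q. q dvd e * t})"
  then obtain t q where p: "p = (t, q)" "1 \<le> t" "t \<le> M div e" "q dvd e * t" by auto
  have et: "e * t \<ge> 1" using p e by (simp add: Suc_le_eq)
  have "e * t \<le> M" using p e by (metis div_times_less_eq_dividend le_trans mult.commute mult_le_mono2)
  have dv: "lcm e q dvd e * t" using p by (intro lcm_least) auto
  then have el: "lcm e q * (e * t div lcm e q) = e * t" by simp
  have q: "1 \<le> q" "q \<le> M" using p et \<open>e * t \<le> M\<close> dvd_imp_le[OF p(4)] by (auto simp: Suc_le_eq intro: Nat.gr0I)
  have j: "1 \<le> e * t div lcm e q" "e * t div lcm e q \<le> M div lcm e q"
   using el et \<open>e * t \<le> M\<close> by (auto simp: Suc_le_eq intro!: Nat.gr0I div_le_mono)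
  show "(case case p of (t, q) \<Rightarrow> (q, e * t div lcm e q) of (q, j) \<Rightarrow> (lcm e q * j div e, q)) = p"
   using e by (simp add: p el)
  show "(case p of (t, q) \<Rightarrow> (q, e * t div lcm e q)) \<in> (SIGMA q:{1..M}. {1..M div lcm e q})"
   using q j by (simp add: p)
 qed
 also have "\<dots> = (\<Sum>t\<in>{1..M div e}. \<Sum>q\<in>{q. q dvd e * t}. G q (e * t))"
  by (rule sum.Sigma[symmetric]) (use fin in auto)
 finally show ?thesis .
qed

lemma sum_mult_sum_swap:
 fixes f w :: "_ \<Rightarrow> complex"
 shows "(\<Sum>a\<in>A. k * (\<Sum>j\<in>B. f a * w j)) = k * (\<Sum>j\<in>B. (\<Sum>a\<in>A. f a) * w j)"
proof -
 have "(\<Sum>j\<in>B. (\<Sum>a\<in>A. f a) * w j) = (\<Sum>a\<in>A. \<Sum>j\<in>B. f a * w j)"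
  unfolding sum_distrib_right by (rule sum.swap)
 then show ?thesis by (simp add: sum_distrib_left)
qed

lemma norm_rvec_perp [simp]: "norm (rvec (perp n)) = norm (rvec n)"
 by (simp add: rvec_def perp_def norm_prod_def add.commute)

lemma norm_rvec_iscale [simp]: "norm (rvec (iscale k n)) = \<bar>of_int k\<bar> * norm (rvec n)"
proof -
 have "rvec (iscale k n) = of_int k *\<^sub>R rvec n" by (simp add: rvec_def iscale_def)
 then show ?thesis by simp
qed

lemma vgcd_eq_0_iff: "vgcd r = 0 \<longleftrightarrow> r = 0"
 by (cases r) (auto simp: vgcd_def zero_prod_def)

lemma vgcd_le_norm:
 assumes "r \<noteq> 0"
 shows "of_int (vgcd r) \<le> norm (rvec r)"
proof -
 have "vgcd r \<le> max \<bar>fst r\<bar> \<bar>snd r\<bar>"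
 proof (cases "fst r = 0")
  case True
  then show ?thesis by (simp add: vgcd_def)
 next
  case False
  then have "vgcd r \<le> \<bar>fst r\<bar>" unfolding vgcd_def by (metis abs_gcd_int dvd_imp_le_int gcd_dvd1)
  then show ?thesis by simp
 qed
 then have "real_of_int (vgcd r) \<le> max \<bar>of_int (fst r)\<bar> \<bar>of_int (snd r)\<bar>" by (simp add: le_max_iff_disj) linarith
 then show ?thesis using abs_fst_le_norm[of "rvec r"] abs_snd_le_norm[of "rvec r"] by (auto simp: rvec_def)
qed

lemma obtain_primitive:
 assumes "r \<noteq> 0"
 obtains c where "primitive c" "r = iscale (vgcd r) c"
proof -
 have g: "vgcd r \<noteq> 0" using assms vgcd_eq_0_iff by simp
 have d: "vgcd r dvd fst r" "vgcd r dvd snd r" by (simp_all add: vgcd_def)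
 have "gcd (fst r div vgcd r) (snd r div vgcd r) = 1"
  using g unfolding vgcd_def by (intro div_gcd_coprime[unfolded coprime_iff_gcd_eq_1]) auto
 then show ?thesis
  using d by (intro that[of "(fst r div vgcd r, snd r div vgcd r)"]) (auto simp: primitive_def vgcd_def iscale_def prod_eq_iff)
qed

lemma primitive_orthogonal:
 assumes c: "primitive c" and o: "idot c m = 0"
 obtains s where "m = iscale s (perp c)"
proof -
 obtain u v where uv: "u * fst c + v * snd c = 1"
  using bezout_int[of "fst c" "snd c"] c unfolding primitive_def vgcd_def by auto
 have o': "fst c * fst m = - (snd c * snd m)" using o by (simp add: idot_def)
 define s where "s = v * fst m - u * snd m"
 have "fst m = (u * fst c + v * snd c) * fst m" by (simp add: uv)
 also have "\<dots> = u * (fst c * fst m) + v * snd c * fst m" by (simp add: algebra_simps)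
 also have "\<dots> = s * snd c" unfolding o' by (simp add: s_def algebra_simps)
 finally have 1: "fst m = s * snd c" .
 have "snd m = (u * fst c + v * snd c) * snd m" by (simp add: uv)
 also have "\<dots> = u * fst c * snd m + v * (snd c * snd m)" by (simp add: algebra_simps)
 also have "snd c * snd m = - (fst c * fst m)" using o' by simp
 also have "u * fst c * snd m + v * - (fst c * fst m) = - (s * fst c)" by (simp add: s_def algebra_simps)
 finally have 2: "snd m = - (s * fst c)" .
 show ?thesis by (rule that[of s]) (simp add: iscale_def perp_def prod_eq_iff 1 2)
qed

text \<open>The origin is left out, so that gcd(r) is positive; its weight \<omega>(0)
  vanishes.\<close>

definition int_disc :: "real \<Rightarrow> (int \<times> int) set" where
 "int_disc R = {r. r \<noteq> 0 \<and> norm (rvec r) \<le> R}"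

lemma int_disc_subset: "int_disc R \<subseteq> {-\<lfloor>R\<rfloor>..\<lfloor>R\<rfloor>} \<times> {-\<lfloor>R\<rfloor>..\<lfloor>R\<rfloor>}"
proof
 fix r assume r: "r \<in> int_disc R"
 have "\<bar>of_int (fst r)\<bar> \<le> R" "\<bar>of_int (snd r)\<bar> \<le> R"
  using r abs_fst_le_norm[of "rvec r"] abs_snd_le_norm[of "rvec r"] by (auto simp: int_disc_def rvec_def)
 then have "fst r \<in> {-\<lfloor>R\<rfloor>..\<lfloor>R\<rfloor>}" "snd r \<in> {-\<lfloor>R\<rfloor>..\<lfloor>R\<rfloor>}"
  using le_floor_iff[of "- fst r" R] le_floor_iff[of "fst r" R] le_floor_iff[of "- snd r" R] le_floor_iff[of "snd r" R] by auto
 then show "r \<in> {-\<lfloor>R\<rfloor>..\<lfloor>R\<rfloor>} \<times> {-\<lfloor>R\<rfloor>..\<lfloor>R\<rfloor>}" by (cases r) auto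
qed

lemma finite_int_disc [simp]: "finite (int_disc R)"
 by (rule finite_subset[OF int_disc_subset]) simp

lemma card_int_disc_le:
 assumes "R \<ge> 1"
 shows "real (card (int_disc R)) \<le> 9 * R\<^sup>2"
proof -
 have F: "\<lfloor>R\<rfloor> \<ge> 1" using assms by simp
 have "card (int_disc R) \<le> card ({-\<lfloor>R\<rfloor>..\<lfloor>R\<rfloor>} \<times> {-\<lfloor>R\<rfloor>..\<lfloor>R\<rfloor>})"
  by (rule card_mono[OF _ int_disc_subset]) simp
 also have "\<dots> = nat (2 * \<lfloor>R\<rfloor> + 1) ^ 2" by (simp add: power2_eq_square)
 finally have "real (card (int_disc R)) \<le> real (nat (2 * \<lfloor>R\<rfloor> + 1)) ^ 2"
  by (metis of_nat_le_iff of_nat_power)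
 also have "\<dots> \<le> (3 * R) ^ 2" using assms F by (intro power_mono) linarith+
 finally show ?thesis by (simp add: power_mult_distrib)
qed

lemma finite_nat_divisors_int:
 assumes "z \<noteq> 0"
 shows "finite {m. int m dvd z}"
proof (rule finite_subset)
 show "{m. int m dvd z} \<subseteq> {..nat \<bar>z\<bar>}"
 proof
  fix m assume "m \<in> {m. int m dvd z}"
  then have "int m \<le> \<bar>z\<bar>" using dvd_imp_le_int[of z "int m"] assms by simp
  then show "m \<in> {..nat \<bar>z\<bar>}" by simp
 qed
qed simp

context delta_weights
begin

lemma \<omega>_radius:
 assumes "Q \<ge> 1" "\<omega> (norm (rvec r) / Q powr (1/2)) \<noteq> 0"
 shows "1/2 * Q powr (1/2) \<le> norm (rvec r)" "norm (rvec r) \<le> Q powr (1/2)" "r \<in> int_disc (Q powr (1/2))"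
proof -
 have q: "Q powr (1/2) > 0" using assms(1) by simp
 have "1/2 < norm (rvec r) / Q powr (1/2)" "norm (rvec r) / Q powr (1/2) < 1"
  using \<omega>_0[of "norm (rvec r) / Q powr (1/2)"] assms(2) by linarith+
 then show 1: "1/2 * Q powr (1/2) \<le> norm (rvec r)" "norm (rvec r) \<le> Q powr (1/2)" using q by (auto simp: field_simps)
 have "norm (rvec r) > 0" using 1 q by linarith
 then have "r \<noteq> 0" by (auto simp: rvec_def zero_prod_def)
 then show "r \<in> int_disc (Q powr (1/2))" using 1 by (simp add: int_disc_def)
qed

text \<open>After grouping by m = qj, the sum over q dividing m of the sums over a is m^2 if m
  divides gcd(n) and 0 otherwise; m^2 cancels the weight 1/m^2 in p1.\<close>

lemma sum_arc_p1:
 assumes Q: "Q \<ge> 1" and n: "n \<noteq> 0"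
 defines "M \<equiv> nat \<lfloor>Q\<rfloor>"
 shows "(\<Sum>q\<in>{1..M}. \<Sum>a\<in>primitive_residues q. arc_integral (p1' Q q) a q n)
  = of_real (- (2 * c_const \<omega> / Q) * cut Q n * (\<Sum>m\<in>{m. int m dvd vgcd n}. \<omega> (norm (rvec n) / (real m * Q powr (1/2)))))"
proof -
 define W where "W m = 1 / (real m)\<^sup>2 * \<omega> (norm (rvec n) / (real m * Q powr (1/2)))" for m
 define \<kappa> where "\<kappa> = complex_of_real (- (2 * c_const \<omega> / Q) * cut Q n)"
 have val: "arc_integral (p1' Q q) a q n = \<kappa> * (\<Sum>j\<in>{1..M div lcm 1 q}. frac_char a q n * of_real (W (lcm 1 q * j)))"
  if q: "q \<in> {1..M}" for q a
 proof -
  have q1: "q \<ge> 1" "real q \<le> Q" using q Q by (auto simp: M_def le_nat_iff le_floor_iff)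
  have J: "real j * real q \<ge> Q" if "j > M div q" for j
  proof -
   have "M < j * q" using that q1 by (simp add: div_less_iff_less_mult)
   then have "real M + 1 \<le> real (j * q)" by linarith
   moreover have "Q \<le> real M + 1" unfolding M_def using Q by linarith
   ultimately show ?thesis by simp
  qed
  show ?thesis
   unfolding \<kappa>_def W_def lcm_1_left
   by (subst arc_integral_p1(2)[OF Q q1, of "M div q"], rule J, assumption)
     (simp add: sum_distrib_left mult_ac)
 qed
 have "(\<Sum>q\<in>{1..M}. \<Sum>a\<in>primitive_residues q. arc_integral (p1' Q q) a q n)
  = (\<Sum>q\<in>{1..M}. \<Sum>a\<in>primitive_residues q. \<kappa> * (\<Sum>j\<in>{1..M div lcm 1 q}. frac_char a q n * of_real (W (lcm 1 q * j))))"
  by (intro sum.cong refl val)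
 also have "\<dots> = \<kappa> * (\<Sum>q\<in>{1..M}. \<Sum>j\<in>{1..M div lcm 1 q}. (\<Sum>a\<in>primitive_residues q. frac_char a q n) * of_real (W (lcm 1 q * j)))"
  unfolding sum_mult_sum_swap by (rule sum_distrib_left[symmetric])
 also have "(\<Sum>q\<in>{1..M}. \<Sum>j\<in>{1..M div lcm 1 q}. (\<Sum>a\<in>primitive_residues q. frac_char a q n) * of_real (W (lcm 1 q * j)))
  = (\<Sum>m\<in>{1..M div 1}. \<Sum>q\<in>{q. q dvd 1 * m}. (\<Sum>a\<in>primitive_residues q. frac_char a q n) * of_real (W (1 * m)))"
  using sum_divisor_swap[of 1 "\<lambda>q m. (\<Sum>a\<in>primitive_residues q. frac_char a q n) * of_real (W m)" M] by simp
 also have "\<dots> = (\<Sum>m\<in>{1..M}. (if int m dvd vgcd n then of_nat m ^ 2 else 0) * of_real (W m))"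
  using ramanujan_sum_divisors[of _ n] by (intro sum.cong) (auto simp: sum_distrib_right[symmetric])
 also have "\<dots> = (\<Sum>m\<in>{1..M}. of_real (if int m dvd vgcd n then \<omega> (norm (rvec n) / (real m * Q powr (1/2))) else 0))"
  by (intro sum.cong refl) (auto simp: W_def)
 also have "\<dots> = of_real (\<Sum>m\<in>{m \<in> {1..M}. int m dvd vgcd n}. \<omega> (norm (rvec n) / (real m * Q powr (1/2))))"
  unfolding of_real_sum[symmetric] by (simp only: sum.inter_filter finite_atLeastAtMost)
 also have "\<kappa> * of_real (\<Sum>m\<in>{m \<in> {1..M}. int m dvd vgcd n}. \<omega> (norm (rvec n) / (real m * Q powr (1/2))))
  = of_real (- (2 * c_const \<omega> / Q) * cut Q n * (\<Sum>m\<in>{m. int m dvd vgcd n}. \<omega> (norm (rvec n) / (real m * Q powr (1/2)))))"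
 proof (cases "cut Q n = 0")
  case False
  have g: "vgcd n \<noteq> 0" using n vgcd_eq_0_iff by simp
  have fin: "finite {m. int m dvd vgcd n}" by (rule finite_nat_divisors_int[OF g])
  have "(\<Sum>m\<in>{m \<in> {1..M}. int m dvd vgcd n}. \<omega> (norm (rvec n) / (real m * Q powr (1/2))))
   = (\<Sum>m\<in>{m. int m dvd vgcd n}. \<omega> (norm (rvec n) / (real m * Q powr (1/2))))"
  proof (rule sum.mono_neutral_left[OF fin], blast, rule ballI)
   fix m assume m: "m \<in> {m. int m dvd vgcd n} - {m \<in> {1..M}. int m dvd vgcd n}"
   then have "m = 0 \<or> m > M" by auto
   moreover have "m \<noteq> 0" using m g by auto
   ultimately have "real m \<ge> Q" unfolding M_def using Q by linarith
   then have mQ: "Q powr (3/2) \<le> real m * Q powr (1/2)" unfolding powr_Q(5)[OF Q] by (intro mult_right_mono) auto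
   have "norm (rvec n) / (real m * Q powr (1/2)) \<le> norm (rvec n) / Q powr (3/2)"
    using mQ powr_Q(2)[OF Q] less_le_trans[OF powr_Q(2)[OF Q] mQ] by (intro divide_left_mono mult_pos_pos[of "real m * Q powr (1/2)"]) auto
   also have "\<dots> \<le> 1/2" using cut_support[OF Q False] powr_Q(2)[OF Q] by (simp add: field_simps)
   finally show "\<omega> (norm (rvec n) / (real m * Q powr (1/2))) = 0" by (intro \<omega>_0 disjI1)
  qed
  then show ?thesis by (simp add: \<kappa>_def)
 qed (simp add: \<kappa>_def)
 finally show ?thesis .
qed

lemma sum_arc_p1_0:
 assumes Q: "Q \<ge> 1" and q: "q \<ge> 1" "real q \<le> Q"
 shows "arc_integral (p1' Q q) a q 0 = 0"
proof -
 have "\<exists>J::nat. \<forall>j>J. real j * real q \<ge> Q"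
 proof (intro exI[of _ "nat \<lceil>Q\<rceil>"] allI impI)
  fix j assume "nat \<lceil>Q\<rceil> < j"
  then have "Q \<le> real j" by linarith
  also have "\<dots> \<le> real j * real q" using q mult_left_mono[of 1 "real q" "real j"] by simp
  finally show "Q \<le> real j * real q" .
 qed
 then obtain J where J: "\<And>j. j > J \<Longrightarrow> real j * real q \<ge> Q" by blast
 have n0: "norm (rvec 0) = 0" by (simp add: rvec_def zero_prod_def)
 show ?thesis
  by (subst arc_integral_p1(2)[OF Q q, of J], rule J, assumption) (simp add: n0 \<omega>_0)
qed

definition k_of :: "int \<times> int \<Rightarrow> nat \<Rightarrow> nat" where
 "k_of r q = nat (vgcd r div vgcd_mod r q)"

lemma k_of_mult:
 assumes "q \<ge> 1" "vgcd r = int e"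
 shows "k_of r q * q = lcm e q"
proof -
 have "vgcd r div vgcd_mod r q = int (e div gcd e q)"
  unfolding vgcd_mod_def assms(2) by (simp add: zdiv_int)
 then have "k_of r q = e div gcd e q" by (simp add: k_of_def)
 then show ?thesis by (simp add: lcm_nat_def div_mult_swap mult.commute)
qed

lemma idot_rvec: "rvec r \<bullet> rvec n = of_int (idot r n)"
 by (simp add: rvec_def idot_def inner_prod_def)

text \<open>Put kqj = et and c . n = e \<mu>. Then y j = et/Q and z = e^2 \<mu>/Q^2, so |z|/(y j) =
  e|\<mu>|/(tQ) is the value of et/Q at the complementary divisor |\<mu>|/t. Hence the two halves of
  h have equal sums when \<mu> is nonzero. For \<mu> = 0 the second half is \<omega>(0) = 0, and the
  first survives for every t.\<close>

lemma sum_arc_p2: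
 assumes Q: "Q \<ge> 1" and r: "1/2 * Q powr (1/2) \<le> norm (rvec r)" "norm (rvec r) \<le> Q powr (1/2)"
  and e: "vgcd r = int e" and c: "primitive c" "r = iscale (int e) c" and e1: "e \<ge> 1"
 defines "M \<equiv> nat \<lfloor>Q\<rfloor>"
 shows "(\<Sum>q\<in>{1..M}. \<Sum>a\<in>{a \<in> primitive_residues q. int q dvd incident r a}. arc_integral (p2' Q r (k_of r q) q) a q n)
  = of_real (c_const \<omega> / Q\<^sup>2 * cut Q n * (if int e dvd vgcd n \<and> idot c n = 0 then real e * (\<Sum>t\<in>{1..M div e}. \<omega> (real (e * t) / Q)) else 0))"
proof -
 define z where "z = (rvec r \<bullet> rvec n) / Q\<^sup>2"
 define g where "g s = (\<omega> s - (\<omega> (z / s) + \<omega> (- (z / s)))) / s" for s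
 define \<kappa> where "\<kappa> = complex_of_real (c_const \<omega> / Q ^ 3 * cut Q n)"
 have MQ: "real M \<le> Q" "Q < real M + 1" unfolding M_def using Q by linarith+
 have zle: "\<bar>z\<bar> \<le> 1/2" if "cut Q n \<noteq> 0"
  unfolding z_def using cut_support[OF Q that] powr_Q(2)[OF Q] by (intro p2_argument_le[OF Q r(2)]) (simp add: field_simps)
 have g0: "g s = 0" if "s \<ge> 1" "cut Q n \<noteq> 0" for s
 proof -
  have "\<bar>z\<bar> / s \<le> 1/2" using zle[OF that(2)] that(1) by (simp add: field_simps)
  then have "\<omega> (\<bar>z\<bar> / s) = 0" by (intro \<omega>_0) auto
  moreover have "\<omega> s = 0" using that by (intro \<omega>_0) auto
  ultimately show ?thesis using \<omega>_abs[of s z] that by (simp add: g_def)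
 qed
 have val: "arc_integral (p2' Q r (k_of r q) q) a q n = \<kappa> * (\<Sum>j\<in>{1..M div lcm e q}. frac_char a q n * of_real (g (real (lcm e q * j) / Q)))"
  if q: "q \<in> {1..M}" for q a
 proof -
  have q1: "q \<ge> 1" using q by auto
  define l where "l = lcm e q"
  have l: "l \<ge> 1" using q1 e1 by (simp add: l_def Suc_le_eq lcm_pos_nat)
  have kl: "k_of r q * q = l" using k_of_mult[OF q1 e] by (simp add: l_def)
  then have klr: "real (k_of r q) * real q = real l" by (metis of_nat_mult)
  have k1: "k_of r q \<ge> 1" using kl l by (auto simp: Suc_le_eq intro: Nat.gr0I)
  \<comment> \<open>One more term than l j \<le> M allows, so that J l > M and the truncation of h
    is exact; the extra term vanishes because its argument is at least 1.\<close>
  define J where "J = M div l + 1"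
  have "M mod l < l" using l by simp
  then have "M < l * (M div l) + l" using mult_div_mod_eq[of l M] by linarith
  then have "M < J * l" by (simp add: J_def algebra_simps)
  then have "real M + 1 \<le> real (J * l)" by linarith
  then have Jl: "real J * real l \<ge> Q" using MQ by simp
  then have J: "real J * (real (k_of r q) * real q / Q) \<ge> 1" unfolding klr using Q by (simp add: field_simps)
  have yj: "real l / Q * real j = real (l * j) / Q" for j by simp
  have "cut Q n * h_sum J (real l / Q) z = cut Q n * (\<Sum>j\<in>{1..M div l}. g (real (l * j) / Q))"
  proof (cases "cut Q n = 0")
   case False
   have "h_sum J (real l / Q) z = (\<Sum>j\<in>{1..J}. g (real (l * j) / Q))"
    unfolding h_sum_def h_main_def h_tail_def sum_subtractf[symmetric] g_def yj diff_divide_distrib ..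
   also have "\<dots> = (\<Sum>j\<in>{1..M div l}. g (real (l * j) / Q)) + g (real (l * J) / Q)"
    unfolding J_def by (simp add: distrib_left)
   also have "g (real (l * J) / Q) = 0"
    by (rule g0[OF _ False]) (use Jl Q in \<open>simp add: field_simps\<close>)
   finally show ?thesis by simp
  qed simp
  then show ?thesis
   unfolding arc_integral_p2(2)[OF Q r k1 q1 J] klr z_def[symmetric] l_def[symmetric] \<kappa>_def
   by (auto simp: sum_distrib_left[symmetric] mult_ac)
 qed
 define P where "P q = {a \<in> primitive_residues q. int q dvd incident r a}" for q
 have "(\<Sum>q\<in>{1..M}. \<Sum>a\<in>P q. arc_integral (p2' Q r (k_of r q) q) a q n)
  = (\<Sum>q\<in>{1..M}. \<Sum>a\<in>P q. \<kappa> * (\<Sum>j\<in>{1..M div lcm e q}. frac_char a q n * of_real (g (real (lcm e q * j) / Q))))"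
  by (intro sum.cong refl val)
 also have "\<dots> = \<kappa> * (\<Sum>q\<in>{1..M}. \<Sum>j\<in>{1..M div lcm e q}. (\<Sum>a\<in>P q. frac_char a q n) * of_real (g (real (lcm e q * j) / Q)))"
  unfolding sum_mult_sum_swap by (rule sum_distrib_left[symmetric])
 also have "(\<Sum>q\<in>{1..M}. \<Sum>j\<in>{1..M div lcm e q}. (\<Sum>a\<in>P q. frac_char a q n) * of_real (g (real (lcm e q * j) / Q)))
  = (\<Sum>t\<in>{1..M div e}. \<Sum>q\<in>{q. q dvd e * t}. (\<Sum>a\<in>P q. frac_char a q n) * of_real (g (real (e * t) / Q)))"
  by (rule sum_divisor_swap[OF e1])
 also have "\<dots> = (\<Sum>t\<in>{1..M div e}. (if int e dvd vgcd n \<and> int t dvd idot c n div int e then of_nat (e * t) * of_nat e else 0) * of_real (g (real (e * t) / Q)))"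
  unfolding sum_distrib_right[symmetric]
  by (intro sum.cong refl arg_cong2[where f="(*)"]) (use incident_sum_divisors[OF c(1) _ e1, of _ n] c(2) in \<open>simp add: P_def\<close>)
 finally have eq: "(\<Sum>q\<in>{1..M}. \<Sum>a\<in>P q. arc_integral (p2' Q r (k_of r q) q) a q n)
  = \<kappa> * (\<Sum>t\<in>{1..M div e}. (if int e dvd vgcd n \<and> int t dvd idot c n div int e then of_nat (e * t) * of_nat e else 0) * of_real (g (real (e * t) / Q)))" .
 have \<kappa>Q: "\<kappa> * of_real (Q * x) = of_real (c_const \<omega> / Q\<^sup>2 * cut Q n * x)" for x
  using Q by (simp add: \<kappa>_def power2_eq_square power3_eq_cube)
 show ?thesis
 proof (cases "cut Q n = 0 \<or> \<not> int e dvd vgcd n")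
  case True
  then show ?thesis using eq unfolding P_def[symmetric] by (auto simp: \<kappa>_def)
 next
  case False
  then have cut: "cut Q n \<noteq> 0" and en: "int e dvd vgcd n" by auto
  define \<mu> where "\<mu> = idot c n div int e"
  have "int e dvd idot c n" using en by (auto simp: idot_def vgcd_def)
  then have \<mu>: "idot c n = int e * \<mu>" by (simp add: \<mu>_def)
  have z: "z = real e * real e * of_int \<mu> / Q\<^sup>2"
   unfolding z_def idot_rvec c(2) using \<mu> by (simp add: idot_def iscale_def algebra_simps flip: of_int_mult of_int_add)
     (metis (no_types, lifting) distrib_left mult.left_commute of_int_mult of_int_of_nat_eq)
  define f where "f t = \<omega> (real (e * t) / Q) - \<omega> (real e * \<bar>of_int \<mu>\<bar> / (real t * Q))" for t
  have gf: "real (e * t) * g (real (e * t) / Q) = Q * f t" if "t \<ge> 1" for t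
  proof -
   have s: "real (e * t) / Q > 0" using that e1 Q by simp
   have "\<bar>z\<bar> / (real (e * t) / Q) = real e * \<bar>of_int \<mu>\<bar> / (real t * Q)"
    using Q e1 that unfolding z by (simp add: abs_mult power2_eq_square)
   then have "g (real (e * t) / Q) = f t / (real (e * t) / Q)"
    unfolding g_def f_def \<omega>_abs[OF s, symmetric] by simp
   then show ?thesis using s Q e1 that by (auto simp: field_simps)
  qed
  have "(\<Sum>t\<in>{1..M div e}. (if int e dvd vgcd n \<and> int t dvd idot c n div int e then of_nat (e * t) * of_nat e else 0) * of_real (g (real (e * t) / Q)))
   = (\<Sum>t\<in>{1..M div e}. complex_of_real (if int t dvd \<mu> then Q * (real e * f t) else 0))"
  proof (intro sum.cong refl)
   fix t assume "t \<in> {1..M div e}"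
   show "(if int e dvd vgcd n \<and> int t dvd idot c n div int e then of_nat (e * t) * of_nat e else 0) * of_real (g (real (e * t) / Q))
    = complex_of_real (if int t dvd \<mu> then Q * (real e * f t) else 0)"
    (is "(if ?A then ?u else 0) * of_real ?g = _")
   proof (cases "int t dvd \<mu>")
    case True
    then have A: ?A using en by (simp add: \<mu>_def)
    have "?u * complex_of_real ?g = of_real (real e * (real (e * t) * ?g))"
     unfolding of_real_mult of_real_of_nat_eq by (simp only: mult_ac)
    also have "real e * (real (e * t) * ?g) = real e * (Q * f t)"
     using gf[of t] \<open>t \<in> {1..M div e}\<close> by (simp only: atLeastAtMost_iff)
    also have "\<dots> = Q * (real e * f t)" by simp
    finally show ?thesis using A True by simp
   next
    case False
    then have "\<not> ?A" by (simp add: \<mu>_def)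
    then show ?thesis using False by (simp only: if_False of_real_0 mult_zero_left)
   qed
  qed
  also have "\<dots> = of_real (Q * (real e * (\<Sum>t\<in>{t \<in> {1..M div e}. int t dvd \<mu>}. f t)))"
   unfolding of_real_sum[symmetric] sum_distrib_left by (simp only: sum.inter_filter[symmetric] finite_atLeastAtMost)
  finally have main: "(\<Sum>q\<in>{1..M}. \<Sum>a\<in>P q. arc_integral (p2' Q r (k_of r q) q) a q n)
   = of_real (c_const \<omega> / Q\<^sup>2 * cut Q n * (real e * (\<Sum>t\<in>{t \<in> {1..M div e}. int t dvd \<mu>}. f t)))"
   unfolding eq by (simp only: \<kappa>Q)
  show ?thesis
  proof (cases "\<mu> = 0")
   case True
   then have "f t = \<omega> (real (e * t) / Q)" for t by (simp add: f_def \<omega>_0)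
   moreover have "idot c n = 0" using \<mu> True by simp
   moreover have "{t \<in> {1..M div e}. int t dvd \<mu>} = {1..M div e}" using True by auto
   ultimately show ?thesis using main en unfolding P_def by (simp only: simp_thms if_True)
  next
   case False
   define D where "D = {t. int t dvd \<mu>}"
   have fin: "finite D" unfolding D_def by (rule finite_nat_divisors_int[OF False])
   have pos: "t \<ge> 1" if "t \<in> D" for t using that False by (auto simp: D_def Suc_le_eq intro: Nat.gr0I)
   \<comment> \<open>The switch of divisors needs all divisors of \<mu>. Those beyond M div e have
     et/Q \<ge> 1 and contribute nothing.\<close>
   have "(\<Sum>t\<in>{t \<in> {1..M div e}. int t dvd \<mu>}. f t) = (\<Sum>t\<in>D. f t)"
   proof (rule sum.mono_neutral_left[OF fin])
    show "{t \<in> {1..M div e}. int t dvd \<mu>} \<subseteq> D" by (auto simp: D_def)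
    show "\<forall>t\<in>D - {t \<in> {1..M div e}. int t dvd \<mu>}. f t = 0"
    proof
     fix t assume t: "t \<in> D - {t \<in> {1..M div e}. int t dvd \<mu>}"
     then have t1: "t \<ge> 1" "t > M div e" using pos by (auto simp: D_def)
     then have "M < t * e" using e1 by (simp add: div_less_iff_less_mult)
     then have "real M + 1 \<le> real (t * e)" by linarith
     then have "real M + 1 \<le> real (e * t)" by (simp add: mult.commute)
     then have "real (e * t) / Q \<ge> 1" using MQ Q by simp
     from g0[OF this cut] gf[OF t1(1)] Q show "f t = 0" by simp
    qed
   qed
   also have "\<dots> = (\<Sum>t\<in>D. \<omega> (real (e * t) / Q)) - (\<Sum>t\<in>D. \<omega> (real e * \<bar>of_int \<mu>\<bar> / (real t * Q)))"
    by (simp add: f_def sum_subtractf)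
   also have "(\<Sum>t\<in>D. \<omega> (real e * \<bar>of_int \<mu>\<bar> / (real t * Q))) = (\<Sum>t\<in>D. \<omega> (real (e * t) / Q))"
   proof -
    have inv: "nat (\<bar>\<mu>\<bar> div int (nat (\<bar>\<mu>\<bar> div int t))) = t" "nat (\<bar>\<mu>\<bar> div int t) \<in> D"
     "\<omega> (real (e * nat (\<bar>\<mu>\<bar> div int t)) / Q) = \<omega> (real e * \<bar>of_int \<mu>\<bar> / (real t * Q))" if t: "t \<in> D" for t
    proof -
    from t have "int t dvd \<bar>\<mu>\<bar>" by (simp add: D_def)
    then obtain s where s: "\<bar>\<mu>\<bar> = int t * s" by (elim dvdE)
    have s0: "s > 0" using s False by (smt (verit) mult_nonneg_nonpos of_nat_0_le_iff zero_less_abs_iff)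
    have t0: "int t > 0" using pos[OF t] by simp
    have n1: "nat (\<bar>\<mu>\<bar> div int t) = nat s" using s t0 by simp
    have n2: "\<bar>\<mu>\<bar> div int (nat s) = int t" using s s0 by simp
    show "nat (\<bar>\<mu>\<bar> div int (nat (\<bar>\<mu>\<bar> div int t))) = t" unfolding n1 n2 by simp
    show "nat (\<bar>\<mu>\<bar> div int t) \<in> D" unfolding n1 D_def using s s0 by (simp, metis abs_dvd_iff dvd_triv_right dvd_abs_iff)
    have "real_of_int \<bar>\<mu>\<bar> = real t * of_int s" by (simp add: s)
    then have "real e * \<bar>of_int \<mu>\<bar> / (real t * Q) = real (e * nat s) / Q"
     using t0 s0 by simp
    then show "\<omega> (real (e * nat (\<bar>\<mu>\<bar> div int t)) / Q) = \<omega> (real e * \<bar>of_int \<mu>\<bar> / (real t * Q))" unfolding n1 by simp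
    qed
    show ?thesis
     by (rule sum.reindex_bij_witness[where i="\<lambda>t. nat (\<bar>\<mu>\<bar> div int t)" and j="\<lambda>t. nat (\<bar>\<mu>\<bar> div int t)"])
       (use inv in blast)+
   qed
   finally have "(\<Sum>t\<in>{t \<in> {1..M div e}. int t dvd \<mu>}. f t) = 0" by simp
   moreover have "idot c n \<noteq> 0" using \<mu> False e1 by simp
   ultimately show ?thesis using main unfolding P_def by simp
  qed
 qed
qed

end


section \<open>Lattices, and integer vectors orthogonal to n\<close>

text \<open>For the converse, a Bezout relation x (u a1 + v a2) + w q = 1 provides the multiplier k
  = x (u r1 + v r2), for which r - k a is divisible by q as soon as q divides the
  determinant.\<close>

lemma incident_lattice:
 assumes "vgcd_mod a q = 1"
 shows "lattice_of a q = {r. int q dvd incident r a}"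
proof safe
 fix r assume "r \<in> lattice_of a q"
 then obtain k y where "r = iscale k a + iscale (int q) y" by (auto simp: lattice_of_def)
 then have "incident r a = int q * incident y a"
  by (simp add: incident_def idot_def iscale_def perp_def algebra_simps)
 then show "int q dvd incident r a" by simp
next
 fix r assume "int q dvd incident r a"
 then obtain z where z: "fst r * snd a - snd r * fst a = int q * z"
  by (auto simp: incident_def idot_def perp_def)
 obtain u v where uv: "u * fst a + v * snd a = gcd (fst a) (snd a)" using bezout_int by blast
 obtain x w where xw: "x * gcd (fst a) (snd a) + w * int q = 1"
  using bezout_int[of "gcd (fst a) (snd a)" "int q"] assms by (auto simp: vgcd_mod_def vgcd_def)
 have one: "x * (u * fst a + v * snd a) + w * int q = 1" using uv xw by simp
 define k where "k = x * (u * fst r + v * snd r)"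
 have "fst r = (x * (u * fst a + v * snd a) + w * int q) * fst r" by (simp add: one)
 also have "\<dots> = k * fst a + x * v * (fst r * snd a - snd r * fst a) + int q * (w * fst r)"
  by (simp add: k_def algebra_simps)
 finally have 1: "fst r = k * fst a + int q * (x * v * z + w * fst r)" unfolding z by (simp add: algebra_simps)
 have "snd r = (x * (u * fst a + v * snd a) + w * int q) * snd r" by (simp add: one)
 also have "\<dots> = k * snd a - x * u * (fst r * snd a - snd r * fst a) + int q * (w * snd r)"
  by (simp add: k_def algebra_simps)
 finally have 2: "snd r = k * snd a + int q * (w * snd r - x * u * z)" unfolding z by (simp add: algebra_simps)
 have "r = iscale k a + iscale (int q) (x * v * z + w * fst r, w * snd r - x * u * z)"
  unfolding prod_eq_iff using 1 2 by (simp add: iscale_def)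
 then show "r \<in> lattice_of a q" unfolding lattice_of_def by blast
qed

text \<open>The lattice determines q: if it contains q' times every integer vector, then q divides
  q' a1 and q' a2, hence q' because gcd(a, q) = 1. This gives the dependence of p on the lattice
  alone, since p1 and k involve q explicitly.\<close>

lemma lattice_modulus_dvd:
 assumes "vgcd_mod a q = 1" "vgcd_mod a' q' = 1" "lattice_of a q = lattice_of a' q'"
 shows "q dvd q'"
proof -
 have "int q dvd int q' * (fst a * fst y + snd a * snd y)" for y
 proof -
  have "iscale (int q') (snd y, - fst y) \<in> lattice_of a' q'"
   unfolding incident_lattice[OF assms(2)] by (simp add: incident_def idot_def iscale_def perp_def mult.assoc flip: right_diff_distrib)
  then have "int q dvd incident (iscale (int q') (snd y, - fst y)) a"
   unfolding assms(3)[symmetric] incident_lattice[OF assms(1)] by simp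
  then show ?thesis by (simp add: incident_def idot_def iscale_def perp_def algebra_simps)
 qed
 from this[of "(1, 0)"] this[of "(0, 1)"] have "int q dvd int q' * fst a" "int q dvd int q' * snd a" by simp_all
 moreover have "int q dvd int q' * int q" by simp
 ultimately have "int q dvd gcd (gcd (int q' * fst a) (int q' * snd a)) (int q' * int q)" by simp
 also have "\<dots> = int q' * vgcd_mod a q"
  unfolding vgcd_mod_def vgcd_def by (simp add: gcd_mult_distrib_int[symmetric] abs_mult)
 finally show ?thesis using assms(1) by simp
qed

lemma sum_int_divisors:
 fixes F :: "nat \<Rightarrow> real"
 assumes "g \<noteq> 0"
 shows "(\<Sum>s\<in>{s. s dvd g}. F (nat \<bar>s\<bar>)) = 2 * (\<Sum>m\<in>{m. int m dvd g}. F m)"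
proof -
 define D where "D = {m. int m dvd g}"
 have fin: "finite D" unfolding D_def by (rule finite_nat_divisors_int[OF assms])
 have un: "{s. s dvd g} = int ` D \<union> (\<lambda>m. - int m) ` D"
 proof safe
  fix s assume s: "s dvd g" "s \<notin> (\<lambda>m. - int m) ` D"
  have "s = int (nat s)"
  proof (rule ccontr)
   assume "s \<noteq> int (nat s)"
   then have "s = - int (nat (- s))" by (cases "s \<ge> 0") auto
   moreover have "s < 0" using \<open>s \<noteq> int (nat s)\<close> by (cases "s \<ge> 0") auto
   then have "nat (- s) \<in> D" using s(1) by (simp add: D_def)
   ultimately show False using s(2) by (metis imageI)
  qed
  then show "s \<in> int ` D" using s(1) unfolding D_def by (metis (mono_tags) imageI mem_Collect_eq)
 qed (auto simp: D_def)
 have "0 \<notin> D" using assms by (auto simp: D_def)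
 then have disj: "int ` D \<inter> (\<lambda>m. - int m) ` D = {}" by (auto) (metis int_eq_iff_numeral neg_0_equal_iff_equal of_nat_eq_0_iff of_nat_0_le_iff neg_le_0_iff_le antisym)?
 show ?thesis
  unfolding un D_def[symmetric]
  by (subst sum.union_disjoint) (use fin disj in \<open>auto simp: sum.reindex inj_on_def\<close>)
qed

text \<open>Write n = g \<nu> with \<nu> primitive. Vectors orthogonal to n are s times perp \<nu>,
  with gcd |s|, so the condition is that s divides g. The two signs give the factor 2, and passing
  to the complementary divisor m = g/|s| turns |s||\<nu>| into |n|/m.\<close>

lemma sum_orthogonal_divisors:
 fixes F :: "real \<Rightarrow> real"
 assumes n: "n \<noteq> 0"
 shows "(\<Sum>r\<in>{r. r \<noteq> 0 \<and> vgcd r dvd vgcd n \<and> idot r n = 0}. F (norm (rvec r)))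
  = 2 * (\<Sum>m\<in>{m. int m dvd vgcd n}. F (norm (rvec n) / real m))"
  and "finite {r. r \<noteq> 0 \<and> vgcd r dvd vgcd n \<and> idot r n = 0}"
proof -
 define g where "g = vgcd n"
 have g0: "g > 0" using vgcd_eq_0_iff[of n] n by (simp add: g_def vgcd_def order_less_le zero_prod_def prod_eq_iff)
 obtain \<nu> where \<nu>: "primitive \<nu>" "n = iscale g \<nu>" using obtain_primitive[OF n] unfolding g_def by blast
 have vg: "vgcd (iscale s (perp \<nu>)) = \<bar>s\<bar>" for s
  using \<nu>(1) by (simp add: vgcd_def iscale_def perp_def primitive_def gcd_mult_left gcd.commute abs_mult)
 have id: "idot (iscale s (perp \<nu>)) n = 0" for s
  unfolding \<nu>(2) by (simp add: idot_def iscale_def perp_def)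
 have bij: "bij_betw (\<lambda>s. iscale s (perp \<nu>)) {s. s dvd g} {r. r \<noteq> 0 \<and> vgcd r dvd vgcd n \<and> idot r n = 0}"
 proof (rule bij_betw_imageI)
  show "inj_on (\<lambda>s. iscale s (perp \<nu>)) {s. s dvd g}"
  proof (rule inj_onI)
   fix s s' assume e: "iscale s (perp \<nu>) = iscale s' (perp \<nu>)"
   have "fst \<nu> \<noteq> 0 \<or> snd \<nu> \<noteq> 0" using \<nu>(1) by (auto simp: primitive_def vgcd_def)
   then show "s = s'" using e by (auto simp: iscale_def perp_def)
  qed
  show "(\<lambda>s. iscale s (perp \<nu>)) ` {s. s dvd g} = {r. r \<noteq> 0 \<and> vgcd r dvd vgcd n \<and> idot r n = 0}"
  proof (intro equalityI subsetI)
   fix r assume "r \<in> (\<lambda>s. iscale s (perp \<nu>)) ` {s. s dvd g}"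
   then obtain s where s: "s dvd g" "r = iscale s (perp \<nu>)" by blast
   have "s \<noteq> 0" using s(1) g0 by auto
   then have "vgcd r \<noteq> 0" unfolding s(2) vg by simp
   moreover have "vgcd r dvd vgcd n" unfolding s(2) vg using s(1) by (simp add: g_def)
   moreover have "idot r n = 0" unfolding s(2) by (rule id)
   ultimately show "r \<in> {r. r \<noteq> 0 \<and> vgcd r dvd vgcd n \<and> idot r n = 0}" by (simp add: vgcd_eq_0_iff)
  next
   fix r assume "r \<in> {r. r \<noteq> 0 \<and> vgcd r dvd vgcd n \<and> idot r n = 0}"
   then have r: "r \<noteq> 0" "vgcd r dvd vgcd n" "idot r n = 0" by auto
   have "idot r n = g * idot \<nu> r" unfolding \<nu>(2) by (simp add: idot_def iscale_def algebra_simps)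
   then have "idot \<nu> r = 0" using r g0 by simp
   then obtain s where s: "r = iscale s (perp \<nu>)" using primitive_orthogonal[OF \<nu>(1)] by blast
   then show "r \<in> (\<lambda>s. iscale s (perp \<nu>)) ` {s. s dvd g}" using vg[of s] r(2) by (auto simp: g_def)
  qed
 qed
 have fin: "finite {s. s dvd g}" using g0 by simp
 show "finite {r. r \<noteq> 0 \<and> vgcd r dvd vgcd n \<and> idot r n = 0}" using bij_betw_finite[OF bij] fin by simp
 have "(\<Sum>r\<in>{r. r \<noteq> 0 \<and> vgcd r dvd vgcd n \<and> idot r n = 0}. F (norm (rvec r)))
  = (\<Sum>s\<in>{s. s dvd g}. F (norm (rvec (iscale s (perp \<nu>)))))"
  by (rule sum.reindex_bij_betw[OF bij, symmetric])
 also have "\<dots> = (\<Sum>s\<in>{s. s dvd g}. F (real (nat \<bar>s\<bar>) * norm (rvec \<nu>)))" by simp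
 also have "\<dots> = 2 * (\<Sum>m\<in>{m. int m dvd g}. F (real m * norm (rvec \<nu>)))"
  using sum_int_divisors[of g "\<lambda>m. F (real m * norm (rvec \<nu>))"] g0 by simp
 also have "(\<Sum>m\<in>{m. int m dvd g}. F (real m * norm (rvec \<nu>))) = (\<Sum>m\<in>{m. int m dvd g}. F (norm (rvec n) / real m))"
 proof -
  have inv: "nat (g div int (nat (g div int m))) = m" "nat (g div int m) \<in> {m. int m dvd g}"
   "F (norm (rvec n) / real (nat (g div int m))) = F (real m * norm (rvec \<nu>))" if m: "m \<in> {m. int m dvd g}" for m
  proof -
  from m obtain s where s: "g = int m * s" by (auto elim: dvdE)
  have s0: "s > 0" and m0: "int m > 0" using s g0 by (auto simp: zero_less_mult_iff)
  have n1: "nat (g div int m) = nat s" using s m0 by simp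
  have n2: "g div int (nat s) = int m" using s s0 by simp
  show "nat (g div int (nat (g div int m))) = m" unfolding n1 n2 by simp
  show "nat (g div int m) \<in> {m. int m dvd g}" unfolding n1 using s s0 by simp
  have "norm (rvec n) = real m * of_int s * norm (rvec \<nu>)" unfolding \<nu>(2) using s s0 m0 by simp
  then have "norm (rvec n) / real (nat s) = real m * norm (rvec \<nu>)" using s0 by simp
  then show "F (norm (rvec n) / real (nat (g div int m))) = F (real m * norm (rvec \<nu>))" unfolding n1 by simp
  qed
  show ?thesis
   by (rule sum.reindex_bij_witness[where i="\<lambda>m. nat (g div int m)" and j="\<lambda>m. nat (g div int m)"])
     (use inv in blast)+
 qed
 finally show "(\<Sum>r\<in>{r. r \<noteq> 0 \<and> vgcd r dvd vgcd n \<and> idot r n = 0}. F (norm (rvec r)))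
  = 2 * (\<Sum>m\<in>{m. int m dvd vgcd n}. F (norm (rvec n) / real m))" by (simp add: g_def)
qed

section \<open>Averages of the weights over divisors and vectors\<close>

context delta_weights
begin

lemma integrable_\<omega>_norm: "integrable lborel (\<lambda>x :: real \<times> real. \<omega> (norm x))"
 by (rule compact_support_integrable[OF continuous_\<omega>_norm, where R=1]) (simp add: \<omega>_0)

text \<open>The integral is nonzero because \<omega>(|x|) is nonzero on a nonempty open set; thus c
  is a genuine reciprocal and not the default \<open>inverse 0\<close>.\<close>

lemma c_const_mult: "c_const \<omega> * (LINT x|lborel. \<omega> (norm (x :: real \<times> real))) = 1" "c_const \<omega> > 0"
proof -
 have "\<exists>t. \<omega> t \<noteq> 0"
 proof (rule ccontr)
  assume "\<nexists>t. \<omega> t \<noteq> 0"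
  then show False using \<omega>_integral by simp
 qed
 then obtain t where t: "\<omega> t \<noteq> 0" by blast
 have t0: "t > 0" using \<omega>_0[of t] t by linarith
 define I where "I = (LINT x|lborel. \<omega> (norm (x :: real \<times> real)))"
 have "I \<noteq> 0"
 proof
  assume "I = 0"
  then have ae: "AE x in lborel. \<omega> (norm (x :: real \<times> real)) = 0"
   unfolding I_def using integral_nonneg_eq_0_iff_AE[OF integrable_\<omega>_norm] \<omega>_nonneg by simp
  define U where "U = {x :: real \<times> real. \<omega> (norm x) \<noteq> 0}"
  have op: "open U" unfolding U_def by (intro open_Collect_neq continuous_\<omega>_norm continuous_on_const)
  have "(t, 0) \<in> U" using t t0 by (simp add: U_def)
  then have "U \<noteq> {}" by blast
  moreover have "U \<in> null_sets lborel"
   using ae AE_iff_null[of lborel "\<lambda>x :: real \<times> real. \<omega> (norm x) = 0"] op unfolding U_def by (simp add: borel_open)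
  then have "U \<in> null_sets lebesgue" by (rule null_sets_completionI)
  then have "negligible U" by (simp add: negligible_iff_null_sets)
  ultimately show False using open_not_negligible[OF op] by blast
 qed
 moreover have "I \<ge> 0" unfolding I_def by (intro integral_nonneg_AE) (simp add: \<omega>_nonneg)
 ultimately show "c_const \<omega> * (LINT x|lborel. \<omega> (norm (x :: real \<times> real))) = 1" "c_const \<omega> > 0"
  unfolding c_const_def I_def[symmetric] by auto
qed

lemma \<omega>_bounded: "\<exists>B\<ge>0. \<forall>x. \<omega> x \<le> B"
proof -
 have "compact (\<omega> ` {0..1})" by (intro compact_continuous_image continuous_on_\<omega> continuous_intros) auto
 then have "bounded (\<omega> ` {0..1})" by (rule compact_imp_bounded)
 then obtain B where B: "\<And>y. y \<in> \<omega> ` {0..1} \<Longrightarrow> norm y \<le> B" unfolding bounded_iff by blast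
 have "\<omega> x \<le> max B 0" for x
 proof (cases "x \<in> {0..1}")
  case True then show ?thesis using B[of "\<omega> x"] by fastforce
 next
  case False then show ?thesis using \<omega>_0[of x] by auto
 qed
 then show ?thesis by (intro exI[of _ "max B 0"]) auto
qed

lemma cut_bounded: "\<exists>B\<ge>0. \<forall>Q n. \<bar>cut Q n\<bar> \<le> B"
proof -
 have c: "continuous_on UNIV (\<lambda>x :: real \<times> real. \<omega>0 (norm x))" by (intro continuous_intros)
 have "compact ((\<lambda>x :: real \<times> real. \<omega>0 (norm x)) ` cball 0 1)" by (intro compact_continuous_image continuous_on_subset[OF c]) auto
 then have "bounded ((\<lambda>x :: real \<times> real. \<omega>0 (norm x)) ` cball 0 1)" by (rule compact_imp_bounded)
 then obtain B where B': "\<And>y. y \<in> (\<lambda>x :: real \<times> real. \<omega>0 (norm x)) ` cball 0 1 \<Longrightarrow> norm y \<le> B" unfolding bounded_iff by blast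
 have B: "\<bar>\<omega>0 (norm x)\<bar> \<le> B" if "norm x \<le> 1" for x :: "real \<times> real"
  using B'[OF imageI[of x "cball 0 1"]] that by simp
 have "\<bar>cut Q n\<bar> \<le> max B 0" for Q n
 proof (cases "norm ((1 / Q powr (3/2)) *\<^sub>R rvec n) \<le> 1")
  case True
  then show ?thesis unfolding cut_def using B by fastforce
 next
  case False
  then have "cut Q n = 0" unfolding cut_def by (intro \<omega>0_outside) linarith
  then show ?thesis by simp
 qed
 then show ?thesis by (intro exI[of _ "max B 0"]) auto
qed

text \<open>A Riemann sum of \<omega>, whose integral is 1, with step e/Q. From e \<le> Q^(1/2) the
  step is at most Q^(-1/2), so 2K derivatives give the error Q^(-K).\<close>

lemma weight_average_divisor:
 "\<exists>C\<ge>0. \<forall>Q e. Q \<ge> 1 \<longrightarrow> e \<ge> 1 \<longrightarrow> real e \<le> Q powr (1/2) \<longrightarrow>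
  \<bar>real e * (\<Sum>t\<in>{1..nat \<lfloor>Q\<rfloor> div e}. \<omega> (real (e * t) / Q)) / Q - 1\<bar> \<le> C / Q ^ K"
proof -
 have out: "complex_of_real (\<omega> x) = 0" if "\<bar>x\<bar> > 1" for x
  using \<omega>_0[of x] that by (cases "x \<ge> 1") auto
 obtain C where C: "C \<ge> 0" "\<And>X M. X > 0 \<Longrightarrow> 1 * X + 1 \<le> of_int M \<Longrightarrow>
  norm ((\<Sum>n\<in>{-M..M}. complex_of_real (\<omega> (of_int n / X))) - X *\<^sub>R (LINT y|lborel. complex_of_real (\<omega> y))) \<le> C * of_int M / X ^ (2 * K)"
  by (rule periodic_sum_approx_single[where R=1 and N="2*K", OF bounded_derivs_\<omega> zero_le_one out], simp, rule that)
 show ?thesis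
 proof (intro exI[of _ "3 * C"] conjI allI impI)
  show "0 \<le> 3 * C" using C by simp
  fix Q :: real and e :: nat assume Q: "Q \<ge> 1" and e: "e \<ge> 1" "real e \<le> Q powr (1/2)"
  define X where "X = Q / real e"
  define M where "M = nat \<lfloor>Q\<rfloor>"
  define M' where "M' = \<lceil>X\<rceil> + 1"
  have q2: "Q = Q powr (1/2) * Q powr (1/2)" using powr_Q(3)[OF Q] by (simp add: power2_eq_square)
  have Xs: "X \<ge> Q powr (1/2)" unfolding X_def using e Q by (subst q2) (simp add: field_simps)
  then have X1: "X \<ge> 1" using powr_Q(1)[OF Q] by linarith
  have M': "1 * X + 1 \<le> of_int M'" "of_int M' \<le> 3 * X" unfolding M'_def using X1 by linarith+
  have fd: "real (e * t) / Q = real t / X" for t unfolding X_def using e by simp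
  have "(\<Sum>n\<in>{-M'..M'}. \<omega> (of_int n / X)) = (\<Sum>n\<in>int ` {1..M div e}. \<omega> (of_int n / X))"
  proof (rule sum.mono_neutral_right)
   show "int ` {1..M div e} \<subseteq> {- M'..M'}"
   proof safe
    fix t assume t: "t \<in> {1..M div e}"
    then have "t * e \<le> M" using e by (simp add: less_eq_div_iff_mult_less_eq)
    then have "real (t * e) \<le> Q" unfolding M_def using Q by linarith
    then have "real t \<le> X" unfolding X_def using e by (simp add: field_simps)
    then show "int t \<in> {- M'..M'}" using M'(1) by auto
   qed
   show "\<forall>n\<in>{- M'..M'} - int ` {1..M div e}. \<omega> (of_int n / X) = 0"
   proof
    fix n assume n: "n \<in> {- M'..M'} - int ` {1..M div e}"
    show "\<omega> (of_int n / X) = 0"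
    proof (cases "n \<le> 0")
     case True
     then have "of_int n / X \<le> 0" using X1 by (simp add: divide_nonpos_pos)
     then show ?thesis by (intro \<omega>_0 disjI1) linarith
    next
     case False
     then have "nat n \<notin> {1..M div e}" using n by (metis DiffD2 imageI int_nat_eq le_cases nat_0_le)
     then have "nat n > M div e" using False by auto
     then have "M < nat n * e" using e by (simp add: div_less_iff_less_mult)
     then have "real M + 1 \<le> real (nat n * e)" by linarith
     moreover have "Q \<le> real M + 1" unfolding M_def using Q by linarith
     ultimately have "Q \<le> of_int n * real e" using False by simp
     then have "of_int n / X \<ge> 1" unfolding X_def using Q e by (simp add: field_simps)
     then show ?thesis by (intro \<omega>_0 disjI2)
    qed
   qed
  qed simp
  also have "\<dots> = (\<Sum>t\<in>{1..M div e}. \<omega> (real (e * t) / Q))" unfolding fd by (simp add: sum.reindex)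
  finally have S: "(\<Sum>n\<in>{-M'..M'}. \<omega> (of_int n / X)) = (\<Sum>t\<in>{1..M div e}. \<omega> (real (e * t) / Q))" .
  have I: "(LINT y|lborel. complex_of_real (\<omega> y)) = 1" using \<omega>_integral by simp
  have "norm (complex_of_real ((\<Sum>t\<in>{1..M div e}. \<omega> (real (e * t) / Q)) - X)) \<le> C * of_int M' / X ^ (2 * K)"
   using C(2)[of X M'] X1 M' unfolding I S[symmetric] by (simp add: scaleR_conv_of_real)
  then have b: "\<bar>(\<Sum>t\<in>{1..M div e}. \<omega> (real (e * t) / Q)) - X\<bar> \<le> C * of_int M' / X ^ (2 * K)"
   by (simp only: norm_of_real)
  have "\<bar>real e * (\<Sum>t\<in>{1..M div e}. \<omega> (real (e * t) / Q)) / Q - 1\<bar> = \<bar>(\<Sum>t\<in>{1..M div e}. \<omega> (real (e * t) / Q)) - X\<bar> / X"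
  proof -
   have "real e * S / Q - 1 = (S - X) / X" for S unfolding X_def using e Q by (simp add: field_simps)
   then show ?thesis using X1 by (simp only: abs_divide)
  qed
  also have "\<dots> \<le> (C * of_int M' / X ^ (2 * K)) / X" using b X1 by (intro divide_right_mono) auto
  also have "\<dots> \<le> (C * (3 * X) / X ^ (2 * K)) / X" using M' C X1 by (intro divide_right_mono mult_left_mono) auto
  also have "\<dots> = 3 * C / X ^ (2 * K)" using X1 by simp
  also have "\<dots> \<le> 3 * C / (Q powr (1/2)) ^ (2 * K)"
  proof (rule divide_left_mono)
   show "(Q powr (1/2)) ^ (2 * K) \<le> X ^ (2 * K)" using Xs powr_Q(1)[OF Q] by (intro power_mono) auto
   have "0 < Q powr (1/2)" "0 < X" using powr_Q(1)[OF Q] X1 by linarith+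
   then show "0 < X ^ (2 * K) * (Q powr (1/2)) ^ (2 * K)" by (intro mult_pos_pos zero_less_power)
  qed (use C in simp)
  also have "(Q powr (1/2)) ^ (2 * K) = Q ^ K" using powr_Q(3)[OF Q] by (simp add: power_mult)
  finally show "\<bar>real e * (\<Sum>t\<in>{1..nat \<lfloor>Q\<rfloor> div e}. \<omega> (real (e * t) / Q)) / Q - 1\<bar> \<le> 3 * C / Q ^ K" by (simp add: M_def)
 qed
qed

text \<open>A two-dimensional Riemann sum of \<omega>(|x|) with step Q^(-1/2). The constant c was
  defined to make its limit 1; this is the delta identity at n = 0.\<close>

lemma weight_average_disc:
 "\<exists>C\<ge>0. \<forall>Q. Q \<ge> 1 \<longrightarrow>
  \<bar>c_const \<omega> / Q * (\<Sum>r\<in>int_disc (Q powr (1/2)). \<omega> (norm (rvec r) / Q powr (1/2))) - 1\<bar> \<le> C / Q ^ K"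
proof -
 define F where "F = {\<lambda>x. complex_of_real (\<omega> (norm (\<alpha> + x *\<^sub>R \<beta>))) | \<alpha> \<beta> :: real \<times> real. norm \<beta> \<le> 1}"
 define g where "g p = complex_of_real (\<omega> (norm p))" for p :: "real \<times> real"
 have cg: "continuous_on UNIV g" unfolding g_def by (intro continuous_intros continuous_\<omega>_norm)
 have s1: "(\<lambda>x. g (x, y)) \<in> F" for y
  unfolding F_def g_def by (rule CollectI, rule exI[of _ "(0, y)"], rule exI[of _ "(1, 0)"]) simp
 have s2: "(\<lambda>y. g (x, y)) \<in> F" for x
  unfolding F_def g_def by (rule CollectI, rule exI[of _ "(x, 0)"], rule exI[of _ "(0, 1)"]) simp
 have out: "g (x, y) = 0" if "\<bar>x\<bar> > 1 \<or> \<bar>y\<bar> > 1" for x y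
  using that abs_fst_le_norm[of "(x, y)"] abs_snd_le_norm[of "(x, y)"] unfolding g_def by (auto intro!: \<omega>_0)
 have I: "(LINT p|lborel. g p) = of_real (LINT x|lborel. \<omega> (norm (x :: real \<times> real)))" unfolding g_def by simp
 have bF: "bounded_derivs (2 * K) F" unfolding F_def by (rule bounded_derivs_\<omega>_norm)
 obtain C where C: "C \<ge> 0" "\<And>X M. X > 0 \<Longrightarrow> 1 * X + 1 \<le> of_int M \<Longrightarrow>
  norm ((\<Sum>m\<in>{-M..M}. \<Sum>n\<in>{-M..M}. g (of_int m / X, of_int n / X)) - X\<^sup>2 *\<^sub>R (LINT p|lborel. g p)) \<le> C * (of_int M)\<^sup>2 / X ^ (2 * K)"
  using periodic_sum_approx_pair[OF bF] cg s1 s2 out zero_le_one by blast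
 have c0: "c_const \<omega> > 0" by (rule c_const_mult(2))
 show ?thesis
 proof (intro exI[of _ "9 * C * c_const \<omega>"] conjI allI impI)
  show "0 \<le> 9 * C * c_const \<omega>" using C c0 by simp
  fix Q :: real assume Q: "Q \<ge> 1"
  define X where "X = Q powr (1/2)"
  have X1: "X \<ge> 1" and X2: "X\<^sup>2 = Q" using powr_Q(1,3)[OF Q] by (simp_all add: X_def)
  define M where "M = \<lceil>X\<rceil> + 1"
  have M: "1 * X + 1 \<le> of_int M" "of_int M \<le> 3 * X" unfolding M_def using X1 by linarith+
  define S where "S = (\<Sum>r\<in>int_disc X. \<omega> (norm (rvec r) / X))"
  have gr: "g (of_int (fst r) / X, of_int (snd r) / X) = of_real (\<omega> (norm (rvec r) / X))" for r
  proof -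
   have "(of_int (fst r) / X, of_int (snd r) / X) = (1 / X) *\<^sub>R rvec r" by (simp add: rvec_def)
   then show ?thesis using X1 by (simp add: g_def)
  qed
  have "(\<Sum>m\<in>{-M..M}. \<Sum>n\<in>{-M..M}. g (of_int m / X, of_int n / X))
    = (\<Sum>r\<in>{-M..M} \<times> {-M..M}. g (of_int (fst r) / X, of_int (snd r) / X))"
   unfolding sum.cartesian_product by (simp add: case_prod_beta)
  also have "\<dots> = (\<Sum>r\<in>{-M..M} \<times> {-M..M}. of_real (\<omega> (norm (rvec r) / X)))" by (simp only: gr)
  also have "\<dots> = (\<Sum>r\<in>int_disc X. of_real (\<omega> (norm (rvec r) / X)))"
  proof (rule sum.mono_neutral_right)
   have "\<lfloor>X\<rfloor> \<le> M" unfolding M_def by linarith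
   then have "{-\<lfloor>X\<rfloor>..\<lfloor>X\<rfloor>} \<subseteq> {-M..M}" by auto
   then show "int_disc X \<subseteq> {- M..M} \<times> {- M..M}" using int_disc_subset[of X] by blast
   show "\<forall>r\<in>{- M..M} \<times> {- M..M} - int_disc X. complex_of_real (\<omega> (norm (rvec r) / X)) = 0"
    using \<omega>_radius(3)[OF Q] unfolding X_def by auto
  qed simp
  finally have E: "(\<Sum>m\<in>{-M..M}. \<Sum>n\<in>{-M..M}. g (of_int m / X, of_int n / X)) = of_real S" unfolding S_def by simp
  have "norm (complex_of_real (S - Q * (LINT x|lborel. \<omega> (norm (x :: real \<times> real))))) \<le> C * (of_int M)\<^sup>2 / X ^ (2 * K)"
   using C(2)[of X M] X1 M unfolding E I X2 by (simp add: scaleR_conv_of_real)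
  then have b: "\<bar>S - Q * (LINT x|lborel. \<omega> (norm (x :: real \<times> real)))\<bar> \<le> C * (of_int M)\<^sup>2 / X ^ (2 * K)" by (simp only: norm_of_real)
  also have "\<dots> \<le> C * (3 * X)\<^sup>2 / X ^ (2 * K)" using M X1 C by (intro divide_right_mono mult_left_mono power_mono) auto
  also have "\<dots> = 9 * C * Q / Q ^ K" by (simp add: power_mult_distrib power_mult X2)
  finally have b: "\<bar>S - Q * (LINT x|lborel. \<omega> (norm (x :: real \<times> real)))\<bar> \<le> 9 * C * Q / Q ^ K" .
  have "c_const \<omega> / Q * S - 1 = c_const \<omega> / Q * (S - Q * (LINT x|lborel. \<omega> (norm (x :: real \<times> real))))"
   using c_const_mult(1) Q by (simp add: right_diff_distrib)
  then have "\<bar>c_const \<omega> / Q * S - 1\<bar> = c_const \<omega> / Q * \<bar>S - Q * (LINT x|lborel. \<omega> (norm (x :: real \<times> real)))\<bar>"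
   using c0 Q by (simp add: abs_mult)
  also have "\<dots> \<le> c_const \<omega> / Q * (9 * C * Q / Q ^ K)" using b c0 Q by (intro mult_left_mono) auto
  also have "\<dots> = 9 * C * c_const \<omega> / Q ^ K" using Q by simp
  finally show "\<bar>c_const \<omega> / Q * (\<Sum>r\<in>int_disc (Q powr (1/2)). \<omega> (norm (rvec r) / Q powr (1/2))) - 1\<bar> \<le> 9 * C * c_const \<omega> / Q ^ K"
   unfolding S_def X_def .
 qed
qed

end


section \<open>Assembly of the two forms of the delta identity\<close>

lemma nat_floor_interval: "{q. 1 \<le> q \<and> real q \<le> Q} = {1..nat \<lfloor>Q\<rfloor>}"
 by (auto simp: le_nat_floor) linarith

lemma integrable_mult_e2pi:
 fixes f :: "real \<times> real \<Rightarrow> complex"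
 assumes "integrable lborel f"
 shows "integrable lborel (\<lambda>w. f w * e2pi ((x + w) \<bullet> v))"
proof (rule Bochner_Integration.integrable_bound[OF assms])
 have "(\<lambda>w :: real \<times> real. e2pi ((x + w) \<bullet> v)) \<in> borel_measurable borel"
  by (intro borel_measurable_continuous_onI continuous_intros)
 then show "(\<lambda>w. f w * e2pi ((x + w) \<bullet> v)) \<in> borel_measurable lborel"
  using assms by (intro borel_measurable_times) auto
qed (simp add: norm_mult)

text \<open>With e = dk = gcd(r), the conditions on q in (5) say exactly that d = gcd(e, q), so that
  k = e/d is the value attached to r and q in the sum over the lattice.\<close>

lemma gcd_cofactor_iff:
 fixes d e q :: nat
 assumes "d dvd e" "e \<ge> 1" "q \<ge> 1"
 shows "d dvd q \<and> gcd (q div d) (e div d) = 1 \<longleftrightarrow> d = gcd e q"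
proof
 assume "d dvd q \<and> gcd (q div d) (e div d) = 1"
 then have dq: "d dvd q" and g: "gcd (q div d) (e div d) = 1" by auto
 have "gcd e q = gcd (d * (e div d)) (d * (q div d))" using assms dq by simp
 also have "\<dots> = d * gcd (e div d) (q div d)" by (simp add: gcd_mult_distrib_nat)
 finally show "d = gcd e q" using g by (simp add: gcd.commute)
next
 assume d: "d = gcd e q"
 have "coprime (q div gcd q e) (e div gcd q e)" using assms by (intro div_gcd_coprime) auto
 then have "gcd (q div d) (e div d) = 1" unfolding d gcd.commute[of e q] coprime_iff_gcd_eq_1 .
 moreover have "d dvd q" unfolding d by (rule gcd_dvd2)
 ultimately show "d dvd q \<and> gcd (q div d) (e div d) = 1" by blast
qed

text \<open>Cancelling d from both sides leaves divisibility by m = q/d, and the extra factor k of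
  \<open>incident r a\<close> is coprime to m.\<close>

lemma dvd_incident_iff:
 assumes "r = iscale (int d * int k) c" "d dvd q" "gcd (q div d) k = 1"
 shows "int q dvd int d * idot c (perp a) \<longleftrightarrow> int q dvd incident r a"
proof (cases "d = 0")
 case True
 then show ?thesis using assms by (simp add: incident_def idot_def iscale_def)
next
 case False
 define m where "m = q div d"
 have q: "int q = int d * int m" using assms(2) by (simp add: m_def flip: of_nat_mult)
 have cop: "coprime (int m) (int k)" using assms(3) by (simp add: m_def coprime_iff_gcd_eq_1)
 have i: "incident r a = int d * (int k * idot c (perp a))"
  unfolding assms(1) by (simp add: incident_def idot_def iscale_def algebra_simps)
 show ?thesis unfolding q i using False cop by (simp add: coprime_dvd_mult_right_iff)
qed

context delta_weights
begin

lemma k_of_eq: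
 assumes "vgcd r = int e"
 shows "k_of r q = e div gcd e q"
proof -
 have "vgcd r div vgcd_mod r q = int (e div gcd e q)"
  unfolding vgcd_mod_def assms by (simp add: zdiv_int)
 then show ?thesis by (simp add: k_of_def)
qed

lemma arc_integral_0: "(\<And>w. p w = 0) \<Longrightarrow> arc_integral p a q n = 0"
 by (simp add: arc_integral_def)

definition sum_p1 :: "real \<Rightarrow> int \<times> int \<Rightarrow> complex" where
 "sum_p1 Q n = (\<Sum>q\<in>{1..nat \<lfloor>Q\<rfloor>}. \<Sum>a\<in>primitive_residues q. arc_integral (p1' Q q) a q n)"

definition sum_p2_at :: "real \<Rightarrow> int \<times> int \<Rightarrow> int \<times> int \<Rightarrow> complex" where
 "sum_p2_at Q n r = (\<Sum>q\<in>{1..nat \<lfloor>Q\<rfloor>}. \<Sum>a\<in>{a \<in> primitive_residues q. int q dvd incident r a}.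
   arc_integral (p2' Q r (k_of r q) q) a q n)"

definition sum_p2 :: "real \<Rightarrow> int \<times> int \<Rightarrow> complex" where
 "sum_p2 Q n = (\<Sum>r\<in>int_disc (Q powr (1/2)). of_real (\<omega> (norm (rvec r) / Q powr (1/2))) * sum_p2_at Q n r)"

text \<open>The relative error of the divisor average for e = gcd(r), so that 1 plus this quantity
  is the factor by which r contributes.\<close>

definition divisor_defect :: "real \<Rightarrow> int \<times> int \<Rightarrow> real" where
 "divisor_defect Q r = real (nat (vgcd r)) *
   (\<Sum>t\<in>{1..nat \<lfloor>Q\<rfloor> div nat (vgcd r)}. \<omega> (real (nat (vgcd r) * t) / Q)) / Q - 1"

lemma sum_p2_at_eq:
 assumes Q: "Q \<ge> 1" and w: "\<omega> (norm (rvec r) / Q powr (1/2)) \<noteq> 0"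
 shows "sum_p2_at Q n r = of_real (c_const \<omega> / Q * cut Q n *
  (if vgcd r dvd vgcd n \<and> idot r n = 0 then 1 + divisor_defect Q r else 0))"
proof -
 have r0: "r \<noteq> 0" using \<omega>_radius(3)[OF Q w] by (simp add: int_disc_def)
 define e where "e = nat (vgcd r)"
 have e: "vgcd r = int e" by (simp add: e_def vgcd_def)
 have e1: "e \<ge> 1" using r0 e vgcd_eq_0_iff[of r] by (auto simp: Suc_le_eq intro: Nat.gr0I)
 obtain c where c: "primitive c" "r = iscale (int e) c" using obtain_primitive[OF r0] unfolding e by blast
 have id: "idot r n = int e * idot c n" unfolding c(2) by (simp add: idot_def iscale_def algebra_simps)
 have cond: "(vgcd r dvd vgcd n \<and> idot r n = 0) = (int e dvd vgcd n \<and> idot c n = 0)" unfolding e id using e1 by simp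
 define S where "S = (\<Sum>t\<in>{1..nat \<lfloor>Q\<rfloor> div e}. \<omega> (real (e * t) / Q))"
 have S: "real e * S = Q * (1 + divisor_defect Q r)"
  unfolding divisor_defect_def e_def[symmetric] S_def[symmetric] using Q by simp
 have "sum_p2_at Q n r = of_real (c_const \<omega> / Q\<^sup>2 * cut Q n * (if int e dvd vgcd n \<and> idot c n = 0 then real e * S else 0))"
  unfolding sum_p2_at_def S_def by (rule sum_arc_p2[OF Q \<omega>_radius(1,2)[OF Q w] e c e1])
 also have "\<dots> = of_real (c_const \<omega> / Q * cut Q n * (if int e dvd vgcd n \<and> idot c n = 0 then 1 + divisor_defect Q r else 0))"
  unfolding S using Q by (simp add: power2_eq_square)
 finally show ?thesis unfolding cond .
qed

text \<open>The factor 2 is the one in the coefficient -2c/Q of p1, so the main terms of p1 and p2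
  cancel exactly for nonzero n.\<close>

lemma main_sum_nonzero:
 assumes Q: "Q \<ge> 1" and n: "n \<noteq> 0"
 shows "(\<Sum>r\<in>int_disc (Q powr (1/2)). if vgcd r dvd vgcd n \<and> idot r n = 0 then \<omega> (norm (rvec r) / Q powr (1/2)) else 0)
  = 2 * (\<Sum>m\<in>{m. int m dvd vgcd n}. \<omega> (norm (rvec n) / (real m * Q powr (1/2))))"
proof -
 define P where "P = {r. r \<noteq> 0 \<and> vgcd r dvd vgcd n \<and> idot r n = 0}"
 have "(\<Sum>r\<in>int_disc (Q powr (1/2)). if vgcd r dvd vgcd n \<and> idot r n = 0 then \<omega> (norm (rvec r) / Q powr (1/2)) else 0)
  = (\<Sum>r\<in>{r \<in> int_disc (Q powr (1/2)). vgcd r dvd vgcd n \<and> idot r n = 0}. \<omega> (norm (rvec r) / Q powr (1/2)))"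
  by (simp only: sum.inter_filter[OF finite_int_disc])
 also have "\<dots> = (\<Sum>r\<in>P. \<omega> (norm (rvec r) / Q powr (1/2)))"
 proof (rule sum.mono_neutral_left)
  show "finite P" unfolding P_def by (rule sum_orthogonal_divisors(2)[OF n])
  show "{r \<in> int_disc (Q powr (1/2)). vgcd r dvd vgcd n \<and> idot r n = 0} \<subseteq> P" by (auto simp: P_def int_disc_def)
  show "\<forall>r\<in>P - {r \<in> int_disc (Q powr (1/2)). vgcd r dvd vgcd n \<and> idot r n = 0}. \<omega> (norm (rvec r) / Q powr (1/2)) = 0"
   unfolding P_def using \<omega>_radius(3)[OF Q] by blast
 qed
 also have "\<dots> = 2 * (\<Sum>m\<in>{m. int m dvd vgcd n}. \<omega> (norm (rvec n) / real m / Q powr (1/2)))"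
  unfolding P_def by (rule sum_orthogonal_divisors(1)[OF n, of "\<lambda>x. \<omega> (x / Q powr (1/2))"])
 finally show ?thesis by simp
qed

text \<open>There are O(Q) vectors r, each with a relative error O(Q^(-K)), and the common prefactor
  is c/Q, so nothing is lost in summation. For nonzero n these are the only errors; at n = 0 the
  error of the average over the disc is added.\<close>

lemma delta_estimate:
 "\<exists>C\<ge>0. \<forall>Q n. Q \<ge> 1 \<longrightarrow> cmod (delta_vec n - (sum_p1 Q n + sum_p2 Q n)) \<le> C / Q ^ K"
proof -
 obtain C1 where C1: "C1 \<ge> 0" "\<And>Q e. Q \<ge> 1 \<Longrightarrow> e \<ge> 1 \<Longrightarrow> real e \<le> Q powr (1/2) \<Longrightarrow>
  \<bar>real e * (\<Sum>t\<in>{1..nat \<lfloor>Q\<rfloor> div e}. \<omega> (real (e * t) / Q)) / Q - 1\<bar> \<le> C1 / Q ^ K"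
  using weight_average_divisor[of K] by blast
 obtain C2 where C2: "C2 \<ge> 0" "\<And>Q. Q \<ge> 1 \<Longrightarrow>
  \<bar>c_const \<omega> / Q * (\<Sum>r\<in>int_disc (Q powr (1/2)). \<omega> (norm (rvec r) / Q powr (1/2))) - 1\<bar> \<le> C2 / Q ^ K"
  using weight_average_disc[of K] by blast
 obtain B where B: "B \<ge> 0" "\<And>x. \<omega> x \<le> B" using \<omega>_bounded by blast
 obtain B0 where B0: "B0 \<ge> 0" "\<And>Q n. \<bar>cut Q n\<bar> \<le> B0" using cut_bounded by blast
 have c0: "c_const \<omega> > 0" by (rule c_const_mult(2))
 define C where "C = C2 + c_const \<omega> * B0 * (9 * (B * C1))"
 show ?thesis
 proof (intro exI[of _ C] conjI allI impI)
  show "C \<ge> 0" using C1 C2 B B0 c0 by (simp add: C_def)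
  fix Q :: real and n assume Q: "Q \<ge> 1"
  define D where "D = int_disc (Q powr (1/2))"
  define W where "W r = \<omega> (norm (rvec r) / Q powr (1/2))" for r
  define P where "P r \<longleftrightarrow> vgcd r dvd vgcd n \<and> idot r n = 0" for r
  define main where "main = (\<Sum>r\<in>D. if P r then W r else 0)"
  define rest where "rest = (\<Sum>r\<in>D. if P r then W r * divisor_defect Q r else 0)"
  have val: "of_real (W r) * sum_p2_at Q n r = of_real (c_const \<omega> / Q * cut Q n * ((if P r then W r else 0) + (if P r then W r * divisor_defect Q r else 0)))" for r
  proof (cases "W r = 0")
   case False
   then show ?thesis
    using sum_p2_at_eq[OF Q, of r n] unfolding W_def[symmetric] P_def[symmetric]
    by (cases "P r") (simp_all add: algebra_simps add_divide_distrib)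
  qed simp
  have T2: "sum_p2 Q n = of_real (c_const \<omega> / Q * cut Q n * (main + rest))"
   unfolding sum_p2_def D_def[symmetric] W_def[symmetric] val main_def rest_def
   by (simp only: of_real_sum[symmetric] sum_distrib_left[symmetric] sum.distrib)
  have defect: "\<bar>divisor_defect Q r\<bar> \<le> C1 / Q ^ K" if r: "r \<in> D" for r
  proof -
   have "vgcd r \<noteq> 0" "vgcd r \<ge> 0" using r vgcd_eq_0_iff[of r] by (auto simp: D_def int_disc_def vgcd_def)
   then have "nat (vgcd r) \<ge> 1" "real (nat (vgcd r)) = of_int (vgcd r)" by auto
   moreover have "real_of_int (vgcd r) \<le> Q powr (1/2)" using r vgcd_le_norm[of r] by (auto simp: D_def int_disc_def)
   ultimately show ?thesis unfolding divisor_defect_def by (intro C1(2)[OF Q]) simp_all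
  qed
  have "\<bar>rest\<bar> \<le> (\<Sum>r\<in>D. \<bar>if P r then W r * divisor_defect Q r else 0\<bar>)" unfolding rest_def by (rule sum_abs)
  also have "\<dots> \<le> (\<Sum>r\<in>D. B * (C1 / Q ^ K))"
  proof (rule sum_mono)
   fix r assume r: "r \<in> D"
   have "\<bar>W r * divisor_defect Q r\<bar> \<le> B * (C1 / Q ^ K)"
    unfolding abs_mult using defect[OF r] B \<omega>_nonneg by (intro mult_mono) (auto simp: W_def)
   then show "\<bar>if P r then W r * divisor_defect Q r else 0\<bar> \<le> B * (C1 / Q ^ K)" using B C1 Q by simp
  qed
  also have "\<dots> = real (card D) * (B * (C1 / Q ^ K))" by simp
  also have "\<dots> \<le> 9 * (Q powr (1/2))\<^sup>2 * (B * (C1 / Q ^ K))"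
   unfolding D_def using card_int_disc_le[of "Q powr (1/2)"] powr_Q(1)[OF Q] B C1 Q by (intro mult_right_mono) auto
  also have "\<dots> = Q * (9 * (B * C1) / Q ^ K)" unfolding powr_Q(3)[OF Q] by simp
  finally have rest: "\<bar>rest\<bar> \<le> Q * (9 * (B * C1) / Q ^ K)" .
  have "\<bar>c_const \<omega> / Q * cut Q n * rest\<bar> = c_const \<omega> / Q * (\<bar>cut Q n\<bar> * \<bar>rest\<bar>)"
   using c0 Q by (simp add: abs_mult)
  also have "\<dots> \<le> c_const \<omega> / Q * (B0 * (Q * (9 * (B * C1) / Q ^ K)))"
   using rest B0 c0 Q by (intro mult_left_mono mult_mono) auto
  also have "\<dots> = c_const \<omega> * B0 * (9 * (B * C1)) / Q ^ K" using Q by simp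
  finally have err: "\<bar>c_const \<omega> / Q * cut Q n * rest\<bar> \<le> c_const \<omega> * B0 * (9 * (B * C1)) / Q ^ K" .
  \<comment> \<open>Common conclusion of both cases: x is the value of the delta symbol and t the
    contribution of p1.\<close>
  have dec: "\<bar>x - (c_const \<omega> / Q * cut Q n * (main + rest) + t)\<bar> \<le> C / Q ^ K" if "\<bar>c_const \<omega> / Q * cut Q n * main + t - x\<bar> \<le> C2 / Q ^ K" for x t
  proof -
   have "c_const \<omega> / Q * cut Q n * (main + rest) = c_const \<omega> / Q * cut Q n * main + c_const \<omega> / Q * cut Q n * rest"
    by (rule distrib_left)
   moreover have "C / Q ^ K = C2 / Q ^ K + c_const \<omega> * B0 * (9 * (B * C1)) / Q ^ K"
    unfolding C_def by (rule add_divide_distrib)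
   ultimately show ?thesis using that err by linarith
  qed
  show "cmod (delta_vec n - (sum_p1 Q n + sum_p2 Q n)) \<le> C / Q ^ K"
  proof (cases "n = 0")
   case False
   define t where "t = - (2 * c_const \<omega> / Q) * cut Q n * (\<Sum>m\<in>{m. int m dvd vgcd n}. \<omega> (norm (rvec n) / (real m * Q powr (1/2))))"
   have T1: "sum_p1 Q n = of_real t" unfolding sum_p1_def t_def by (rule sum_arc_p1[OF Q False])
   have "c_const \<omega> / Q * cut Q n * main + t = 0"
    unfolding main_def D_def P_def W_def main_sum_nonzero[OF Q False] t_def by simp
   then have b: "\<bar>0 - (c_const \<omega> / Q * cut Q n * (main + rest) + t)\<bar> \<le> C / Q ^ K" using C2 Q by (intro dec) simp
   have "delta_vec n - (sum_p1 Q n + sum_p2 Q n) = of_real (0 - (c_const \<omega> / Q * cut Q n * (main + rest) + t))"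
    unfolding T1 T2 using False by (simp add: delta_vec_def)
   then show ?thesis using b by (simp only: norm_of_real)
  next
   case True
   have T1: "sum_p1 Q n = 0" unfolding sum_p1_def True
   proof (intro sum.neutral ballI)
    fix q a assume "q \<in> {1..nat \<lfloor>Q\<rfloor>}"
    then have "q \<ge> 1" "real q \<le> Q" unfolding nat_floor_interval[symmetric] by simp_all
    then show "arc_integral (p1' Q q) a q 0 = 0" by (rule sum_arc_p1_0[OF Q])
   qed
   have cut1: "cut Q n = 1" by (simp add: cut_def True rvec_def zero_prod_def[symmetric] \<omega>0_0)
   have "P r" for r by (simp add: P_def True vgcd_def idot_def)
   then have "main = (\<Sum>r\<in>D. W r)" by (simp add: main_def)
   then have "\<bar>c_const \<omega> / Q * cut Q n * main + 0 - 1\<bar> \<le> C2 / Q ^ K"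
    unfolding cut1 using C2(2)[OF Q] by (simp add: D_def W_def)
   then have b: "\<bar>1 - (c_const \<omega> / Q * cut Q n * (main + rest) + 0)\<bar> \<le> C / Q ^ K" by (rule dec)
   have "delta_vec n - (sum_p1 Q n + sum_p2 Q n) = of_real (1 - (c_const \<omega> / Q * cut Q n * (main + rest) + 0))"
    unfolding T1 T2 by (simp add: delta_vec_def True)
   then show ?thesis using b by (simp only: norm_of_real)
  qed
 qed
qed

lemma p_Lambda_eq:
 assumes Q: "Q \<ge> 1" and a: "vgcd_mod a q = 1"
 shows "p_Lambda \<omega> \<omega>0 Q a q w = p1' Q q w +
  (\<Sum>r\<in>{r \<in> int_disc (Q powr (1/2)). int q dvd incident r a}.
    of_real (\<omega> (norm (rvec r) / Q powr (1/2))) * p2' Q r (k_of r q) q w)"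
proof -
 have "(\<Sum>\<^sub>\<infinity>r\<in>lattice_of a q. complex_of_real (\<omega> (norm (rvec r) / Q powr (1/2))) * p2' Q r (k_of r q) q w)
  = (\<Sum>r\<in>{r \<in> int_disc (Q powr (1/2)). int q dvd incident r a}.
    of_real (\<omega> (norm (rvec r) / Q powr (1/2))) * p2' Q r (k_of r q) q w)"
 proof (rule infsum_eq_sum)
  show "{r \<in> int_disc (Q powr (1/2)). int q dvd incident r a} \<subseteq> lattice_of a q" unfolding incident_lattice[OF a] by blast
  fix r assume "r \<in> lattice_of a q - {r \<in> int_disc (Q powr (1/2)). int q dvd incident r a}"
  then have "r \<notin> int_disc (Q powr (1/2))" unfolding incident_lattice[OF a] by blast
  then have "\<omega> (norm (rvec r) / Q powr (1/2)) = 0" using \<omega>_radius(3)[OF Q] by blast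
  then show "complex_of_real (\<omega> (norm (rvec r) / Q powr (1/2))) * p2' Q r (k_of r q) q w = 0" by simp
 qed simp
 then show ?thesis unfolding p_Lambda_def k_of_def by simp
qed

lemma p_Lambda_lattice:
 assumes Q: "Q \<ge> 1" and "q \<ge> 1" "q' \<ge> 1" "vgcd_mod a q = 1" "vgcd_mod a' q' = 1" "lattice_of a q = lattice_of a' q'"
 shows "p_Lambda \<omega> \<omega>0 Q a q = p_Lambda \<omega> \<omega>0 Q a' q'"
proof -
 have "q dvd q'" "q' dvd q" using lattice_modulus_dvd assms by metis+
 then have "q = q'" by (rule dvd_antisym)
 then show ?thesis unfolding p_Lambda_def using assms(6) by simp
qed

lemma k_of_ge_1:
 assumes "r \<noteq> 0" "q \<ge> 1"
 shows "k_of r q \<ge> 1"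
proof -
 have v: "vgcd r = int (nat (vgcd r))" by (simp add: vgcd_def)
 then have "nat (vgcd r) \<noteq> 0" using assms(1) vgcd_eq_0_iff[of r] by auto
 then have "lcm (nat (vgcd r)) q \<noteq> 0" using assms(2) by simp
 then have "k_of r q * q \<noteq> 0" using k_of_mult[OF assms(2) v] by simp
 then show ?thesis by auto
qed

lemma integrable_p2_weighted:
 assumes Q: "Q \<ge> 1" and r: "r \<in> int_disc (Q powr (1/2))" and q: "q \<ge> 1"
 shows "integrable lborel (\<lambda>w. of_real (\<omega> (norm (rvec r) / Q powr (1/2))) * p2' Q r (k_of r q) q w)"
proof (cases "\<omega> (norm (rvec r) / Q powr (1/2)) = 0")
 case False
 have k: "k_of r q \<ge> 1" using r by (intro k_of_ge_1 q) (auto simp: int_disc_def)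
 have pos: "real (k_of r q) * real q / Q > 0" using k q Q by (intro divide_pos_pos mult_pos_pos) auto
 obtain J :: nat where "1 / (real (k_of r q) * real q / Q) \<le> real J" using real_arch_simple by blast
 then have J: "real J * (real (k_of r q) * real q / Q) \<ge> 1" using pos by (simp only: pos_divide_le_eq)
 show ?thesis by (intro integrable_mult_right arc_integral_p2(1)[OF Q \<omega>_radius(1,2)[OF Q False] k q J])
qed simp

lemma integrable_p1:
 assumes Q: "Q \<ge> 1" and q: "q \<ge> 1" "real q \<le> Q"
 shows "integrable lborel (p1' Q q)"
proof (rule arc_integral_p1(1)[OF Q q])
 fix j assume "nat \<lceil>Q\<rceil> < j"
 then have "Q \<le> real j" by linarith
 also have "\<dots> \<le> real j * real q" using q mult_left_mono[of 1 "real q" "real j"] by simp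
 finally show "Q \<le> real j * real q" .
qed

lemma arc_integral_p_Lambda:
 assumes Q: "Q \<ge> 1" and q: "q \<ge> 1" "real q \<le> Q" and a: "vgcd_mod a q = 1"
 shows "arc_integral (p_Lambda \<omega> \<omega>0 Q a q) a q n = arc_integral (p1' Q q) a q n +
  (\<Sum>r\<in>{r \<in> int_disc (Q powr (1/2)). int q dvd incident r a}.
    of_real (\<omega> (norm (rvec r) / Q powr (1/2))) * arc_integral (p2' Q r (k_of r q) q) a q n)"
proof -
 define E where "E w = e2pi (((1 / real q) *\<^sub>R rvec a + w) \<bullet> rvec n)" for w
 define D where "D = {r \<in> int_disc (Q powr (1/2)). int q dvd incident r a}"
 define W where "W r = complex_of_real (\<omega> (norm (rvec r) / Q powr (1/2)))" for r
 have fin: "finite D" by (simp add: D_def)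
 have i1: "integrable lborel (\<lambda>w. p1' Q q w * E w)" unfolding E_def by (intro integrable_mult_e2pi integrable_p1 Q q)
 have i2: "integrable lborel (\<lambda>w. W r * p2' Q r (k_of r q) q w * E w)" if "r \<in> D" for r
  unfolding E_def W_def using that by (intro integrable_mult_e2pi integrable_p2_weighted Q q) (auto simp: D_def)
 have "arc_integral (p_Lambda \<omega> \<omega>0 Q a q) a q n = (LINT w|lborel. p1' Q q w * E w + (\<Sum>r\<in>D. W r * p2' Q r (k_of r q) q w * E w))"
  unfolding arc_integral_def p_Lambda_eq[OF Q a] E_def[symmetric] D_def[symmetric] W_def[symmetric]
  by (simp add: distrib_right sum_distrib_right)
 also have "\<dots> = (LINT w|lborel. p1' Q q w * E w) + (LINT w|lborel. (\<Sum>r\<in>D. W r * p2' Q r (k_of r q) q w * E w))"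
  by (intro Bochner_Integration.integral_add i1 Bochner_Integration.integrable_sum i2)
 also have "(LINT w|lborel. (\<Sum>r\<in>D. W r * p2' Q r (k_of r q) q w * E w)) = (\<Sum>r\<in>D. LINT w|lborel. W r * p2' Q r (k_of r q) q w * E w)"
  by (intro Bochner_Integration.integral_sum i2)
 also have "\<dots> = (\<Sum>r\<in>D. W r * (LINT w|lborel. p2' Q r (k_of r q) q w * E w))"
  by (simp add: mult.assoc)
 finally show ?thesis unfolding arc_integral_def E_def D_def W_def .
qed

lemma sum_p_Lambda:
 assumes Q: "Q \<ge> 1"
 shows "(\<Sum>q | 1 \<le> q \<and> real q \<le> Q. \<Sum>a\<in>primitive_residues q. arc_integral (p_Lambda \<omega> \<omega>0 Q a q) a q n)
  = sum_p1 Q n + sum_p2 Q n"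
proof -
 define D where "D = int_disc (Q powr (1/2))"
 define W where "W r = complex_of_real (\<omega> (norm (rvec r) / Q powr (1/2)))" for r
 define A where "A r q a = arc_integral (p2' Q r (k_of r q) q) a q n" for r q a
 define I where "I = {1..nat \<lfloor>Q\<rfloor>}"
 have fin: "finite D" "finite I" by (simp_all add: D_def I_def)
 have "(\<Sum>q | 1 \<le> q \<and> real q \<le> Q. \<Sum>a\<in>primitive_residues q. arc_integral (p_Lambda \<omega> \<omega>0 Q a q) a q n)
  = (\<Sum>q\<in>I. \<Sum>a\<in>primitive_residues q. arc_integral (p1' Q q) a q n + (\<Sum>r\<in>{r \<in> D. int q dvd incident r a}. W r * A r q a))"
  unfolding nat_floor_interval I_def D_def W_def A_def
 proof (rule sum.cong[OF refl], rule sum.cong[OF refl], rule arc_integral_p_Lambda[OF Q])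
  fix q a assume q: "q \<in> {1..nat \<lfloor>Q\<rfloor>}" and a: "a \<in> primitive_residues q"
  show "1 \<le> q" using q by simp
  show "real q \<le> Q" using q unfolding nat_floor_interval[symmetric] by simp
  show "vgcd_mod a q = 1" using a unfolding primitive_residues_def by simp
 qed
 also have "\<dots> = sum_p1 Q n + (\<Sum>q\<in>I. \<Sum>a\<in>primitive_residues q. \<Sum>r\<in>{r \<in> D. int q dvd incident r a}. W r * A r q a)"
  by (simp add: sum.distrib sum_p1_def I_def)
 also have "(\<Sum>q\<in>I. \<Sum>a\<in>primitive_residues q. \<Sum>r\<in>{r \<in> D. int q dvd incident r a}. W r * A r q a)
  = (\<Sum>q\<in>I. \<Sum>a\<in>primitive_residues q. \<Sum>r\<in>D. if int q dvd incident r a then W r * A r q a else 0)"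
  by (intro sum.cong refl sum.inter_filter fin)
 also have "\<dots> = (\<Sum>q\<in>I. \<Sum>r\<in>D. \<Sum>a\<in>primitive_residues q. if int q dvd incident r a then W r * A r q a else 0)"
  by (intro sum.cong refl sum.swap)
 also have "\<dots> = (\<Sum>r\<in>D. \<Sum>q\<in>I. \<Sum>a\<in>primitive_residues q. if int q dvd incident r a then W r * A r q a else 0)"
  by (rule sum.swap)
 also have "\<dots> = (\<Sum>r\<in>D. \<Sum>q\<in>I. \<Sum>a\<in>{a \<in> primitive_residues q. int q dvd incident r a}. W r * A r q a)"
  by (intro sum.cong refl sum.inter_filter[symmetric] finite_primitive_residues)
 also have "\<dots> = sum_p2 Q n"
  unfolding sum_p2_def sum_p2_at_def D_def I_def W_def A_def by (simp add: sum_distrib_left)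
 finally show ?thesis .
qed

text \<open>For fixed r and q the sum over d collapses to d = gcd(e, q). The ranges q \<le> Q/k and
  q \<le> Q may be exchanged because p2 vanishes for kq \<ge> Q.\<close>

lemma inner_sum_divisors:
 assumes Q: "Q \<ge> 1" and r: "r \<in> int_disc (Q powr (1/2))" and e: "vgcd r = int e" and c: "r = iscale (int e) c"
 shows "(\<Sum>d\<in>{d. d dvd e}. \<Sum>q | 1 \<le> q \<and> real q \<le> Q / real (e div d) \<and> d dvd q \<and> gcd (q div d) (e div d) = 1.
   \<Sum>a\<in>{a \<in> primitive_residues q. int q dvd int d * idot c (perp a)}. arc_integral (p2' Q r (e div d) q) a q n)
  = sum_p2_at Q n r"
proof -
 have "r \<noteq> 0" using r by (simp add: int_disc_def)
 then have e1: "e \<ge> 1" using e vgcd_eq_0_iff[of r] by (auto simp: Suc_le_eq intro: Nat.gr0I)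
 have nr: "norm (rvec r) \<le> Q powr (1/2)" using r by (simp add: int_disc_def)
 have finE: "finite {d. d dvd e}" using e1 by (intro finite_divisors_nat) auto
 define I where "I = {1..nat \<lfloor>Q\<rfloor>}"
 define G where "G d q = (\<Sum>a\<in>{a \<in> primitive_residues q. int q dvd int d * idot c (perp a)}. arc_integral (p2' Q r (e div d) q) a q n)" for d q
 have "(\<Sum>q | 1 \<le> q \<and> real q \<le> Q / real (e div d) \<and> d dvd q \<and> gcd (q div d) (e div d) = 1. G d q)
   = (\<Sum>q\<in>I. if d = gcd e q then G d q else 0)" if d: "d dvd e" for d
 proof -
  have k1: "e div d \<ge> 1" using d e1 by (metis One_nat_def Suc_leI dvd_div_eq_0_iff neq0_conv not_one_le_zero)
  have sub: "{q. 1 \<le> q \<and> real q \<le> Q / real (e div d) \<and> d dvd q \<and> gcd (q div d) (e div d) = 1} \<subseteq> {q \<in> I. d = gcd e q}"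
  proof
   fix q assume "q \<in> {q. 1 \<le> q \<and> real q \<le> Q / real (e div d) \<and> d dvd q \<and> gcd (q div d) (e div d) = 1}"
   then have q: "1 \<le> q" "real q \<le> Q / real (e div d)" "d dvd q" "gcd (q div d) (e div d) = 1" by simp_all
   have "real q * 1 \<le> real q * real (e div d)" using k1 by (intro mult_left_mono) auto
   also have "\<dots> \<le> Q" using q(2) k1 by (simp add: pos_le_divide_eq)
   finally have "q \<in> I" using q unfolding I_def nat_floor_interval[symmetric] by simp
   moreover have "d = gcd e q" using gcd_cofactor_iff[OF d e1 q(1)] q(3,4) by blast
   ultimately show "q \<in> {q \<in> I. d = gcd e q}" by blast
  qed
  have "(\<Sum>q | 1 \<le> q \<and> real q \<le> Q / real (e div d) \<and> d dvd q \<and> gcd (q div d) (e div d) = 1. G d q)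
   = (\<Sum>q\<in>{q \<in> I. d = gcd e q}. G d q)"
  proof (rule sum.mono_neutral_left[OF _ sub])
   show "\<forall>q\<in>{q \<in> I. d = gcd e q} - {q. 1 \<le> q \<and> real q \<le> Q / real (e div d) \<and> d dvd q \<and> gcd (q div d) (e div d) = 1}. G d q = 0"
   proof
    fix q assume q: "q \<in> {q \<in> I. d = gcd e q} - {q. 1 \<le> q \<and> real q \<le> Q / real (e div d) \<and> d dvd q \<and> gcd (q div d) (e div d) = 1}"
    then have q1: "q \<ge> 1" and dq: "d = gcd e q" by (auto simp: I_def)
    then have "\<not> real q \<le> Q / real (e div d)" using q gcd_cofactor_iff[OF d e1 q1] by auto
    then have "real (e div d) * real q \<ge> Q" using k1 by (simp add: pos_le_divide_eq mult.commute)
    then show "G d q = 0" unfolding G_def by (intro sum.neutral ballI arc_integral_0 p2_eq_0[OF Q nr])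
   qed
  qed (simp add: I_def)
  then show ?thesis by (rule trans) (rule sum.inter_filter, simp add: I_def)
 qed
 then have "(\<Sum>d\<in>{d. d dvd e}. \<Sum>q | 1 \<le> q \<and> real q \<le> Q / real (e div d) \<and> d dvd q \<and> gcd (q div d) (e div d) = 1. G d q)
  = (\<Sum>d\<in>{d. d dvd e}. \<Sum>q\<in>I. if d = gcd e q then G d q else 0)"
  by (intro sum.cong[OF refl]) blast
 also have "\<dots> = (\<Sum>q\<in>I. \<Sum>d\<in>{d. d dvd e}. if d = gcd e q then G d q else 0)" by (rule sum.swap)
 also have "\<dots> = (\<Sum>q\<in>I. G (gcd e q) q)" using finE by (simp add: sum.delta)
 also have "\<dots> = sum_p2_at Q n r"
  unfolding sum_p2_at_def I_def[symmetric]
 proof (intro sum.cong refl)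
  fix q assume "q \<in> I"
  then have q1: "q \<ge> 1" by (simp add: I_def)
  have g: "gcd e q dvd e" by simp
  have cof: "gcd e q dvd q" "gcd (q div gcd e q) (e div gcd e q) = 1" using gcd_cofactor_iff[OF g e1 q1] by auto
  have "e = gcd e q * (e div gcd e q)" by simp
  then have rr: "r = iscale (int (gcd e q) * int (e div gcd e q)) c" unfolding c by (simp flip: of_nat_mult)
  show "G (gcd e q) q = (\<Sum>a\<in>{a \<in> primitive_residues q. int q dvd incident r a}. arc_integral (p2' Q r (k_of r q) q) a q n)"
   unfolding G_def k_of_eq[OF e] dvd_incident_iff[OF rr cof] ..
 qed
 finally show ?thesis unfolding G_def .
qed

text \<open>A triple (d, k, c) corresponds to the vector r = dkc together with a divisor d of gcd(r)
  = dk, and c = r/gcd(r). The weight leaves only r in the disc, so the infinite sum is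
  finite.\<close>

lemma infsum_primitive_triples:
 assumes Q: "Q \<ge> 1"
 shows "(\<Sum>\<^sub>\<infinity>(d, k, c)\<in>{(d::nat, k::nat, c :: int \<times> int). d \<ge> 1 \<and> k \<ge> 1 \<and> primitive c}.
   let r = iscale (int d * int k) c in
   of_real (\<omega> (norm (rvec r) / Q powr (1/2))) *
   (\<Sum>q | 1 \<le> q \<and> real q \<le> Q / real k \<and> d dvd q \<and> gcd (q div d) k = 1.
     \<Sum>a\<in>{a \<in> primitive_residues q. int q dvd int d * idot c (perp a)}.
      arc_integral (p2' Q r k q) a q n)) = sum_p2 Q n"
proof -
 define D where "D = int_disc (Q powr (1/2))"
 define W where "W r = complex_of_real (\<omega> (norm (rvec r) / Q powr (1/2)))" for r
 define H where "H d k c = (\<Sum>q | 1 \<le> q \<and> real q \<le> Q / real k \<and> d dvd q \<and> gcd (q div d) k = 1.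
     \<Sum>a\<in>{a \<in> primitive_residues q. int q dvd int d * idot c (perp a)}.
      arc_integral (p2' Q (iscale (int d * int k) c) k q) a q n)" for d k c
 define T where "T = {(d::nat, k::nat, c :: int \<times> int). d \<ge> 1 \<and> k \<ge> 1 \<and> primitive c}"
 define T' where "T' = {(d, k, c). (d, k, c) \<in> T \<and> iscale (int d * int k) c \<in> D}"
 define S where "S = (SIGMA r:D. {d. d dvd nat (vgcd r)})"
 define \<pi> where "\<pi> r = (fst r div vgcd r, snd r div vgcd r)" for r :: "int \<times> int"
 define i where "i p = (case p of (r, d) \<Rightarrow> (d, nat (vgcd r) div d, \<pi> r))" for p :: "(int \<times> int) \<times> nat"
 define j where "j p = (case p of (d, k, c) \<Rightarrow> (iscale (int d * int k) c, d))" for p :: "nat \<times> nat \<times> (int \<times> int)"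
 have vpos: "nat (vgcd r) \<ge> 1" "int (nat (vgcd r)) = vgcd r" "primitive (\<pi> r)" "r = iscale (vgcd r) (\<pi> r)" if "r \<in> D" for r
 proof -
  have r0: "r \<noteq> 0" using that by (simp add: D_def int_disc_def)
  have "vgcd r \<noteq> 0" "vgcd r \<ge> 0" using r0 vgcd_eq_0_iff[of r] by (simp, simp add: vgcd_def)
  then show v: "int (nat (vgcd r)) = vgcd r" "nat (vgcd r) \<ge> 1" by linarith+
  obtain c where c: "primitive c" "r = iscale (vgcd r) c" using obtain_primitive[OF r0] by blast
  have g: "vgcd r \<noteq> 0" using v by linarith
  have "fst r = vgcd r * fst c" "snd r = vgcd r * snd c" using arg_cong[OF c(2), of fst] arg_cong[OF c(2), of snd] by (simp_all add: iscale_def)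
  then have "fst r div vgcd r = fst c" "snd r div vgcd r = snd c" using g by (metis nonzero_mult_div_cancel_left)+
  then have "\<pi> r = c" by (simp add: \<pi>_def)
  then show "primitive (\<pi> r)" "r = iscale (vgcd r) (\<pi> r)" using c by simp_all
 qed
 have finS: "finite S" unfolding S_def
 proof (rule finite_SigmaI)
  fix r assume "r \<in> D" then show "finite {d. d dvd nat (vgcd r)}" using vpos(1)[of r] by (intro finite_divisors_nat) auto
 qed (simp add: D_def)
 have iS: "i p \<in> T'" "j (i p) = p" if "p \<in> S" for p
 proof -
  obtain r d where p0: "p = (r, d)" using surj_pair[of p] by blast
  have p: "p = (r, d)" "r \<in> D" "d dvd nat (vgcd r)" using that unfolding p0 S_def by simp_all
  have dk: "d * (nat (vgcd r) div d) = nat (vgcd r)" using p by simp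
  then have d1: "d \<ge> 1" "nat (vgcd r) div d \<ge> 1" using vpos(1)[OF p(2)] by (auto simp: Suc_le_eq intro!: Nat.gr0I)
  have s: "iscale (int d * int (nat (vgcd r) div d)) (\<pi> r) = r"
   using vpos(2,4)[OF p(2)] unfolding of_nat_mult[symmetric] dk by simp
  show "i p \<in> T'" "j (i p) = p" using p s d1 vpos(3)[OF p(2)] by (simp_all add: i_def j_def T'_def T_def)
 qed
 have jT: "j t \<in> S" "i (j t) = t" if "t \<in> T'" for t
 proof -
  obtain d k c where t0: "t = (d, k, c)" by (rule prod_cases3[of t]) blast
  have t: "t = (d, k, c)" "d \<ge> 1" "k \<ge> 1" "primitive c" "iscale (int d * int k) c \<in> D"
   using that unfolding t0 T'_def T_def by simp_all
  have v: "vgcd (iscale (int d * int k) c) = int (d * k)"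
   using t(4) by (simp add: vgcd_def iscale_def primitive_def gcd_mult_left abs_mult)
  then have v': "nat (vgcd (iscale (int d * int k) c)) = d * k" by (simp only: nat_int)
  have pi: "\<pi> (iscale (int d * int k) c) = c" unfolding \<pi>_def v using t by (simp add: iscale_def)
  show "j t \<in> S" "i (j t) = t" using t v' pi by (simp_all add: i_def j_def S_def)
 qed
 have bij: "bij_betw i S T'" by (rule bij_betw_byWitness[where f'=j]) (use iS jT in auto)
 have finT: "finite T'" using bij_betw_finite[OF bij] finS by simp
 have "(\<Sum>\<^sub>\<infinity>(d, k, c)\<in>T. W (iscale (int d * int k) c) * H d k c) = (\<Sum>(d, k, c)\<in>T'. W (iscale (int d * int k) c) * H d k c)"
 proof (rule infsum_eq_sum[OF finT])
  show "T' \<subseteq> T" by (auto simp: T'_def)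
  fix t assume t: "t \<in> T - T'"
  obtain d k c where tt: "t = (d, k, c)" by (cases t) auto
  have "iscale (int d * int k) c \<notin> D" using t tt by (auto simp: T'_def)
  then have "\<omega> (norm (rvec (iscale (int d * int k) c)) / Q powr (1/2)) = 0" unfolding D_def using \<omega>_radius(3)[OF Q] by blast
  then have "W (iscale (int d * int k) c) = 0" by (simp only: W_def of_real_0)
  then show "(case t of (d, k, c) \<Rightarrow> W (iscale (int d * int k) c) * H d k c) = 0" using tt by simp
 qed
 also have "\<dots> = (\<Sum>p\<in>S. case i p of (d, k, c) \<Rightarrow> W (iscale (int d * int k) c) * H d k c)"
  by (rule sum.reindex_bij_betw[OF bij, symmetric])
 also have "\<dots> = (\<Sum>(r, d)\<in>S. W r * H d (nat (vgcd r) div d) (\<pi> r))"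
 proof (rule sum.cong[OF refl])
  fix p assume p: "p \<in> S"
  obtain r d where pp: "p = (r, d)" using surj_pair[of p] by blast
  have "iscale (int d * int (nat (vgcd r) div d)) (\<pi> r) = r" using iS(2)[OF p] unfolding pp by (simp add: i_def j_def)
  then show "(case i p of (d, k, c) \<Rightarrow> W (iscale (int d * int k) c) * H d k c) = (case p of (r, d) \<Rightarrow> W r * H d (nat (vgcd r) div d) (\<pi> r))"
   unfolding pp by (simp add: i_def)
 qed
 also have "\<dots> = (\<Sum>r\<in>D. \<Sum>d\<in>{d. d dvd nat (vgcd r)}. W r * H d (nat (vgcd r) div d) (\<pi> r))"
 proof (unfold S_def, rule sum.Sigma[symmetric])
  show "\<forall>r\<in>D. finite {d. d dvd nat (vgcd r)}" using vpos(1) finite_divisors_nat by (metis One_nat_def Suc_le_eq)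
 qed (simp add: D_def)
 also have "\<dots> = (\<Sum>r\<in>D. W r * sum_p2_at Q n r)"
 proof (rule sum.cong[OF refl])
  fix r assume r: "r \<in> D"
  have eq: "H d (nat (vgcd r) div d) (\<pi> r) = (\<Sum>q | 1 \<le> q \<and> real q \<le> Q / real (nat (vgcd r) div d) \<and> d dvd q \<and> gcd (q div d) (nat (vgcd r) div d) = 1.
   \<Sum>a\<in>{a \<in> primitive_residues q. int q dvd int d * idot (\<pi> r) (perp a)}. arc_integral (p2' Q r (nat (vgcd r) div d) q) a q n)"
   if "d \<in> {d. d dvd nat (vgcd r)}" for d
  proof -
   have "(r, d) \<in> S" using that r by (simp add: S_def)
   from iS(2)[OF this] have "iscale (int d * int (nat (vgcd r) div d)) (\<pi> r) = r" by (simp add: i_def j_def)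
   then show ?thesis by (simp add: H_def)
  qed
  have rD: "r \<in> int_disc (Q powr (1/2))" using r by (simp add: D_def)
  have rc: "r = iscale (int (nat (vgcd r))) (\<pi> r)" unfolding vpos(2)[OF r] by (rule vpos(4)[OF r])
  have "(\<Sum>d\<in>{d. d dvd nat (vgcd r)}. H d (nat (vgcd r) div d) (\<pi> r)) = sum_p2_at Q n r"
   by (rule trans[OF sum.cong[OF refl eq] inner_sum_divisors[OF Q rD vpos(2)[OF r, symmetric] rc, of n]])
  then show "(\<Sum>d\<in>{d. d dvd nat (vgcd r)}. W r * H d (nat (vgcd r) div d) (\<pi> r)) = W r * sum_p2_at Q n r"
   by (simp flip: sum_distrib_left)
 qed
 finally show ?thesis unfolding sum_p2_def D_def W_def T_def H_def Let_def .
qed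

end


section \<open>Smooth sums over the points of a lattice\<close>

lemma sum_symmetric_nat:
 fixes F :: "int \<Rightarrow> 'a::comm_monoid_add"
 shows "(\<Sum>n\<in>{- int J..int J}. F n) = F 0 + (\<Sum>j\<in>{1..J}. F (int j) + F (- int j))"
proof (induction J)
 case (Suc J)
 have "{- int (Suc J)..int (Suc J)} = insert (int (Suc J)) (insert (- int (Suc J)) {- int J..int J})" by auto
 then have "(\<Sum>n\<in>{- int (Suc J)..int (Suc J)}. F n) = F (int (Suc J)) + (F (- int (Suc J)) + (\<Sum>n\<in>{- int J..int J}. F n))"
  by (simp only: finite_insert finite_atLeastAtMost_int sum.insert) simp
 then show ?case by (simp only: Suc.IH) (simp add: ac_simps)
qed simp

lemma lborel_integral_shift_scale_pair:
 fixes f :: "real \<times> real \<Rightarrow> complex"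
 assumes f: "f \<in> borel_measurable borel" and k: "k > 0"
 shows "(LINT p|lborel. f (c + k *\<^sub>R p)) = (1 / k\<^sup>2) *\<^sub>R (LINT p|lborel. f p)"
proof -
 have m: "(\<lambda>p. f (c + p)) \<in> borel_measurable borel" using f by measurable
 have "(LINT p|lborel. f (c + p)) = (LINT p|distr lborel borel ((+) c). f p)"
  by (rule integral_distr[symmetric]) (use f in auto)
 also have "\<dots> = (LINT p|lborel. f p)" by (simp only: lborel_distr_plus)
 finally have "(LINT p|lborel. f p) = k\<^sup>2 *\<^sub>R (LINT p|lborel. f (c + k *\<^sub>R p))"
  using lborel_integral_scale_pair[OF m, of k] k by simp
 then show ?thesis using k by simp
qed

text \<open>The character sum over incident residues at n = 0 counts them. The auxiliary congruence
  becomes that of x a with 0 modulo q, whose only solution is x = 0 since gcd(a, q) = 1.\<close>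

lemma card_incident_residues:
 assumes q: "q \<ge> 1" and a: "vgcd_mod a q = 1"
 shows "card {b \<in> residue_box q. int q dvd incident b a} = q" "finite {b \<in> residue_box q. int q dvd incident b a}"
proof -
 have sw: "incident b a = - incident a b" for b by (simp add: incident_def idot_def perp_def)
 have "{x \<in> {0..<int q}. int q dvd fst (0 :: int \<times> int) - x * snd a \<and> int q dvd snd (0 :: int \<times> int) + x * fst a} = {0}"
 proof (intro equalityI subsetI)
  fix x assume x: "x \<in> {x \<in> {0..<int q}. int q dvd fst (0 :: int \<times> int) - x * snd a \<and> int q dvd snd (0 :: int \<times> int) + x * fst a}"
  then have "int q dvd x * fst a" "int q dvd x * snd a" "int q dvd x * int q" by simp_all
  then have "int q dvd gcd (gcd (x * fst a) (x * snd a)) (x * int q)" by simp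
  also have "\<dots> = \<bar>x\<bar> * vgcd_mod a q" unfolding vgcd_mod_def vgcd_def by (cases "x \<ge> 0") (simp_all add: gcd_mult_left abs_mult)
  finally have "int q dvd x" using a by simp
  then show "x \<in> {0}" using x zdvd_not_zless[of x "int q"] by fastforce
 qed (use q in simp)
 then have c: "card {x \<in> {0..<int q}. int q dvd fst (0 :: int \<times> int) - x * snd a \<and> int q dvd snd (0 :: int \<times> int) + x * fst a} = 1" by simp
 have "(\<Sum>b\<in>{b \<in> residue_box q. int q dvd incident a b}. frac_char b q 0) = of_nat q"
  using sum_frac_char_incident[OF q, where r=a and n=0] c by simp
 then have "of_nat (card {b \<in> residue_box q. int q dvd incident a b}) = (of_nat q :: complex)"
  by (simp add: frac_char_def idot_def)
 then show "card {b \<in> residue_box q. int q dvd incident b a} = q" unfolding sw by (simp only: of_nat_eq_iff dvd_minus_iff)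
 show "finite {b \<in> residue_box q. int q dvd incident b a}" by (simp add: residue_box_def)
qed

lemma incident_shift: "int q dvd incident (fst b + int q * m, snd b + int q * m') a \<longleftrightarrow> int q dvd incident b a"
proof -
 have "incident (fst b + int q * m, snd b + int q * m') a = incident b a + int q * (m * snd a - m' * fst a)"
  by (simp add: incident_def idot_def perp_def algebra_simps)
 then show ?thesis by (simp add: dvd_add_left_iff)
qed

text \<open>The lattice is a union of cosets of q times the integer lattice, represented by the
  incident residues b. The support of g lets the box of side M replace the disc.\<close>

lemma sum_lattice_cosets:
 fixes g :: "real \<times> real \<Rightarrow> complex"
 assumes q: "q \<ge> 1" and L: "L > 0" "L + 2 \<le> of_int M" and g: "\<And>p. norm p > 1 \<Longrightarrow> g p = 0" "g 0 = 0"
 shows "(\<Sum>r\<in>{r \<in> int_disc L. int q dvd incident r a}. g ((1 / L) *\<^sub>R rvec r))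
  = (\<Sum>b\<in>{b \<in> residue_box q. int q dvd incident b a}. \<Sum>m\<in>{-M..M}. \<Sum>m'\<in>{-M..M}. g ((1 / L) *\<^sub>R rvec (fst b + int q * m, snd b + int q * m')))"
proof -
 define B where "B = {b \<in> residue_box q. int q dvd incident b a}"
 define I where "I = {-M..M}"
 define \<phi> where "\<phi> x = (fst (fst x) + int q * fst (snd x), snd (fst x) + int q * snd (snd x))" for x :: "(int \<times> int) \<times> (int \<times> int)"
 have finB: "finite B" by (simp add: B_def residue_box_def)
 have Bb: "0 \<le> fst b" "fst b < int q" "0 \<le> snd b" "snd b < int q" "int q dvd incident b a" if "b \<in> B" for b
  using that by (auto simp: B_def residue_box_def)
 have inj: "inj_on \<phi> (B \<times> (I \<times> I))"
 proof (rule inj_onI)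
  fix x x' assume x: "x \<in> B \<times> (I \<times> I)" "x' \<in> B \<times> (I \<times> I)" and e: "\<phi> x = \<phi> x'"
  have b: "fst x \<in> B" "fst x' \<in> B" using x by auto
  have e1: "fst (fst x) + int q * fst (snd x) = fst (fst x') + int q * fst (snd x')"
   and e2: "snd (fst x) + int q * snd (snd x) = snd (fst x') + int q * snd (snd x')" using e by (simp_all add: \<phi>_def)
  have 1: "fst (fst x) = fst (fst x')" using arg_cong[OF e1, of "\<lambda>z. z mod int q"] Bb[OF b(1)] Bb[OF b(2)] by simp
  have 2: "snd (fst x) = snd (fst x')" using arg_cong[OF e2, of "\<lambda>z. z mod int q"] Bb[OF b(1)] Bb[OF b(2)] by simp
  have "fst (snd x) = fst (snd x')" "snd (snd x) = snd (snd x')" using e1 e2 1 2 q by simp_all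
  then show "x = x'" using 1 2 by (simp add: prod_eq_iff)
 qed
 \<comment> \<open>Division rounds downwards, so the quotient of a negative z may exceed |z|/q by up
   to 1 in absolute value; the slack in L + 2 \<le> M covers this.\<close>
 have bound: "\<bar>z div int q\<bar> \<le> M" if z: "\<bar>real_of_int z\<bar> \<le> L" for z
 proof -
  have "of_int \<bar>z\<bar> + 2 \<le> real_of_int M" using z L by simp
  then have zM: "\<bar>z\<bar> + 2 \<le> M" by linarith
  have "int q * (z div int q) + z mod int q = z" by simp
  moreover have "0 \<le> z mod int q" "z mod int q < int q" using q by simp_all
  ultimately have "\<bar>int q * (z div int q)\<bar> \<le> \<bar>z\<bar> + int q" by linarith
  also have "\<dots> \<le> int q * (\<bar>z\<bar> + 1)" using q mult_right_mono[of 1 "int q" "\<bar>z\<bar>"] by (simp add: distrib_left)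
  finally have "int q * \<bar>z div int q\<bar> \<le> int q * (\<bar>z\<bar> + 1)" by (simp add: abs_mult)
  then have "\<bar>z div int q\<bar> \<le> \<bar>z\<bar> + 1" using q by (simp add: mult_le_cancel_left_pos)
  then show ?thesis using zM by linarith
 qed
 have "(\<Sum>b\<in>B. \<Sum>m\<in>I. \<Sum>m'\<in>I. g ((1 / L) *\<^sub>R rvec (fst b + int q * m, snd b + int q * m')))
   = (\<Sum>x\<in>B \<times> (I \<times> I). g ((1 / L) *\<^sub>R rvec (\<phi> x)))"
  unfolding sum.cartesian_product by (simp add: case_prod_beta \<phi>_def)
 also have "\<dots> = (\<Sum>r\<in>\<phi> ` (B \<times> (I \<times> I)). g ((1 / L) *\<^sub>R rvec r))"
  by (simp add: sum.reindex[OF inj])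
 also have "\<dots> = (\<Sum>r\<in>{r \<in> int_disc L. int q dvd incident r a}. g ((1 / L) *\<^sub>R rvec r))"
 proof (rule sum.mono_neutral_right)
  show "finite (\<phi> ` (B \<times> (I \<times> I)))" using finB by (simp add: I_def)
  show "{r \<in> int_disc L. int q dvd incident r a} \<subseteq> \<phi> ` (B \<times> (I \<times> I))"
  proof
   fix r assume "r \<in> {r \<in> int_disc L. int q dvd incident r a}"
   then have r: "norm (rvec r) \<le> L" "int q dvd incident r a" by (auto simp: int_disc_def)
   define b where "b = (fst r mod int q, snd r mod int q)"
   define m where "m = (fst r div int q, snd r div int q)"
   have rb: "r = (fst b + int q * fst m, snd b + int q * snd m)" by (simp add: b_def m_def)
   then have "int q dvd incident b a" using r(2) incident_shift by metis
   then have "b \<in> B" using q by (simp add: B_def residue_box_def b_def)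
   moreover have "\<bar>fst m\<bar> \<le> M" "\<bar>snd m\<bar> \<le> M"
    unfolding m_def using bound[of "fst r"] bound[of "snd r"] r(1) abs_fst_le_norm[of "rvec r"] abs_snd_le_norm[of "rvec r"] by (simp_all add: rvec_def)
   then have "m \<in> I \<times> I" by (cases m) (auto simp: I_def)
   ultimately show "r \<in> \<phi> ` (B \<times> (I \<times> I))" using rb by (intro image_eqI[of _ _ "(b, m)"]) (simp_all add: \<phi>_def)
  qed
  show "\<forall>r\<in>\<phi> ` (B \<times> (I \<times> I)) - {r \<in> int_disc L. int q dvd incident r a}. g ((1 / L) *\<^sub>R rvec r) = 0"
  proof
   fix r assume r: "r \<in> \<phi> ` (B \<times> (I \<times> I)) - {r \<in> int_disc L. int q dvd incident r a}"
   then obtain x where x: "r = \<phi> x" "fst x \<in> B" by auto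
   have "int q dvd incident r a" unfolding x(1) \<phi>_def incident_shift using Bb[OF x(2)] by blast
   then have "r \<notin> int_disc L" using r by blast
   then consider "r = 0" | "norm (rvec r) > L" by (auto simp: int_disc_def)
   then show "g ((1 / L) *\<^sub>R rvec r) = 0"
   proof cases
    case 1
    then have "(1 / L) *\<^sub>R rvec r = 0" by (simp add: rvec_def zero_prod_def)
    then show ?thesis using g(2) by (simp only:)
   next
    case 2 then show ?thesis using L by (intro g(1)) simp
   qed
  qed
 qed
 finally show ?thesis unfolding B_def I_def by (rule sym)
qed

text \<open>Each of the q cosets, rescaled by 1/L, is a shifted grid of spacing q/L and contributes
  (L/q)^2 times the integral; together this is L^2/q, in accordance with the covolume q. The
  parameter X is free: derivatives are measured along steps of length qX/L, and smoothness at that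
  scale gains X^(-n).\<close>

lemma lattice_poisson:
 assumes F: "bounded_derivs n F"
 shows "\<exists>C\<ge>0. \<forall>g a q L X. \<forall>M::int. continuous_on UNIV g \<longrightarrow> (\<forall>p. norm p > 1 \<longrightarrow> g p = 0) \<longrightarrow> g 0 = 0 \<longrightarrow>
  (\<forall>p. (\<lambda>x. g (p + x *\<^sub>R (real q * X / L, 0))) \<in> F) \<longrightarrow> (\<forall>p. (\<lambda>x. g (p + x *\<^sub>R (0, real q * X / L))) \<in> F) \<longrightarrow>
  q \<ge> 1 \<longrightarrow> vgcd_mod a q = 1 \<longrightarrow> L > 0 \<longrightarrow> X > 0 \<longrightarrow> L + 2 \<le> of_int M \<longrightarrow>
  norm ((\<Sum>r\<in>{r \<in> int_disc L. int q dvd incident r a}. g ((1 / L) *\<^sub>R rvec r)) - (L\<^sup>2 / real q) *\<^sub>R (LINT p|lborel. g p))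
   \<le> C * real q * (of_int M)\<^sup>2 / X ^ n"
proof -
 obtain C where C: "C \<ge> 0" "\<And>G R X M. continuous_on UNIV G \<Longrightarrow> (\<forall>y. (\<lambda>x. G (x, y)) \<in> F) \<Longrightarrow> (\<forall>x. (\<lambda>y. G (x, y)) \<in> F) \<Longrightarrow>
   (\<forall>x y. \<bar>x\<bar> > R \<or> \<bar>y\<bar> > R \<longrightarrow> G (x, y) = 0) \<Longrightarrow> R \<ge> 0 \<Longrightarrow> X > 0 \<Longrightarrow> R * X + 1 \<le> of_int M \<Longrightarrow>
   norm ((\<Sum>m\<in>{-M..M}. \<Sum>n\<in>{-M..M}. G (of_int m / X, of_int n / X)) - X\<^sup>2 *\<^sub>R (LINT p|lborel. G p)) \<le> C * (of_int M)\<^sup>2 / X ^ n"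
  using periodic_sum_approx_pair[OF F] by blast
 have "norm ((\<Sum>r\<in>{r \<in> int_disc L. int q dvd incident r a}. g ((1 / L) *\<^sub>R rvec r)) - (L\<^sup>2 / real q) *\<^sub>R (LINT p|lborel. g p))
   \<le> C * real q * (of_int M)\<^sup>2 / X ^ n"
  if g: "continuous_on UNIV g" "\<And>p. norm p > 1 \<Longrightarrow> g p = 0" "g 0 = 0"
   and s: "\<And>p. (\<lambda>x. g (p + x *\<^sub>R (real q * X / L, 0))) \<in> F" "\<And>p. (\<lambda>x. g (p + x *\<^sub>R (0, real q * X / L))) \<in> F"
   and q: "q \<ge> 1" and a: "vgcd_mod a q = 1" and L: "L > 0" and X: "X > 0" and M: "L + 2 \<le> of_int M"
  for g a q L X and M :: int
 proof -
  define B where "B = {b \<in> residue_box q. int q dvd incident b a}"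
  define k where "k = real q * X / L"
  have k0: "k > 0" using q L X by (simp add: k_def)
  define G where "G b p = g ((1 / L) *\<^sub>R rvec b + k *\<^sub>R p)" for b p
  define I where "I = (LINT p|lborel. g p)"
  define S where "S b = (\<Sum>m\<in>{-M..M}. \<Sum>m'\<in>{-M..M}. g ((1 / L) *\<^sub>R rvec (fst b + int q * m, snd b + int q * m')))" for b
  have gm: "g \<in> borel_measurable borel" using g(1) by (rule borel_measurable_continuous_onI)
  have Gm: "G b (of_int m / X, of_int m' / X) = g ((1 / L) *\<^sub>R rvec (fst b + int q * m, snd b + int q * m'))" for b m m'
  proof -
   have "(1 / L) *\<^sub>R rvec b + k *\<^sub>R (of_int m / X, of_int m' / X) = (1 / L) *\<^sub>R rvec (fst b + int q * m, snd b + int q * m')"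
    using L X by (simp add: rvec_def k_def field_simps)
   then show ?thesis unfolding G_def by (simp only:)
  qed
  have GI: "X\<^sup>2 *\<^sub>R (LINT p|lborel. G b p) = (L\<^sup>2 / (real q)\<^sup>2) *\<^sub>R I" for b
  proof -
   have "X\<^sup>2 * (1 / k\<^sup>2) = L\<^sup>2 / (real q)\<^sup>2" unfolding k_def using X L q by (simp add: power_divide power_mult_distrib)
   then show ?thesis unfolding G_def I_def lborel_integral_shift_scale_pair[OF gm k0] scaleR_scaleR by (simp only:)
  qed
  have each: "norm (S b - (L\<^sup>2 / (real q)\<^sup>2) *\<^sub>R I) \<le> C * (of_int M)\<^sup>2 / X ^ n" if b: "b \<in> B" for b
  proof -
   have bb: "0 \<le> fst b" "fst b < int q" "0 \<le> snd b" "snd b < int q" using b by (auto simp: B_def residue_box_def)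
   \<comment> \<open>The radius allows for the shift b/L, each coordinate of which is less than q/L:
     beyond it the scaled coordinate exceeds 1 + q/L, so the point lies outside the unit
     disc.\<close>
   have big: "norm ((1 / L) *\<^sub>R rvec b + k *\<^sub>R (x, y)) > 1" if xy: "\<bar>x\<bar> > (L / real q + 1) / X \<or> \<bar>y\<bar> > (L / real q + 1) / X" for x y
   proof -
    have kR: "k * ((L / real q + 1) / X) = 1 + real q / L" unfolding k_def using L X q by (simp add: field_simps)
    have coord: "\<bar>of_int z / L + k * t\<bar> > 1" if "0 \<le> z" "z < int q" "\<bar>t\<bar> > (L / real q + 1) / X" for z t
    proof -
     have "k * \<bar>t\<bar> > 1 + real q / L" using mult_strict_left_mono[OF that(3) k0] unfolding kR .
     moreover have "\<bar>k * t\<bar> = k * \<bar>t\<bar>" using k0 by (simp add: abs_mult)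
     moreover have "0 \<le> of_int z / L" "of_int z / L \<le> real q / L" using that L by (auto intro!: divide_right_mono)
     ultimately show ?thesis by linarith
    qed
    have "\<bar>fst ((1 / L) *\<^sub>R rvec b + k *\<^sub>R (x, y))\<bar> = \<bar>of_int (fst b) / L + k * x\<bar>" "\<bar>snd ((1 / L) *\<^sub>R rvec b + k *\<^sub>R (x, y))\<bar> = \<bar>of_int (snd b) / L + k * y\<bar>"
     by (simp_all add: rvec_def)
    then show ?thesis
     using xy coord[OF bb(1,2), of x] coord[OF bb(3,4), of y] abs_fst_le_norm[of "(1 / L) *\<^sub>R rvec b + k *\<^sub>R (x, y)"] abs_snd_le_norm[of "(1 / L) *\<^sub>R rvec b + k *\<^sub>R (x, y)"]
     by linarith
   qed
   have "norm ((\<Sum>m\<in>{-M..M}. \<Sum>m'\<in>{-M..M}. G b (of_int m / X, of_int m' / X)) - X\<^sup>2 *\<^sub>R (LINT p|lborel. G b p)) \<le> C * (of_int M)\<^sup>2 / X ^ n"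
   proof (rule C(2)[where R="(L / real q + 1) / X"])
    show "continuous_on UNIV (G b)" unfolding G_def by (intro continuous_intros continuous_on_compose2[OF g(1)]) auto
    show "\<forall>y. (\<lambda>x. G b (x, y)) \<in> F"
    proof
     fix y
     have "(\<lambda>x. G b (x, y)) = (\<lambda>x. g (((1 / L) *\<^sub>R rvec b + (0, k * y)) + x *\<^sub>R (real q * X / L, 0)))"
      unfolding G_def by (rule ext, rule arg_cong[of _ _ g]) (simp add: k_def)
     then show "(\<lambda>x. G b (x, y)) \<in> F" using s(1) by (simp only:)
    qed
    show "\<forall>x. (\<lambda>y. G b (x, y)) \<in> F"
    proof
     fix x
     have "(\<lambda>y. G b (x, y)) = (\<lambda>y. g (((1 / L) *\<^sub>R rvec b + (k * x, 0)) + y *\<^sub>R (0, real q * X / L)))"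
      unfolding G_def by (rule ext, rule arg_cong[of _ _ g]) (simp add: k_def)
     then show "(\<lambda>y. G b (x, y)) \<in> F" using s(2) by (simp only:)
    qed
    show "\<forall>x y. \<bar>x\<bar> > (L / real q + 1) / X \<or> \<bar>y\<bar> > (L / real q + 1) / X \<longrightarrow> G b (x, y) = 0"
     unfolding G_def using g(2) big by blast
    show "(L / real q + 1) / X \<ge> 0" using L X by simp
    have "L / real q \<le> L / 1" using q L by (intro divide_left_mono) auto
    then show "(L / real q + 1) / X * X + 1 \<le> of_int M" using M X by simp
   qed (rule X)
   then show ?thesis unfolding Gm GI S_def .
  qed
  have cB: "card B = q" "finite B" unfolding B_def using card_incident_residues[OF q a] by simp_all
  have "(L\<^sup>2 / real q) *\<^sub>R I = (\<Sum>b\<in>B. (L\<^sup>2 / (real q)\<^sup>2) *\<^sub>R I)"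
   using q by (simp add: cB scaleR_conv_of_real power2_eq_square)
  then have "norm ((\<Sum>b\<in>B. S b) - (L\<^sup>2 / real q) *\<^sub>R I) = norm (\<Sum>b\<in>B. S b - (L\<^sup>2 / (real q)\<^sup>2) *\<^sub>R I)"
   by (simp only: sum_subtractf)
  also have "\<dots> \<le> (\<Sum>b\<in>B. C * (of_int M)\<^sup>2 / X ^ n)" by (rule sum_norm_le) (rule each)
  also have "\<dots> = C * real q * (of_int M)\<^sup>2 / X ^ n" by (simp add: cB)
  finally have "norm ((\<Sum>b\<in>B. S b) - (L\<^sup>2 / real q) *\<^sub>R I) \<le> C * real q * (of_int M)\<^sup>2 / X ^ n" .
  moreover have "(\<Sum>r\<in>{r \<in> int_disc L. int q dvd incident r a}. g ((1 / L) *\<^sub>R rvec r)) = (\<Sum>b\<in>B. S b)"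
   unfolding B_def S_def by (rule sum_lattice_cosets[where g=g, OF q L M _ g(3)]) (rule g(2))
  ultimately show ?thesis unfolding I_def by simp
 qed
 then show ?thesis using C(1) by (intro exI[of _ C]) blast
qed

section \<open>Small q and w: reduction to means over rays\<close>

context delta_weights
begin

text \<open>The function \<omega>0(|u|) e(-v . u) on the line u = \<alpha> + t \<beta>, where
  \<sigma> stands for v . \<beta>; the constant phase of \<alpha> is omitted.\<close>

definition gray :: "real \<times> real \<Rightarrow> real \<times> real \<Rightarrow> real \<Rightarrow> real \<Rightarrow> complex" where
 "gray \<alpha> \<beta> \<sigma> t = of_real (\<omega>0 (norm (\<alpha> + t *\<^sub>R \<beta>))) * e2pi (- (\<sigma> * t))"

lemma continuous_on_gray [continuous_intros]:
 "continuous_on A \<alpha> \<Longrightarrow> continuous_on A \<beta> \<Longrightarrow> continuous_on A \<sigma> \<Longrightarrow> continuous_on A t \<Longrightarrow>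
  continuous_on A (\<lambda>x. gray (\<alpha> x) (\<beta> x) (\<sigma> x) (t x))"
 unfolding gray_def by (intro continuous_intros)

lemma \<omega>0_norm_bounded: "\<exists>B\<ge>0. \<forall>x :: real \<times> real. \<bar>\<omega>0 (norm x)\<bar> \<le> B"
proof -
 have c: "continuous_on UNIV (\<lambda>x :: real \<times> real. \<omega>0 (norm x))" by (intro continuous_intros)
 have "compact ((\<lambda>x :: real \<times> real. \<omega>0 (norm x)) ` cball 0 1)" by (intro compact_continuous_image continuous_on_subset[OF c]) auto
 then have "bounded ((\<lambda>x :: real \<times> real. \<omega>0 (norm x)) ` cball 0 1)" by (rule compact_imp_bounded)
 then obtain B where B': "\<And>y. y \<in> (\<lambda>x :: real \<times> real. \<omega>0 (norm x)) ` cball 0 1 \<Longrightarrow> norm y \<le> B" unfolding bounded_iff by blast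
 have "\<bar>\<omega>0 (norm x)\<bar> \<le> max B 0" for x :: "real \<times> real"
 proof (cases "norm x \<le> 1")
  case True
  then show ?thesis using B'[OF imageI[of x "cball 0 1"]] by simp
 next
  case False
  then have "\<omega>0 (norm x) = 0" by (intro \<omega>0_outside) linarith
  then show ?thesis by simp
 qed
 then show ?thesis by (intro exI[of _ "max B 0"]) auto
qed

lemma gray_ray_eq_0: "1/2 \<le> norm u \<Longrightarrow> \<bar>t\<bar> > 1 \<Longrightarrow> gray 0 u \<sigma> t = 0"
proof -
 assume "1/2 \<le> norm u" "\<bar>t\<bar> > 1"
 then have "1 * (1/2) \<le> \<bar>t\<bar> * norm u" by (intro mult_mono) auto
 then have "\<omega>0 (norm (t *\<^sub>R u)) = 0" by (intro \<omega>0_outside) simp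
 then show "gray 0 u \<sigma> t = 0" by (simp add: gray_def)
qed

text \<open>Traversing the line at speed X s turns the step s into 1/X. The function stays in
  \<open>fam0 2\<close> as long as X s |\<beta>| and X s |\<sigma>| are at most 2, so the error
  gains X^(-n).\<close>

lemma gray_poisson:
 "\<exists>C\<ge>0. \<forall>\<alpha> \<beta> \<sigma> s X. \<forall>M::int. norm \<beta> * (X * s) \<le> 2 \<longrightarrow> \<bar>\<sigma>\<bar> * (X * s) \<le> 2 \<longrightarrow> (\<forall>t. \<bar>t\<bar> > 1 \<longrightarrow> gray \<alpha> \<beta> \<sigma> t = 0) \<longrightarrow>
  s > 0 \<longrightarrow> X > 0 \<longrightarrow> 1 / s + 1 \<le> of_int M \<longrightarrow>
  norm ((\<Sum>j\<in>{-M..M}. gray \<alpha> \<beta> \<sigma> (of_int j * s)) - (1 / s) *\<^sub>R (LINT t|lborel. gray \<alpha> \<beta> \<sigma> t)) \<le> C * of_int M / X ^ n"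
proof -
 obtain C where C: "C \<ge> 0" "\<forall>f\<in>fam0 2. \<forall>R\<ge>0::real. \<forall>X>0::real. \<forall>M::int. \<forall>x\<in>{0..1}.
   (\<forall>x. \<bar>x\<bar> > R \<longrightarrow> f x = 0) \<longrightarrow> R * X + 1 \<le> of_int M \<longrightarrow>
   norm ((\<Sum>n\<in>{-M..M}. f ((of_int n + x) / X)) - X *\<^sub>R (LINT y|lborel. f y)) \<le> C * of_int M / X ^ n"
  using periodic_sum_approx[OF bounded_derivs_fam0[of 2 n]] by auto
 have "norm ((\<Sum>j\<in>{-M..M}. gray \<alpha> \<beta> \<sigma> (of_int j * s)) - (1 / s) *\<^sub>R (LINT t|lborel. gray \<alpha> \<beta> \<sigma> t)) \<le> C * of_int M / X ^ n"
  if h: "norm \<beta> * (X * s) \<le> 2" "\<bar>\<sigma>\<bar> * (X * s) \<le> 2" and z: "\<And>t. \<bar>t\<bar> > 1 \<Longrightarrow> gray \<alpha> \<beta> \<sigma> t = 0"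
   and s: "s > 0" and X: "X > 0" and M: "1 / s + 1 \<le> of_int M" for \<alpha> \<beta> \<sigma> s X and M :: int
 proof -
  define f where "f x = gray \<alpha> \<beta> \<sigma> (0 + (X * s) * x)" for x
  have Xs: "X * s > 0" using X s by simp
  have "(\<lambda>x. complex_of_real (\<omega>0 (norm (\<alpha> + x *\<^sub>R ((X * s) *\<^sub>R \<beta>)))) * e2pi (- (\<sigma> * (X * s)) * x + 0)) \<in> fam0 2"
   by (rule fam0I) (use h X s in \<open>simp_all add: abs_mult mult_ac\<close>)
  moreover have "f = (\<lambda>x. complex_of_real (\<omega>0 (norm (\<alpha> + x *\<^sub>R ((X * s) *\<^sub>R \<beta>)))) * e2pi (- (\<sigma> * (X * s)) * x + 0))"
   by (rule ext) (simp add: f_def gray_def mult_ac)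
  ultimately have f: "f \<in> fam0 2" by simp
  have f0: "\<forall>x. \<bar>x\<bar> > 1 / (X * s) \<longrightarrow> f x = 0"
  proof (intro allI impI)
   fix x assume "\<bar>x\<bar> > 1 / (X * s)"
   then have "1 < \<bar>0 + X * s * x\<bar>" using X s by (simp add: abs_mult field_simps)
   then show "f x = 0" unfolding f_def by (rule z)
  qed
  have "norm ((\<Sum>n\<in>{-M..M}. f ((of_int n + 0) / X)) - X *\<^sub>R (LINT y|lborel. f y)) \<le> C * of_int M / X ^ n"
   by (rule C(2)[rule_format, of f "1 / (X * s)" X 0 M]) (use f f0 X Xs s M in \<open>auto simp: field_simps\<close>)
  moreover have "f ((of_int n + 0) / X) = gray \<alpha> \<beta> \<sigma> (of_int n * s)" for n using X by (simp add: f_def mult.commute)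
  moreover have "X *\<^sub>R (LINT y|lborel. f y) = (1 / s) *\<^sub>R (LINT t|lborel. gray \<alpha> \<beta> \<sigma> t)"
   unfolding f_def using lborel_integral_real_affine[of "X * s" "gray \<alpha> \<beta> \<sigma>" 0] Xs X s by simp
  ultimately show ?thesis by simp
 qed
 then show ?thesis using C(1) by (intro exI[of _ C]) blast
qed

lemma ray_fubini:
 fixes v :: "real \<times> real"
 shows "integrable lborel (\<lambda>u. of_real (\<omega> (norm u)) * (LINT t|lborel. gray 0 u (v \<bullet> u) t))"
  and "integrable lborel (\<lambda>t. LINT u|lborel. of_real (\<omega> (norm u)) * gray 0 u (v \<bullet> u) t)"
  and "(LINT u|lborel. of_real (\<omega> (norm u)) * (LINT t|lborel. gray 0 u (v \<bullet> u) t))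
   = (LINT t|lborel. LINT u|lborel. of_real (\<omega> (norm u)) * gray 0 u (v \<bullet> u) t)"
proof -
 define f where "f u t = complex_of_real (\<omega> (norm u)) * gray 0 u (v \<bullet> u) t" for u t
 have "integrable lborel (\<lambda>p. f (fst p) (snd p))"
 proof (rule compact_support_integrable[of _ 3])
  show "continuous_on UNIV (\<lambda>p. f (fst p) (snd p))" unfolding f_def by (intro continuous_intros continuous_on_compose2[OF continuous_on_\<omega>]) auto
  fix p :: "(real \<times> real) \<times> real" assume "norm p > 3"
  moreover have "norm p \<le> norm (fst p) + norm (snd p)" using norm_Pair_le[of "fst p" "snd p"] by simp
  ultimately have "norm (fst p) > 1 \<or> \<bar>snd p\<bar> > 1" by auto
  then show "f (fst p) (snd p) = 0"
  proof
   assume "norm (fst p) > 1" then show ?thesis using \<omega>_0[of "norm (fst p)"] by (simp add: f_def)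
  next
   assume "\<bar>snd p\<bar> > 1" then show ?thesis using \<omega>_0[of "norm (fst p)"] gray_ray_eq_0[of "fst p" "snd p"] by (cases "1/2 \<le> norm (fst p)") (auto simp: f_def)
  qed
 qed
 then have int: "integrable (lborel \<Otimes>\<^sub>M lborel) (\<lambda>(u, t). f u t)" by (simp add: lborel_prod case_prod_beta')
 have eq: "(LINT t|lborel. f u t) = of_real (\<omega> (norm u)) * (LINT t|lborel. gray 0 u (v \<bullet> u) t)" for u unfolding f_def by simp
 show "integrable lborel (\<lambda>u. of_real (\<omega> (norm u)) * (LINT t|lborel. gray 0 u (v \<bullet> u) t))"
  using lborel_pair.integrable_fst[OF int] unfolding eq .
 show "integrable lborel (\<lambda>t. LINT u|lborel. of_real (\<omega> (norm u)) * gray 0 u (v \<bullet> u) t)"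
  using lborel_pair.integrable_snd[OF int] unfolding f_def .
 show "(LINT u|lborel. of_real (\<omega> (norm u)) * (LINT t|lborel. gray 0 u (v \<bullet> u) t))
   = (LINT t|lborel. LINT u|lborel. of_real (\<omega> (norm u)) * gray 0 u (v \<bullet> u) t)"
  using lborel_pair.Fubini_integral[OF int] unfolding eq unfolding f_def by simp
qed

text \<open>Up to the factor cQ/q, the quantity that p1 contains with a minus sign and the sum of
  the p2 with a plus sign.\<close>

definition ray_mean :: "real \<times> real \<Rightarrow> complex" where
 "ray_mean v = (LINT u|lborel. of_real (\<omega> (norm u)) * (LINT t|lborel. gray 0 u (v \<bullet> u) t))"

lemma shell_eq_ray:
 assumes "Q \<ge> 1"
 shows "shell (real j * real q / Q) ((real j * real q * Q powr (1/2)) *\<^sub>R w)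
  = (LINT u|lborel. of_real (\<omega> (norm u)) * gray 0 u ((Q powr (3/2) *\<^sub>R w) \<bullet> u) (real j * (real q / Q)))"
proof -
 have "real j * real q * Q powr (1/2) * (w \<bullet> u) = Q powr (3/2) * (w \<bullet> u) * (real j * (real q / Q))" for u
  unfolding powr_Q(5)[OF assms] using assms by simp
 then show ?thesis unfolding shell_def gray_def by (simp add: mult_ac)
qed

text \<open>By the symmetry of u and -u, p1 is -c times the sum of the shells over all nonzero
  integers j. The term j = 0 would be the integral of \<omega>(|u|), and c times it is 1; adding it
  produces the main term 1. The completed sum is a Riemann sum along each ray with step q/Q.\<close>

lemma p1_major_approx:
 "\<exists>C\<ge>0. \<forall>Q q w X J. Q \<ge> 1 \<longrightarrow> q \<ge> 1 \<longrightarrow> X > 0 \<longrightarrow> X * (real q / Q) \<le> 1 \<longrightarrow>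
   norm (Q powr (3/2) *\<^sub>R w) * (X * (real q / Q)) \<le> 2 \<longrightarrow> Q + 1 \<le> real J \<longrightarrow>
   norm (p1' Q q w - 1 + of_real (c_const \<omega> * Q / real q) * ray_mean (Q powr (3/2) *\<^sub>R w)) \<le> C * real J / X ^ n"
proof -
 obtain C where C: "C \<ge> 0" "\<And>\<alpha> \<beta> \<sigma> s X M. norm \<beta> * (X * s) \<le> 2 \<Longrightarrow> \<bar>\<sigma>\<bar> * (X * s) \<le> 2 \<Longrightarrow> (\<forall>t. \<bar>t\<bar> > 1 \<longrightarrow> gray \<alpha> \<beta> \<sigma> t = 0) \<Longrightarrow>
  s > 0 \<Longrightarrow> X > 0 \<Longrightarrow> 1 / s + 1 \<le> of_int M \<Longrightarrow>
  norm ((\<Sum>j\<in>{-M..M}. gray \<alpha> \<beta> \<sigma> (of_int j * s)) - (1 / s) *\<^sub>R (LINT t|lborel. gray \<alpha> \<beta> \<sigma> t)) \<le> C * of_int M / X ^ n"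
  using gray_poisson[of n] by blast
 have c0: "c_const \<omega> > 0" by (rule c_const_mult(2))
 have "norm (p1' Q q w - 1 + of_real (c_const \<omega> * Q / real q) * ray_mean (Q powr (3/2) *\<^sub>R w)) \<le> C * real J / X ^ n"
  if Q: "Q \<ge> 1" and q: "q \<ge> 1" and X: "X > 0" "X * (real q / Q) \<le> 1"
   and v2: "norm (Q powr (3/2) *\<^sub>R w) * (X * (real q / Q)) \<le> 2" and J: "Q + 1 \<le> real J" for Q q w X J
 proof -
  define v where "v = Q powr (3/2) *\<^sub>R w"
  define s where "s = real q / Q"
  have s0: "s > 0" using q Q by (simp add: s_def)
  define g where "g n u = complex_of_real (\<omega> (norm u)) * gray 0 u (v \<bullet> u) (of_int n * s)" for n :: int and u
  have gi: "integrable lborel (g n)" for n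
  proof (rule compact_support_integrable[of _ 1])
   show "continuous_on UNIV (g n)" unfolding g_def by (intro continuous_intros continuous_on_compose2[OF continuous_on_\<omega>]) auto
  qed (simp add: g_def \<omega>_0)
  define Sh where "Sh n = (LINT u|lborel. g n u)" for n
  have sym: "Sh (- n) = Sh n" for n
  proof -
   have "g n ((-1) *\<^sub>R u) = g (- n) u" for u by (simp add: g_def gray_def)
   moreover have "g n \<in> borel_measurable borel" using gi[of n] by auto
   ultimately show ?thesis unfolding Sh_def using lborel_integral_scale_pair[of "g n" "-1"] by simp
  qed
  have Sh0: "Sh 0 = of_real (LINT u|lborel. \<omega> (norm (u :: real \<times> real)))"
   unfolding Sh_def g_def by (simp add: gray_def \<omega>0_0)
  have cSh0: "of_real (c_const \<omega>) * Sh 0 = 1" unfolding Sh0 of_real_mult[symmetric] c_const_mult(1) by simp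
  have big: "real j * real q \<ge> Q" if "j > J" for j
  proof -
   have "Q \<le> real j * 1" using that J by simp
   also have "\<dots> \<le> real j * real q" using q by (intro mult_left_mono) auto
   finally show ?thesis .
  qed
  have sh: "shell (real j * real q / Q) ((real j * real q * Q powr (1/2)) *\<^sub>R w) = Sh (int j)" for j
   unfolding shell_eq_ray[OF Q] Sh_def g_def v_def s_def by simp
  have "p1' Q q w = - of_real (2 * c_const \<omega>) * (\<Sum>j\<in>{1..J}. Sh (int j))"
   unfolding sh[symmetric] by (rule p1_eq_shell[OF Q q]) (rule big)
  also have "\<dots> = 1 - of_real (c_const \<omega>) * (\<Sum>n\<in>{- int J..int J}. Sh n)"
   unfolding sum_symmetric_nat sym by (simp add: distrib_left cSh0 flip: sum_distrib_left mult_2)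
  finally have p1: "p1' Q q w = 1 - of_real (c_const \<omega>) * (\<Sum>n\<in>{- int J..int J}. Sh n)" .
  define E where "E u = complex_of_real (\<omega> (norm u)) * ((\<Sum>n\<in>{- int J..int J}. gray 0 u (v \<bullet> u) (of_int n * s)) - (1 / s) *\<^sub>R (LINT t|lborel. gray 0 u (v \<bullet> u) t))" for u
  have i1: "integrable lborel (\<lambda>u. \<Sum>n\<in>{- int J..int J}. g n u)" by (intro Bochner_Integration.integrable_sum gi)
  have i2: "integrable lborel (\<lambda>u. of_real (1 / s) * (of_real (\<omega> (norm u)) * (LINT t|lborel. gray 0 u (v \<bullet> u) t)))"
   by (intro integrable_mult_right ray_fubini(1))
  have Eeq: "E u = (\<Sum>n\<in>{- int J..int J}. g n u) - of_real (1 / s) * (of_real (\<omega> (norm u)) * (LINT t|lborel. gray 0 u (v \<bullet> u) t))" for u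
   unfolding E_def g_def by (simp add: right_diff_distrib sum_distrib_left scaleR_conv_of_real)
  have Eint: "(LINT u|lborel. E u) = (\<Sum>n\<in>{- int J..int J}. Sh n) - of_real (1 / s) * ray_mean v"
   unfolding Eeq Bochner_Integration.integral_diff[OF i1 i2] Sh_def ray_mean_def
   by (simp only: Bochner_Integration.integral_sum[OF gi] integral_mult_right_zero)
  have eq: "p1' Q q w - 1 + of_real (c_const \<omega> * Q / real q) * ray_mean v = - of_real (c_const \<omega>) * (LINT u|lborel. E u)"
   unfolding p1 Eint s_def by (simp add: algebra_simps)
  have bd: "norm (E u) \<le> \<omega> (norm u) * (C * real J / X ^ n)" for u
  proof (cases "\<omega> (norm u) = 0")
   case False
   then have u: "1/2 \<le> norm u" "norm u \<le> 1" using \<omega>_0[of "norm u"] by linarith+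
   have "\<bar>v \<bullet> u\<bar> \<le> norm v * norm u" by (rule Cauchy_Schwarz_ineq2)
   also have "\<dots> \<le> norm v * 1" using u by (intro mult_left_mono) auto
   finally have "\<bar>v \<bullet> u\<bar> * (X * s) \<le> norm v * (X * s)" using X s0 by (intro mult_right_mono) auto
   then have h2: "\<bar>v \<bullet> u\<bar> * (X * s) \<le> 2" using v2 unfolding v_def s_def by linarith
   have "0 \<le> X * s" "X * s \<le> 1" using X s0 by (simp, simp add: s_def)
   then have "norm u * (X * s) \<le> 1 * 1" using u by (intro mult_mono) simp_all
   then have h1: "norm u * (X * s) \<le> 2" by simp
   have "1 / s = Q / real q" by (simp add: s_def)
   also have "\<dots> \<le> Q / 1" using q Q by (intro divide_left_mono) auto
   finally have h3: "1 / s + 1 \<le> of_int (int J)" using J by simp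
   have "norm ((\<Sum>n\<in>{- int J..int J}. gray 0 u (v \<bullet> u) (of_int n * s)) - (1 / s) *\<^sub>R (LINT t|lborel. gray 0 u (v \<bullet> u) t)) \<le> C * of_int (int J) / X ^ n"
    by (rule C(2)[OF h1 h2 _ s0 X(1) h3]) (use gray_ray_eq_0[OF u(1)] in blast)
   then have "\<omega> (norm u) * norm ((\<Sum>n\<in>{- int J..int J}. gray 0 u (v \<bullet> u) (of_int n * s)) - (1 / s) *\<^sub>R (LINT t|lborel. gray 0 u (v \<bullet> u) t))
    \<le> \<omega> (norm u) * (C * of_int (int J) / X ^ n)" by (rule mult_left_mono) (rule \<omega>_nonneg)
   then show ?thesis unfolding E_def norm_mult by (simp add: abs_of_nonneg \<omega>_nonneg)
  qed (simp add: E_def)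
  have "norm (LINT u|lborel. E u) \<le> (LINT u|lborel. \<omega> (norm (u :: real \<times> real)) * (C * real J / X ^ n))"
   by (rule Bochner_Integration.integral_norm_bound_integral)
     (use bd i1 i2 in \<open>auto simp: Eeq[abs_def] intro!: integrable_mult_left integrable_\<omega>_norm Bochner_Integration.integrable_diff\<close>)
  then have "c_const \<omega> * norm (LINT u|lborel. E u) \<le> c_const \<omega> * ((LINT u|lborel. \<omega> (norm (u :: real \<times> real))) * (C * real J / X ^ n))"
   using c0 by (intro mult_left_mono) simp_all
  also have "\<dots> = C * real J / X ^ n" using c_const_mult(1) by (simp flip: mult.assoc)
  finally show ?thesis unfolding v_def[symmetric] eq using c0 by (simp add: norm_mult)
 qed
 then show ?thesis using C(1) by (intro exI[of _ C]) blast
qed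

text \<open>For fixed t the tail of h is unfolded by s = y j x and s = -y j x: it becomes an
  average, with weight \<omega>(x), of the sum of the integrand over the nonzero multiples of y
  x.\<close>

lemma window_inner_eq:
 fixes \<rho> v :: "real \<times> real"
 assumes y: "0 < y" and \<rho>: "1/2 \<le> norm \<rho>" "norm \<rho> \<le> 1"
 defines "\<beta> \<equiv> (1 / (norm \<rho>)\<^sup>2) *\<^sub>R \<rho>"
 defines "\<sigma> \<equiv> v \<bullet> \<beta>"
 shows "(LINT s|lborel. window_coord (h_sum J y) \<rho> v (s, t)) = e2pi (- ((v \<bullet> perp \<rho>) * t)) *
  (of_real (h_main J y) * (LINT s|lborel. gray (t *\<^sub>R perp \<rho>) \<beta> \<sigma> s)
   - (LINT x|lborel. of_real (\<omega> x) * (\<Sum>j\<in>{1..J}. gray (t *\<^sub>R perp \<rho>) \<beta> \<sigma> (real j * (y * x)) + gray (t *\<^sub>R perp \<rho>) \<beta> \<sigma> (- real j * (y * x)))))"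
  and "\<bar>s\<bar> > 1 \<Longrightarrow> gray (t *\<^sub>R perp \<rho>) \<beta> \<sigma> s = 0"
proof -
 define f where "f s = gray (t *\<^sub>R perp \<rho>) \<beta> \<sigma> s" for s
 have f0: "f s = 0" if "\<bar>s\<bar> > 1" for s
  using \<omega>0_coord_eq_0[OF \<rho>, of s t] that by (simp add: f_def gray_def coord_def \<beta>_def add.commute)
 then show "\<bar>s\<bar> > 1 \<Longrightarrow> gray (t *\<^sub>R perp \<rho>) \<beta> \<sigma> s = 0" by (simp add: f_def)
 have cf: "continuous_on A (\<lambda>x. f (h x))" if "continuous_on A h" for A :: "real set" and h
  unfolding f_def using that by (intro continuous_intros)
 have i0: "integrable lborel f"
  by (rule compact_support_integrable[of _ 1]) (use f0 cf[of UNIV "\<lambda>x. x"] in auto)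
 have ij: "integrable lborel (\<lambda>s. of_real (\<omega> (s / c)) * f s)" if "c \<noteq> 0" for c
  by (rule compact_support_integrable[of _ 1]) (use f0 that in \<open>auto intro!: continuous_intros cf\<close>)
 have ix: "integrable lborel (\<lambda>x. of_real (\<omega> x) * f (c * x))" for c
  by (rule compact_support_integrable[of _ 1]) (use \<omega>_0 in \<open>auto simp: abs_if split: if_splits intro!: continuous_intros cf\<close>)
 define K where "K c = (LINT x|lborel. of_real (\<omega> x) * f (c * x))" for c
 have Kc: "(LINT s|lborel. of_real (\<omega> (s / c)) * f s) = of_real \<bar>c\<bar> * K c" if "c \<noteq> 0" for c
  using lborel_integral_real_affine[OF that, of "\<lambda>s. of_real (\<omega> (s / c)) * f s" 0] that
  by (simp add: K_def scaleR_conv_of_real)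
 have nz: "y * real j \<noteq> 0" "- (y * real j) \<noteq> 0" if "j \<in> {1..J}" for j using that y by auto
 define T where "T j s = of_real (1 / (y * real j)) * (of_real (\<omega> (s / (y * real j))) * f s + of_real (\<omega> (s / (- (y * real j)))) * f s)" for j s
 have iT: "integrable lborel (T j)" if "j \<in> {1..J}" for j
  unfolding T_def[abs_def] by (intro integrable_mult_right Bochner_Integration.integrable_add ij nz[OF that])
 have vT: "(LINT s|lborel. T j s) = K (y * real j) + K (- (y * real j))" if j: "j \<in> {1..J}" for j
 proof -
  have "(LINT s|lborel. T j s) = of_real (1 / (y * real j)) * (of_real \<bar>y * real j\<bar> * K (y * real j) + of_real \<bar>- (y * real j)\<bar> * K (- (y * real j)))"
   unfolding T_def integral_mult_right_zero
   by (simp only: Bochner_Integration.integral_add[OF ij[OF nz(1)[OF j]] ij[OF nz(2)[OF j]]] Kc[OF nz(1)[OF j]] Kc[OF nz(2)[OF j]])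
  also have "\<dots> = of_real (1 / (y * real j) * \<bar>y * real j\<bar>) * K (y * real j) + of_real (1 / (y * real j) * \<bar>- (y * real j)\<bar>) * K (- (y * real j))"
   unfolding of_real_mult by (simp only: distrib_left mult.assoc)
  also have "1 / (y * real j) * \<bar>y * real j\<bar> = 1" using y j by simp
  also have "1 / (y * real j) * \<bar>- (y * real j)\<bar> = 1" using y j by simp
  finally show ?thesis by simp
 qed
 have Geq: "window_coord (h_sum J y) \<rho> v (s, t) = e2pi (- ((v \<bullet> perp \<rho>) * t)) * (of_real (h_main J y) * f s - (\<Sum>j\<in>{1..J}. T j s))" for s
  unfolding T_def f_def gray_def window_coord_def h_sum_def h_tail_def coord_def \<sigma>_def \<beta>_def
  by (simp add: sum_distrib_left sum_distrib_right algebra_simps add_divide_distrib sum.distrib)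
 have iS: "integrable lborel (\<lambda>s. \<Sum>j\<in>{1..J}. T j s)" by (intro Bochner_Integration.integrable_sum iT)
 have "(LINT s|lborel. window_coord (h_sum J y) \<rho> v (s, t)) = e2pi (- ((v \<bullet> perp \<rho>) * t)) *
  (of_real (h_main J y) * (LINT s|lborel. f s) - (\<Sum>j\<in>{1..J}. K (y * real j) + K (- (y * real j))))"
  unfolding Geq integral_mult_right_zero Bochner_Integration.integral_diff[OF integrable_mult_right[OF i0] iS]
  by (simp only: Bochner_Integration.integral_sum[OF iT] vT cong: sum.cong)
 also have "(\<Sum>j\<in>{1..J}. K (y * real j) + K (- (y * real j)))
  = (LINT x|lborel. (\<Sum>j\<in>{1..J}. of_real (\<omega> x) * f (y * real j * x) + of_real (\<omega> x) * f (- (y * real j) * x)))"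
 proof -
  have "(LINT x|lborel. (\<Sum>j\<in>{1..J}. of_real (\<omega> x) * f (y * real j * x) + of_real (\<omega> x) * f (- (y * real j) * x)))
   = (\<Sum>j\<in>{1..J}. LINT x|lborel. of_real (\<omega> x) * f (y * real j * x) + of_real (\<omega> x) * f (- (y * real j) * x))"
   by (intro Bochner_Integration.integral_sum Bochner_Integration.integrable_add ix)
  then show ?thesis unfolding K_def by (simp only: Bochner_Integration.integral_add[OF ix ix])
 qed
 also have "\<dots> = (LINT x|lborel. of_real (\<omega> x) * (\<Sum>j\<in>{1..J}. f (real j * (y * x)) + f (- real j * (y * x))))"
  by (simp add: sum_distrib_left distrib_left mult_ac)
 finally show "(LINT s|lborel. window_coord (h_sum J y) \<rho> v (s, t)) = e2pi (- ((v \<bullet> perp \<rho>) * t)) *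
  (of_real (h_main J y) * (LINT s|lborel. gray (t *\<^sub>R perp \<rho>) \<beta> \<sigma> s)
   - (LINT x|lborel. of_real (\<omega> x) * (\<Sum>j\<in>{1..J}. gray (t *\<^sub>R perp \<rho>) \<beta> \<sigma> (real j * (y * x)) + gray (t *\<^sub>R perp \<rho>) \<beta> \<sigma> (- real j * (y * x)))))"
  unfolding f_def .
qed

text \<open>For smooth test functions h acts like a point mass at z = 0. Let f be the integrand
  along \<rho> and A0 its integral. The main half gives A0 times \<open>log_mean\<close>/y. In the
  tail, the sum of f over nonzero multiples of y x is close to A0/(y x) - f(0), and its average over
  x is A0 times \<open>log_mean\<close>/y minus f(0). The difference is f(0), which leaves the
  integral along the ray in direction perp \<rho>.\<close>

lemma window_major_approx:
 "\<exists>C\<ge>0. \<forall>\<rho> v X y J. 1/2 \<le> norm \<rho> \<longrightarrow> norm \<rho> \<le> 1 \<longrightarrow> 0 < y \<longrightarrow> X \<ge> 1 \<longrightarrow> X * y \<le> 1 \<longrightarrow> norm v * (X * y) \<le> 1 \<longrightarrow> 2 / y + 1 \<le> real J \<longrightarrow>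
   norm (window (h_sum J y) \<rho> v - (LINT t|lborel. gray 0 (perp \<rho>) (v \<bullet> perp \<rho>) t)) \<le> C * real J / X ^ n"
proof -
 obtain C where C: "C \<ge> 0" "\<And>\<alpha> \<beta> \<sigma> s X M. norm \<beta> * (X * s) \<le> 2 \<Longrightarrow> \<bar>\<sigma>\<bar> * (X * s) \<le> 2 \<Longrightarrow> (\<forall>t. \<bar>t\<bar> > 1 \<longrightarrow> gray \<alpha> \<beta> \<sigma> t = 0) \<Longrightarrow>
  s > 0 \<Longrightarrow> X > 0 \<Longrightarrow> 1 / s + 1 \<le> of_int M \<Longrightarrow>
  norm ((\<Sum>j\<in>{-M..M}. gray \<alpha> \<beta> \<sigma> (of_int j * s)) - (1 / s) *\<^sub>R (LINT t|lborel. gray \<alpha> \<beta> \<sigma> t)) \<le> C * of_int M / X ^ n"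
  using gray_poisson[of n] by blast
 obtain A where A: "A \<ge> 0" "\<And>y J. 0 < y \<Longrightarrow> y \<le> 1 \<Longrightarrow> real J * y \<ge> 1 \<Longrightarrow>
  norm (complex_of_real (h_main J y) - of_real (1 / y) * log_mean) \<le> A * y ^ n"
  using h_main_approx[of n] by blast
 obtain B where B: "B \<ge> 0" "\<And>x :: real \<times> real. \<bar>\<omega>0 (norm x)\<bar> \<le> B" using \<omega>0_norm_bounded by blast
 have "norm (window (h_sum J y) \<rho> v - (LINT t|lborel. gray 0 (perp \<rho>) (v \<bullet> perp \<rho>) t)) \<le> (4 * A * B + 2 * C) * real J / X ^ n"
  if \<rho>: "1/2 \<le> norm \<rho>" "norm \<rho> \<le> 1" and y: "0 < y" and X: "X \<ge> 1" "X * y \<le> 1" and v: "norm v * (X * y) \<le> 1" and J: "2 / y + 1 \<le> real J"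
  for \<rho> v X y J
 proof -
  have \<rho>0: "\<rho> \<noteq> 0" using \<rho> by auto
  have y1: "y \<le> 1" using X y mult_right_mono[of 1 X y] by linarith
  have y2: "0 < 1 / y" "2 / y = 2 * (1 / y)" using y by simp_all
  have J1: "real J \<ge> 1" "1 / y \<le> real J" using J y2 by linarith+
  have Jy: "real J * y \<ge> 1" using J1(2) y by (simp only: pos_divide_le_eq)
  define \<beta> where "\<beta> = (1 / (norm \<rho>)\<^sup>2) *\<^sub>R \<rho>"
  define \<sigma> where "\<sigma> = v \<bullet> \<beta>"
  define \<tau> where "\<tau> = v \<bullet> perp \<rho>"
  have n\<beta>: "norm \<beta> \<le> 2"
  proof -
   have "norm \<beta> = 1 / norm \<rho>" using \<rho>0 by (simp add: \<beta>_def power2_eq_square)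
   also have "\<dots> \<le> 1 / (1/2)" using \<rho> by (intro divide_left_mono) auto
   finally show ?thesis by simp
  qed
  have n\<sigma>: "\<bar>\<sigma>\<bar> \<le> norm v * 2" unfolding \<sigma>_def
   using Cauchy_Schwarz_ineq2[of v \<beta>] mult_left_mono[OF n\<beta> norm_ge_zero[of v]] by linarith
  have H: "continuous_on UNIV (h_sum J y)" using y by (intro continuous_intros) auto
  define G where "G = window_coord (h_sum J y) \<rho> v"
  have G0: "G (s, t) = 0" if "\<bar>s\<bar> > 1/2 \<or> \<bar>t\<bar> > 1" for s t
   unfolding G_def by (rule window_coord_0[OF \<rho> that])
  have int: "integrable lborel G"
  proof (rule compact_support_integrable[of _ 2])
   show "continuous_on UNIV G" unfolding G_def by (rule continuous_window_coord[OF H])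
   fix p :: "real \<times> real" assume "norm p > 2"
   then have "\<bar>fst p\<bar> > 1/2 \<or> \<bar>snd p\<bar> > 1" using norm_Pair_le_add[of p] by linarith
   then show "G p = 0" using G0[of "fst p" "snd p"] by simp
  qed
  define r where "r t = gray 0 (perp \<rho>) \<tau> t" for t
  have r0: "r t = 0" if "\<bar>t\<bar> > 1" for t unfolding r_def by (rule gray_ray_eq_0) (use \<rho> that in simp_all)
  have ir: "integrable lborel r"
   by (rule compact_support_integrable[of _ 1]) (use r0 in \<open>auto simp: r_def intro!: continuous_intros\<close>)
  define E where "E t = (LINT s|lborel. G (s, t)) - r t" for t
  have E0: "E t = 0" if "\<bar>t\<bar> > 1" for t
  proof -
   have "(\<lambda>s. G (s, t)) = (\<lambda>s. 0)" using G0 that by auto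
   then show ?thesis using r0[OF that] by (simp add: E_def)
  qed
  have Ebd: "norm (E t) \<le> (2 * A * B + C) * real J / X ^ n" for t
  proof -
   define f where "f s = gray (t *\<^sub>R perp \<rho>) \<beta> \<sigma> s" for s
   define A0 where "A0 = (LINT s|lborel. f s)"
   have f0: "f s = 0" if "\<bar>s\<bar> > 1" for s
    unfolding f_def \<beta>_def \<sigma>_def by (rule window_inner_eq(2)[OF y \<rho> that])
   have fB: "norm (f s) \<le> B" for s unfolding f_def gray_def using B(2) by (simp add: norm_mult)
   have A0: "norm A0 \<le> 2 * 1 * B" unfolding A0_def by (rule norm_integral_support_le[OF f0 fB]) auto
   have cf: "continuous_on S (\<lambda>x. f (h x))" if "continuous_on S h" for S :: "real set" and h
    unfolding f_def using that by (intro continuous_intros)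
   define U where "U x = (\<Sum>j\<in>{1..J}. f (real j * (y * x)) + f (- real j * (y * x)))" for x
   have Ueq: "U x = (\<Sum>n\<in>{- int J..int J}. f (of_int n * (y * x))) - f 0" for x
    unfolding sum_symmetric_nat U_def by simp
   have i1: "integrable lborel (\<lambda>x. of_real (\<omega> x) * U x)"
    by (rule compact_support_integrable[of _ 1]) (use \<omega>_0 in \<open>auto simp: U_def abs_if split: if_splits intro!: continuous_intros cf\<close>)
   have i2: "integrable lborel (\<lambda>x. complex_of_real (\<omega> x))"
    by (rule compact_support_integrable[of _ 1]) (use \<omega>_0 in \<open>auto simp: abs_if split: if_splits intro!: continuous_intros\<close>)
   have i3: "integrable lborel (\<lambda>x. of_real (x powi -1) * complex_of_real (\<omega> x))"
   proof (rule Bochner_Integration.integrable_bound[OF integrable_mult_right[OF i2, of 2]])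
    have "norm (of_real (x powi -1) * complex_of_real (\<omega> x)) \<le> norm (2 * complex_of_real (\<omega> x))" for x
    proof (cases "\<omega> x = 0")
     case False
     then have "x > 1/2" using \<omega>_0[of x] by linarith
     then have "\<bar>1 / x\<bar> \<le> 2" by (simp add: field_simps)
     have pi: "x powi -1 = 1 / x" by (simp add: power_int_minus_divide)
     have "norm (of_real (x powi -1) * complex_of_real (\<omega> x)) = \<bar>1 / x\<bar> * \<bar>\<omega> x\<bar>"
      unfolding pi by (simp only: norm_mult norm_of_real)
     also have "\<dots> \<le> 2 * \<bar>\<omega> x\<bar>" using \<open>\<bar>1 / x\<bar> \<le> 2\<close> by (rule mult_right_mono) simp
     also have "\<dots> = norm (2 * complex_of_real (\<omega> x))" by (simp add: norm_mult)
     finally show ?thesis .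
    qed simp
    then show "AE x in lborel. norm (of_real (x powi -1) * complex_of_real (\<omega> x)) \<le> norm (2 * complex_of_real (\<omega> x))" by simp
    have [measurable]: "\<omega> \<in> borel_measurable borel" by (intro borel_measurable_continuous_onI continuous_on_\<omega> continuous_intros)
    show "(\<lambda>x. of_real (x powi -1) * complex_of_real (\<omega> x)) \<in> borel_measurable lborel"
     by (simp add: power_int_minus_divide)
   qed
   \<comment> \<open>The weighted error of the Riemann sum with step y x, once the missing term f(0)
     has been restored.\<close>
   define V where "V x = of_real (\<omega> x) * U x + f 0 * of_real (\<omega> x) - of_real (1 / y) * A0 * (of_real (x powi -1) * of_real (\<omega> x))" for x
   have iV: "(LINT x|lborel. V x) = (LINT x|lborel. of_real (\<omega> x) * U x) + f 0 - of_real (1 / y) * A0 * log_mean"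
    unfolding V_def log_mean_def
    by (subst Bochner_Integration.integral_diff, intro Bochner_Integration.integrable_add i1 integrable_mult_right i2,
      intro integrable_mult_right i3, subst Bochner_Integration.integral_add[OF i1 integrable_mult_right[OF i2]])
      (simp add: \<omega>_integral)
   have V: "norm (V x) \<le> \<omega> x * (C * real J / X ^ n)" for x
   proof (cases "\<omega> x = 0")
    case False
    then have x: "1/2 < x" "x < 1" using \<omega>_0[of x] by linarith+
    have yx: "y * x > 0" "y * x \<le> y" using x y by (simp_all add: mult_left_le)
    have Xy: "X * (y * x) \<le> X * y" "X * (y * x) \<ge> 0" using X yx by (auto intro: mult_left_mono)
    have h1: "norm \<beta> * (X * (y * x)) \<le> 2" using mult_mono[OF n\<beta> order_trans[OF Xy(1) X(2)] _ Xy(2)] by simp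
    have "\<bar>\<sigma>\<bar> * (X * (y * x)) \<le> norm v * 2 * (X * y)" by (intro mult_mono n\<sigma> Xy) simp_all
    then have h2: "\<bar>\<sigma>\<bar> * (X * (y * x)) \<le> 2" using v by (simp add: mult_ac)
    \<comment> \<open>On the support of \<omega> one has x > 1/2, which is where the requirement 2/y
      + 1 \<le> J comes from.\<close>
    have "1 / (y * x) \<le> 1 / (y * (1/2))" using x y by (intro divide_left_mono mult_left_mono) auto
    then have h3: "1 / (y * x) + 1 \<le> of_int (int J)" using J by simp
    have b: "norm ((\<Sum>n\<in>{- int J..int J}. f (of_int n * (y * x))) - (1 / (y * x)) *\<^sub>R A0) \<le> C * of_int (int J) / X ^ n"
     unfolding A0_def f_def by (rule C(2)[OF h1 h2 _ yx(1) _ h3]) (use f0 X in \<open>auto simp: f_def\<close>)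
    have "V x = of_real (\<omega> x) * ((\<Sum>n\<in>{- int J..int J}. f (of_int n * (y * x))) - (1 / (y * x)) *\<^sub>R A0)"
     unfolding V_def Ueq using x y by (simp add: scaleR_conv_of_real power_int_minus_divide field_simps)
    then have "norm (V x) = \<omega> x * norm ((\<Sum>n\<in>{- int J..int J}. f (of_int n * (y * x))) - (1 / (y * x)) *\<^sub>R A0)"
     by (simp only: norm_mult norm_of_real abs_of_nonneg[OF \<omega>_nonneg])
    also have "\<dots> \<le> \<omega> x * (C * of_int (int J) / X ^ n)" using b \<omega>_nonneg by (rule mult_left_mono)
    finally show ?thesis by simp
   qed (simp add: V_def)
   have "norm (LINT x|lborel. V x) \<le> (LINT x|lborel. \<omega> x * (C * real J / X ^ n))"
   proof (rule Bochner_Integration.integral_norm_bound_integral)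
    show "integrable lborel V" unfolding V_def[abs_def]
     by (intro Bochner_Integration.integrable_diff Bochner_Integration.integrable_add i1 integrable_mult_right i2 i3)
    have "integrable lborel \<omega>"
     by (rule compact_support_integrable[of _ 1]) (use \<omega>_0 in \<open>auto simp: abs_if split: if_splits intro!: continuous_on_\<omega> continuous_intros\<close>)
    then show "integrable lborel (\<lambda>x. \<omega> x * (C * real J / X ^ n))" by (rule integrable_mult_left)
   qed (rule V)
   also have "\<dots> = C * real J / X ^ n" by (simp add: \<omega>_integral)
   finally have Vb: "norm (LINT x|lborel. V x) \<le> C * real J / X ^ n" .
   have "(LINT s|lborel. G (s, t)) = e2pi (- (\<tau> * t)) * (of_real (h_main J y) * A0 - (LINT x|lborel. of_real (\<omega> x) * U x))"
    unfolding G_def A0_def U_def f_def \<tau>_def \<beta>_def \<sigma>_def by (rule window_inner_eq(1)[OF y \<rho>])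
   also have "\<dots> = e2pi (- (\<tau> * t)) * ((of_real (h_main J y) - of_real (1 / y) * log_mean) * A0 - (LINT x|lborel. V x)) + e2pi (- (\<tau> * t)) * f 0"
    unfolding iV by (simp add: algebra_simps)
   also have "e2pi (- (\<tau> * t)) * f 0 = r t" by (simp add: f_def r_def gray_def mult.commute)
   finally have "E t = e2pi (- (\<tau> * t)) * ((of_real (h_main J y) - of_real (1 / y) * log_mean) * A0 - (LINT x|lborel. V x))" by (simp add: E_def)
   then have "norm (E t) = norm ((of_real (h_main J y) - of_real (1 / y) * log_mean) * A0 - (LINT x|lborel. V x))" by (simp add: norm_mult)
   also have "\<dots> \<le> norm (complex_of_real (h_main J y) - of_real (1 / y) * log_mean) * norm A0 + C * real J / X ^ n"
    using norm_triangle_ineq4[of "(of_real (h_main J y) - of_real (1 / y) * log_mean) * A0" "LINT x|lborel. V x"] Vb by (simp add: norm_mult)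
   also have "norm (complex_of_real (h_main J y) - of_real (1 / y) * log_mean) * norm A0 \<le> (A * y ^ n) * (2 * 1 * B)"
    by (intro mult_mono A(2) A0 y y1 Jy) (use A y in auto)
   also have "y ^ n \<le> (1 / X) ^ n" using y X by (intro power_mono) (auto simp: field_simps)
   then have "(A * y ^ n) * (2 * 1 * B) \<le> (A * (1 / X) ^ n) * (2 * 1 * B)" using A B by (intro mult_right_mono mult_left_mono) auto
   also have "\<dots> = 2 * A * B * 1 / X ^ n" by (simp add: power_one_over field_simps)
   also have "\<dots> \<le> 2 * A * B * real J / X ^ n" using A B J1(1) X by (intro divide_right_mono mult_left_mono) auto
   finally show ?thesis by (simp add: add_divide_distrib distrib_right)
  qed
  have w: "window (h_sum J y) \<rho> v = (LINT t|lborel. LINT s|lborel. G (s, t))"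
   unfolding window_eq_coord[OF H \<rho>0] G_def[symmetric] using lborel_integral_snd[OF int] by simp
  have Eint: "(LINT t|lborel. E t) = (LINT t|lborel. LINT s|lborel. G (s, t)) - (LINT t|lborel. gray 0 (perp \<rho>) (v \<bullet> perp \<rho>) t)"
   unfolding E_def r_def \<tau>_def
   by (rule Bochner_Integration.integral_diff[OF lborel_integrable_snd[OF int] ir[unfolded r_def[abs_def] \<tau>_def]])
  have "window (h_sum J y) \<rho> v - (LINT t|lborel. gray 0 (perp \<rho>) (v \<bullet> perp \<rho>) t) = (LINT t|lborel. E t)"
   unfolding w Eint by (rule refl)
  also have "norm \<dots> \<le> 2 * 1 * ((2 * A * B + C) * real J / X ^ n)"
   by (rule norm_integral_support_le[OF E0 Ebd]) auto
  finally show ?thesis by (simp add: algebra_simps)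
 qed
 then show ?thesis using A B C by (intro exI[of _ "4 * A * B + 2 * C"]) auto
qed

text \<open>For each t in [-1, 1] the smooth lattice sum is applied to the integrand as a function
  of the lattice point, then the result is integrated over t. Rotation by a right angle preserves
  measure and the radial weight, so the rays in direction perp p have the same mean as those in
  direction p.\<close>

lemma ray_lattice_sum:
 "\<exists>C\<ge>0. \<forall>v a q L X. \<forall>M::int. q \<ge> 1 \<longrightarrow> vgcd_mod a q = 1 \<longrightarrow> L > 0 \<longrightarrow> X > 0 \<longrightarrow> real q * X / L \<le> 1 \<longrightarrow>
   norm v * (real q * X / L) \<le> 1 \<longrightarrow> L + 2 \<le> of_int M \<longrightarrow>
   norm ((\<Sum>r\<in>{r \<in> int_disc L. int q dvd incident r a}. of_real (\<omega> (norm ((1 / L) *\<^sub>R rvec r))) *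
     (LINT t|lborel. gray 0 (perp ((1 / L) *\<^sub>R rvec r)) (v \<bullet> perp ((1 / L) *\<^sub>R rvec r)) t))
    - (L\<^sup>2 / real q) *\<^sub>R ray_mean v) \<le> C * real q * (of_int M)\<^sup>2 / X ^ n"
proof -
 have bF: "bounded_derivs n (fam1 1)" by (rule bounded_derivs_fam1) simp
 obtain C where C: "C \<ge> 0" "\<And>g a q L X M. continuous_on UNIV g \<Longrightarrow> (\<forall>p. norm p > 1 \<longrightarrow> g p = 0) \<Longrightarrow> g 0 = 0 \<Longrightarrow>
  (\<forall>p. (\<lambda>x. g (p + x *\<^sub>R (real q * X / L, 0))) \<in> fam1 1) \<Longrightarrow> (\<forall>p. (\<lambda>x. g (p + x *\<^sub>R (0, real q * X / L))) \<in> fam1 1) \<Longrightarrow>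
  q \<ge> 1 \<Longrightarrow> vgcd_mod a q = 1 \<Longrightarrow> L > 0 \<Longrightarrow> X > 0 \<Longrightarrow> L + 2 \<le> of_int M \<Longrightarrow>
  norm ((\<Sum>r\<in>{r \<in> int_disc L. int q dvd incident r a}. g ((1 / L) *\<^sub>R rvec r)) - (L\<^sup>2 / real q) *\<^sub>R (LINT p|lborel. g p))
   \<le> C * real q * (of_int M)\<^sup>2 / X ^ n"
  using lattice_poisson[OF bF] by blast
 have "norm ((\<Sum>r\<in>{r \<in> int_disc L. int q dvd incident r a}. of_real (\<omega> (norm ((1 / L) *\<^sub>R rvec r))) *
     (LINT t|lborel. gray 0 (perp ((1 / L) *\<^sub>R rvec r)) (v \<bullet> perp ((1 / L) *\<^sub>R rvec r)) t))
    - (L\<^sup>2 / real q) *\<^sub>R ray_mean v) \<le> 2 * C * real q * (of_int M)\<^sup>2 / X ^ n"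
  if q: "q \<ge> 1" and a: "vgcd_mod a q = 1" and L: "L > 0" and X: "X > 0" and k: "real q * X / L \<le> 1" and v: "norm v * (real q * X / L) \<le> 1" and M: "L + 2 \<le> of_int M"
  for v a q L X and M :: int
 proof -
  define D where "D = {r \<in> int_disc L. int q dvd incident r a}"
  define \<kappa> where "\<kappa> = real q * X / L"
  have \<kappa>: "0 \<le> \<kappa>" "\<kappa> \<le> 1" "norm v * \<kappa> \<le> 1" using q L X k v by (simp_all add: \<kappa>_def)
  define g where "g t p = complex_of_real (\<omega> (norm p)) * gray 0 (perp p) (v \<bullet> perp p) t" for t and p :: "real \<times> real"
  define h where "h t p = complex_of_real (\<omega> (norm p)) * gray 0 p (v \<bullet> p) t" for t and p :: "real \<times> real"
  have np: "norm (perp p) = norm p" for p :: "real \<times> real" by (simp add: perp_def norm_prod_def add.commute)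
  have cperp: "continuous_on UNIV (perp :: real \<times> real \<Rightarrow> real \<times> real)" unfolding perp_def by (intro continuous_intros)
  have ch: "continuous_on UNIV (h t)" for t unfolding h_def by (intro continuous_intros continuous_on_compose2[OF continuous_on_\<omega>]) auto
  have gh: "g t p = h t (perp p)" for t p unfolding g_def h_def np ..
  have cg: "continuous_on UNIV (g t)" for t unfolding gh[abs_def] by (intro continuous_on_compose2[OF ch cperp]) auto
  have rot: "(LINT p|lborel. g t p) = (LINT p|lborel. h t p)" for t
  proof -
   have "h t \<in> borel_measurable borel" using ch by (rule borel_measurable_continuous_onI)
   then have "(LINT p|lborel. h t (0 * fst p + 1 * snd p, (-1) * fst p + 0 * snd p)) = (1 / \<bar>0 * 0 - 1 * (-1)\<bar>) *\<^sub>R (LINT p|lborel. h t p)"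
    by (rule lborel_integral_linear_pair) simp
   then show ?thesis unfolding gh perp_def by simp
  qed
  have g0: "g t p = 0" if "norm p > 1" for t p using \<omega>_0[of "norm p"] that by (simp add: g_def)
  have gt0: "g t p = 0" if "\<bar>t\<bar> > 1" for t p
   using \<omega>_0[of "norm p"] gray_ray_eq_0[of "perp p" t] that np[of p] by (cases "1/2 \<le> norm p") (auto simp: g_def)
  have ht0: "h t p = 0" if "\<bar>t\<bar> > 1" for t p
   using \<omega>_0[of "norm p"] gray_ray_eq_0[of p t] that by (cases "1/2 \<le> norm p") (auto simp: h_def)
  have slice: "(\<lambda>x. g t (p + x *\<^sub>R e)) \<in> fam1 1" if t: "\<bar>t\<bar> \<le> 1" and e: "norm e = \<kappa>" for t p e
  proof -
   have pl: "perp (p + x *\<^sub>R e) = perp p + x *\<^sub>R perp e" for x by (simp add: perp_def)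
   have te: "\<bar>t\<bar> * \<kappa> \<le> 1 * 1" using t \<kappa> by (intro mult_mono) auto
   have "\<bar>v \<bullet> perp e\<bar> \<le> norm v * \<kappa>" using Cauchy_Schwarz_ineq2[of v "perp e"] unfolding np e .
   then have ve: "\<bar>t\<bar> * \<bar>v \<bullet> perp e\<bar> \<le> 1 * 1" using t \<kappa> by (intro mult_mono) auto
   have "(\<lambda>x. of_real (\<omega>0 (norm (t *\<^sub>R perp p + x *\<^sub>R (t *\<^sub>R perp e)))) * e2pi (- (t * (v \<bullet> perp e)) * x + - (t * (v \<bullet> perp p)))) \<in> fam0 1"
    by (rule fam0I) (use te ve in \<open>simp_all add: np e abs_mult\<close>)
   from fam1I[of e 1, OF _ this, of p]
   have "(\<lambda>x. of_real (\<omega> (norm (p + x *\<^sub>R e))) * (of_real (\<omega>0 (norm (t *\<^sub>R perp p + x *\<^sub>R (t *\<^sub>R perp e)))) * e2pi (- (t * (v \<bullet> perp e)) * x + - (t * (v \<bullet> perp p))))) \<in> fam1 1"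
    using e \<kappa> by simp
   moreover have "g t (p + x *\<^sub>R e) = of_real (\<omega> (norm (p + x *\<^sub>R e))) * (of_real (\<omega>0 (norm (t *\<^sub>R perp p + x *\<^sub>R (t *\<^sub>R perp e)))) * e2pi (- (t * (v \<bullet> perp e)) * x + - (t * (v \<bullet> perp p))))" for x
    unfolding g_def gray_def pl by (simp add: algebra_simps inner_add_right)
   ultimately show ?thesis by simp
  qed
  define E where "E t = (\<Sum>r\<in>D. g t ((1 / L) *\<^sub>R rvec r)) - (L\<^sup>2 / real q) *\<^sub>R (LINT p|lborel. h t p)" for t
  have E0: "E t = 0" if "\<bar>t\<bar> > 1" for t
  proof -
   have "g t = (\<lambda>p. 0)" "h t = (\<lambda>p. 0)" using gt0[OF that] ht0[OF that] by blast+
   then show ?thesis by (simp add: E_def)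
  qed
  have E1: "norm (E t) \<le> C * real q * (of_int M)\<^sup>2 / X ^ n" for t
  proof (cases "\<bar>t\<bar> \<le> 1")
   case True
   show ?thesis unfolding E_def D_def rot[symmetric]
   proof (rule C(2)[OF cg _ _ _ _ q a L X M])
    show "\<forall>p. norm p > 1 \<longrightarrow> g t p = 0" using g0 by blast
    show "g t 0 = 0" by (simp add: g_def \<omega>_0)
    show "\<forall>p. (\<lambda>x. g t (p + x *\<^sub>R (real q * X / L, 0))) \<in> fam1 1" unfolding \<kappa>_def[symmetric]
     by (intro allI slice[OF True]) (use \<kappa> in \<open>simp add: norm_prod_def\<close>)
    show "\<forall>p. (\<lambda>x. g t (p + x *\<^sub>R (0, real q * X / L))) \<in> fam1 1" unfolding \<kappa>_def[symmetric]
     by (intro allI slice[OF True]) (use \<kappa> in \<open>simp add: norm_prod_def\<close>)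
   qed
  next
   case False
   then show ?thesis using E0[of t] C(1) X by simp
  qed
  have ig: "integrable lborel (\<lambda>t. g t p)" for p
   by (rule compact_support_integrable[of _ 1]) (use gt0 in \<open>auto simp: g_def intro!: continuous_intros\<close>)
  have iD: "integrable lborel (\<lambda>t. \<Sum>r\<in>D. g t ((1 / L) *\<^sub>R rvec r))" by (intro Bochner_Integration.integrable_sum ig)
  have ih: "integrable lborel (\<lambda>t. LINT p|lborel. h t p)" unfolding h_def by (rule ray_fubini(2))
  have "(LINT t|lborel. E t) = (\<Sum>r\<in>D. LINT t|lborel. g t ((1 / L) *\<^sub>R rvec r)) - (L\<^sup>2 / real q) *\<^sub>R (LINT t|lborel. LINT p|lborel. h t p)"
   unfolding E_def Bochner_Integration.integral_diff[OF iD integrable_scaleR_right[OF ih]]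
   by (simp only: Bochner_Integration.integral_sum[OF ig] integral_scaleR_right)
  also have "(LINT t|lborel. LINT p|lborel. h t p) = ray_mean v" unfolding h_def ray_mean_def by (rule ray_fubini(3)[symmetric])
  finally have "(\<Sum>r\<in>D. LINT t|lborel. g t ((1 / L) *\<^sub>R rvec r)) - (L\<^sup>2 / real q) *\<^sub>R ray_mean v = (LINT t|lborel. E t)" by simp
  moreover have "norm (LINT t|lborel. E t) \<le> 2 * 1 * (C * real q * (of_int M)\<^sup>2 / X ^ n)"
   by (rule norm_integral_support_le[OF E0 E1]) auto
  ultimately show ?thesis unfolding D_def g_def by (simp add: mult.assoc)
 qed
 then show ?thesis using C(1) by (intro exI[of _ "2 * C"]) auto
qed

end


context delta_weights
begin

lemma k_of_le:
 assumes "r \<noteq> 0"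
 shows "real (k_of r q) \<le> norm (rvec r)"
proof -
 have v: "vgcd r = int (nat (vgcd r))" by (simp add: vgcd_def)
 have "k_of r q \<le> nat (vgcd r)" unfolding k_of_eq[OF v] by (rule div_le_dividend)
 then have "real (k_of r q) \<le> real (nat (vgcd r))" by simp
 also have "\<dots> = of_int (vgcd r)" using v by linarith
 finally show ?thesis using vgcd_le_norm[OF assms] by linarith
qed

text \<open>Three errors are added: those of p1, of each p2, and of the lattice sum. The two means
  over rays cancel because L^2 = Q. The condition q X \<le> Q^(1/2) suffices for every r since k
  \<le> gcd(r) \<le> |r| \<le> Q^(1/2), whence X k q/Q \<le> 1; similarly for the condition
  involving w.\<close>

lemma p_Lambda_major_approx:
 "\<exists>C\<ge>0. \<forall>Q q a w X. Q \<ge> 1 \<longrightarrow> q \<ge> 1 \<longrightarrow> vgcd_mod a q = 1 \<longrightarrow> X \<ge> 1 \<longrightarrow> real q * X \<le> Q powr (1/2) \<longrightarrow>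
   norm (Q powr (3/2) *\<^sub>R w) * (real q * X) \<le> Q powr (1/2) \<longrightarrow>
   norm (p_Lambda \<omega> \<omega>0 Q a q w - 1) \<le> C * Q ^ 3 / X ^ n"
proof -
 obtain C1 where C1: "C1 \<ge> 0" "\<And>Q q w X J. Q \<ge> 1 \<Longrightarrow> q \<ge> 1 \<Longrightarrow> X > 0 \<Longrightarrow> X * (real q / Q) \<le> 1 \<Longrightarrow>
   norm (Q powr (3/2) *\<^sub>R w) * (X * (real q / Q)) \<le> 2 \<Longrightarrow> Q + 1 \<le> real J \<Longrightarrow>
   norm (p1' Q q w - 1 + of_real (c_const \<omega> * Q / real q) * ray_mean (Q powr (3/2) *\<^sub>R w)) \<le> C1 * real J / X ^ n"
  using p1_major_approx[of n] by blast
 obtain C2 where C2: "C2 \<ge> 0" "\<And>\<rho> v X y J. 1/2 \<le> norm \<rho> \<Longrightarrow> norm \<rho> \<le> 1 \<Longrightarrow> 0 < y \<Longrightarrow> X \<ge> 1 \<Longrightarrow> X * y \<le> 1 \<Longrightarrow> norm v * (X * y) \<le> 1 \<Longrightarrow> 2 / y + 1 \<le> real J \<Longrightarrow>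
   norm (window (h_sum J y) \<rho> v - (LINT t|lborel. gray 0 (perp \<rho>) (v \<bullet> perp \<rho>) t)) \<le> C2 * real J / X ^ n"
  using window_major_approx[of n] by blast
 obtain C3 where C3: "C3 \<ge> 0" "\<And>v a q L X M. q \<ge> 1 \<Longrightarrow> vgcd_mod a q = 1 \<Longrightarrow> L > 0 \<Longrightarrow> X > 0 \<Longrightarrow> real q * X / L \<le> 1 \<Longrightarrow>
   norm v * (real q * X / L) \<le> 1 \<Longrightarrow> L + 2 \<le> of_int M \<Longrightarrow>
   norm ((\<Sum>r\<in>{r \<in> int_disc L. int q dvd incident r a}. of_real (\<omega> (norm ((1 / L) *\<^sub>R rvec r))) *
     (LINT t|lborel. gray 0 (perp ((1 / L) *\<^sub>R rvec r)) (v \<bullet> perp ((1 / L) *\<^sub>R rvec r)) t))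
    - (L\<^sup>2 / real q) *\<^sub>R ray_mean v) \<le> C3 * real q * (of_int M)\<^sup>2 / X ^ n"
  using ray_lattice_sum[of n] by blast
 obtain B where B: "B \<ge> 0" "\<And>x. \<omega> x \<le> B" using \<omega>_bounded by blast
 have c0: "c_const \<omega> > 0" by (rule c_const_mult(2))
 have "norm (p_Lambda \<omega> \<omega>0 Q a q w - 1) \<le> (4 * C1 + c_const \<omega> * (16 * C3) + c_const \<omega> * (36 * (B * C2))) * Q ^ 3 / X ^ n"
  if Q: "Q \<ge> 1" and q: "q \<ge> 1" and a: "vgcd_mod a q = 1" and X: "X \<ge> 1" and qX: "real q * X \<le> Q powr (1/2)"
   and v: "norm (Q powr (3/2) *\<^sub>R w) * (real q * X) \<le> Q powr (1/2)" for Q q a w X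
 proof -
  define L where "L = Q powr (1/2)"
  \<comment> \<open>One J for all r: y = kq/Q is at least 1/Q, so 2/y + 1 \<le> 2Q + 1.\<close>
  define J where "J = nat \<lceil>2 * Q + 1\<rceil>"
  define v where "v = Q powr (3/2) *\<^sub>R w"
  have L1: "L \<ge> 1" and L2: "L * L = Q" using powr_Q(1,3)[OF Q] by (simp_all add: L_def power2_eq_square)
  have LQ: "L \<le> Q" using L1 L2 mult_left_mono[of 1 L L] by linarith
  have J: "2 * Q + 1 \<le> real J" "real J \<le> 4 * Q" unfolding J_def using Q by linarith+
  have X0: "X > 0" using X by simp
  have Xn: "X ^ n > 0" using X0 by simp
  have qXL: "real q * X \<le> L" and vL: "norm v * (real q * X) \<le> L" using qX v by (simp_all add: L_def v_def)
  have qL: "real q \<le> Q"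
  proof -
   have "real q * 1 \<le> real q * X" using X by (intro mult_left_mono) auto
   then show ?thesis using qXL LQ by linarith
  qed
  define D where "D = {r \<in> int_disc L. int q dvd incident r a}"
  define W where "W r = \<omega> (norm ((1 / L) *\<^sub>R rvec r))" for r
  define \<Phi> where "\<Phi> r = (LINT t|lborel. gray 0 (perp ((1 / L) *\<^sub>R rvec r)) (v \<bullet> perp ((1 / L) *\<^sub>R rvec r)) t)" for r
  define P where "P r = p2' Q r (k_of r q) q w" for r
  have Weq: "\<omega> (norm (rvec r) / Q powr (1/2)) = W r" for r unfolding W_def L_def[symmetric] using L1 by simp
  have e1: "norm (p1' Q q w - 1 + of_real (c_const \<omega> * Q / real q) * ray_mean v) \<le> 4 * C1 * Q ^ 3 / X ^ n"
  proof -
   have "X * (real q / Q) = (real q * X) / Q" by simp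
   also have "\<dots> \<le> L / Q" using qXL Q by (intro divide_right_mono) auto
   also have "\<dots> \<le> 1" using LQ Q by simp
   finally have h1: "X * (real q / Q) \<le> 1" .
   have "norm v * (X * (real q / Q)) = norm v * (real q * X) / Q" by simp
   also have "\<dots> \<le> L / Q" using vL Q by (intro divide_right_mono) auto
   also have "\<dots> \<le> 1" using LQ Q by simp
   finally have h2: "norm v * (X * (real q / Q)) \<le> 2" by linarith
   have h3: "Q + 1 \<le> real J" using J Q by linarith
   have "norm (p1' Q q w - 1 + of_real (c_const \<omega> * Q / real q) * ray_mean v) \<le> C1 * real J / X ^ n"
    unfolding v_def by (rule C1(2)[OF Q q X0 h1 h2[unfolded v_def] h3])
   also have "\<dots> \<le> C1 * (4 * Q ^ 3) / X ^ n"
   proof (intro divide_right_mono mult_left_mono)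
    have "Q ^ 1 \<le> Q ^ 3" using Q by (intro power_increasing) auto
    then show "real J \<le> 4 * Q ^ 3" using J by simp
   qed (use C1 Xn in auto)
   finally show ?thesis by (simp add: mult_ac)
  qed
  have e3: "norm ((\<Sum>r\<in>D. of_real (W r) * \<Phi> r) - (Q / real q) *\<^sub>R ray_mean v) \<le> 16 * C3 * Q ^ 3 / X ^ n"
  proof -
   have h1: "real q * X / L \<le> 1" using qXL L1 by simp
   have h2: "norm v * (real q * X / L) \<le> 1" using vL L1 by (simp add: field_simps)
   have h3: "L + 2 \<le> of_int (int J)" using J LQ Q by simp
   have "norm ((\<Sum>r\<in>D. of_real (W r) * \<Phi> r) - (L\<^sup>2 / real q) *\<^sub>R ray_mean v) \<le> C3 * real q * (of_int (int J))\<^sup>2 / X ^ n"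
    unfolding D_def W_def \<Phi>_def by (rule C3(2)[OF q a _ X0 h1 h2 h3]) (use L1 in linarith)
   also have "\<dots> \<le> C3 * Q * (4 * Q)\<^sup>2 / X ^ n"
    using qL J C3(1) Xn by (intro divide_right_mono mult_mono power_mono) auto
   finally show ?thesis by (simp add: L2 power2_eq_square power3_eq_cube mult_ac)
  qed
  have each: "norm (of_real (W r) * (P r - of_real (c_const \<omega>) * \<Phi> r)) \<le> B * (c_const \<omega> * (C2 * (4 * Q) / X ^ n))" if r: "r \<in> D" for r
  proof (cases "W r = 0")
   case True
   then show ?thesis using B C2 c0 Q Xn by simp
  next
   case False
   then have w0: "\<omega> (norm (rvec r) / Q powr (1/2)) \<noteq> 0" by (simp add: Weq)
   have r0: "r \<noteq> 0" and rL: "norm (rvec r) \<le> L" using r by (auto simp: D_def int_disc_def)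
   define k where "k = k_of r q"
   have k1: "k \<ge> 1" unfolding k_def by (rule k_of_ge_1[OF r0 q])
   have kL: "real k \<le> L" unfolding k_def using k_of_le[OF r0, of q] rL by linarith
   define y where "y = real k * real q / Q"
   have kq1: "real k * real q \<ge> 1" using mult_mono[of 1 "real k" 1 "real q"] k1 q by simp
   have y0: "y > 0" using kq1 Q by (simp add: y_def)
   have y1: "2 / y + 1 \<le> real J"
   proof -
    have "2 / y = 2 * Q / (real k * real q)" by (simp add: y_def)
    also have "\<dots> \<le> 2 * Q / 1" using kq1 Q by (intro divide_left_mono) auto
    finally show ?thesis using J by linarith
   qed
   have Jy: "real J * y \<ge> 1"
   proof -
    have "1 / y \<le> real J" using y1 y0 divide_right_mono[of 1 2 y] by simp
    then show ?thesis using y0 by (simp only: pos_divide_le_eq)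
   qed
   have "X * y = real k * (real q * X) / Q" by (simp add: y_def)
   also have "\<dots> \<le> L * L / Q" using kL qXL L1 Q X0 by (intro divide_right_mono mult_mono) auto
   finally have Xy: "X * y \<le> 1" using L2 Q by simp
   have "norm v * (X * y) = real k * (norm v * (real q * X)) / Q" by (simp add: y_def)
   also have "\<dots> \<le> L * L / Q" using kL vL L1 Q X0 by (intro divide_right_mono mult_mono) auto
   finally have vy: "norm v * (X * y) \<le> 1" using L2 Q by simp
   define \<rho> where "\<rho> = (1 / L) *\<^sub>R rvec r"
   have n\<rho>: "norm \<rho> = norm (rvec r) / L" using L1 by (simp add: \<rho>_def)
   have \<rho>: "1/2 \<le> norm \<rho>" "norm \<rho> \<le> 1"
    unfolding n\<rho> using \<omega>_radius(1,2)[OF Q w0] L1 unfolding L_def[symmetric] by (simp_all add: field_simps)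
   have Peq: "P r = of_real (c_const \<omega>) * window (h_sum J y) \<rho> v"
    unfolding P_def k_def[symmetric] y_def \<rho>_def v_def L_def
    by (rule p2_eq_window[OF Q \<omega>_radius(2)[OF Q w0] k1 q Jy[unfolded y_def]])
   have "norm (window (h_sum J y) \<rho> v - \<Phi> r) \<le> C2 * real J / X ^ n"
    unfolding \<Phi>_def \<rho>_def[symmetric] by (rule C2(2)[OF \<rho> y0 X Xy vy y1])
   also have "\<dots> \<le> C2 * (4 * Q) / X ^ n" using J C2(1) Xn by (intro divide_right_mono mult_left_mono) auto
   finally have "c_const \<omega> * norm (window (h_sum J y) \<rho> v - \<Phi> r) \<le> c_const \<omega> * (C2 * (4 * Q) / X ^ n)"
    using c0 by (intro mult_left_mono) auto
   moreover have "norm (P r - of_real (c_const \<omega>) * \<Phi> r) = c_const \<omega> * norm (window (h_sum J y) \<rho> v - \<Phi> r)"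
    unfolding Peq right_diff_distrib[symmetric] norm_mult using c0 by simp
   ultimately have "norm (P r - of_real (c_const \<omega>) * \<Phi> r) \<le> c_const \<omega> * (C2 * (4 * Q) / X ^ n)" by simp
   moreover have "norm (complex_of_real (W r)) \<le> B" using B(2) \<omega>_nonneg by (simp add: W_def)
   ultimately show ?thesis unfolding norm_mult using B(1) by (intro mult_mono) auto
  qed
  have cD: "real (card D) \<le> 9 * Q"
  proof -
   have "card D \<le> card (int_disc L)" unfolding D_def by (intro card_mono) auto
   then have "real (card D) \<le> real (card (int_disc L))" by simp
   also have "\<dots> \<le> 9 * L\<^sup>2" by (rule card_int_disc_le[OF L1])
   finally show ?thesis by (simp add: power2_eq_square L2)
  qed
  have "norm (\<Sum>r\<in>D. of_real (W r) * (P r - of_real (c_const \<omega>) * \<Phi> r)) \<le> (\<Sum>r\<in>D. B * (c_const \<omega> * (C2 * (4 * Q) / X ^ n)))"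
   by (rule sum_norm_le) (rule each)
  also have "\<dots> = real (card D) * (B * (c_const \<omega> * (C2 * (4 * Q) / X ^ n)))" by simp
  also have "\<dots> \<le> 9 * Q * (B * (c_const \<omega> * (C2 * (4 * Q) / X ^ n)))"
   using cD B(1) C2(1) c0 Q Xn by (intro mult_right_mono) auto
  also have "\<dots> = c_const \<omega> * (36 * (B * C2)) * Q ^ 2 / X ^ n" by (simp add: power2_eq_square)
  also have "\<dots> \<le> c_const \<omega> * (36 * (B * C2)) * Q ^ 3 / X ^ n"
   using B(1) C2(1) c0 Q Xn by (intro divide_right_mono mult_left_mono power_increasing) auto
  finally have e2: "norm (\<Sum>r\<in>D. of_real (W r) * (P r - of_real (c_const \<omega>) * \<Phi> r)) \<le> c_const \<omega> * (36 * (B * C2)) * Q ^ 3 / X ^ n" .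
  have pL: "p_Lambda \<omega> \<omega>0 Q a q w = p1' Q q w + (\<Sum>r\<in>D. of_real (W r) * P r)"
   unfolding p_Lambda_eq[OF Q a] Weq D_def P_def L_def ..
  have sp: "(\<Sum>r\<in>D. of_real (W r) * P r) = (\<Sum>r\<in>D. of_real (W r) * (P r - of_real (c_const \<omega>) * \<Phi> r)) + of_real (c_const \<omega>) * (\<Sum>r\<in>D. of_real (W r) * \<Phi> r)"
   by (simp add: right_diff_distrib sum_subtractf sum_distrib_left mult_ac)
  have dec: "p_Lambda \<omega> \<omega>0 Q a q w - 1 = (p1' Q q w - 1 + of_real (c_const \<omega> * Q / real q) * ray_mean v)
   + of_real (c_const \<omega>) * ((\<Sum>r\<in>D. of_real (W r) * \<Phi> r) - (Q / real q) *\<^sub>R ray_mean v)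
   + (\<Sum>r\<in>D. of_real (W r) * (P r - of_real (c_const \<omega>) * \<Phi> r))"
   unfolding pL sp by (simp add: right_diff_distrib scaleR_conv_of_real)
  have "norm (of_real (c_const \<omega>) * ((\<Sum>r\<in>D. of_real (W r) * \<Phi> r) - (Q / real q) *\<^sub>R ray_mean v))
   = c_const \<omega> * norm ((\<Sum>r\<in>D. of_real (W r) * \<Phi> r) - (Q / real q) *\<^sub>R ray_mean v)"
   unfolding norm_mult using c0 by simp
  also have "\<dots> \<le> c_const \<omega> * (16 * C3 * Q ^ 3 / X ^ n)" using e3 c0 by (intro mult_left_mono) auto
  finally have e3': "norm (of_real (c_const \<omega>) * ((\<Sum>r\<in>D. of_real (W r) * \<Phi> r) - (Q / real q) *\<^sub>R ray_mean v)) \<le> c_const \<omega> * (16 * C3 * Q ^ 3 / X ^ n)" .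
  have tri: "norm (x + y + z) \<le> norm x + norm y + norm z" for x y z :: complex
   by (rule order_trans[OF norm_triangle_ineq add_right_mono[OF norm_triangle_ineq]])
  have "norm (p_Lambda \<omega> \<omega>0 Q a q w - 1) \<le> 4 * C1 * Q ^ 3 / X ^ n + c_const \<omega> * (16 * C3 * Q ^ 3 / X ^ n) + c_const \<omega> * (36 * (B * C2)) * Q ^ 3 / X ^ n"
   unfolding dec by (rule order_trans[OF tri add_mono[OF add_mono[OF e1 e3'] e2]])
  also have "\<dots> = (4 * C1 + c_const \<omega> * (16 * C3) + c_const \<omega> * (36 * (B * C2))) * Q ^ 3 / X ^ n"
   by (simp add: add_divide_distrib algebra_simps)
  finally show ?thesis .
 qed
 moreover have "4 * C1 + c_const \<omega> * (16 * C3) + c_const \<omega> * (36 * (B * C2)) \<ge> 0" using B(1) C1(1) C2(1) C3(1) c0 by simp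
 ultimately show ?thesis by blast
qed

text \<open>The free parameter is taken as X = Q^\<delta>: then q < Q^(1/2 - \<delta>) and q|w| <
  Q^(-1 - \<delta>) are exactly what makes q X and Q^(3/2) |w| q X at most Q^(1/2).\<close>

lemma p_Lambda_major:
 "(\<forall>(\<delta>::real) (N::real). \<delta> > 0 \<and> N > 0 \<longrightarrow> (\<exists>C::real. \<forall>Q::real. Q \<ge> 1 \<longrightarrow>
    (\<forall>(q::nat) (a :: int \<times> int) (w :: real \<times> real).
     q \<ge> 1 \<and> vgcd_mod a q = 1 \<and> real q < Q powr (1/2 - \<delta>) \<and>
     norm w < 1 / real q * Q powr (- 1 - \<delta>) \<longrightarrow>
     cmod (p_Lambda \<omega> \<omega>0 Q a q w - 1) \<le> C * Q powr (- N))))"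
proof (intro allI impI)
 fix \<delta> N :: real assume dn: "\<delta> > 0 \<and> N > 0"
 \<comment> \<open>Chosen so that X^n = Q^(\<delta> n) is at least Q^(N + 3), which absorbs the
   polynomial loss Q^3.\<close>
 define n where "n = nat \<lceil>(N + 3) / \<delta>\<rceil>"
 obtain C where C: "C \<ge> 0" "\<And>Q q a w X. Q \<ge> 1 \<Longrightarrow> q \<ge> 1 \<Longrightarrow> vgcd_mod a q = 1 \<Longrightarrow> X \<ge> 1 \<Longrightarrow> real q * X \<le> Q powr (1/2) \<Longrightarrow>
   norm (Q powr (3/2) *\<^sub>R w) * (real q * X) \<le> Q powr (1/2) \<Longrightarrow>
   norm (p_Lambda \<omega> \<omega>0 Q a q w - 1) \<le> C * Q ^ 3 / X ^ n"
  using p_Lambda_major_approx[of n] by blast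
 have "cmod (p_Lambda \<omega> \<omega>0 Q a q w - 1) \<le> C * Q powr (- N)"
  if Q: "Q \<ge> 1" and h: "q \<ge> 1 \<and> vgcd_mod a q = 1 \<and> real q < Q powr (1/2 - \<delta>) \<and> norm w < 1 / real q * Q powr (- 1 - \<delta>)" for Q q a w
 proof -
  define X where "X = Q powr \<delta>"
  have q0: "real q > 0" using h by simp
  have X: "X \<ge> 1" unfolding X_def using Q dn by (intro ge_one_powr_ge_zero) auto
  have "real q * X \<le> Q powr (1/2 - \<delta>) * Q powr \<delta>" unfolding X_def using h by (intro mult_right_mono) auto
  also have "\<dots> = Q powr (1/2)" by (simp flip: powr_add)
  finally have qX: "real q * X \<le> Q powr (1/2)" .
  have "norm (Q powr (3/2) *\<^sub>R w) * (real q * X) = Q powr (3/2) * X * (real q * norm w)" by simp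
  also have "\<dots> \<le> Q powr (3/2) * X * (real q * (1 / real q * Q powr (- 1 - \<delta>)))"
   using h X by (intro mult_left_mono) auto
  also have "\<dots> = Q powr (3/2) * Q powr \<delta> * Q powr (- 1 - \<delta>)" using q0 by (simp add: X_def)
  also have "\<dots> = Q powr (1/2)" by (simp flip: powr_add)
  finally have vX: "norm (Q powr (3/2) *\<^sub>R w) * (real q * X) \<le> Q powr (1/2)" .
  have "(N + 3) / \<delta> \<le> real n" unfolding n_def by linarith
  then have n: "N + 3 \<le> \<delta> * real n" using dn by (simp add: field_simps)
  have Q0: "Q > 0" using Q by simp
  have "X ^ n = Q powr (\<delta> * real n)" unfolding X_def using Q0 by (simp add: powr_powr flip: powr_realpow)
  then have "Q ^ 3 / X ^ n = Q powr (3 - \<delta> * real n)" using Q0 by (simp add: powr_diff powr_numeral)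
  also have "\<dots> \<le> Q powr (- N)" using Q n by (intro powr_mono) auto
  finally have "C * (Q ^ 3 / X ^ n) \<le> C * Q powr (- N)" using C(1) by (rule mult_left_mono)
  moreover have "norm (p_Lambda \<omega> \<omega>0 Q a q w - 1) \<le> C * Q ^ 3 / X ^ n"
   by (rule C(2)[OF Q _ _ X qX vX]) (use h in simp_all)
  ultimately show ?thesis by simp
 qed
 then show "\<exists>C::real. \<forall>Q::real. Q \<ge> 1 \<longrightarrow> (\<forall>(q::nat) (a :: int \<times> int) (w :: real \<times> real).
   q \<ge> 1 \<and> vgcd_mod a q = 1 \<and> real q < Q powr (1/2 - \<delta>) \<and> norm w < 1 / real q * Q powr (- 1 - \<delta>) \<longrightarrow>
   cmod (p_Lambda \<omega> \<omega>0 Q a q w - 1) \<le> C * Q powr (- N))" by blast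
qed

lemma p_Lambda_depends_on_lattice:
 "(\<forall>Q::real. Q \<ge> 1 \<longrightarrow>
    (\<forall>(q::nat) (q'::nat) (a :: int \<times> int) (a' :: int \<times> int).
     q \<ge> 1 \<and> q' \<ge> 1 \<and> vgcd_mod a q = 1 \<and> vgcd_mod a' q' = 1 \<and>
     lattice_of a q = lattice_of a' q' \<longrightarrow>
     p_Lambda \<omega> \<omega>0 Q a q = p_Lambda \<omega> \<omega>0 Q a' q'))"
 using p_Lambda_lattice by blast

lemma delta_approx:
 "\<exists>C. \<forall>Q. Q \<ge> 1 \<longrightarrow> (\<forall>n. cmod (delta_vec n - (sum_p1 Q n + sum_p2 Q n)) \<le> C * Q powr (- N))"
proof -
 obtain C where C: "C \<ge> 0" "\<And>Q n. Q \<ge> 1 \<Longrightarrow> cmod (delta_vec n - (sum_p1 Q n + sum_p2 Q n)) \<le> C / Q ^ nat \<lceil>N\<rceil>"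
  using delta_estimate[of "nat \<lceil>N\<rceil>"] by blast
 have "cmod (delta_vec n - (sum_p1 Q n + sum_p2 Q n)) \<le> C * Q powr (- N)" if Q: "Q \<ge> 1" for Q n
 proof -
  have "C * (1 / Q ^ nat \<lceil>N\<rceil>) \<le> C * Q powr (- N)" using powr_minus_ge_power[OF Q] C(1) by (rule mult_left_mono)
  then show ?thesis using C(2)[OF Q, of n] by simp
 qed
 then show ?thesis by blast
qed

lemma delta_sum_p_Lambda:
 "(\<forall>N::real. N > 0 \<longrightarrow> (\<exists>C::real. \<forall>Q::real. Q \<ge> 1 \<longrightarrow> (\<forall>n :: int \<times> int.
    cmod (delta_vec n -
     (\<Sum>q | 1 \<le> q \<and> real q \<le> Q. \<Sum>a\<in>primitive_residues q.
       arc_integral (p_Lambda \<omega> \<omega>0 Q a q) a q n))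
    \<le> C * Q powr (- N))))"
proof (intro allI impI)
 fix N :: real assume "N > 0"
 show "\<exists>C::real. \<forall>Q::real. Q \<ge> 1 \<longrightarrow> (\<forall>n :: int \<times> int.
    cmod (delta_vec n -
     (\<Sum>q | 1 \<le> q \<and> real q \<le> Q. \<Sum>a\<in>primitive_residues q.
       arc_integral (p_Lambda \<omega> \<omega>0 Q a q) a q n))
    \<le> C * Q powr (- N))"
  using delta_approx[of N] by (simp only: sum_p_Lambda cong: imp_cong)
qed

lemma delta_sum_primitive:
 "(\<forall>N::real. N > 0 \<longrightarrow> (\<exists>C::real. \<forall>Q::real. Q \<ge> 1 \<longrightarrow> (\<forall>n :: int \<times> int.
    cmod (delta_vec n -
     ((\<Sum>q | 1 \<le> q \<and> real q \<le> Q. \<Sum>a\<in>primitive_residues q.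
       arc_integral (p1 \<omega> \<omega>0 Q q) a q n)
      + (\<Sum>\<^sub>\<infinity>(d, k, c)\<in>{(d::nat, k::nat, c :: int \<times> int). d \<ge> 1 \<and> k \<ge> 1 \<and> primitive c}.
        let r = iscale (int d * int k) c in
        of_real (\<omega> (norm (rvec r) / Q powr (1/2))) *
        (\<Sum>q | 1 \<le> q \<and> real q \<le> Q / real k \<and> d dvd q \<and> gcd (q div d) k = 1.
          \<Sum>a\<in>{a \<in> primitive_residues q. int q dvd int d * idot c (perp a)}.
           arc_integral (p2 \<omega> \<omega>0 Q r k q) a q n))))
    \<le> C * Q powr (- N))))"
proof (intro allI impI)
 fix N :: real assume "N > 0"
 obtain C where C: "\<And>Q n. Q \<ge> 1 \<Longrightarrow> cmod (delta_vec n - (sum_p1 Q n + sum_p2 Q n)) \<le> C * Q powr (- N)"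
  using delta_approx[of N] by blast
 show "\<exists>C::real. \<forall>Q::real. Q \<ge> 1 \<longrightarrow> (\<forall>n :: int \<times> int.
    cmod (delta_vec n -
     ((\<Sum>q | 1 \<le> q \<and> real q \<le> Q. \<Sum>a\<in>primitive_residues q.
       arc_integral (p1 \<omega> \<omega>0 Q q) a q n)
      + (\<Sum>\<^sub>\<infinity>(d, k, c)\<in>{(d::nat, k::nat, c :: int \<times> int). d \<ge> 1 \<and> k \<ge> 1 \<and> primitive c}.
        let r = iscale (int d * int k) c in
        of_real (\<omega> (norm (rvec r) / Q powr (1/2))) *
        (\<Sum>q | 1 \<le> q \<and> real q \<le> Q / real k \<and> d dvd q \<and> gcd (q div d) k = 1.
          \<Sum>a\<in>{a \<in> primitive_residues q. int q dvd int d * idot c (perp a)}.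
           arc_integral (p2 \<omega> \<omega>0 Q r k q) a q n))))
    \<le> C * Q powr (- N))"
  by (intro exI[of _ C] allI impI, unfold nat_floor_interval infsum_primitive_triples sum_p1_def[symmetric], rule C, assumption)
qed

end

theorem theorem1p2:
  fixes \<omega> \<omega>0 :: "real \<Rightarrow> real"
  assumes "weight_functions \<omega> \<omega>0"
  shows
    \<comment> \<open>dependence on the lattice only\<close>
    "(\<forall>Q::real. Q \<ge> 1 \<longrightarrow>
       (\<forall>(q::nat) (q'::nat) (a :: int \<times> int) (a' :: int \<times> int).
          q \<ge> 1 \<and> q' \<ge> 1 \<and> vgcd_mod a q = 1 \<and> vgcd_mod a' q' = 1 \<and>
          lattice_of a q = lattice_of a' q' \<longrightarrow>
          p_Lambda \<omega> \<omega>0 Q a q = p_Lambda \<omega> \<omega>0 Q a' q'))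
     \<and>
     \<comment> \<open>(1)\<close>
     (\<forall>N::real. N > 0 \<longrightarrow> (\<exists>C::real. \<forall>Q::real. Q \<ge> 1 \<longrightarrow> (\<forall>n :: int \<times> int.
        cmod (delta_vec n -
          (\<Sum>q | 1 \<le> q \<and> real q \<le> Q. \<Sum>a\<in>primitive_residues q.
             arc_integral (p_Lambda \<omega> \<omega>0 Q a q) a q n))
        \<le> C * Q powr (- N))))
     \<and>
     \<comment> \<open>(2)\<close>
     (\<forall>(\<delta>::real) (N::real). \<delta> > 0 \<and> N > 0 \<longrightarrow> (\<exists>C::real. \<forall>Q::real. Q \<ge> 1 \<longrightarrow>
        (\<forall>(q::nat) (a :: int \<times> int) (w :: real \<times> real).
          q \<ge> 1 \<and> vgcd_mod a q = 1 \<and> real q < Q powr (1/2 - \<delta>) \<and>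
          norm w < 1 / real q * Q powr (- 1 - \<delta>) \<longrightarrow>
          cmod (p_Lambda \<omega> \<omega>0 Q a q w - 1) \<le> C * Q powr (- N))))
     \<and>
     \<comment> \<open>(3)\<close>
     (\<forall>N::real. N > 0 \<longrightarrow> (\<exists>C::real. \<forall>Q::real. Q \<ge> 1 \<longrightarrow>
        (\<forall>(q::nat) (w :: real \<times> real). 1 \<le> q \<and> real q \<le> Q \<longrightarrow>
          cmod (p1 \<omega> \<omega>0 Q q w)
          \<le> C * (Q / (real q * (1 + norm w * Q powr (3/2)))) *
              (1 + norm w * real q * Q powr (1/2)) powr (- N))))
     \<and>
     \<comment> \<open>(4)\<close>
     (\<forall>N::real. N > 0 \<longrightarrow> (\<exists>C::real. \<forall>Q::real. Q \<ge> 1 \<longrightarrow>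
        (\<forall>(w :: real \<times> real) (k::nat) (q::nat) (r :: int \<times> int).
          k \<ge> 1 \<and> q \<ge> 1 \<and>
          1/2 * Q powr (1/2) \<le> norm (rvec r) \<and> norm (rvec r) \<le> Q powr (1/2) \<longrightarrow>
          cmod (p2 \<omega> \<omega>0 Q r k q w)
          \<le> C * (1 + norm w * real k * real q * Q powr (1/2)
                   + \<bar>w \<bullet> perp (rvec r)\<bar> * Q) powr (- N))))
     \<and>
     \<comment> \<open>(5)\<close>
     (\<forall>N::real. N > 0 \<longrightarrow> (\<exists>C::real. \<forall>Q::real. Q \<ge> 1 \<longrightarrow> (\<forall>n :: int \<times> int.
        cmod (delta_vec n -
          ((\<Sum>q | 1 \<le> q \<and> real q \<le> Q. \<Sum>a\<in>primitive_residues q.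
              arc_integral (p1 \<omega> \<omega>0 Q q) a q n)
           + (\<Sum>\<^sub>\<infinity>(d, k, c)\<in>{(d::nat, k::nat, c :: int \<times> int). d \<ge> 1 \<and> k \<ge> 1 \<and> primitive c}.
                let r = iscale (int d * int k) c in
                of_real (\<omega> (norm (rvec r) / Q powr (1/2))) *
                (\<Sum>q | 1 \<le> q \<and> real q \<le> Q / real k \<and> d dvd q \<and> gcd (q div d) k = 1.
                   \<Sum>a\<in>{a \<in> primitive_residues q. int q dvd int d * idot c (perp a)}.
                     arc_integral (p2 \<omega> \<omega>0 Q r k q) a q n))))
        \<le> C * Q powr (- N))))"
proof -
  interpret delta_weights \<omega> \<omega>0 by unfold_locales (rule assms)
  show ?thesis
    by (intro conjI p_Lambda_depends_on_lattice delta_sum_p_Lambda p_Lambda_major p1_bound p2_bound delta_sum_primitive)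
qed

end
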